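(* Let $k^+$ and $k^-$ be positive integers and let $Z_\lambda=(Z_\lambda^+,Z_\lambda^-)$ be a 1-parameter family of piecewise analytic Filippov vector fields, equal to $Z_\lambda^+$ for $y>0$ and to $Z_\lambda^-$ for $y<0$, having a $(2k^+,2k^-)$-monodromic tangential singularity at the origin for every $\lambda$ in an interval $I$. Let $V_2(\lambda)$ and $V_4(\lambda)$ be, respectively, the second and the fourth Lyapunov coefficients. Assume that, for some $\lambda_0\in I$, $V_2(\lambda_0)=0$, $d:=V_2'(\lambda_0)\neq0$, and $\ell:=V_4(\lambda_0)\neq0$. Then there exists a neighborhood $J\subset I$ of $\lambda_0$ such that, for every $\lambda\in J$ satisfying $d\,\ell\,(\lambda-\lambda_0)<0$, the Filippov vector field $Z_\lambda$ admits a hyperbolic limit cycle in a $\sqrt{|\lambda-\lambda_0|}$-neighborhood of the origin. In addition, such a limit cycle is asymptotically stable (resp. unstable) provided that $\ell<0$ (resp. $\ell>0$).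
   Context: For a piecewise vector field $Z=(Z^+,Z^-)$, with $Z^\pm=(X^\pm,Y^\pm)$ analytic and discontinuity line $\Sigma=\{y=0\}$, the origin is a $(2k^+,2k^-)$-monodromic tangential singularity when it is an invisible contact of multiplicity $2k^{+}$ of $Z^+$ with $\Sigma$, an invisible contact of multiplicity $2k^-$ of $Z^-$ with $\Sigma$, and a first-return map on $\Sigma$ is defined around it; concretely: C1. $X^{\pm}(0,0)\neq0$, $Y^{\pm}(0,0)=0$, $\frac{\partial^i Y^{\pm}}{\partial x^i}(0,0)=0$ for $i=1,\ldots,2k^{\pm}-2$, and $\frac{\partial^{2k^{\pm}-1} Y^{\pm}}{\partial x^{2k^{\pm}-1}}(0,0)\neq0$; C2. $X^+(0,0)\frac{\partial^{2k^{+}-1} Y^{+}}{\partial x^{2k^{+}-1}}(0,0)<0$ and $X^-(0,0)\frac{\partial^{2k^{-}-1} Y^{-}}{\partial x^{2k^{-}-1}}(0,0)>0$; C3. $X^+(0,0)X^-(0,0)<0$. Put $\delta=\mathrm{sign}(X^+(0,0))=-\mathrm{sign}(X^-(0,0))$. Half-return maps: for $x\neq 0$ close to $0$, the orbit of $Z^{+}$ through $(x,0)$ restricted to $\{y\ge 0\}$ (resp. of $Z^-$ restricted to $\{y\le0\}$), followed forward or backward in time (whichever direction enters $\{y>0\}$, resp. $\{y<0\}$), meets $\Sigma$ again for the first time at $(\varphi^{+}(x),0)$ (resp. $(\varphi^{-}(x),0)$); $\varphi^{\pm}(0)=0$. The maps $\varphi^{\pm}$ are analytic involutions near $0$, with $\varphi^{\pm}(x)=-x+\sum_{n\ge2}\alpha_n^{\pm}x^n$.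 The displacement function is $\Delta(x)=\delta(\varphi^+(x)-\varphi^-(x))=\sum_{n\ge2}V_nx^n$, and the $n$th Lyapunov coefficient is $V_n=\delta(\alpha_n^+-\alpha_n^-)$; for the family $Z_\lambda$ it is denoted $V_n(\lambda)$. Trajectories follow Filippov's convention; near the origin, orbits of $Z$ cross $\Sigma\setminus\{(0,0)\}$ by concatenating orbits of $Z^+$ in $y\ge0$ and of $Z^-$ in $y\le0$. A limit cycle is an isolated closed orbit; it is hyperbolic if the derivative of the first-return map on $\Sigma$ at the corresponding fixed point differs from $1$ in absolute value.
   Formalization: The family is assumed to depend continuously on λ (power series at the origin with continuous coefficients and locally uniform bounds), and the √|λ−λ0|-neighborhood is read as a ball of radius C√|λ−λ0| with C independent of λ. *)

theory Defs
  imports "HOL-Analysis.Analysis"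
begin

type_synonym vfield = "real \<times> real \<Rightarrow> real \<times> real"

text \<open>A piecewise vector field \<open>(Z\<^sup>+, Z\<^sup>-)\<close>, discontinuous across \<open>y = 0\<close>. Both components are
  total functions; only their values near the origin matter.\<close>
type_synonym pw_field = "vfield \<times> vfield"

subsection \<open>Analytic families\<close>

text \<open>Every member is real analytic at the origin (\<open>W l (x, y)\<close> is the sum of its power series), and
  the dependence on the parameter is continuous: near each \<open>m \<in> I\<close> the series have a common
  polydisc of convergence with a common Cauchy bound, and continuous coefficients. No differentiability
  in the parameter is required. A family that is jointly analytic in \<open>(l, x, y)\<close> is a special case.\<close>

definition analytic_family :: "real set \<Rightarrow> (real \<Rightarrow> vfield) \<Rightarrow> bool" where
  "analytic_family I W \<longleftrightarrow>
     (\<forall>m\<in>I. \<exists>S r M (a :: real \<Rightarrow> nat \<Rightarrow> nat \<Rightarrow> real \<times> real).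
        openin (top_of_set I) S \<and> m \<in> S \<and> 0 < r \<and>
        (\<forall>i j. continuous_on S (\<lambda>l. a l i j)) \<and>
        (\<forall>l\<in>S. \<forall>i j. norm (a l i j) * r ^ (i + j) \<le> M) \<and>
        (\<forall>l\<in>S. \<forall>x y. \<bar>x\<bar> < r \<longrightarrow> \<bar>y\<bar> < r \<longrightarrow>
           ((\<lambda>(i, j). (x ^ i * y ^ j) *\<^sub>R a l i j) has_sum W l (x, y)) UNIV))"

subsection \<open>Monodromic tangential singularities\<close>

definition dYdx :: "vfield \<Rightarrow> nat \<Rightarrow> real" where
  "dYdx W i = (deriv ^^ i) (\<lambda>x. snd (W (x, 0))) 0"

definition X0 :: "vfield \<Rightarrow> real" where
  "X0 W = fst (W (0, 0))"

definition contact :: "nat \<Rightarrow> vfield \<Rightarrow> bool" where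
  "contact k W \<longleftrightarrow> X0 W \<noteq> 0 \<and> snd (W (0, 0)) = 0 \<and>
     (\<forall>i\<in>{1..2 * k - 2}. dYdx W i = 0) \<and> dYdx W (2 * k - 1) \<noteq> 0"

definition monodromic_tangential :: "nat \<Rightarrow> nat \<Rightarrow> pw_field \<Rightarrow> bool" where
  "monodromic_tangential kp km Z \<longleftrightarrow>
     contact kp (fst Z) \<and> contact km (snd Z) \<and>
     X0 (fst Z) * dYdx (fst Z) (2 * kp - 1) < 0 \<and>
     X0 (snd Z) * dYdx (snd Z) (2 * km - 1) > 0 \<and>
     X0 (fst Z) * X0 (snd Z) < 0"

subsection \<open>Half-return maps and Lyapunov coefficients\<close>

text \<open>\<open>T\<close> may be negative: the orbit is followed in whichever time direction enters the half-plane
  \<open>\<sigma> y > 0\<close>, with \<open>\<sigma> = 1\<close> for \<open>Z\<^sup>+\<close> and \<open>\<sigma> = -1\<close> for \<open>Z\<^sup>-\<close>.\<close>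

definition half_orbit :: "real \<Rightarrow> vfield \<Rightarrow> real \<Rightarrow> real \<Rightarrow> bool" where
  "half_orbit \<sigma> W x x' \<longleftrightarrow>
     (\<exists>\<gamma> T. T \<noteq> 0 \<and>
        (\<forall>t\<in>closed_segment 0 T. (\<gamma> has_vector_derivative W (\<gamma> t)) (at t within closed_segment 0 T)) \<and>
        \<gamma> 0 = (x, 0) \<and> \<gamma> T = (x', 0) \<and>
        (\<forall>t\<in>open_segment 0 T. \<sigma> * snd (\<gamma> t) > 0))"

definition half_return :: "real \<Rightarrow> vfield \<Rightarrow> real \<Rightarrow> real" where
  "half_return \<sigma> W x = (if x = 0 then 0 else (THE x'. half_orbit \<sigma> W x x'))"

definition half_return_coeff :: "real \<Rightarrow> vfield \<Rightarrow> nat \<Rightarrow> real" where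
  "half_return_coeff \<sigma> W n = (deriv ^^ n) (half_return \<sigma> W) 0 / fact n"

definition lyapunov_coeff :: "pw_field \<Rightarrow> nat \<Rightarrow> real" where
  "lyapunov_coeff Z n =
     sgn (X0 (fst Z)) * (half_return_coeff 1 (fst Z) n - half_return_coeff (-1) (snd Z) n)"

subsection \<open>Filippov trajectories\<close>

definition filippov_set :: "pw_field \<Rightarrow> real \<times> real \<Rightarrow> (real \<times> real) set" where
  "filippov_set Z p =
     (if snd p > 0 then {fst Z p}
      else if snd p < 0 then {snd Z p}
      else closed_segment (fst Z p) (snd Z p))"

text \<open>The integral form of: \<open>\<gamma>\<close> is locally absolutely continuous on the interval \<open>D\<close> and
  \<open>\<gamma>' (t) \<in> filippov_set Z (\<gamma> t)\<close> for almost every \<open>t\<close>. Since the sets are nonempty, the velocity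
  \<open>v\<close> can be corrected on a null set so that the inclusion holds for every \<open>t\<close>.\<close>

definition filippov_solution :: "pw_field \<Rightarrow> real set \<Rightarrow> (real \<Rightarrow> real \<times> real) \<Rightarrow> bool" where
  "filippov_solution Z D \<gamma> \<longleftrightarrow>
     (\<exists>v. (\<forall>t\<in>D. v t \<in> filippov_set Z (\<gamma> t)) \<and>
          (\<forall>s\<in>D. \<forall>t\<in>D. s \<le> t \<longrightarrow>
             v absolutely_integrable_on {s..t} \<and> integral {s..t} v = \<gamma> t - \<gamma> s))"

definition closed_orbit :: "pw_field \<Rightarrow> (real \<times> real) set \<Rightarrow> bool" where
  "closed_orbit Z \<Gamma> \<longleftrightarrow>
     (\<exists>\<gamma> T. 0 < T \<and> filippov_solution Z UNIV \<gamma> \<and> (\<forall>t. \<gamma> (t + T) = \<gamma> t) \<and>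
        inj_on \<gamma> {0..<T} \<and> \<Gamma> = range \<gamma>)"

definition limit_cycle :: "pw_field \<Rightarrow> (real \<times> real) set \<Rightarrow> bool" where
  "limit_cycle Z \<Gamma> \<longleftrightarrow> closed_orbit Z \<Gamma> \<and>
     (\<exists>U. open U \<and> \<Gamma> \<subseteq> U \<and> (\<forall>\<Gamma>'. closed_orbit Z \<Gamma>' \<and> \<Gamma>' \<subseteq> U \<longrightarrow> \<Gamma>' = \<Gamma>))"

text \<open>A trajectory turning around the origin meets \<open>y = 0\<close> alternately on either side of the origin.
  The first-return map is the forward first return to the same side, i.e. after one full turn.\<close>

definition first_return :: "pw_field \<Rightarrow> real \<Rightarrow> real \<Rightarrow> bool" where
  "first_return Z x x' \<longleftrightarrow>
     (\<exists>\<gamma> T. 0 < T \<and> filippov_solution Z {0..T} \<gamma> \<and> \<gamma> 0 = (x, 0) \<and> \<gamma> T = (x', 0) \<and> x * x' > 0 \<and>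
        (\<forall>t\<in>{0<..<T}. \<not> (snd (\<gamma> t) = 0 \<and> x * fst (\<gamma> t) > 0)))"

definition return_map :: "pw_field \<Rightarrow> real \<Rightarrow> real" where
  "return_map Z x = (THE x'. first_return Z x x')"

definition hyperbolic_cycle :: "pw_field \<Rightarrow> (real \<times> real) set \<Rightarrow> bool" where
  "hyperbolic_cycle Z \<Gamma> \<longleftrightarrow>
     (\<exists>x D. (x, 0) \<in> \<Gamma> \<and> first_return Z x x \<and> return_map Z x = x \<and>
        (return_map Z has_real_derivative D) (at x) \<and> \<bar>D\<bar> \<noteq> 1)"

subsection \<open>Orbital stability\<close>

definition orbitally_stable :: "pw_field \<Rightarrow> (real \<times> real) set \<Rightarrow> bool" where
  "orbitally_stable Z \<Gamma> \<longleftrightarrow>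
     (\<forall>\<epsilon>>0. \<exists>\<eta>>0. \<forall>\<gamma> T. 0 \<le> T \<longrightarrow> filippov_solution Z {0..T} \<gamma> \<longrightarrow> infdist (\<gamma> 0) \<Gamma> < \<eta> \<longrightarrow>
        (\<forall>t\<in>{0..T}. infdist (\<gamma> t) \<Gamma> < \<epsilon>))"

definition asymptotically_stable :: "pw_field \<Rightarrow> (real \<times> real) set \<Rightarrow> bool" where
  "asymptotically_stable Z \<Gamma> \<longleftrightarrow> orbitally_stable Z \<Gamma> \<and>
     (\<exists>\<eta>>0. \<forall>\<gamma>. filippov_solution Z {0..} \<gamma> \<longrightarrow> infdist (\<gamma> 0) \<Gamma> < \<eta> \<longrightarrow>
        ((\<lambda>t. infdist (\<gamma> t) \<Gamma>) \<longlongrightarrow> 0) at_top)"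

definition time_reversed :: "pw_field \<Rightarrow> pw_field" where
  "time_reversed Z = ((\<lambda>p. - fst Z p), (\<lambda>p. - snd Z p))"

text \<open>Both usual meanings at once: not stable, and repelling.\<close>

definition unstable :: "pw_field \<Rightarrow> (real \<times> real) set \<Rightarrow> bool" where
  "unstable Z \<Gamma> \<longleftrightarrow> \<not> orbitally_stable Z \<Gamma> \<and> asymptotically_stable (time_reversed Z) \<Gamma>"

end

theory Submission imports Defs "HOL-Complex_Analysis.Complex_Analysis" begin

text \<open>Near a point where \<open>X \<noteq> 0\<close>, orbits are graphs of solutions of the scalar equation \<open>dy/dx = Y/X\<close>. After
  complexification, the initial value \<open>H x\<close> at \<open>0\<close> of the solution that vanishes at \<open>x\<close> is a holomorphic function
  with a zero of order \<open>2k\<close> at the origin, so \<open>H = w^(2k)\<close> for a holomorphic chart \<open>w\<close>, and the half-return map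
  is \<open>x \<mapsto> w\<^sup>-\<^sup>1 (- w x)\<close>. It is therefore holomorphic on a disc that does not depend on the parameter, and depends
  continuously on the parameter, uniformly on that disc.

  A half-return map is an involution, which forces \<open>\<alpha>\<^sub>3 = - \<alpha>\<^sub>2\<^sup>2\<close>; hence \<open>V\<^sub>3 = O(V\<^sub>2)\<close>, and the displacement
  function is \<open>V\<^sub>2 x\<^sup>2 (1 + O(x)) + V\<^sub>4 x\<^sup>4 + O(x\<^sup>5)\<close> uniformly in the parameter. When \<open>V\<^sub>2\<close> and \<open>V\<^sub>4\<close> have opposite
  signs it has a transversal zero \<open>x\<close> of order \<open>\<surd>\<bar>\<lambda> - \<lambda>\<^sub>0\<bar>\<close>, and the sign of its derivative there is that
  of \<open>V\<^sub>4\<close>.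

  The orbits cross \<open>\<Sigma>\<close> away from the origin, so a Filippov solution near the cycle follows the arcs of the two
  systems alternately, and the first-return map is the composition of the two half-return maps. If its
  derivative at \<open>x\<close> is less than \<open>1\<close> in absolute value, then the annuli of arcs over small intervals around \<open>x\<close>
  are invariant and shrink to the cycle; otherwise the same holds for the time-reversed system. Only the
  clockwise case is treated directly, the other one follows by reflection in \<open>\<Sigma>\<close>.\<close>

subsection \<open>Holomorphic functions of two variables\<close>

text \<open>The parameter enters only continuously, so nothing may be differentiated in it and every
  object has to come with a domain fixed in advance. The solution, its initial value
  \<open>H\<close> and the involution are therefore all built as limits of contractions on a given
  disc; holomorphy, reality on the real axis and continuity in the parameter then pass to the limit
  together. Complex discs pay off at the end: Cauchy's inequality turns one sup bound into bounds on
  all Taylor coefficients and remainders. The order \<open>2k\<close> of the zero of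
  \<open>H\<close> does not change with the parameter; hence \<open>H = z^(2k) u\<close>, and by the
  maximum modulus principle division by \<open>z^(2k)\<close> costs only a constant factor.

  The relation for \<alpha> gives \<open>V\<^sub>3 = - (\<alpha>\<^sub>2\<^sup>+ +
  \<alpha>\<^sub>2\<^sup>-) V\<^sub>2\<close>, so for small \<open>x\<close> the cubic term is
  absorbed by the quadratic one, and the balance is between \<open>V\<^sub>2 x\<^sup>2\<close> and
  \<open>V\<^sub>4 x\<^sup>4\<close>.\<close>

definition hol2 :: "real \<Rightarrow> real \<Rightarrow> (complex \<Rightarrow> complex \<Rightarrow> complex) \<Rightarrow> bool" where
  "hol2 r s f \<longleftrightarrow> continuous_on (ball 0 r \<times> ball 0 s) (\<lambda>(x, y). f x y) \<and>
     (\<forall>S g h. open S \<longrightarrow> g holomorphic_on S \<longrightarrow> h holomorphic_on S \<longrightarrow>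
        g ` S \<subseteq> ball 0 r \<longrightarrow> h ` S \<subseteq> ball 0 s \<longrightarrow> (\<lambda>z. f (g z) (h z)) holomorphic_on S)"

text \<open>Holomorphy in two variables is tested along all pairs of holomorphic maps of one
  variable, so substitution is built into the definition. Joint continuity is a separate clause
  since integration over a parameter uses it.\<close>

lemma hol2_comp:
  assumes "hol2 r s f" "open S" "g holomorphic_on S" "h holomorphic_on S"
    "\<And>z. z \<in> S \<Longrightarrow> norm (g z) < r" "\<And>z. z \<in> S \<Longrightarrow> norm (h z) < s"
  shows "(\<lambda>z. f (g z) (h z)) holomorphic_on S"
proof -
  have "g ` S \<subseteq> ball 0 r" "h ` S \<subseteq> ball 0 s" using assms by auto
  then show ?thesis using assms unfolding hol2_def by blast
qed

lemma hol2_cont: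
  fixes a b :: "'t::topological_space \<Rightarrow> complex"
  assumes "hol2 r s f" "continuous_on T a" "continuous_on T b"
    "\<And>z. z \<in> T \<Longrightarrow> norm (a z) < r" "\<And>z. z \<in> T \<Longrightarrow> norm (b z) < s"
  shows "continuous_on T (\<lambda>z. f (a z) (b z))"
proof -
  have "continuous_on T ((\<lambda>(x, y). f x y) \<circ> (\<lambda>z. (a z, b z)))"
  proof (rule continuous_on_compose)
    show "continuous_on T (\<lambda>z. (a z, b z))"
      by (intro continuous_intros assms)
    show "continuous_on ((\<lambda>z. (a z, b z)) ` T) (\<lambda>(x, y). f x y)"
      by (rule continuous_on_subset[where s = "ball 0 r \<times> ball 0 s"])
         (use assms in \<open>auto simp: hol2_def\<close>)
  qed
  then show ?thesis by (simp add: o_def)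
qed

lemma hol2I:
  assumes "continuous_on (ball 0 r \<times> ball 0 s) (\<lambda>(x, y). f x y)"
    and "\<And>S g h. open S \<Longrightarrow> g holomorphic_on S \<Longrightarrow> h holomorphic_on S \<Longrightarrow>
        (\<And>z. z \<in> S \<Longrightarrow> norm (g z) < r) \<Longrightarrow> (\<And>z. z \<in> S \<Longrightarrow> norm (h z) < s)
        \<Longrightarrow> (\<lambda>z. f (g z) (h z)) holomorphic_on S"
  shows "hol2 r s f"
  unfolding hol2_def
proof (intro conjI allI impI assms)
  fix S and g h :: "complex \<Rightarrow> complex" assume *: "g ` S \<subseteq> ball 0 r" "h ` S \<subseteq> ball 0 s"
  show "norm (g z) < r" if "z \<in> S" for z using that * by auto
  show "norm (h z) < s" if "z \<in> S" for z using that * by auto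
qed

lemma hol2_mono:
  assumes "hol2 r s f" "r' \<le> r" "s' \<le> s"
  shows "hol2 r' s' f"
proof (rule hol2I)
  show "continuous_on (ball 0 r' \<times> ball 0 s') (\<lambda>(x, y). f x y)"
    by (rule continuous_on_subset[where s = "ball 0 r \<times> ball 0 s"])
         (use assms in \<open>auto simp: hol2_def\<close>)
next
  fix S and g h :: "complex \<Rightarrow> complex" assume *: "open S" "g holomorphic_on S" "h holomorphic_on S"
    "\<And>z. z \<in> S \<Longrightarrow> norm (g z) < r'" "\<And>z. z \<in> S \<Longrightarrow> norm (h z) < s'"
  show "(\<lambda>z. f (g z) (h z)) holomorphic_on S"
    by (rule hol2_comp[OF assms(1) *(1-3)]) (use *(4,5) assms(2,3) in \<open>blast intro: less_le_trans\<close>)+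
qed

lemma hol2_fst:
  assumes "F holomorphic_on ball 0 r" shows "hol2 r s (\<lambda>x y. F x)"
proof (rule hol2I)
  have "continuous_on (ball 0 r) F" using assms by (rule holomorphic_on_imp_continuous_on)
  then have "continuous_on (ball 0 r \<times> ball 0 s) (F \<circ> fst)"
    by (intro continuous_on_compose continuous_intros) (auto elim: continuous_on_subset)
  then show "continuous_on (ball 0 r \<times> ball 0 s) (\<lambda>(x, y::complex). F x)"
    by (simp add: o_def case_prod_unfold)
next
  fix S and g :: "complex \<Rightarrow> complex" assume "open S" "g holomorphic_on S" "\<And>z. z \<in> S \<Longrightarrow> norm (g z) < r"
  then show "(\<lambda>z. F (g z)) holomorphic_on S"
    using holomorphic_on_compose_gen[of g S F "ball 0 r"] assms by (force simp: o_def)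
qed

lemma hol2_snd:
  assumes "F holomorphic_on ball 0 s" shows "hol2 r s (\<lambda>x y. F y)"
proof (rule hol2I)
  have "continuous_on (ball 0 s) F" using assms by (rule holomorphic_on_imp_continuous_on)
  then have "continuous_on (ball 0 r \<times> ball 0 s) (F \<circ> snd)"
    by (intro continuous_on_compose continuous_intros) (auto elim: continuous_on_subset)
  then show "continuous_on (ball 0 r \<times> ball 0 s) (\<lambda>(x::complex, y). F y)"
    by (simp add: o_def case_prod_unfold)
next
  fix S and h :: "complex \<Rightarrow> complex" assume "open S" "h holomorphic_on S" "\<And>z. z \<in> S \<Longrightarrow> norm (h z) < s"
  then show "(\<lambda>z. F (h z)) holomorphic_on S"
    using holomorphic_on_compose_gen[of h S F "ball 0 s"] assms by (force simp: o_def)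
qed

lemma hol2_add:
  assumes "hol2 r s f" "hol2 r s g" shows "hol2 r s (\<lambda>x y. f x y + g x y)"
proof (rule hol2I)
  show "continuous_on (ball 0 r \<times> ball 0 s) (\<lambda>(x, y). f x y + g x y)"
    using assms unfolding hol2_def case_prod_unfold by (intro continuous_on_add) auto
qed (intro holomorphic_on_add hol2_comp[OF assms(1)] hol2_comp[OF assms(2)]; assumption)

lemma hol2_diff:
  assumes "hol2 r s f" "hol2 r s g" shows "hol2 r s (\<lambda>x y. f x y - g x y)"
proof (rule hol2I)
  show "continuous_on (ball 0 r \<times> ball 0 s) (\<lambda>(x, y). f x y - g x y)"
    using assms unfolding hol2_def case_prod_unfold by (intro continuous_on_diff) auto
qed (intro holomorphic_on_diff hol2_comp[OF assms(1)] hol2_comp[OF assms(2)]; assumption)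

lemma hol2_mult:
  assumes "hol2 r s f" "hol2 r s g" shows "hol2 r s (\<lambda>x y. f x y * g x y)"
proof (rule hol2I)
  show "continuous_on (ball 0 r \<times> ball 0 s) (\<lambda>(x, y). f x y * g x y)"
    using assms unfolding hol2_def case_prod_unfold by (intro continuous_on_mult) auto
qed (intro holomorphic_on_mult hol2_comp[OF assms(1)] hol2_comp[OF assms(2)]; assumption)

lemma hol2_divide:
  assumes "hol2 r s f" "hol2 r s g" "\<And>x y. norm x < r \<Longrightarrow> norm y < s \<Longrightarrow> g x y \<noteq> 0"
  shows "hol2 r s (\<lambda>x y. f x y / g x y)"
proof (rule hol2I)
  show "continuous_on (ball 0 r \<times> ball 0 s) (\<lambda>(x, y). f x y / g x y)"
    using assms unfolding hol2_def case_prod_unfold by (intro continuous_on_divide) auto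
next
  fix S and a h :: "complex \<Rightarrow> complex" assume *: "open S" "a holomorphic_on S" "h holomorphic_on S"
    "\<And>z. z \<in> S \<Longrightarrow> norm (a z) < r" "\<And>z. z \<in> S \<Longrightarrow> norm (h z) < s"
  show "(\<lambda>z. f (a z) (h z) / g (a z) (h z)) holomorphic_on S"
    by (intro holomorphic_on_divide hol2_comp[OF assms(1)] hol2_comp[OF assms(2)] * assms(3))
qed

lemma hol2_comp_snd:
  assumes f: "hol2 r s f" and g: "hol2 r t g" and "\<And>x y. norm x < r \<Longrightarrow> norm y < t \<Longrightarrow> norm (g x y) < s"
  shows "hol2 r t (\<lambda>x y. f x (g x y))"
proof (rule hol2I)
  have "continuous_on (ball 0 r \<times> ball 0 t) (\<lambda>p. f (fst p) (g (fst p) (snd p)))"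
    by (rule hol2_cont[OF f])
      (use assms in \<open>auto intro!: continuous_intros hol2_cont[OF g]\<close>)
  then show "continuous_on (ball 0 r \<times> ball 0 t) (\<lambda>(x, y). f x (g x y))"
    by (simp add: case_prod_unfold)
next
  fix S and a h :: "complex \<Rightarrow> complex" assume *: "open S" "a holomorphic_on S" "h holomorphic_on S"
    "\<And>z. z \<in> S \<Longrightarrow> norm (a z) < r" "\<And>z. z \<in> S \<Longrightarrow> norm (h z) < t"
  show "(\<lambda>z. f (a z) (g (a z) (h z))) holomorphic_on S"
    by (intro hol2_comp[OF f] hol2_comp[OF g] * assms(3))
qed

lemma hol2_section:
  assumes "hol2 r s f" "norm y < s" shows "(\<lambda>x. f x y) holomorphic_on ball 0 r"
  by (rule hol2_comp[OF assms(1)]) (use assms(2) in \<open>auto intro!: holomorphic_intros\<close>)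

lemma hol2_section':
  assumes "hol2 r s f" "norm x < r" shows "(\<lambda>y. f x y) holomorphic_on ball 0 s"
  by (rule hol2_comp[OF assms(1)]) (use assms(2) in \<open>auto intro!: holomorphic_intros\<close>)

lemma hol2_uniform_limit:
  assumes F: "\<And>n. hol2 r s (F n)"
    and lim: "uniform_limit (ball 0 r \<times> ball 0 s) (\<lambda>n p. F n (fst p) (snd p)) (\<lambda>p. f (fst p) (snd p)) sequentially"
  shows "hol2 r s f"
proof (rule hol2I)
  have "continuous_on (ball 0 r \<times> ball 0 s) (\<lambda>p. f (fst p) (snd p))"
    by (rule uniform_limit_theorem[OF _ lim])
      (use F in \<open>auto simp: hol2_def case_prod_unfold\<close>)
  then show "continuous_on (ball 0 r \<times> ball 0 s) (\<lambda>(x, y). f x y)"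
    by (simp add: case_prod_unfold)
next
  fix S and a h :: "complex \<Rightarrow> complex" assume *: "open S" "a holomorphic_on S" "h holomorphic_on S"
    "\<And>z. z \<in> S \<Longrightarrow> norm (a z) < r" "\<And>z. z \<in> S \<Longrightarrow> norm (h z) < s"
  show "(\<lambda>z. f (a z) (h z)) holomorphic_on S"
  proof (rule holomorphic_uniform_sequence[OF \<open>open S\<close>])
    show "(\<lambda>z. F n (a z) (h z)) holomorphic_on S" for n
      by (intro hol2_comp[OF F] *)
    fix x assume "x \<in> S"
    then obtain d where "d > 0" "cball x d \<subseteq> S" using \<open>open S\<close> by (meson open_contains_cball)
    moreover have "uniform_limit (cball x d) (\<lambda>n z. F n (a z) (h z)) (\<lambda>z. f (a z) (h z)) sequentially"
      using uniform_limit_compose'[OF lim, of "\<lambda>z. (a z, h z)" "cball x d"] calculation * by force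
    ultimately show "\<exists>d>0. cball x d \<subseteq> S \<and>
        uniform_limit (cball x d) (\<lambda>n z. F n (a z) (h z)) (\<lambda>z. f (a z) (h z)) sequentially" by blast
  qed
qed

text \<open>Discs of radius \<open>r/4\<close> about points of the half disc stay in
  \<open>ball 0 r\<close>, so Cauchy's inequality bounds the derivative there by
  \<open>4 * B / r\<close>; the half disc is convex.\<close>

lemma holomorphic_bounded_lipschitz:
  assumes f: "f holomorphic_on ball 0 r" and B: "\<And>z. norm z < r \<Longrightarrow> norm (f z) \<le> B"
    and x: "norm x < r / 2" "norm y < r / 2"
  shows "norm (f x - f y) \<le> 4 * B / r * norm (x - y)"
proof (rule field_differentiable_bound[where S = "ball 0 (r/2)" and f' = "deriv f"])
  have r: "r > 0" using x norm_ge_zero[of x] by linarith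
  fix z :: complex assume z: "z \<in> ball 0 (r/2)"
  then have "z \<in> ball 0 r" using r by auto
  then show "(f has_field_derivative deriv f z) (at z within ball 0 (r / 2))"
    using f by (meson holomorphic_derivI open_ball has_field_derivative_at_within)
  have sub: "cball z (r/4) \<subseteq> ball 0 r"
  proof
    fix w assume "w \<in> cball z (r/4)"
    then have "norm (w - z) \<le> r/4" by (simp add: dist_norm norm_minus_commute)
    moreover have "norm w \<le> norm z + norm (w - z)" using norm_triangle_ineq[of z "w - z"] by simp
    ultimately show "w \<in> ball 0 r" using z r by auto
  qed
  have "norm ((deriv ^^ 1) f z) \<le> fact 1 * B / (r/4) ^ 1"
  proof (rule Cauchy_inequality)
    show "f holomorphic_on ball z (r/4)" using f sub ball_subset_cball by (meson holomorphic_on_subset order_trans)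
    show "continuous_on (cball z (r/4)) f"
      using f sub by (meson holomorphic_on_imp_continuous_on continuous_on_subset)
    show "norm (f w) \<le> B" if "norm (z - w) = r/4" for w
      using B[of w] sub that by (auto simp: dist_norm)
  qed (use r in auto)
  then show "norm (deriv f z) \<le> 4 * B / r" by (simp add: mult.commute)
qed (use x in auto)

lemma norm_integral_01_le:
  fixes g :: "real \<Rightarrow> complex"
  assumes "continuous_on {0..1} g" "\<And>t. t \<in> {0..1} \<Longrightarrow> norm (g t) \<le> B"
  shows "norm (integral {0..1} g) \<le> B"
  using integral_bound[of 0 1 g B] assms by simp

text \<open>Morera's theorem: the integral over a triangle is exchanged with the integral over
  \<open>t\<close>, and for each fixed \<open>t\<close> it vanishes by Cauchy's theorem.\<close>

lemma holomorphic_on_integral_01: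
  fixes f :: "complex \<Rightarrow> real \<Rightarrow> complex"
  assumes S: "open S" and cont: "continuous_on (S \<times> {0..1}) (\<lambda>(z, t). f z t)"
    and hol: "\<And>t. t \<in> {0..1} \<Longrightarrow> (\<lambda>z. f z t) holomorphic_on S"
  shows "(\<lambda>z. integral {0..1} (f z)) holomorphic_on S"
proof -
  have "(\<lambda>z. integral {0..1} (f z)) analytic_on S"
  proof (rule Morera_triangle[OF _ S])
    show "continuous_on S (\<lambda>z. integral {0..1} (f z))"
      using integral_continuous_on_param[of S 0 1 f] cont by simp
  next
    fix a b c
    show "convex hull {a, b, c} \<subseteq> S \<longrightarrow> contour_integral (linepath a b) (\<lambda>z. integral {0..1} (f z)) +
       contour_integral (linepath b c) (\<lambda>z. integral {0..1} (f z)) +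
       contour_integral (linepath c a) (\<lambda>z. integral {0..1} (f z)) = 0"
    proof
    assume sub: "convex hull {a, b, c} \<subseteq> S"
    define I where "I = (\<lambda>a b t. integral {0..1} (\<lambda>s. f (linepath a b s) t * (b - a)))"
    have lp: "continuous_on ({0..1} \<times> {0..1}) (\<lambda>(s, t). f (linepath a b s) t * (b - a))"
      if "closed_segment a b \<subseteq> S" for a b
    proof -
      have "continuous_on ({0..1} \<times> {0..1}) ((\<lambda>(z, t). f z t) \<circ> (\<lambda>p. (linepath a b (fst p), snd p)))"
      proof (rule continuous_on_compose)
        show "continuous_on ({0..1} \<times> {0..1}) (\<lambda>p. (linepath a b (fst p), snd p))"
          unfolding linepath_def by (intro continuous_intros)
        have "linepath a b s \<in> S" if "s \<in> {0..1}" for s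
          using that \<open>closed_segment a b \<subseteq> S\<close> by (metis linepath_in_path subsetD)
        then show "continuous_on ((\<lambda>p. (linepath a b (fst p), snd p)) ` ({0..1} \<times> {0..1})) (\<lambda>(z, t). f z t)"
          by (intro continuous_on_subset[OF cont]) auto
      qed
      then show ?thesis unfolding case_prod_unfold o_def by (auto intro!: continuous_intros)
    qed
    have swap: "contour_integral (linepath a b) (\<lambda>z. integral {0..1} (f z)) = integral {0..1} (I a b)"
      if "closed_segment a b \<subseteq> S" for a b
    proof -
      have "contour_integral (linepath a b) (\<lambda>z. integral {0..1} (f z)) =
         integral {0..1} (\<lambda>s. integral {0..1} (\<lambda>t. f (linepath a b s) t * (b - a)))"
        by (simp add: contour_integral_integral)
      also have "\<dots> = integral {0..1} (I a b)"
        using integral_swap_continuous[of 0 0 1 1 "\<lambda>s t. f (linepath a b s) t * (b - a)"] lp[OF that]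
        unfolding cbox_Pair_eq I_def by simp
      finally show ?thesis .
    qed
    have Icont: "continuous_on {0..1} (I a b)" if "closed_segment a b \<subseteq> S" for a b
    proof -
      have "continuous_on ({0..1} \<times> {0..1}) (\<lambda>p. (\<lambda>(s, t). f (linepath a b s) t * (b - a)) (snd p, fst p))"
        by (rule continuous_on_compose2[OF lp[OF that]])
          (auto simp del: case_prod_conv intro!: continuous_on_Pair continuous_on_fst continuous_on_snd continuous_on_id)
      then show ?thesis
        using integral_continuous_on_param[of "{0..1}" 0 1 "\<lambda>t s. f (linepath a b s) t * (b - a)"]
        unfolding I_def by (simp add: case_prod_unfold o_def)
    qed
    have seg: "closed_segment a b \<subseteq> S" "closed_segment b c \<subseteq> S" "closed_segment c a \<subseteq> S"
      using sub by (meson convex_contains_segment convex_convex_hull hull_inc insert_iff order_trans)+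
    have z: "I a b t + I b c t + I c a t = 0" if t: "t \<in> {0..1}" for t
    proof -
      have "((\<lambda>z. f z t) has_contour_integral 0) (linepath a b +++ linepath b c +++ linepath c a)"
        by (rule Cauchy_theorem_triangle) (use hol[OF t] sub holomorphic_on_subset in blast)
      then have "contour_integral (linepath a b) (\<lambda>z. f z t) + contour_integral (linepath b c) (\<lambda>z. f z t)
        + contour_integral (linepath c a) (\<lambda>z. f z t) = 0"
        by (rule has_chain_integral_chain_integral3)
      then show ?thesis by (simp add: I_def contour_integral_integral)
    qed
    have "integral {0..1} (I a b) + integral {0..1} (I b c) + integral {0..1} (I c a)
       = integral {0..1} (\<lambda>t. I a b t + I b c t + I c a t)"
      by (subst integral_add; (subst integral_add)?)
        (auto intro!: integrable_continuous_interval continuous_intros Icont seg)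
    also have "\<dots> = integral {0..1} (\<lambda>t::real. 0::complex)"
      by (rule integral_cong) (use z in auto)
    finally show "contour_integral (linepath a b) (\<lambda>z. integral {0..1} (f z)) +
       contour_integral (linepath b c) (\<lambda>z. integral {0..1} (f z)) +
       contour_integral (linepath c a) (\<lambda>z. integral {0..1} (f z)) = 0"
      by (simp add: swap seg)
    qed
  qed
  then show ?thesis by (rule analytic_imp_holomorphic)
qed

text \<open>Up to a factor \<open>x\<close> this is the primitive of \<open>g\<close> in the first
  variable that vanishes at 0. Rescaling the segment from 0 to \<open>x\<close> to
  \<open>{0..1}\<close> gives one interval for all complex \<open>x\<close>, and
  \<open>t * x\<close> never leaves the disc.\<close>

lemma hol2_integral_01:
  assumes g: "hol2 r s g"
  shows "hol2 r s (\<lambda>x k. integral {0..1} (\<lambda>t. g (of_real t * x) k))"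
proof (rule hol2I)
  have lt: "norm (of_real t * x) < r" if "norm x < r" "t \<in> {0..1}" for t and x :: complex
    using that mult_right_mono[of "\<bar>t\<bar>" 1 "norm x"] by (auto simp: norm_mult)
  let ?T = "((ball 0 r \<times> ball 0 s) \<times> cbox 0 1) :: ((complex \<times> complex) \<times> real) set"
  have "continuous_on ?T (\<lambda>q. of_real (snd q) * fst (fst q))" "continuous_on ?T (\<lambda>q. snd (fst q))"
    by (intro continuous_intros)+
  then have "continuous_on ?T (\<lambda>q. g (of_real (snd q) * fst (fst q)) (snd (fst q)))"
    by (rule hol2_cont[OF g]) (use lt in auto)
  then show "continuous_on (ball 0 r \<times> ball 0 s) (\<lambda>(x, k). integral {0..1} (\<lambda>t. g (of_real t * x) k))"
    using integral_continuous_on_param[of "ball 0 r \<times> ball 0 s" 0 1 "\<lambda>p t. g (of_real t * fst p) (snd p)"]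
    by (simp add: case_prod_unfold)
  fix S and a h :: "complex \<Rightarrow> complex" assume *: "open S" "a holomorphic_on S" "h holomorphic_on S"
    "\<And>z. z \<in> S \<Longrightarrow> norm (a z) < r" "\<And>z. z \<in> S \<Longrightarrow> norm (h z) < s"
  have ac: "continuous_on S a" "continuous_on S h" using * holomorphic_on_imp_continuous_on by blast+
  show "(\<lambda>z. integral {0..1} (\<lambda>t. g (of_real t * a z) (h z))) holomorphic_on S"
  proof (rule holomorphic_on_integral_01[OF \<open>open S\<close>])
    have c: "continuous_on (S \<times> {0..1}) (\<lambda>q. a (fst q))" "continuous_on (S \<times> {0..1}) (\<lambda>q. h (fst q))"
      by (rule continuous_on_compose2[OF ac(1)] continuous_on_compose2[OF ac(2)]; force intro: continuous_on_fst continuous_on_id)+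
    have c': "continuous_on (S \<times> {0..1}) (\<lambda>q. complex_of_real (snd q))"
      by (intro continuous_intros)
    have "continuous_on (S \<times> {0..1}) (\<lambda>q. g (of_real (snd q) * a (fst q)) (h (fst q)))"
      by (rule hol2_cont[OF g continuous_on_mult[OF c'(1) c(1)] c(2)]) (use lt * in auto)
    then show "continuous_on (S \<times> {0..1}) (\<lambda>(z, t). g (of_real t * a z) (h z))"
      by (simp add: case_prod_unfold)
    show "(\<lambda>z. g (of_real t * a z) (h z)) holomorphic_on S" if "t \<in> {0..1}" for t
      by (rule hol2_comp[OF g \<open>open S\<close> holomorphic_on_mult[OF holomorphic_on_const *(2)] *(3)]) (use lt * that in auto)
  qed
qed

text \<open>The increments form a uniformly summable series. The limit is written with
  \<open>lim\<close> to match the definitions of \<open>picard\<close> and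
  \<open>fixp\<close>.\<close>

lemma uniform_limit_geometric:
  fixes u :: "nat \<Rightarrow> 'a \<Rightarrow> complex"
  assumes d: "\<And>n p. p \<in> A \<Longrightarrow> norm (u (Suc n) p - u n p) \<le> C * q ^ n" and q: "0 \<le> q" "q < 1"
  shows "uniform_limit A u (\<lambda>p. lim (\<lambda>n. u n p)) sequentially"
proof -
  have "uniform_limit A (\<lambda>n x. \<Sum>i<n. u (Suc i) x - u i x) (\<lambda>x. suminf (\<lambda>i. u (Suc i) x - u i x)) sequentially"
    by (rule Weierstrass_m_test[OF d summable_mult[OF summable_geometric]]) (use q in auto)
  moreover have "(\<Sum>i<n. u (Suc i) x - u i x) = u n x - u 0 x" for n x
    using sum_lessThan_telescope[of "\<lambda>i. u i x"] by simp
  ultimately have "uniform_limit A (\<lambda>n x. u n x - u 0 x) (\<lambda>x. suminf (\<lambda>i. u (Suc i) x - u i x)) sequentially"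
    by simp
  from uniform_limit_add[OF this uniform_limit_const[of "u 0" A]]
  have *: "uniform_limit A u (\<lambda>x. suminf (\<lambda>i. u (Suc i) x - u i x) + u 0 x) sequentially"
    by simp
  from uniformly_convergentI[OF this] show ?thesis
    by (simp add: uniformly_convergent_uniform_limit_iff)
qed

subsection \<open>Scalar differential equations with holomorphic right-hand side\<close>

text \<open>Picard iteration for \<open>y' = f x y\<close>, \<open>y 0 = k\<close>. The integral
  from 0 to \<open>x\<close> is written as \<open>x\<close> times an integral over
  \<open>{0..1}\<close>, which makes sense for complex \<open>x\<close>; the initial value
  \<open>k\<close> stays a second complex variable.\<close>

primrec picit :: "(complex \<Rightarrow> complex \<Rightarrow> complex) \<Rightarrow> nat \<Rightarrow> complex \<Rightarrow> complex \<Rightarrow> complex" where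
  "picit f 0 x k = k"
| "picit f (Suc n) x k = k + x * integral {0..1} (\<lambda>t. f (of_real t * x) (picit f n (of_real t * x) k))"

definition picard :: "(complex \<Rightarrow> complex \<Rightarrow> complex) \<Rightarrow> complex \<Rightarrow> complex \<Rightarrow> complex" where
  "picard f x k = lim (\<lambda>n. picit f n x k)"

text \<open>The function \<open>f\<close> is controlled on a box of size \<open>b\<close>, and
  initial values are taken below \<open>b/2\<close>. The condition
  \<open>\<rho> * F \<le> b / 8\<close> keeps every iterate in the box, as
  \<open>b/2 + b/8 < b\<close>, and \<open>\<rho> * K \<le> 1 / 4\<close> makes the iteration
  contract. In the later use the same four constants serve all parameters near the base
  parameter.\<close>

locale picard_rhs =
  fixes f :: "complex \<Rightarrow> complex \<Rightarrow> complex" and b F K \<rho> :: real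
  assumes f_hol2: "hol2 b b f"
    and f_le: "norm x < b \<Longrightarrow> norm y < b \<Longrightarrow> norm (f x y) \<le> F"
    and f_lip: "norm x < b \<Longrightarrow> norm y < b \<Longrightarrow> norm y' < b \<Longrightarrow> norm (f x y - f x y') \<le> K * norm (y - y')"
    and pos: "0 < \<rho>" "\<rho> \<le> b" "0 \<le> K" "0 \<le> F" "\<rho> * F \<le> b / 8" "\<rho> * K \<le> 1 / 4"
begin

lemma scaled_less: "norm x < r \<Longrightarrow> t \<in> {0..1} \<Longrightarrow> norm (of_real t * x) < (r::real)" for x :: complex
  using mult_right_mono[of "\<bar>t\<bar>" 1 "norm x"] by (auto simp: norm_mult)

lemma xF: "norm x < \<rho> \<Longrightarrow> norm x * F \<le> b / 8" for x :: complex
  using pos mult_right_mono[of "norm x" \<rho> F] by linarith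

lemma xK: "norm x < \<rho> \<Longrightarrow> norm x * K \<le> 1 / 4" for x :: complex
  using pos mult_right_mono[of "norm x" \<rho> K] by linarith

lemma b_pos: "0 < b" using pos by linarith

lemma in_box:
  fixes x k g :: complex
  assumes "norm x < \<rho>" "norm k < b / 2" "norm (g - k) \<le> norm x * F"
  shows "norm g < b"
proof -
  have "norm g \<le> norm k + norm (g - k)" using norm_triangle_ineq[of k "g - k"] by simp
  then show ?thesis using assms xF[OF assms(1)] b_pos by linarith
qed

text \<open>The two claims need a common induction: the next iterate is holomorphic because the
  previous one stays in the box on which \<open>f\<close> is.\<close>

lemma picit_hol2_bound:
  "hol2 \<rho> (b/2) (picit f n) \<and>
   (\<forall>x k. norm x < \<rho> \<longrightarrow> norm k < b/2 \<longrightarrow> norm (picit f n x k - k) \<le> norm x * F)"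
proof (induction n)
  case 0
  have "hol2 \<rho> (b/2) (\<lambda>x k. k)" by (rule hol2_snd) (rule holomorphic_on_ident)
  moreover have "picit f 0 = (\<lambda>x k. k)" by (intro ext) simp
  ultimately show ?case using pos by simp
next
  case (Suc n)
  define g where "g x k = f x (picit f n x k)" for x k
  have box: "norm (picit f n x k) < b" if "norm x < \<rho>" "norm k < b/2" for x k
    using in_box Suc that by blast
  have g: "hol2 \<rho> (b/2) g"
    unfolding g_def by (rule hol2_comp_snd[OF hol2_mono[OF f_hol2, of \<rho> b]]) (use Suc box pos in auto)
  have i: "hol2 \<rho> (b/2) (\<lambda>x k. integral {0..1} (\<lambda>t. g (of_real t * x) k))"
    by (rule hol2_integral_01[OF g])
  have eq: "picit f (Suc n) = (\<lambda>x k. k + x * integral {0..1} (\<lambda>t. g (of_real t * x) k))"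
    by (intro ext) (simp add: g_def)
  have 1: "hol2 \<rho> (b/2) (picit f (Suc n))"
    unfolding eq
    by (intro hol2_add hol2_mult i hol2_snd[OF holomorphic_on_ident] hol2_fst[OF holomorphic_on_ident])
  have 2: "norm (picit f (Suc n) x k - k) \<le> norm x * F" if x: "norm x < \<rho>" and k: "norm k < b/2" for x k
  proof -
    have "continuous_on {0..1} (\<lambda>t. of_real t * x)" by (intro continuous_intros)
    then have "continuous_on {0..1} (\<lambda>t. g (of_real t * x) k)"
      by (rule hol2_cont[OF g]) (use x k scaled_less in auto)
    moreover have "norm (g (of_real t * x) k) \<le> F" if "t \<in> {0..1}" for t
      unfolding g_def using scaled_less[OF x that] box k pos by (intro f_le) (auto intro: less_le_trans)
    ultimately have "norm (integral {0..1} (\<lambda>t. g (of_real t * x) k)) \<le> F"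
      by (rule norm_integral_01_le)
    then show ?thesis by (simp add: eq norm_mult mult_left_mono)
  qed
  show ?case using 1 2 by blast
qed

lemmas picit_hol2 = picit_hol2_bound[THEN conjunct1]
lemmas picit_le = picit_hol2_bound[THEN conjunct2, rule_format]

lemma picit_box: "norm x < \<rho> \<Longrightarrow> norm k < b/2 \<Longrightarrow> norm (picit f n x k) < b"
  using in_box picit_le by blast

lemma norm_step:
  fixes u v :: "real \<Rightarrow> complex"
  assumes "continuous_on {0..1} u" "continuous_on {0..1} v"
    and "\<And>t. t \<in> {0..1} \<Longrightarrow> norm (u t - v t) \<le> B"
  shows "norm (x * integral {0..1} u - x * integral {0..1} v) \<le> norm x * B"
proof -
  have "x * integral {0..1} u - x * integral {0..1} v = x * integral {0..1} (\<lambda>t. u t - v t)"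
    using assms by (subst integral_diff) (auto intro: integrable_continuous_interval simp: right_diff_distrib)
  moreover have "norm (integral {0..1} (\<lambda>t. u t - v t)) \<le> B"
    by (rule norm_integral_01_le) (use assms in \<open>auto intro: continuous_on_diff\<close>)
  ultimately show ?thesis by (simp add: norm_mult mult_left_mono)
qed

lemma cont_ray:
  assumes "hol2 \<rho> (b/2) g" "\<And>x k. norm x < \<rho> \<Longrightarrow> norm k < b/2 \<Longrightarrow> norm (g x k) < b" "norm x < \<rho>" "norm k < b/2"
  shows "continuous_on {0..1} (\<lambda>t. f (of_real t * x) (g (of_real t * x) k))"
proof -
  have c: "continuous_on {0..1} (\<lambda>t. of_real t * x)" by (intro continuous_intros)
  have "continuous_on {0..1} (\<lambda>t. g (of_real t * x) k)"
    by (rule hol2_cont[OF assms(1) c]) (use assms scaled_less in auto)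
  then show ?thesis
    by (rule hol2_cont[OF f_hol2 c]) (use assms scaled_less pos in \<open>auto intro: less_le_trans\<close>)
qed

lemma picit_diff:
  "norm x < \<rho> \<Longrightarrow> norm k < b/2 \<Longrightarrow> norm (picit f (Suc n) x k - picit f n x k) \<le> (b / 8) * (1/4)^n"
proof (induction n arbitrary: x)
  case 0
  then show ?case using picit_le[of x k "Suc 0"] xF[of x] by simp
next
  case (Suc n)
  have "norm (x * integral {0..1} (\<lambda>t. f (of_real t * x) (picit f (Suc n) (of_real t * x) k))
     - x * integral {0..1} (\<lambda>t. f (of_real t * x) (picit f n (of_real t * x) k))) \<le> norm x * (K * ((b / 8) * (1/4)^n))"
  proof (rule norm_step)
    fix t :: real assume t: "t \<in> {0..1}"
    let ?y = "of_real t * x"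
    have y: "norm ?y < \<rho>" using scaled_less t Suc by blast
    have "norm (f ?y (picit f (Suc n) ?y k) - f ?y (picit f n ?y k)) \<le> K * norm (picit f (Suc n) ?y k - picit f n ?y k)"
      by (rule f_lip) (use y picit_box Suc pos in \<open>auto intro: less_le_trans simp del: picit.simps\<close>)
    also have "\<dots> \<le> K * ((b / 8) * (1/4)^n)" using Suc y pos by (intro mult_left_mono) auto
    finally show "norm (f ?y (picit f (Suc n) ?y k) - f ?y (picit f n ?y k)) \<le> K * ((b / 8) * (1/4)^n)" .
  qed (rule cont_ray[OF picit_hol2 picit_box]; use Suc in simp)+
  also have "\<dots> = (norm x * K) * ((b / 8) * (1/4)^n)" by simp
  also have "\<dots> \<le> (1/4) * ((b / 8) * (1/4)^n)" using xK Suc b_pos by (intro mult_right_mono) auto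
  finally show ?case by simp
qed

lemma picit_uniform:
  "uniform_limit (ball 0 \<rho> \<times> ball 0 (b/2)) (\<lambda>n p. picit f n (fst p) (snd p)) (\<lambda>p. picard f (fst p) (snd p)) sequentially"
  unfolding picard_def
  by (rule uniform_limit_geometric[where C = "b/8" and q = "1/4"]) (use picit_diff in \<open>auto simp del: picit.simps\<close>)

lemma picit_tendsto: "norm x < \<rho> \<Longrightarrow> norm k < b/2 \<Longrightarrow> (\<lambda>n. picit f n x k) \<longlonglongrightarrow> picard f x k"
  using tendsto_uniform_limitI[OF picit_uniform, of "(x, k)"] by simp

lemma picard_hol2: "hol2 \<rho> (b/2) (picard f)"
  by (rule hol2_uniform_limit[OF picit_hol2 picit_uniform])

lemma picard_le: "norm x < \<rho> \<Longrightarrow> norm k < b/2 \<Longrightarrow> norm (picard f x k - k) \<le> norm x * F"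
  by (rule tendsto_upperbound[OF tendsto_norm[OF tendsto_diff[OF picit_tendsto tendsto_const]]])
    (use picit_le in \<open>auto simp del: picit.simps\<close>)

lemma picard_box: "norm x < \<rho> \<Longrightarrow> norm k < b/2 \<Longrightarrow> norm (picard f x k) < b"
  using in_box picard_le by blast

lemma picard_eq:
  assumes x: "norm x < \<rho>" and k: "norm k < b/2"
  shows "picard f x k = k + x * integral {0..1} (\<lambda>t. f (of_real t * x) (picard f (of_real t * x) k))"
    (is "_ = ?R")
proof (rule LIMSEQ_unique)
  show "(\<lambda>n. picit f (Suc n) x k) \<longlonglongrightarrow> picard f x k"
    using picit_tendsto[OF x k] by (rule LIMSEQ_Suc)
  show "(\<lambda>n. picit f (Suc n) x k) \<longlonglongrightarrow> ?R"
  proof (rule metric_LIMSEQ_I)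
    fix e :: real assume "e > 0"
    then have "\<forall>\<^sub>F n in sequentially. \<forall>p\<in>ball 0 \<rho> \<times> ball 0 (b/2). dist (picit f n (fst p) (snd p)) (picard f (fst p) (snd p)) < e"
      using picit_uniform by (simp add: uniform_limit_iff)
    then obtain N where "\<And>n p. n \<ge> N \<Longrightarrow> p \<in> ball 0 \<rho> \<times> ball 0 (b/2) \<Longrightarrow>
        dist (picit f n (fst p) (snd p)) (picard f (fst p) (snd p)) < e"
      unfolding eventually_sequentially by blast
    from this[of _ "(_, _)"]
    \<comment> \<open>The integrals run along the whole ray \<open>t * x\<close>, so one index
      \<open>N\<close> must serve all its points; this is where uniform convergence enters.\<close>
    have N: "norm (picit f n x k - picard f x k) < e" if "n \<ge> N" "norm x < \<rho>" "norm k < b/2" for n x k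
      using that by (simp add: dist_norm)
    show "\<exists>N. \<forall>n\<ge>N. dist (picit f (Suc n) x k) ?R < e"
    proof (intro exI allI impI)
      fix n assume n: "n \<ge> N"
      have "norm (x * integral {0..1} (\<lambda>t. f (of_real t * x) (picit f n (of_real t * x) k))
          - x * integral {0..1} (\<lambda>t. f (of_real t * x) (picard f (of_real t * x) k))) \<le> norm x * (K * e)"
      proof (rule norm_step)
        fix t :: real assume t: "t \<in> {0..1}"
        let ?y = "of_real t * x"
        have y: "norm ?y < \<rho>" using scaled_less t x by blast
        have "norm (f ?y (picit f n ?y k) - f ?y (picard f ?y k)) \<le> K * norm (picit f n ?y k - picard f ?y k)"
          by (rule f_lip) (use y picit_box picard_box k pos in \<open>auto intro: less_le_trans simp del: picit.simps\<close>)
        also have "\<dots> \<le> K * e" using N[OF n y k] pos by (intro mult_left_mono) auto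
        finally show "norm (f ?y (picit f n ?y k) - f ?y (picard f ?y k)) \<le> K * e" .
      qed (rule cont_ray[OF picit_hol2 picit_box] cont_ray[OF picard_hol2 picard_box]; use x k in simp)+
      also have "\<dots> = (norm x * K) * e" by simp
      also have "\<dots> \<le> (1/4) * e" using xK x \<open>e > 0\<close> by (intro mult_right_mono) auto
      also have "\<dots> < e" using \<open>e > 0\<close> by simp
      finally show "dist (picit f (Suc n) x k) ?R < e" by (simp add: dist_norm)
    qed
  qed
qed

text \<open>The right-hand side along the solution is holomorphic, so it has a primitive
  \<open>P\<close>, and the integral equation collapses to
  \<open>picard f z k = k + (P z - P 0)\<close>.\<close>

lemma picard_deriv:
  assumes x: "norm x < \<rho>" and k: "norm k < b/2"
  shows "((\<lambda>x. picard f x k) has_field_derivative f x (picard f x k)) (at x)"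
proof -
  define g where "g z = f z (picard f z k)" for z
  have "g holomorphic_on ball 0 \<rho>"
    unfolding g_def
    by (rule hol2_comp[OF f_hol2 open_ball holomorphic_on_ident hol2_section[OF picard_hol2 k]])
      (use picard_box k pos in \<open>auto intro: less_le_trans\<close>)
  from holomorphic_convex_primitive'[OF convex_ball open_ball this]
  obtain P where P: "\<And>z. z \<in> ball 0 \<rho> \<Longrightarrow> (P has_field_derivative g z) (at z within ball 0 \<rho>)" by blast
  have P': "(P has_field_derivative g z) (at z)" if "norm z < \<rho>" for z
    using P[of z] at_within_open[of z "ball 0 \<rho>"] that by simp
  have eq: "picard f z k = k + (P z - P 0)" if z: "norm z < \<rho>" for z
  proof -
    have "((\<lambda>t. g (of_real t * z) * z) has_integral (P (of_real 1 * z) - P (of_real 0 * z))) {0..1}"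
    proof (rule fundamental_theorem_of_calculus)
      fix t :: real assume t: "t \<in> {0..1}"
      have "((\<lambda>t. of_real t * z) has_vector_derivative z) (at t within {0..1})"
        by (auto intro!: derivative_eq_intros)
      then show "((\<lambda>t. P (of_real t * z)) has_vector_derivative g (of_real t * z) * z) (at t within {0..1})"
        using field_vector_diff_chain_within[of "\<lambda>t. of_real t * z" z t "{0..1}" P "g (of_real t * z)"]
          P'[OF scaled_less[OF z t]] by (simp add: o_def has_field_derivative_at_within mult.commute)
    qed simp
    from integral_unique[OF this] have "integral {0..1} (\<lambda>t. g (of_real t * z)) * z = P z - P 0"
      by simp
    then show ?thesis
      using picard_eq[OF z k] by (simp add: g_def mult.commute)
  qed
  have "((\<lambda>z. k + (P z - P 0)) has_field_derivative g x) (at x)"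
    using P'[OF x] by (auto intro!: derivative_eq_intros)
  then show ?thesis
    unfolding g_def by (rule has_field_derivative_transform_within_open[where S = "ball 0 \<rho>"]) (use x eq in auto)
qed

text \<open>The constant 2 reproduces itself under the iteration because
  \<open>1 + (1/4) * 2 \<le> 2\<close>.\<close>

lemma picit_lip:
  "norm x < \<rho> \<Longrightarrow> norm k < b/2 \<Longrightarrow> norm k' < b/2 \<Longrightarrow> norm (picit f n x k - picit f n x k') \<le> 2 * norm (k - k')"
proof (induction n arbitrary: x)
  case (Suc n)
  have *: "norm (x * integral {0..1} (\<lambda>t. f (of_real t * x) (picit f n (of_real t * x) k))
     - x * integral {0..1} (\<lambda>t. f (of_real t * x) (picit f n (of_real t * x) k'))) \<le> norm x * (K * (2 * norm (k - k')))"
  proof (rule norm_step)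
    fix t :: real assume t: "t \<in> {0..1}"
    let ?y = "of_real t * x"
    have y: "norm ?y < \<rho>" using scaled_less t Suc by blast
    have "norm (f ?y (picit f n ?y k) - f ?y (picit f n ?y k')) \<le> K * norm (picit f n ?y k - picit f n ?y k')"
      by (rule f_lip) (use y picit_box Suc pos in \<open>auto intro: less_le_trans simp del: picit.simps\<close>)
    also have "\<dots> \<le> K * (2 * norm (k - k'))" using Suc y pos by (intro mult_left_mono) auto
    finally show "norm (f ?y (picit f n ?y k) - f ?y (picit f n ?y k')) \<le> K * (2 * norm (k - k'))" .
  qed (rule cont_ray[OF picit_hol2 picit_box]; use Suc in simp)+
  have "norm x * (K * (2 * norm (k - k'))) = (norm x * K) * (2 * norm (k - k'))" by simp
  also have "\<dots> \<le> (1/4) * (2 * norm (k - k'))" using xK Suc by (intro mult_right_mono) auto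
  finally have "norm (x * integral {0..1} (\<lambda>t. f (of_real t * x) (picit f n (of_real t * x) k))
     - x * integral {0..1} (\<lambda>t. f (of_real t * x) (picit f n (of_real t * x) k'))) \<le> norm (k - k')"
    using * norm_ge_zero[of "k - k'"] by linarith
  then show ?case using norm_triangle_ineq[of "k - k'" "x * integral {0..1} (\<lambda>t. f (of_real t * x) (picit f n (of_real t * x) k))
     - x * integral {0..1} (\<lambda>t. f (of_real t * x) (picit f n (of_real t * x) k'))"]
    by (simp add: algebra_simps)
qed simp

lemma picard_lip0:
  "norm x < \<rho> \<Longrightarrow> norm k < b/2 \<Longrightarrow> norm k' < b/2 \<Longrightarrow> norm (picard f x k - picard f x k') \<le> 2 * norm (k - k')"
  by (rule tendsto_upperbound[OF tendsto_norm[OF tendsto_diff[OF picit_tendsto picit_tendsto]]])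
    (use picit_lip in \<open>auto simp del: picit.simps\<close>)

text \<open>As a function of the initial value the solution is the identity up to an error with a
  factor \<open>norm x\<close>. Bounding this factor makes \<open>k - picard f x k\<close> a
  contraction in \<open>k\<close>; letting it tend to 0 yields the leading term of
  \<open>crossing\<close>.\<close>

lemma picard_lip:
  assumes x: "norm x < \<rho>" and k: "norm k < b/2" "norm k' < b/2"
  shows "norm (picard f x k - picard f x k' - (k - k')) \<le> 2 * K * norm x * norm (k - k')"
proof -
  have "norm (x * integral {0..1} (\<lambda>t. f (of_real t * x) (picard f (of_real t * x) k))
     - x * integral {0..1} (\<lambda>t. f (of_real t * x) (picard f (of_real t * x) k'))) \<le> norm x * (K * (2 * norm (k - k')))"
  proof (rule norm_step)
    fix t :: real assume t: "t \<in> {0..1}"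
    let ?y = "of_real t * x"
    have y: "norm ?y < \<rho>" using scaled_less t x by blast
    have "norm (f ?y (picard f ?y k) - f ?y (picard f ?y k')) \<le> K * norm (picard f ?y k - picard f ?y k')"
      by (rule f_lip) (use y picard_box k pos in \<open>auto intro: less_le_trans\<close>)
    also have "\<dots> \<le> K * (2 * norm (k - k'))" using picard_lip0 k y pos by (intro mult_left_mono) auto
    finally show "norm (f ?y (picard f ?y k) - f ?y (picard f ?y k')) \<le> K * (2 * norm (k - k'))" .
  qed (rule cont_ray[OF picard_hol2 picard_box]; use x k in simp)+
  then show ?thesis
    by (subst picard_eq[OF x k(1)], subst picard_eq[OF x k(2)]) (simp add: algebra_simps)
qed

lemma picard_lip_half:
  assumes x: "norm x < \<rho>" and k: "norm k < b/2" "norm k' < b/2"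
  shows "norm (picard f x k - picard f x k' - (k - k')) \<le> 1/2 * norm (k - k')"
proof -
  have "2 * K * norm x * norm (k - k') \<le> 1/2 * norm (k - k')"
    using xK[OF x] by (intro mult_right_mono) (auto simp: mult.commute)
  then show ?thesis using picard_lip[OF assms] by linarith
qed

lemma picard_real:
  assumes "\<And>x y. \<bar>x\<bar> < b \<Longrightarrow> \<bar>y\<bar> < b \<Longrightarrow> f (of_real x) (of_real y) \<in> \<real>"
    and x: "\<bar>x\<bar> < \<rho>" and k: "\<bar>k\<bar> < b/2"
  shows "picard f (of_real x) (of_real k) \<in> \<real>"
proof -
  have "picit f n (of_real x) (of_real k) \<in> \<real>" if "\<bar>x\<bar> < \<rho>" for n x
    using that
  proof (induction n arbitrary: x)
    case (Suc n)
    let ?g = "\<lambda>t. f (of_real t * of_real x) (picit f n (of_real t * of_real x) (of_real k))"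
    have c: "continuous_on {0..1} ?g"
      by (rule cont_ray[OF picit_hol2 picit_box]) (use Suc k in auto)
    have "Im (?g t) = 0" if "t \<in> {0..1}" for t
    proof -
      have "\<bar>t * x\<bar> < \<rho>" using scaled_less[of "of_real x" \<rho> t] that Suc.prems by (simp add: norm_mult abs_mult)
      note tx = this
      from Suc.IH[OF this] obtain y where y: "picit f n (of_real (t * x)) (of_real k) = of_real y"
        by (auto elim: Reals_cases)
      have "\<bar>y\<bar> < b" using picit_box[of "of_real (t * x)" "of_real k" n] tx k unfolding y by (simp add: norm_mult abs_mult)
      then have "f (of_real (t * x)) (of_real y) \<in> \<real>" using tx pos by (intro assms(1)) auto
      then show ?thesis using y by (simp add: complex_is_Real_iff)
    qed
    then have "integral {0..1} (\<lambda>t. Im (?g t)) = integral {0..1} (\<lambda>t::real. 0)"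
      by (intro integral_cong) auto
    moreover have "integral {0..1} (Im \<circ> ?g) = Im (integral {0..1} ?g)"
      by (rule integral_linear[OF integrable_continuous_interval[OF c] bounded_linear_Im])
    ultimately have "integral {0..1} ?g \<in> \<real>" by (simp add: complex_is_Real_iff o_def)
    then show ?case by simp
  qed simp
  then have *: "\<forall>n. picit f n (of_real x) (of_real k) \<in> \<real>" using x by blast
  have "(\<lambda>n. picit f n (of_real x) (of_real k)) \<longlonglongrightarrow> picard f (of_real x) (of_real k)"
    using x k by (intro picit_tendsto) auto
  then show ?thesis
    by (rule closed_sequentially[OF closed_complex_Reals *[rule_format]])
qed

end

text \<open>The bound \<open>2 * \<rho> * e\<close> reproduces itself under the iteration because
  \<open>(1/4) * 2 + 1 \<le> 2\<close>.\<close>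

lemma picard_stable:
  assumes 1: "picard_rhs f b F K \<rho>" and 2: "picard_rhs g b F K \<rho>"
    and e: "\<And>x y. norm x < b \<Longrightarrow> norm y < b \<Longrightarrow> norm (f x y - g x y) \<le> e"
    and x: "norm x < \<rho>" and k: "norm k < b/2"
  shows "norm (picard f x k - picard g x k) \<le> 2 * \<rho> * e"
proof -
  interpret f: picard_rhs f b F K \<rho> by fact
  interpret g: picard_rhs g b F K \<rho> by fact
  have e0: "e \<ge> 0" by (rule order_trans[OF norm_ge_zero e[of 0 0]]) (use f.b_pos in auto)
  have "norm (picit f n x k - picit g n x k) \<le> 2 * \<rho> * e" if "norm x < \<rho>" for n x
    using that
  proof (induction n arbitrary: x)
    case 0
    then show ?case using f.pos e0 by simp
  next
    case (Suc n)
    have "norm (x * integral {0..1} (\<lambda>t. f (of_real t * x) (picit f n (of_real t * x) k))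
       - x * integral {0..1} (\<lambda>t. g (of_real t * x) (picit g n (of_real t * x) k))) \<le> norm x * (K * (2 * \<rho> * e) + e)"
    proof (rule f.norm_step)
      fix t :: real assume t: "t \<in> {0..1}"
      let ?y = "of_real t * x"
      have y: "norm ?y < \<rho>" using f.scaled_less t Suc by blast
      have y': "norm ?y < b" using y f.pos by linarith
      have "norm (f ?y (picit f n ?y k) - f ?y (picit g n ?y k)) \<le> K * norm (picit f n ?y k - picit g n ?y k)"
        by (rule f.f_lip) (use y y' f.picit_box g.picit_box k in auto)
      also have "\<dots> \<le> K * (2 * \<rho> * e)" using Suc y f.pos by (intro mult_left_mono) auto
      finally have "norm (f ?y (picit f n ?y k) - f ?y (picit g n ?y k)) \<le> K * (2 * \<rho> * e)" .
      moreover have "norm (f ?y (picit g n ?y k) - g ?y (picit g n ?y k)) \<le> e"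
        by (rule e) (use y y' g.picit_box k in auto)
      ultimately show "norm (f ?y (picit f n ?y k) - g ?y (picit g n ?y k)) \<le> K * (2 * \<rho> * e) + e"
        using norm_diff_triangle_le by blast
    qed (rule f.cont_ray[OF f.picit_hol2 f.picit_box] g.cont_ray[OF g.picit_hol2 g.picit_box]; use Suc k in simp)+
    also have "\<dots> = (norm x * K) * (2 * \<rho> * e) + norm x * e" by (simp add: algebra_simps)
    also have "\<dots> \<le> (1/4) * (2 * \<rho> * e) + \<rho> * e"
      using f.xK[OF Suc.prems] e0 f.pos Suc.prems by (intro add_mono mult_right_mono) auto
    also have "\<dots> \<le> 2 * \<rho> * e" using e0 f.pos by (simp add: field_simps)
    finally show ?case by simp
  qed
  then show ?thesis
    by (intro tendsto_upperbound[OF tendsto_norm[OF tendsto_diff[OF f.picit_tendsto[OF x k] g.picit_tendsto[OF x k]]]])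
      (use x in auto)
qed

subsection \<open>Holomorphic dependence of fixed points\<close>

definition fixp :: "(complex \<Rightarrow> complex \<Rightarrow> complex) \<Rightarrow> complex \<Rightarrow> complex" where
  "fixp T z = lim (\<lambda>n. (T z ^^ n) 0)"

text \<open>A Banach fixed point depending on \<open>z\<close>. The ball of radius \<open>R\<close>
  is invariant because 0 is moved by at most \<open>R/2\<close> and distances are halved. The
  iterates of 0 are holomorphic in \<open>z\<close> and converge uniformly, so the fixed point is
  holomorphic in \<open>z\<close>.\<close>

locale contraction_family =
  fixes T :: "complex \<Rightarrow> complex \<Rightarrow> complex" and \<rho> s R :: real
  assumes T_hol2: "hol2 \<rho> s T" and R: "0 < R" "R < s"
    and T_0: "norm z < \<rho> \<Longrightarrow> norm (T z 0) \<le> R / 2"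
    and T_lip: "norm z < \<rho> \<Longrightarrow> norm q \<le> R \<Longrightarrow> norm q' \<le> R \<Longrightarrow> norm (T z q - T z q') \<le> 1/2 * norm (q - q')"
begin

lemma T_le: assumes "norm z < \<rho>" "norm q \<le> R" shows "norm (T z q) \<le> R"
proof -
  have "norm (T z q) \<le> norm (T z 0) + norm (T z q - T z 0)"
    using norm_triangle_ineq[of "T z 0" "T z q - T z 0"] by simp
  then show ?thesis using T_0[of z] T_lip[of z q 0] assms R by simp
qed

lemma it_le: "norm z < \<rho> \<Longrightarrow> norm ((T z ^^ n) 0) \<le> R"
  by (induction n) (use R T_le in auto)

lemma it_hol: "(\<lambda>z. (T z ^^ n) 0) holomorphic_on ball 0 \<rho>"
proof (induction n)
  case (Suc n)
  then show ?case
    by simp (rule hol2_comp[OF T_hol2 open_ball holomorphic_on_ident],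
      use it_le R in \<open>auto intro: le_less_trans\<close>)
qed simp

lemma it_diff: "norm z < \<rho> \<Longrightarrow> norm ((T z ^^ Suc n) 0 - (T z ^^ n) 0) \<le> R * (1/2)^n"
proof (induction n)
  case 0
  then show ?case using T_0[of z] R by simp
next
  case (Suc n)
  have "norm ((T z ^^ Suc (Suc n)) 0 - (T z ^^ Suc n) 0) \<le> 1/2 * norm ((T z ^^ Suc n) 0 - (T z ^^ n) 0)"
    using T_lip[OF Suc.prems it_le[OF Suc.prems, of "Suc n"] it_le[OF Suc.prems, of n]] by simp
  then show ?case using Suc by simp
qed

lemma it_uniform: "uniform_limit (ball 0 \<rho>) (\<lambda>n z. (T z ^^ n) 0) (fixp T) sequentially"
  unfolding fixp_def
  by (rule uniform_limit_geometric[where C = R and q = "1/2"]) (use it_diff in auto)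

lemma it_tendsto: "norm z < \<rho> \<Longrightarrow> (\<lambda>n. (T z ^^ n) 0) \<longlonglongrightarrow> fixp T z"
  using tendsto_uniform_limitI[OF it_uniform, of z] by simp

lemma fixp_holomorphic: "fixp T holomorphic_on ball 0 \<rho>"
proof (rule holomorphic_uniform_sequence[OF open_ball it_hol])
  fix x :: complex assume "x \<in> ball 0 \<rho>"
  then obtain d where "d > 0" "cball x d \<subseteq> ball 0 \<rho>" by (meson open_ball open_contains_cball)
  then show "\<exists>d>0. cball x d \<subseteq> ball 0 \<rho> \<and> uniform_limit (cball x d) (\<lambda>n z. (T z ^^ n) 0) (fixp T) sequentially"
    using it_uniform uniform_limit_on_subset by blast
qed

lemma fixp_le: "norm z < \<rho> \<Longrightarrow> norm (fixp T z) \<le> R"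
  by (rule tendsto_upperbound[OF tendsto_norm[OF it_tendsto]]) (use it_le in auto)

lemma fixp_eq:
  assumes z: "norm z < \<rho>" shows "T z (fixp T z) = fixp T z"
proof (rule LIMSEQ_unique)
  show "(\<lambda>n. (T z ^^ Suc n) 0) \<longlonglongrightarrow> fixp T z" by (rule LIMSEQ_Suc[OF it_tendsto[OF z]])
  have "(\<lambda>n. (T z ^^ Suc n) 0 - T z (fixp T z)) \<longlonglongrightarrow> 0"
  proof (rule Lim_null_comparison)
    show "\<forall>\<^sub>F n in sequentially. norm ((T z ^^ Suc n) 0 - T z (fixp T z)) \<le> 1/2 * norm ((T z ^^ n) 0 - fixp T z)"
      using T_lip[OF z it_le[OF z] fixp_le[OF z]] by simp
    have "(\<lambda>n. 1/2 * norm ((T z ^^ n) 0 - fixp T z)) \<longlonglongrightarrow> 1/2 * norm (fixp T z - fixp T z)"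
      by (intro tendsto_intros it_tendsto z)
    then show "(\<lambda>n. 1/2 * norm ((T z ^^ n) 0 - fixp T z)) \<longlonglongrightarrow> 0" by simp
  qed
  then show "(\<lambda>n. (T z ^^ Suc n) 0) \<longlonglongrightarrow> T z (fixp T z)" by (simp add: LIM_zero_iff)
qed

lemma fixp_le_2:
  assumes z: "norm z < \<rho>" shows "norm (fixp T z) \<le> 2 * norm (T z 0)"
proof -
  have "norm (T z (fixp T z)) \<le> norm (T z 0) + norm (T z (fixp T z) - T z 0)"
    using norm_triangle_ineq[of "T z 0" "T z (fixp T z) - T z 0"] by simp
  then show ?thesis using T_lip[OF z fixp_le[OF z], of 0] R by (simp add: fixp_eq[OF z])
qed

lemma fixp_real:
  assumes T: "\<And>x y. \<bar>x\<bar> < \<rho> \<Longrightarrow> \<bar>y\<bar> \<le> R \<Longrightarrow> T (of_real x) (of_real y) \<in> \<real>" and x: "\<bar>x\<bar> < \<rho>"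
  shows "fixp T (of_real x) \<in> \<real>"
proof -
  have "(T (of_real x) ^^ n) 0 \<in> \<real>" for n
  proof (induction n)
    case (Suc n)
    then obtain y where y: "(T (of_real x) ^^ n) 0 = of_real y" by (auto elim: Reals_cases)
    have "\<bar>y\<bar> \<le> R" using it_le[of "of_real x" n] x y by simp
    then show ?case using T[OF x] y by simp
  qed simp
  then show ?thesis
    by (rule closed_sequentially[OF closed_complex_Reals _ it_tendsto]) (use x in simp)
qed

end

text \<open>With contraction factor \<open>1/2\<close>, a perturbation of the map by
  \<open>e\<close> moves the fixed point by at most \<open>e / (1 - 1/2)\<close>.\<close>

lemma fixp_stable:
  assumes 1: "contraction_family T \<rho> s R" and 2: "contraction_family U \<rho> s R"
    and e: "\<And>q. norm q \<le> R \<Longrightarrow> norm (T z q - U z q) \<le> e" and z: "norm z < \<rho>"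
  shows "norm (fixp T z - fixp U z) \<le> 2 * e"
proof -
  interpret T: contraction_family T \<rho> s R by fact
  interpret U: contraction_family U \<rho> s R by fact
  have "norm (fixp T z - fixp U z) = norm ((T z (fixp T z) - T z (fixp U z)) + (T z (fixp U z) - U z (fixp U z)))"
    using T.fixp_eq[OF z] U.fixp_eq[OF z] by simp
  also have "\<dots> \<le> 1/2 * norm (fixp T z - fixp U z) + e"
    by (intro norm_triangle_le add_mono T.T_lip e T.fixp_le U.fixp_le z)
  finally show ?thesis by simp
qed

text \<open>The function \<open>H\<close> of the overview: a fixed point \<open>k\<close> means
  \<open>picard f x k = 0\<close>, so the solution of initial value \<open>k\<close> vanishes at
  \<open>x\<close>.\<close>

definition crossing :: "(complex \<Rightarrow> complex \<Rightarrow> complex) \<Rightarrow> complex \<Rightarrow> complex" where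
  "crossing f = fixp (\<lambda>x k. k - picard f x k)"

text \<open>Removable singularities, one factor \<open>z\<close> at a time; a growth bound near 0
  yields a factorisation on the whole disc.\<close>

lemma holomorphic_factor_power:
  assumes "H holomorphic_on ball 0 \<rho>" "0 < \<rho>" "\<forall>\<^sub>F z in at 0. norm (H z) \<le> C * norm z ^ m"
  shows "\<exists>u. u holomorphic_on ball 0 \<rho> \<and> (\<forall>z\<in>ball 0 \<rho>. H z = z ^ m * u z)"
  using assms
proof (induction m arbitrary: H)
  case (Suc m)
  have d: "(H has_field_derivative deriv H 0) (at 0)"
    using Suc.prems by (intro holomorphic_derivI[OF Suc.prems(1) open_ball]) auto
  then have "H \<midarrow>0\<rightarrow> H 0" using DERIV_isCont isContD by blast
  moreover have "H \<midarrow>0\<rightarrow> 0"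
  proof (rule Lim_null_comparison[OF Suc.prems(3)])
    have "((\<lambda>z::complex. C * norm z ^ Suc m) \<longlongrightarrow> C * norm (0::complex) ^ Suc m) (at 0)"
      by (intro tendsto_intros)
    then show "((\<lambda>z::complex. C * norm z ^ Suc m) \<longlongrightarrow> 0) (at 0)" by simp
  qed
  ultimately have H0: "H 0 = 0" using LIM_unique by blast
  define v where "v = (\<lambda>y. if y = 0 then deriv H 0 else H y / y)"
  have v: "v holomorphic_on ball 0 \<rho>"
    unfolding v_def
  proof (rule removable_singularity)
    show "(\<lambda>y. H y / y) holomorphic_on ball 0 \<rho> - {0}"
      by (intro holomorphic_on_divide holomorphic_on_subset[OF Suc.prems(1)] holomorphic_on_ident) auto
    show "(\<lambda>y. H y / y) \<midarrow>0\<rightarrow> deriv H 0"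
      using d by (simp add: has_field_derivative_iff H0)
  qed auto
  have "\<forall>\<^sub>F z in at 0. norm (v z) \<le> C * norm z ^ m"
    using Suc.prems(3) eventually_neq_at_within[of 0 0 UNIV]
    by eventually_elim (simp add: v_def norm_divide field_simps)
  from Suc.IH[OF v Suc.prems(2) this] obtain u where
    u: "u holomorphic_on ball 0 \<rho>" "\<And>z. z \<in> ball 0 \<rho> \<Longrightarrow> v z = z ^ m * u z" by blast
  have "H z = z ^ Suc m * u z" if "z \<in> ball 0 \<rho>" for z
    using u(2)[OF that] H0 by (cases "z = 0") (auto simp: v_def field_simps)
  then show ?case using u(1) by blast
next
  case 0
  then show ?case by auto
qed

text \<open>On the circle of radius \<open>\<rho>/2\<close> the factor \<open>z ^ m\<close> can be
  divided out; the maximum modulus principle carries the bound inside, including to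
  \<open>z = 0\<close>.\<close>

lemma power_factor_stable:
  assumes u: "u holomorphic_on ball 0 \<rho>" and v: "v holomorphic_on ball 0 \<rho>" and "0 < \<rho>"
    and le: "\<And>z. norm z < \<rho> \<Longrightarrow> norm (z ^ m * u z - z ^ m * v z) \<le> e"
    and z: "norm z \<le> \<rho> / 2"
  shows "norm (u z - v z) \<le> e / (\<rho> / 2) ^ m"
proof (rule maximum_modulus_frontier[where f = "\<lambda>z. u z - v z" and S = "cball 0 (\<rho>/2)"])
  have sub: "cball 0 (\<rho>/2) \<subseteq> ball (0::complex) \<rho>" using \<open>0 < \<rho>\<close> by auto
  have h: "(\<lambda>z. u z - v z) holomorphic_on ball 0 \<rho>" by (intro holomorphic_on_diff u v)
  show "(\<lambda>z. u z - v z) holomorphic_on interior (cball 0 (\<rho>/2))"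
    by (rule holomorphic_on_subset[OF h]) (use \<open>0 < \<rho>\<close> in auto)
  show "continuous_on (closure (cball 0 (\<rho> / 2))) (\<lambda>z. u z - v z)"
    using holomorphic_on_imp_continuous_on[OF h] sub by (auto intro: continuous_on_subset)
  fix w :: complex assume "w \<in> frontier (cball 0 (\<rho> / 2))"
  then have w: "norm w = \<rho>/2" by simp
  have "(\<rho>/2) ^ m * norm (u w - v w) \<le> e"
    using le[of w] w \<open>0 < \<rho>\<close> by (simp add: norm_mult norm_power flip: right_diff_distrib)
  then show "norm (u w - v w) \<le> e / (\<rho> / 2) ^ m"
    using \<open>0 < \<rho>\<close> by (simp add: field_simps)
qed (use z in auto)

section \<open>Holomorphy and leading term of the crossing function\<close>

context picard_rhs
begin

text \<open>A solution departs from its initial value by at most \<open>b/8\<close>, which is half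
  of the radius \<open>b/4\<close>; \<open>picard_lip_half\<close> gives the contraction.\<close>

sublocale lev: contraction_family "\<lambda>x k. k - picard f x k" \<rho> "b/2" "b/4"
proof
  show "hol2 \<rho> (b/2) (\<lambda>x k. k - picard f x k)"
    by (intro hol2_diff picard_hol2 hol2_snd holomorphic_on_ident)
  show "norm (0 - picard f z 0) \<le> b / 4 / 2" if "norm z < \<rho>" for z
    using picard_le[OF that, of 0] xF[OF that] b_pos by simp
  show "norm (q - picard f z q - (q' - picard f z q')) \<le> 1/2 * norm (q - q')"
    if "norm z < \<rho>" "norm q \<le> b/4" "norm q' \<le> b/4" for z q q'
  proof -
    have "norm (picard f z q - picard f z q' - (q - q')) \<le> 1/2 * norm (q - q')"
      by (rule picard_lip_half) (use that b_pos in auto)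
    then show ?thesis by (subst norm_minus_cancel[symmetric]) (simp add: algebra_simps)
  qed
qed (use b_pos in auto)

lemma crossing_holomorphic: "crossing f holomorphic_on ball 0 \<rho>"
  unfolding crossing_def by (rule lev.fixp_holomorphic)

lemma crossing_le: "norm x < \<rho> \<Longrightarrow> norm (crossing f x) \<le> b / 4"
  unfolding crossing_def by (rule lev.fixp_le)

lemma crossing_less: "norm x < \<rho> \<Longrightarrow> norm (crossing f x) < b / 2"
  using crossing_le[of x] b_pos by linarith

lemma crossing_le_2: "norm x < \<rho> \<Longrightarrow> norm (crossing f x) \<le> 2 * F * norm x"
  using lev.fixp_le_2[of x] picard_le[of x 0] b_pos by (simp add: crossing_def algebra_simps)

lemma picard_crossing: "norm x < \<rho> \<Longrightarrow> picard f x (crossing f x) = 0"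
  using lev.fixp_eq[of x] by (simp add: crossing_def)

lemma crossing_real:
  assumes "\<And>x y. \<bar>x\<bar> < b \<Longrightarrow> \<bar>y\<bar> < b \<Longrightarrow> f (of_real x) (of_real y) \<in> \<real>" and x: "\<bar>x\<bar> < \<rho>"
  shows "crossing f (of_real x) \<in> \<real>"
  unfolding crossing_def
  by (rule lev.fixp_real[OF _ x]) (use picard_real[OF assms(1)] b_pos in auto)

text \<open>Differentiating \<open>picard f x (H x) = 0\<close> gives \<open>H' x = - f x 0\<close>
  divided by the derivative in the initial value, which is \<open>1 + O(x)\<close>. That partial
  derivative is avoided: \<open>picard_lip\<close> compares the difference quotient of
  \<open>H\<close> with the one of \<open>picard f _ (H x)\<close> at fixed initial value.\<close>

lemma crossing_deriv:
  assumes x: "norm x < \<rho>"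
  shows "norm (deriv (crossing f) x + f x 0) \<le> 2 * K * norm x * norm (deriv (crossing f) x)"
proof -
  let ?h = "crossing f"
  have h: "(?h has_field_derivative deriv ?h x) (at x)"
    by (rule holomorphic_derivI[OF crossing_holomorphic open_ball]) (use x in auto)
  have P: "((\<lambda>z. picard f z (?h x)) has_field_derivative f x 0) (at x)"
    using picard_deriv[OF x crossing_less[OF x]] by (simp add: picard_crossing[OF x])
  let ?q = "\<lambda>z. (?h z - ?h x) / (z - x)" and ?p = "\<lambda>z. picard f z (?h x) / (z - x)"
  have q: "(?q \<longlongrightarrow> deriv ?h x) (at x)" using h by (simp add: has_field_derivative_iff)
  have p: "(?p \<longlongrightarrow> f x 0) (at x)" using P by (simp add: has_field_derivative_iff picard_crossing[OF x])
  have l1: "((\<lambda>z. norm (?q z + ?p z)) \<longlongrightarrow> norm (deriv ?h x + f x 0)) (at x)"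
    by (intro tendsto_intros p q)
  have l2: "((\<lambda>z. 2 * K * norm z * norm (?q z)) \<longlongrightarrow> 2 * K * norm x * norm (deriv ?h x)) (at x)"
    by (intro tendsto_intros q)
  have "\<forall>\<^sub>F z in at x. z \<in> ball 0 \<rho>"
    using x by (intro eventually_at_in_open') auto
  then have ev: "\<forall>\<^sub>F z in at x. norm (?q z + ?p z) \<le> 2 * K * norm z * norm (?q z)"
    using eventually_neq_at_within[of x x UNIV]
  proof eventually_elim
    case (elim z)
    then have z: "norm z < \<rho>" by simp
    have "norm (picard f z (?h z) - picard f z (?h x) - (?h z - ?h x)) \<le> 2 * K * norm z * norm (?h z - ?h x)"
      by (rule picard_lip) (use z x crossing_less in auto)
    then have "norm ((?h z - ?h x) + picard f z (?h x)) \<le> 2 * K * norm z * norm (?h z - ?h x)"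
      using picard_crossing[OF z] by (subst norm_minus_cancel[symmetric]) (simp add: algebra_simps)
    then have "norm ((?h z - ?h x) + picard f z (?h x)) / norm (z - x) \<le> 2 * K * norm z * norm (?h z - ?h x) / norm (z - x)"
      by (intro divide_right_mono) auto
    then show ?case by (simp add: norm_divide flip: add_divide_distrib)
  qed
  show ?thesis by (rule tendsto_le[OF _ l2 l1 ev]) simp
qed

lemma crossing_deriv_half:
  assumes x: "norm x < \<rho>"
  shows "norm (deriv (crossing f) x + f x 0) \<le> 1/2 * norm (deriv (crossing f) x)"
proof -
  have "2 * K * norm x * norm (deriv (crossing f) x) \<le> 1/2 * norm (deriv (crossing f) x)"
    using xK[OF x] by (intro mult_right_mono) (auto simp: mult.commute)
  then show ?thesis using crossing_deriv[OF x] by linarith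
qed

text \<open>By \<open>crossing_deriv\<close>, \<open>H'\<close> is \<open>- f z 0\<close> up to a
  relative error that tends to 0, so it is \<open>O(z^n)\<close>, and integration gives a zero of
  order \<open>n + 1\<close>. Comparing \<open>H' = z^n ((n+1) u + z u')\<close> with
  \<open>- v z^n\<close> at 0 then gives \<open>u 0\<close>.\<close>

lemma crossing_factor:
  assumes n: "n \<ge> 1" and v: "((\<lambda>z. f z 0 / z ^ n) \<longlongrightarrow> v) (at 0)"
  obtains u where "u holomorphic_on ball 0 \<rho>" "\<And>z. norm z < \<rho> \<Longrightarrow> crossing f z = z ^ Suc n * u z"
    "of_nat (Suc n) * u 0 = - v"
proof -
  let ?h = "crossing f"
  have near: "\<forall>\<^sub>F z in at (0::complex). z \<in> ball 0 \<rho>" using pos by (intro eventually_at_in_open') auto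
  have "\<forall>\<^sub>F z in at 0. norm (f z 0 / z ^ n) < norm v + 1"
    using tendsto_norm[OF v] by (rule order_tendstoD) simp
  then have ev: "\<forall>\<^sub>F z in at 0. norm (deriv ?h z) \<le> 2 * (norm v + 1) * norm z ^ n"
    using near eventually_neq_at_within[of "0::complex" 0 UNIV]
  proof eventually_elim
    case (elim z)
    then have "norm (f z 0) \<le> (norm v + 1) * norm z ^ n" by (simp add: norm_divide norm_power field_simps)
    moreover have "norm (deriv ?h z) \<le> norm (deriv ?h z + f z 0) + norm (f z 0)"
      using norm_triangle_ineq4[of "deriv ?h z + f z 0" "f z 0"] by simp
    ultimately have "norm (deriv ?h z) \<le> 2 * ((norm v + 1) * norm z ^ n)"
      using crossing_deriv_half[of z] elim by simp
    then show ?case by (simp only: mult.assoc)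
  qed
  have dh: "deriv ?h holomorphic_on ball 0 \<rho>" by (intro holomorphic_deriv crossing_holomorphic open_ball)
  obtain w where w: "\<And>z. z \<in> ball 0 \<rho> \<Longrightarrow> deriv ?h z = z ^ n * w z"
    using holomorphic_factor_power[OF dh pos(1) ev] by blast
  have h0: "deriv ?h 0 = 0" using w[of 0] n pos by (simp add: power_0_left)
  have c0: "crossing f 0 = 0" using crossing_le_2[of 0] pos by simp
  obtain d where d: "d > 0" "\<And>z. z \<noteq> 0 \<Longrightarrow> norm z < d \<Longrightarrow> norm (deriv ?h z) \<le> 2 * (norm v + 1) * norm z ^ n"
    using ev by (auto simp: eventually_at)
  have "\<forall>\<^sub>F z in at (0::complex). z \<in> ball 0 (min d \<rho>)" using pos d by (intro eventually_at_in_open') auto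
  then have "\<forall>\<^sub>F z in at 0. norm (?h z) \<le> 2 * (norm v + 1) * norm z ^ Suc n"
  proof eventually_elim
    case (elim z)
    have "norm (?h z - ?h 0) \<le> (2 * (norm v + 1) * norm z ^ n) * norm (z - 0)"
    proof (rule field_differentiable_bound[where S = "closed_segment 0 z" and f' = "deriv ?h"])
      fix y assume "y \<in> closed_segment 0 z"
      then have y: "norm y \<le> norm z" using segment_bound(1)[of y 0 z] by simp
      then show "(?h has_field_derivative deriv ?h y) (at y within closed_segment 0 z)"
        using elim by (intro has_field_derivative_at_within[OF holomorphic_derivI[OF crossing_holomorphic open_ball]]) auto
      show "norm (deriv ?h y) \<le> 2 * (norm v + 1) * norm z ^ n"
      proof (cases "y = 0")
        case True
        then show ?thesis by (simp add: h0)
      next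
        case False
        have "norm (deriv ?h y) \<le> 2 * (norm v + 1) * norm y ^ n" using False elim y by (intro d) auto
        also have "\<dots> \<le> 2 * (norm v + 1) * norm z ^ n"
          using y by (intro mult_left_mono power_mono) auto
        finally show ?thesis .
      qed
    qed auto
    then show ?case by (simp add: c0 mult_ac)
  qed
  from holomorphic_factor_power[OF crossing_holomorphic pos(1) this]
  obtain u where u: "u holomorphic_on ball 0 \<rho>" "\<And>z. z \<in> ball 0 \<rho> \<Longrightarrow> ?h z = z ^ Suc n * u z" by blast
  let ?m = "of_nat (Suc n) :: complex"
  have "((\<lambda>z. ?m * u z + z * deriv u z) \<longlongrightarrow> ?m * u 0 + 0 * deriv u 0) (at 0)"
  proof (intro tendsto_intros)
    have "continuous_on (ball 0 \<rho>) u" "continuous_on (ball 0 \<rho>) (deriv u)"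
      using u(1) holomorphic_deriv[OF u(1) open_ball] by (simp_all add: holomorphic_on_imp_continuous_on)
    then show "(u \<longlongrightarrow> u 0) (at 0)" "(deriv u \<longlongrightarrow> deriv u 0) (at 0)"
      using pos by (simp_all add: continuous_on_eq_continuous_at isCont_def)
  qed
  then have lu: "((\<lambda>z. ?m * u z + z * deriv u z) \<longlongrightarrow> ?m * u 0) (at 0)" by simp
  have l1: "((\<lambda>z. norm (?m * u z + z * deriv u z + f z 0 / z ^ n)) \<longlongrightarrow> norm (?m * u 0 + v)) (at 0)"
    by (intro tendsto_intros lu v)
  have "((\<lambda>z. 2 * K * norm z * norm (?m * u z + z * deriv u z)) \<longlongrightarrow> 2 * K * norm (0::complex) * norm (?m * u 0)) (at 0)"
    by (intro tendsto_intros lu)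
  then have l2: "((\<lambda>z. 2 * K * norm z * norm (?m * u z + z * deriv u z)) \<longlongrightarrow> 0) (at 0)" by simp
  have "\<forall>\<^sub>F z in at 0. norm (?m * u z + z * deriv u z + f z 0 / z ^ n) \<le> 2 * K * norm z * norm (?m * u z + z * deriv u z)"
    using near eventually_neq_at_within[of "0::complex" 0 UNIV]
  proof eventually_elim
    case (elim z)
    have "((\<lambda>z. z ^ Suc n * u z) has_field_derivative (?m * z ^ n * u z + z ^ Suc n * deriv u z)) (at z)"
      using DERIV_mult[OF DERIV_power[OF DERIV_ident, of "Suc n"] holomorphic_derivI[OF u(1) open_ball elim(1)]]
      by (simp add: mult.commute del: of_nat_Suc)
    then have "(?h has_field_derivative (?m * z ^ n * u z + z ^ Suc n * deriv u z)) (at z)"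
      by (rule has_field_derivative_transform_within_open[where S = "ball 0 \<rho>"]) (use elim u(2) in auto)
    then have dz: "deriv ?h z = z ^ n * (?m * u z + z * deriv u z)"
      by (simp add: DERIV_imp_deriv algebra_simps)
    have "norm (deriv ?h z + f z 0) / norm z ^ n \<le> 2 * K * norm z * norm (deriv ?h z) / norm z ^ n"
      using crossing_deriv[of z] elim by (intro divide_right_mono) auto
    moreover have "deriv ?h z + f z 0 = z ^ n * (?m * u z + z * deriv u z + f z 0 / z ^ n)"
      using elim by (simp add: dz distrib_left)
    ultimately show ?case using elim by (simp add: dz norm_mult norm_power)
  qed
  from tendsto_le[OF _ l2 l1 this] have "norm (?m * u 0 + v) \<le> 0" by simp
  then have "?m * u 0 = - v" by (simp add: add_eq_0_iff2)
  then show thesis using that u by auto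
qed

end

subsection \<open>The involution defined by a function with an even zero\<close>

text \<open>The chart \<open>w\<close> of the overview: an \<open>m\<close>-th root of
  \<open>z ^ m * u z\<close> by the principal branch, which is holomorphic when \<open>u\<close>
  takes values in the right half-plane.\<close>

definition chart :: "nat \<Rightarrow> (complex \<Rightarrow> complex) \<Rightarrow> complex \<Rightarrow> complex" where
  "chart m u z = z * (u z powr (1 / of_nat m))"

text \<open>A fixed point \<open>q\<close> satisfies \<open>w q = - w z\<close>. The iteration is
  Newton's method with the derivative frozen at \<open>a\<close>, an approximation of the derivative
  of \<open>w\<close> at 0.\<close>

definition chart_involution :: "real \<Rightarrow> (complex \<Rightarrow> complex) \<Rightarrow> complex \<Rightarrow> complex" where
  "chart_involution a w = fixp (\<lambda>z q. q - (w q + w z) / of_real a)"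

text \<open>The number \<open>a\<close> is close to the derivative of the chart at 0; in the later
  use it is the root at the base parameter and serves all nearby parameters. The tolerance
  \<open>a/16\<close> on the disc becomes a Lipschitz constant \<open>a/4\<close> of
  \<open>w z - a z\<close> on the half disc, so the iteration for the involution contracts.\<close>

locale even_zero =
  fixes u :: "complex \<Rightarrow> complex" and \<rho> a :: real and m :: nat
  assumes u_hol: "u holomorphic_on ball 0 \<rho>" and a: "0 < a" and \<rho>: "0 < \<rho>" and m: "even m" "0 < m"
    and Re_u: "norm z < \<rho> \<Longrightarrow> Re (u z) > 0"
    and root: "norm z < \<rho> \<Longrightarrow> norm (u z powr (1 / of_nat m) - of_real a) \<le> a / 16"
    and u_real: "\<bar>x\<bar> < \<rho> \<Longrightarrow> u (of_real x) \<in> \<real>"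
begin

abbreviation "w \<equiv> chart m u"
abbreviation "\<phi> \<equiv> chart_involution a w"

lemma w_hol: "w holomorphic_on ball 0 \<rho>"
proof -
  have "(\<lambda>z. z * (u z powr (1 / of_nat m))) holomorphic_on ball 0 \<rho>"
    by (intro holomorphic_on_mult holomorphic_on_ident holomorphic_on_powr u_hol)
      (use Re_u in \<open>auto simp: complex_nonpos_Reals_iff not_le\<close>)
  then show ?thesis by (simp add: chart_def[abs_def])
qed

lemma w_near: assumes "norm z < \<rho>" shows "norm (w z - of_real a * z) \<le> a / 16 * norm z"
proof -
  have "w z - of_real a * z = z * (u z powr (1 / of_nat m) - of_real a)"
    by (simp add: chart_def algebra_simps)
  then show ?thesis using mult_left_mono[OF root[OF assms], of "norm z"] by (simp add: norm_mult mult.commute)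
qed

lemma w_lip:
  assumes "norm x < \<rho>/2" "norm y < \<rho>/2"
  shows "norm ((w x - of_real a * x) - (w y - of_real a * y)) \<le> a / 4 * norm (x - y)"
proof -
  have "norm ((w x - of_real a * x) - (w y - of_real a * y)) \<le> 4 * (a / 16 * \<rho>) / \<rho> * norm (x - y)"
  proof (rule holomorphic_bounded_lipschitz[where f = "\<lambda>z. w z - of_real a * z"])
    show "(\<lambda>z. w z - of_real a * z) holomorphic_on ball 0 \<rho>"
      by (intro holomorphic_intros w_hol)
    show "norm (w z - of_real a * z) \<le> a / 16 * \<rho>" if "norm z < \<rho>" for z
      using w_near[OF that] that a mult_left_mono[of "norm z" \<rho> "a/16"] by linarith
  qed (use assms in auto)
  then show ?thesis using \<rho> by simp
qed

lemma w_0: "w 0 = 0" by (simp add: chart_def)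

lemma w_power: "norm z < \<rho> \<Longrightarrow> w z ^ m = z ^ m * u z"
proof -
  assume z: "norm z < \<rho>"
  then have "u z \<noteq> 0" using Re_u[OF z] by auto
  then have "(u z powr (1 / of_nat m)) ^ m = u z"
    using m by (simp add: powr_def flip: exp_of_nat_mult)
  then show ?thesis by (simp add: chart_def power_mult_distrib)
qed

lemma w_real: assumes x: "\<bar>x\<bar> < \<rho>" shows "w (of_real x) \<in> \<real>"
proof -
  obtain r where r: "u (of_real x) = of_real r" using u_real[OF x] by (auto elim: Reals_cases)
  then have "r > 0" using Re_u[of "of_real x"] x by simp
  then have "u (of_real x) powr (1 / of_nat m) = of_real (r powr (1 / real m))"
    using powr_of_real[of r "1 / real m"] by (simp add: r)
  then show ?thesis by (simp add: chart_def)
qed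

text \<open>The iteration moves 0 to \<open>- w z / a\<close>, of modulus at most
  \<open>2 * norm z\<close>; for \<open>norm z < \<rho>/16\<close> this is below
  \<open>\<rho>/8\<close>, half of the radius \<open>\<rho>/4\<close>.\<close>

sublocale inv: contraction_family "\<lambda>z q. q - (w q + w z) / of_real a" "\<rho>/16" "\<rho>/2" "\<rho>/4"
proof
  have "w holomorphic_on ball 0 (\<rho>/16)" "w holomorphic_on ball 0 (\<rho>/2)"
    by (rule holomorphic_on_subset[OF w_hol subset_ball], use \<rho> in simp)+
  then show "hol2 (\<rho>/16) (\<rho>/2) (\<lambda>z q. q - (w q + w z) / of_real a)"
    using a by (intro hol2_diff hol2_divide hol2_add hol2_snd hol2_fst holomorphic_on_ident holomorphic_on_const) auto
  show "norm (0 - (w 0 + w z) / of_real a) \<le> \<rho> / 4 / 2" if z: "norm z < \<rho>/16" for z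
  proof -
    have "norm (w z) \<le> norm (w z - of_real a * z) + norm (of_real a * z)"
      using norm_triangle_ineq[of "w z - of_real a * z" "of_real a * z"] by simp
    also have "\<dots> \<le> a / 16 * norm z + a * norm z"
      using w_near[of z] z \<rho> a by (simp add: norm_mult)
    also have "\<dots> \<le> a * (2 * norm z)" using a by (simp add: field_simps)
    also have "\<dots> \<le> a * (\<rho> / 8)" using a z by (intro mult_left_mono) auto
    finally show ?thesis using a by (simp add: w_0 norm_divide field_simps)
  qed
  show "norm (q - (w q + w z) / of_real a - (q' - (w q' + w z) / of_real a)) \<le> 1/2 * norm (q - q')"
    if "norm z < \<rho>/16" "norm q \<le> \<rho>/4" "norm q' \<le> \<rho>/4" for z q q'
  proof -
    have "q - (w q + w z) / of_real a - (q' - (w q' + w z) / of_real a)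
      = - (((w q - of_real a * q) - (w q' - of_real a * q')) / of_real a)"
      using a by (simp add: field_simps)
    moreover have "norm ((w q - of_real a * q) - (w q' - of_real a * q')) \<le> a/4 * norm (q - q')"
      by (rule w_lip) (use that \<rho> in auto)
    ultimately have "norm (q - (w q + w z) / of_real a - (q' - (w q' + w z) / of_real a)) \<le> (a/4 * norm (q - q')) / a"
      using a by (simp add: norm_divide divide_right_mono del: times_divide_eq_left)
    also have "\<dots> \<le> 1/2 * norm (q - q')" using a by simp
    finally show ?thesis .
  qed
qed (use \<rho> in auto)

lemma \<phi>_holomorphic: "\<phi> holomorphic_on ball 0 (\<rho>/16)"
  unfolding chart_involution_def by (rule inv.fixp_holomorphic)

lemma \<phi>_le: "norm z < \<rho>/16 \<Longrightarrow> norm (\<phi> z) \<le> \<rho>/4"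
  unfolding chart_involution_def by (rule inv.fixp_le)

lemma w_\<phi>: "norm z < \<rho>/16 \<Longrightarrow> w (\<phi> z) = - w z"
  using inv.fixp_eq[of z] a by (simp add: chart_involution_def field_simps add_eq_0_iff2)

text \<open>From \<open>norm (w (\<phi> z)) = norm (w z)\<close> and \<open>w_near\<close>,
  \<open>15/16 * norm (\<phi> z) \<le> 17/16 * norm z\<close>. The rounded factor 2 is behind the
  later restrictions to halves and quarters of a radius.\<close>

lemma \<phi>_le_2:
  assumes z: "norm z < \<rho>/16" shows "norm (\<phi> z) \<le> 2 * norm z"
proof -
  have z': "norm z < \<rho>" and p': "norm (\<phi> z) < \<rho>" using \<phi>_le[OF z] z \<rho> by auto
  have "a * norm (\<phi> z) \<le> norm (w (\<phi> z)) + norm (w (\<phi> z) - of_real a * \<phi> z)"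
    using norm_triangle_ineq4[of "w (\<phi> z)" "w (\<phi> z) - of_real a * \<phi> z"] a by (simp add: norm_mult)
  moreover have "norm (w (\<phi> z)) = norm (w z)" using w_\<phi>[OF z] by simp
  moreover have "norm (w z) \<le> norm (w z - of_real a * z) + a * norm z"
    using norm_triangle_ineq[of "w z - of_real a * z" "of_real a * z"] a by (simp add: norm_mult)
  ultimately have "a * norm (\<phi> z) \<le> a / 16 * norm (\<phi> z) + a/16 * norm z + a * norm z"
    using w_near[OF z'] w_near[OF p'] by linarith
  then have "a * (15 * norm (\<phi> z)) \<le> a * (17 * norm z)" by (simp add: field_simps)
  then have "15 * norm (\<phi> z) \<le> 17 * norm z" using a by (simp only: mult_le_cancel_left_pos)
  then show ?thesis using norm_ge_zero[of z] by linarith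
qed

lemma \<phi>_real: assumes x: "\<bar>x\<bar> < \<rho>/16" shows "\<phi> (of_real x) \<in> \<real>"
  unfolding chart_involution_def
proof (rule inv.fixp_real[OF _ x])
  fix x y :: real assume "\<bar>x\<bar> < \<rho> / 16" "\<bar>y\<bar> \<le> \<rho> / 4"
  then have "w (of_real x) \<in> \<real>" "w (of_real y) \<in> \<real>" using \<rho> by (auto intro!: w_real)
  then show "of_real y - (w (of_real y) + w (of_real x)) / of_real a \<in> \<real>" by simp
qed

definition "wr x = Re (w (of_real x))"
definition "\<phi>r x = Re (\<phi> (of_real x))"

lemma w_of_real: "\<bar>x\<bar> < \<rho> \<Longrightarrow> w (of_real x) = of_real (wr x)"
  using w_real[of x] by (simp add: wr_def)

lemma \<phi>_of_real: "\<bar>x\<bar> < \<rho>/16 \<Longrightarrow> \<phi> (of_real x) = of_real (\<phi>r x)"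
  using \<phi>_real[of x] by (simp add: \<phi>r_def)

lemma wr_mono:
  assumes "\<bar>x\<bar> < \<rho>/2" "\<bar>y\<bar> < \<rho>/2" "x < y"
  shows "3/4 * a * (y - x) \<le> wr y - wr x"
proof -
  have "norm ((w (of_real y) - of_real a * of_real y) - (w (of_real x) - of_real a * of_real x)) \<le> a / 4 * norm (of_real y - of_real x :: complex)"
    by (rule w_lip) (use assms in auto)
  also have "(w (of_real y) - of_real a * of_real y) - (w (of_real x) - of_real a * of_real x) = of_real (wr y - a * y - (wr x - a * x))"
    using assms \<rho> by (simp add: w_of_real)
  also have "norm (of_real y - of_real x :: complex) = y - x"
    using assms by (simp flip: of_real_diff)
  finally have "\<bar>wr y - a * y - (wr x - a * x)\<bar> \<le> a/4 * (y - x)" by (simp only: norm_of_real)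
  then have "- (wr y - a * y - (wr x - a * x)) \<le> a/4 * (y - x)" by linarith
  then show ?thesis by (simp add: field_simps)
qed

lemma wr_less: "\<bar>x\<bar> < \<rho>/2 \<Longrightarrow> \<bar>y\<bar> < \<rho>/2 \<Longrightarrow> x < y \<Longrightarrow> wr x < wr y"
  using wr_mono[of x y] a mult_pos_pos[of "3/4*a" "y - x"] by linarith

lemma wr_0: "wr 0 = 0" by (simp add: wr_def w_0)

lemma wr_\<phi>r: assumes "\<bar>x\<bar> < \<rho>/16" shows "wr (\<phi>r x) = - wr x"
proof -
  have "\<bar>\<phi>r x\<bar> < \<rho>" using \<phi>_le[of "of_real x"] \<phi>_of_real[OF assms] assms \<rho> by simp
  then have "of_real (wr (\<phi>r x)) = - (of_real (wr x) :: complex)"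
    using w_\<phi>[of "of_real x"] assms \<phi>_of_real[OF assms] w_of_real[of x] w_of_real[of "\<phi>r x"] \<rho> by simp
  then show ?thesis by (simp flip: of_real_minus)
qed

text \<open>A limit of the difference quotients bounded in \<open>w_lip\<close>. It puts the
  derivative of the chart in the right half-plane on the real axis, which decides the sign of the
  field on \<Sigma>.\<close>

lemma w_deriv_real:
  assumes x: "\<bar>x\<bar> < \<rho>/2"
  shows "norm (deriv w (of_real x) - of_real a) \<le> a / 4"
proof -
  let ?x = "of_real x :: complex"
  let ?e = "\<lambda>z. w z - of_real a * z"
  have "(w has_field_derivative deriv w ?x) (at ?x)"
    by (rule holomorphic_derivI[OF w_hol open_ball]) (use x \<rho> in auto)
  then have "(?e has_field_derivative (deriv w ?x - of_real a)) (at ?x)"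
    by (auto intro!: derivative_eq_intros)
  then have l: "((\<lambda>z. (?e z - ?e ?x) / (z - ?x)) \<longlongrightarrow> deriv w ?x - of_real a) (at ?x)"
    by (simp add: has_field_derivative_iff)
  have "\<forall>\<^sub>F z in at ?x. z \<in> ball 0 (\<rho>/2)" using x by (intro eventually_at_in_open') auto
  then have "\<forall>\<^sub>F z in at ?x. norm ((?e z - ?e ?x) / (z - ?x)) \<le> a / 4"
    using eventually_neq_at_within[of ?x ?x UNIV]
  proof eventually_elim
    case (elim z)
    then have "norm (?e z - ?e ?x) \<le> a/4 * norm (z - ?x)" using x by (intro w_lip) auto
    then have "norm (?e z - ?e ?x) / norm (z - ?x) \<le> a/4" using elim by (simp add: divide_le_eq)
    then show ?case by (simp add: norm_divide)
  qed
  then show ?thesis by (intro tendsto_upperbound[OF tendsto_norm[OF l]]) auto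
qed

end

subsection \<open>Complexification of real analytic functions\<close>

text \<open>The imaginary part is constantly 0 on the axis, so the complex derivative is real there
  and the induction continues. Thus the iterated real \<open>deriv\<close> in the definitions can be
  read off a holomorphic extension.\<close>

lemma iterated_deriv_real:
  fixes F :: "complex \<Rightarrow> complex" and g :: "real \<Rightarrow> real"
  assumes F: "F holomorphic_on ball 0 r" and g: "\<And>x. \<bar>x\<bar> < r \<Longrightarrow> F (of_real x) = of_real (g x)"
    and x: "\<bar>x\<bar> < r"
  shows "(deriv ^^ n) F (of_real x) = of_real ((deriv ^^ n) g x)"
  using x
proof (induction n arbitrary: x)
  case (Suc n)
  let ?F = "(deriv ^^ n) F" and ?g = "(deriv ^^ n) g"
  have "?F holomorphic_on ball 0 r" by (rule holomorphic_higher_deriv[OF F open_ball])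
  then have "(?F has_field_derivative deriv ?F (of_real x)) (at (of_real x))"
    using Suc.prems by (intro holomorphic_derivI[OF _ open_ball]) auto
  then have v: "((\<lambda>y. ?F (of_real y)) has_vector_derivative deriv ?F (of_real x)) (at x)"
    by (rule has_vector_derivative_real_field)
  have "((\<lambda>y. Re (?F (of_real y))) has_vector_derivative Re (deriv ?F (of_real x))) (at x)"
    by (rule bounded_linear.has_vector_derivative[OF bounded_linear_Re v])
  then have "(?g has_vector_derivative Re (deriv ?F (of_real x))) (at x)"
    by (rule has_vector_derivative_transform_within_open[where S = "{-r<..<r}"])
      (use Suc in \<open>auto simp: abs_less_iff\<close>)
  then have 1: "deriv ?g x = Re (deriv ?F (of_real x))"
    by (intro DERIV_imp_deriv) (simp add: has_real_derivative_iff_has_vector_derivative)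
  have "((\<lambda>y. Im (?F (of_real y))) has_vector_derivative Im (deriv ?F (of_real x))) (at x)"
    by (rule bounded_linear.has_vector_derivative[OF bounded_linear_Im v])
  then have "((\<lambda>y. 0) has_vector_derivative Im (deriv ?F (of_real x))) (at x)"
    by (rule has_vector_derivative_transform_within_open[where S = "{-r<..<r}"])
      (use Suc in \<open>auto simp: abs_less_iff\<close>)
  then have "Im (deriv ?F (of_real x)) = 0"
    using vector_derivative_unique_at[OF _ has_vector_derivative_const] by blast
  then show ?case using 1 by (simp add: complex_eq_iff)
qed (use g in simp)

text \<open>Complexification of a real double power series; enumerating the index pairs by
  \<open>prod_decode\<close> turns it into a simple series.\<close>

definition dser :: "(nat \<Rightarrow> nat \<Rightarrow> real) \<Rightarrow> complex \<Rightarrow> complex \<Rightarrow> complex" where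
  "dser c x y = (\<Sum>n. case prod_decode n of (i, j) \<Rightarrow> of_real (c i j) * (x ^ i * y ^ j))"

text \<open>Every partial sum is covered by a square of index pairs, over which the sum is a product
  of two geometric sums, hence at most \<open>2 * 2\<close>.\<close>

lemma summable_half_powers: "summable (\<lambda>n. case prod_decode n of (i, j) \<Rightarrow> (1/2 :: real) ^ (i + j))"
proof (rule summableI_nonneg_bounded)
  fix N
  obtain K where K: "\<And>n. n < N \<Longrightarrow> fst (prod_decode n) \<le> K \<and> snd (prod_decode n) \<le> K"
  proof -
    have "finite ((\<lambda>n. fst (prod_decode n) + snd (prod_decode n)) ` {..<N})" by simp
    then obtain K where "\<And>n. n < N \<Longrightarrow> fst (prod_decode n) + snd (prod_decode n) \<le> K"
      by (metis (no_types, lifting) finite_nat_set_iff_bounded_le image_eqI lessThan_iff)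
    then show ?thesis by (meson that add_leD1 add_leD2)
  qed
  have geo: "(\<Sum>i\<le>K. (1/2 :: real) ^ i) \<le> 2"
    unfolding sum_gp0 by simp
  have "(\<Sum>n<N. case prod_decode n of (i, j) \<Rightarrow> (1/2 :: real) ^ (i + j))
    = (\<Sum>(i, j)\<in>prod_decode ` {..<N}. (1/2) ^ (i + j))"
    by (subst sum.reindex) (auto simp: inj_prod_decode)
  also have "\<dots> \<le> (\<Sum>(i, j)\<in>{..K} \<times> {..K}. (1/2) ^ (i + j))"
  proof (rule sum_mono2)
    show "prod_decode ` {..<N} \<subseteq> {..K} \<times> {..K}"
    proof
      fix p assume "p \<in> prod_decode ` {..<N}"
      then obtain n where "n < N" "p = prod_decode n" by auto
      then show "p \<in> {..K} \<times> {..K}" using K[of n] by (simp add: mem_Times_iff)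
    qed
  qed auto
  also have "\<dots> = (\<Sum>i\<le>K. (1/2) ^ i) * (\<Sum>j\<le>K. (1/2) ^ j)"
    by (simp add: sum_product sum.cartesian_product power_add)
  also have "\<dots> \<le> 2 * 2" by (intro mult_mono geo) (auto intro: sum_nonneg)
  finally show "(\<Sum>n<N. case prod_decode n of (i, j) \<Rightarrow> (1/2 :: real) ^ (i + j)) \<le> 4" by simp
qed (auto split: prod.split)

lemma dser_term_le:
  assumes c: "\<bar>c i j\<bar> * r ^ (i + j) \<le> M" and r: "0 < r" and x: "norm x \<le> r / 2" "norm y \<le> r / 2"
  shows "norm (complex_of_real (c i j) * (x ^ i * y ^ j)) \<le> M * (1/2) ^ (i + j)"
proof -
  have "norm (of_real (c i j) * (x ^ i * y ^ j)) = \<bar>c i j\<bar> * (norm x ^ i * norm y ^ j)"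
    by (simp add: norm_mult norm_power)
  also have "\<dots> \<le> \<bar>c i j\<bar> * ((r/2) ^ i * (r/2) ^ j)"
    using x r by (intro mult_left_mono mult_mono power_mono) auto
  also have "\<dots> = (\<bar>c i j\<bar> * r ^ (i + j)) * (1/2) ^ (i + j)"
    by (simp add: power_divide power_add)
  also have "\<dots> \<le> M * (1/2) ^ (i + j)" using c by (intro mult_right_mono) auto
  finally show ?thesis .
qed

lemma dser_uniform:
  assumes c: "\<And>i j. \<bar>c i j\<bar> * r ^ (i + j) \<le> M" and r: "0 < r"
  shows "uniform_limit (ball 0 (r/2) \<times> ball 0 (r/2))
     (\<lambda>N p. \<Sum>n<N. case prod_decode n of (i, j) \<Rightarrow> of_real (c i j) * (fst p ^ i * snd p ^ j))
     (\<lambda>p. dser c (fst p) (snd p)) sequentially"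
  unfolding dser_def
proof (rule Weierstrass_m_test)
  show "summable (\<lambda>n. M * (case prod_decode n of (i, j) \<Rightarrow> (1/2 :: real) ^ (i + j)))"
    by (rule summable_mult[OF summable_half_powers])
  fix n and p :: "complex \<times> complex" assume p: "p \<in> ball 0 (r/2) \<times> ball 0 (r/2)"
  obtain i j where ij: "prod_decode n = (i, j)" by fastforce
  show "norm (case prod_decode n of (i, j) \<Rightarrow> complex_of_real (c i j) * (fst p ^ i * snd p ^ j))
       \<le> M * (case prod_decode n of (i, j) \<Rightarrow> (1/2) ^ (i + j))"
    using dser_term_le[where c = c and i = i and j = j and x = "fst p" and y = "snd p", OF c[of i j] r] p by (auto simp: ij)
qed

lemma dser_hol2:
  assumes c: "\<And>i j. \<bar>c i j\<bar> * r ^ (i + j) \<le> M" and r: "0 < r"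
  shows "hol2 (r/2) (r/2) (dser c)"
proof (rule hol2_uniform_limit[where F = "\<lambda>N x y. \<Sum>n<N. case prod_decode n of (i, j) \<Rightarrow>
     of_real (c i j) * (x ^ i * y ^ j)", OF _ dser_uniform[OF c r]])
  fix N
  show "hol2 (r/2) (r/2) (\<lambda>x y. \<Sum>n<N. case prod_decode n of (i, j) \<Rightarrow>
     of_real (c i j) * (x ^ i * y ^ j))"
  proof (induction N)
    case 0
    show ?case using hol2_fst[of "\<lambda>x. 0" "r/2" "r/2"] by simp
  next
    case (Suc N)
    obtain i j where ij: "prod_decode N = (i, j)" by fastforce
    have "hol2 (r/2) (r/2) (\<lambda>x y. of_real (c i j) * (x ^ i * y ^ j))"
      by (intro hol2_mult hol2_fst[of "\<lambda>x. x ^ i"] hol2_snd[of "\<lambda>x. x ^ j"] hol2_fst[of "\<lambda>x. of_real (c i j)"] holomorphic_intros)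
    from hol2_add[OF Suc this] show ?case by (simp add: ij)
  qed
qed

lemma dser_summable:
  assumes c: "\<And>i j. \<bar>c i j\<bar> * r ^ (i + j) \<le> M" and r: "0 < r" and x: "norm x < r / 2" "norm y < r / 2"
  shows "summable (\<lambda>n. case prod_decode n of (i, j) \<Rightarrow> complex_of_real (c i j) * (x ^ i * y ^ j))"
    and "norm (dser c x y) \<le> (\<Sum>n. M * (case prod_decode n of (i, j) \<Rightarrow> (1/2 :: real) ^ (i + j)))"
proof -
  have s: "summable (\<lambda>n. M * (case prod_decode n of (i, j) \<Rightarrow> (1/2 :: real) ^ (i + j)))"
    by (rule summable_mult[OF summable_half_powers])
  have le: "norm (case prod_decode n of (i, j) \<Rightarrow> complex_of_real (c i j) * (x ^ i * y ^ j))
     \<le> M * (case prod_decode n of (i, j) \<Rightarrow> (1/2 :: real) ^ (i + j))" for n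
  proof -
    obtain i j where ij: "prod_decode n = (i, j)" by fastforce
    show ?thesis
      using dser_term_le[where c = c and i = i and j = j and x = x and y = y, OF c[of i j] r] x by (simp add: ij)
  qed
  show "summable (\<lambda>n. case prod_decode n of (i, j) \<Rightarrow> complex_of_real (c i j) * (x ^ i * y ^ j))"
    by (rule summable_comparison_test'[OF s le])
  show "norm (dser c x y) \<le> (\<Sum>n. M * (case prod_decode n of (i, j) \<Rightarrow> (1/2 :: real) ^ (i + j)))"
    unfolding dser_def by (rule norm_suminf_le[OF le s]) 
qed

lemma dser_real:
  assumes "((\<lambda>(i, j). x ^ i * y ^ j * c i j) has_sum s) UNIV"
  shows "dser c (of_real x) (of_real y) = of_real s"
proof -
  have "((\<lambda>n. case prod_decode n of (i, j) \<Rightarrow> x ^ i * y ^ j * c i j) has_sum s) UNIV"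
    using has_sum_reindex_bij_betw[OF bij_prod_decode, of "\<lambda>(i, j). x ^ i * y ^ j * c i j" s] assms by simp
  then have "(\<lambda>n. case prod_decode n of (i, j) \<Rightarrow> x ^ i * y ^ j * c i j) sums s"
    by (rule has_sum_imp_sums)
  then have "(\<lambda>n. complex_of_real (case prod_decode n of (i, j) \<Rightarrow> x ^ i * y ^ j * c i j)) sums of_real s"
    by (rule sums_of_real)
  moreover have "complex_of_real (case prod_decode n of (i, j) \<Rightarrow> x ^ i * y ^ j * c i j)
     = (case prod_decode n of (i, j) \<Rightarrow> of_real (c i j) * (of_real x ^ i * of_real y ^ j))" for n
    by (auto split: prod.split)
  ultimately show ?thesis unfolding dser_def by (simp add: sums_unique[symmetric])
qed

text \<open>Tannery's theorem for the series with terms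
  \<open>\<bar>c l i j - c0 i j\<bar> * (r/2) ^ (i + j)\<close>: each term tends to 0, and the terms
  are dominated by \<open>2 * M * (1/2) ^ (i + j)\<close>. The sum of this series majorises the
  difference on the whole half polydisc.\<close>

lemma dser_family:
  fixes c :: "real \<Rightarrow> nat \<Rightarrow> nat \<Rightarrow> real" and G :: "real filter"
  assumes G: "G \<noteq> bot" and ev: "\<forall>\<^sub>F l in G. \<forall>i j. \<bar>c l i j\<bar> * r ^ (i + j) \<le> M"
    and 0: "\<And>i j. \<bar>c0 i j\<bar> * r ^ (i + j) \<le> M" and r: "0 < r"
    and lim: "\<And>i j. ((\<lambda>l. c l i j) \<longlongrightarrow> c0 i j) G"
  shows "uniform_limit (ball 0 (r/2) \<times> ball 0 (r/2)) (\<lambda>l (x, y). dser (c l) x y) (\<lambda>(x, y). dser c0 x y) G"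
proof -
  let ?q = "\<lambda>n. case prod_decode n of (i, j) \<Rightarrow> (r/2) ^ (i + j)"
  let ?d = "\<lambda>n l. case prod_decode n of (i, j) \<Rightarrow> \<bar>c l i j - c0 i j\<bar> * (r/2) ^ (i + j)"
  let ?M = "\<lambda>n. 2 * M * (case prod_decode n of (i, j) \<Rightarrow> (1/2 :: real) ^ (i + j))"
  have dM: "norm (?d n l) \<le> ?M n" if "\<forall>i j. \<bar>c l i j\<bar> * r ^ (i + j) \<le> M" for n l
  proof -
    obtain i j where ij: "prod_decode n = (i, j)" by fastforce
    have "\<bar>c l i j - c0 i j\<bar> * r ^ (i + j) \<le> (\<bar>c l i j\<bar> + \<bar>c0 i j\<bar>) * r ^ (i + j)"
      using r by (intro mult_right_mono) auto
    also have "\<dots> \<le> M + M"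
      using add_mono[OF that[rule_format, of i j] 0[of i j]] by (simp only: distrib_right)
    finally have "\<bar>c l i j - c0 i j\<bar> * r ^ (i + j) * (1/2) ^ (i + j) \<le> (2 * M) * (1/2) ^ (i + j)"
      by (intro mult_right_mono) auto
    then show ?thesis using r by (simp add: ij power_divide abs_mult)
  qed
  have "((\<lambda>l. suminf (\<lambda>n. ?d n l)) \<longlongrightarrow> suminf (\<lambda>n::nat. 0::real)) G"
  proof -
    have "eventually (\<lambda>l. summable (\<lambda>k. norm (?d k l))) G \<and> summable (\<lambda>n::nat. norm (0::real)) \<and>
        ((\<lambda>l. suminf (\<lambda>n. ?d n l)) \<longlongrightarrow> suminf (\<lambda>n::nat. 0::real)) G"
    proof (rule tannerys_theorem[where M = ?M])
      fix n
      obtain i j where ij: "prod_decode n = (i, j)" by fastforce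
      have "((\<lambda>l. \<bar>c l i j - c0 i j\<bar> * (r/2) ^ (i + j)) \<longlongrightarrow> \<bar>c0 i j - c0 i j\<bar> * (r/2) ^ (i + j)) G"
        by (intro tendsto_intros lim)
      then show "((\<lambda>l. ?d n l) \<longlongrightarrow> 0) G" by (simp add: ij)
    next
      show "\<forall>\<^sub>F (k, l) in at_top \<times>\<^sub>F G. norm (?d k l) \<le> ?M k"
        unfolding eventually_prod_filter using ev dM by (intro exI[of _ "\<lambda>_. True"] exI conjI) auto
    qed (rule summable_mult[OF summable_half_powers] G)+
    then show ?thesis by blast
  qed
  then have tend: "((\<lambda>l. suminf (\<lambda>n. ?d n l)) \<longlongrightarrow> 0) G" by simp
  have le: "norm (dser (c l) x y - dser c0 x y) \<le> suminf (\<lambda>n. ?d n l)"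
    if l: "\<forall>i j. \<bar>c l i j\<bar> * r ^ (i + j) \<le> M" and x: "norm x < r/2" "norm y < r/2" for l x y
  proof -
    have "dser (c l) x y - dser c0 x y = (\<Sum>n. (case prod_decode n of (i, j) \<Rightarrow> of_real (c l i j) * (x ^ i * y ^ j))
       - (case prod_decode n of (i, j) \<Rightarrow> of_real (c0 i j) * (x ^ i * y ^ j)))"
      unfolding dser_def
      by (rule suminf_diff; rule dser_summable(1)[OF _ r x]) (use l 0 in auto)
    also have "norm \<dots> \<le> suminf (\<lambda>n. ?d n l)"
    proof (rule norm_suminf_le)
      fix n
      obtain i j where ij: "prod_decode n = (i, j)" by fastforce
      have "of_real (c l i j) * (x ^ i * y ^ j) - of_real (c0 i j) * (x ^ i * y ^ j)
         = of_real (c l i j - c0 i j) * (x ^ i * y ^ j)" by (simp add: algebra_simps)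
      also have "norm \<dots> = \<bar>c l i j - c0 i j\<bar> * (norm x ^ i * norm y ^ j)"
        by (simp only: norm_mult norm_power norm_of_real)
      also have "\<dots> \<le> \<bar>c l i j - c0 i j\<bar> * ((r/2) ^ i * (r/2) ^ j)"
        using x r by (intro mult_left_mono mult_mono power_mono) auto
      finally show "norm ((case prod_decode n of (i, j) \<Rightarrow> of_real (c l i j) * (x ^ i * y ^ j))
       - (case prod_decode n of (i, j) \<Rightarrow> of_real (c0 i j) * (x ^ i * y ^ j))) \<le> ?d n l"
        by (simp add: ij power_add)
    next
      show "summable (\<lambda>n. ?d n l)"
        by (rule summable_comparison_test'[OF summable_mult[OF summable_half_powers] dM[OF l]])
    qed
    finally show ?thesis .
  qed
  show ?thesis
  proof (rule uniform_limitI)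
    fix e :: real assume "e > 0"
    with tend have "\<forall>\<^sub>F l in G. suminf (\<lambda>n. ?d n l) < e" by (rule order_tendstoD(2))
    then show "\<forall>\<^sub>F l in G. \<forall>p\<in>ball 0 (r/2) \<times> ball 0 (r/2).
        dist (case p of (x, y) \<Rightarrow> dser (c l) x y) (case p of (x, y) \<Rightarrow> dser c0 x y) < e"
      using ev
    proof eventually_elim
      case (elim l)
      then show ?case by (auto simp: dist_norm intro!: le_less_trans[OF le[OF elim(2)] elim(1)])
    qed
  qed
qed

text \<open>Unlike \<open>at m within I\<close>, this filter sees \<open>m\<close> itself: what
  holds eventually holds at \<open>m\<close> (\<open>near_self\<close>), and the filter is proper
  also when \<open>m\<close> is an isolated point of \<open>I\<close>.\<close>

abbreviation near :: "real \<Rightarrow> real set \<Rightarrow> real filter" where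
  "near m I \<equiv> inf (nhds m) (principal I)"

lemma near_self: "eventually P (near m I) \<Longrightarrow> m \<in> I \<Longrightarrow> P m"
  by (auto simp: eventually_inf_principal eventually_nhds)

lemma near_neq_bot: "m \<in> I \<Longrightarrow> near m I \<noteq> bot"
  using near_self[of "\<lambda>_. False" m I] by (auto simp: trivial_limit_def)

lemma eventually_near_openin:
  assumes "openin (top_of_set I) S" "m \<in> S" shows "\<forall>\<^sub>F l in near m I. l \<in> S"
  using assms unfolding eventually_inf_principal eventually_nhds openin_open by blast

text \<open>The radius of the Cauchy bound is halved to make the double series dominated by a
  geometric one; radius and bound are then common to all nearby parameters.\<close>

lemma analytic_family_extension:
  assumes W: "analytic_family I W" and m: "m \<in> I"
  obtains r M X Y where "0 < r"
    "\<forall>\<^sub>F l in near m I. hol2 r r (X l) \<and> hol2 r r (Y l) \<and>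
       (\<forall>x y. norm x < r \<longrightarrow> norm y < r \<longrightarrow> norm (X l x y) \<le> M \<and> norm (Y l x y) \<le> M) \<and>
       (\<forall>x y. \<bar>x\<bar> < r \<longrightarrow> \<bar>y\<bar> < r \<longrightarrow> X l (of_real x) (of_real y) = of_real (fst (W l (x, y))) \<and>
          Y l (of_real x) (of_real y) = of_real (snd (W l (x, y))))"
    "uniform_limit (ball 0 r \<times> ball 0 r) (\<lambda>l (x, y). X l x y) (\<lambda>(x, y). X m x y) (near m I)"
    "uniform_limit (ball 0 r \<times> ball 0 r) (\<lambda>l (x, y). Y l x y) (\<lambda>(x, y). Y m x y) (near m I)"
proof -
  obtain S r M and a :: "real \<Rightarrow> nat \<Rightarrow> nat \<Rightarrow> real \<times> real" where
    *: "openin (top_of_set I) S \<and> m \<in> S \<and> 0 < r \<and> (\<forall>i j. continuous_on S (\<lambda>l. a l i j)) \<and>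
      (\<forall>l\<in>S. \<forall>i j. norm (a l i j) * r ^ (i + j) \<le> M) \<and>
      (\<forall>l\<in>S. \<forall>x y. \<bar>x\<bar> < r \<longrightarrow> \<bar>y\<bar> < r \<longrightarrow>
        ((\<lambda>(i, j). (x ^ i * y ^ j) *\<^sub>R a l i j) has_sum W l (x, y)) UNIV)"
    using bspec[OF W[unfolded analytic_family_def] m] by (elim exE) (rule that, assumption)
  from * have S: "openin (top_of_set I) S" "m \<in> S" and r: "0 < r" by simp_all
  from * have cont: "continuous_on S (\<lambda>l. a l i j)" for i j by simp
  from * have bound: "norm (a l i j) * r ^ (i + j) \<le> M" if "l \<in> S" for l i j using that by simp
  from * have sum: "((\<lambda>(i, j). (x ^ i * y ^ j) *\<^sub>R a l i j) has_sum W l (x, y)) UNIV"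
    if "l \<in> S" "\<bar>x\<bar> < r" "\<bar>y\<bar> < r" for l x y using that by simp
  define X where "X l = dser (\<lambda>i j. fst (a l i j))" for l
  define Y where "Y l = dser (\<lambda>i j. snd (a l i j))" for l
  let ?M = "\<Sum>n. M * (case prod_decode n of (i, j) \<Rightarrow> (1/2 :: real) ^ (i + j))"
  have b1: "\<bar>fst (a l i j)\<bar> * r ^ (i + j) \<le> M" "\<bar>snd (a l i j)\<bar> * r ^ (i + j) \<le> M" if "l \<in> S" for l i j
  proof -
    have "\<bar>fst (a l i j)\<bar> \<le> norm (a l i j)" "\<bar>snd (a l i j)\<bar> \<le> norm (a l i j)"
      using norm_fst_le[of "fst (a l i j)" "snd (a l i j)"] norm_snd_le[of "snd (a l i j)" "fst (a l i j)"] by auto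
    then have "\<bar>fst (a l i j)\<bar> * r ^ (i + j) \<le> norm (a l i j) * r ^ (i + j)"
       "\<bar>snd (a l i j)\<bar> * r ^ (i + j) \<le> norm (a l i j) * r ^ (i + j)"
      using r by (auto intro!: mult_right_mono)
    then show "\<bar>fst (a l i j)\<bar> * r ^ (i + j) \<le> M" "\<bar>snd (a l i j)\<bar> * r ^ (i + j) \<le> M"
      using bound[OF that, of i j] by linarith+
  qed
  have evS: "\<forall>\<^sub>F l in near m I. l \<in> S" by (rule eventually_near_openin[OF S])
  have tend: "((\<lambda>l. a l i j) \<longlongrightarrow> a m i j) (near m I)" for i j
  proof -
    have "((\<lambda>l. a l i j) \<longlongrightarrow> a m i j) (at m within S)" using cont S(2) by (auto simp: continuous_on_def)
    moreover have "at m within S = at m within I"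
    proof -
      obtain U where "open U" "S = I \<inter> U" using S(1) unfolding openin_open by blast
      then show ?thesis using S(2) by (intro at_within_nhd[of m U]) auto
    qed
    ultimately show ?thesis by (simp add: tendsto_at_iff_tendsto_nhds_within)
  qed
  show thesis
  proof (rule that[of "r/2" X Y ?M])
    show "0 < r/2" using r by simp
    show "\<forall>\<^sub>F l in near m I. hol2 (r/2) (r/2) (X l) \<and> hol2 (r/2) (r/2) (Y l) \<and>
       (\<forall>x y. norm x < r/2 \<longrightarrow> norm y < r/2 \<longrightarrow> norm (X l x y) \<le> ?M \<and> norm (Y l x y) \<le> ?M) \<and>
       (\<forall>x y. \<bar>x\<bar> < r/2 \<longrightarrow> \<bar>y\<bar> < r/2 \<longrightarrow> X l (of_real x) (of_real y) = of_real (fst (W l (x, y))) \<and>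
          Y l (of_real x) (of_real y) = of_real (snd (W l (x, y))))"
      using evS
    proof eventually_elim
      case (elim l)
      have 1: "hol2 (r/2) (r/2) (X l)" "hol2 (r/2) (r/2) (Y l)"
        unfolding X_def Y_def using b1[OF elim] r by (auto intro!: dser_hol2)
      have 2: "norm (X l x y) \<le> ?M" "norm (Y l x y) \<le> ?M" if "norm x < r/2" "norm y < r/2" for x y
        unfolding X_def Y_def using b1[OF elim] r that by (auto intro!: dser_summable(2))
      have 3: "X l (of_real x) (of_real y) = of_real (fst (W l (x, y)))"
         "Y l (of_real x) (of_real y) = of_real (snd (W l (x, y)))" if "\<bar>x\<bar> < r/2" "\<bar>y\<bar> < r/2" for x y
      proof -
        have s: "((\<lambda>(i, j). (x ^ i * y ^ j) *\<^sub>R a l i j) has_sum W l (x, y)) UNIV"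
          using sum[OF elim] that r by auto
        have "((\<lambda>(i, j). x ^ i * y ^ j * fst (a l i j)) has_sum fst (W l (x, y))) UNIV"
          using has_sum_bounded_linear[OF bounded_linear_fst s] by (simp add: case_prod_unfold o_def)
        then show "X l (of_real x) (of_real y) = of_real (fst (W l (x, y)))"
          unfolding X_def by (rule dser_real)
        have "((\<lambda>(i, j). x ^ i * y ^ j * snd (a l i j)) has_sum snd (W l (x, y))) UNIV"
          using has_sum_bounded_linear[OF bounded_linear_snd s] by (simp add: case_prod_unfold o_def)
        then show "Y l (of_real x) (of_real y) = of_real (snd (W l (x, y)))"
          unfolding Y_def by (rule dser_real)
      qed
      show ?case using 1 2 3 by blast
    qed
    show "uniform_limit (ball 0 (r/2) \<times> ball 0 (r/2)) (\<lambda>l (x, y). X l x y) (\<lambda>(x, y). X m x y) (near m I)"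
      unfolding X_def
      by (rule dser_family[OF near_neq_bot[OF m] _ b1(1)[OF S(2)] r tendsto_fst[OF tend]])
        (use evS b1 in \<open>auto elim: eventually_mono\<close>)
    show "uniform_limit (ball 0 (r/2) \<times> ball 0 (r/2)) (\<lambda>l (x, y). Y l x y) (\<lambda>(x, y). Y m x y) (near m I)"
      unfolding Y_def
      by (rule dser_family[OF near_neq_bot[OF m] _ b1(2)[OF S(2)] r tendsto_snd[OF tend]])
        (use evS b1 in \<open>auto elim: eventually_mono\<close>)
  qed
qed

subsection \<open>Arcs of orbits in the upper half-plane\<close>

text \<open>The interface between the complex analysis and the dynamics. The field \<open>W\<close>
  is used in the upper half-plane, \<sigma> is the sign of its first component,
  \<open>g \<xi>\<close> is the orbit through \<open>(\<xi>, 0)\<close> as a graph, and \<phi> is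
  the half-return map. The box of \<open>W\<close> has size \<open>b\<close>, the graphs are defined
  for abscissae below \<open>b0\<close>, and \<open>r\<close> bounds \<xi>; the condition
  \<open>2 * r \<le> b0\<close> is there because \<phi> may double.\<close>

locale half_system =
  fixes W :: vfield and \<sigma> b b0 r C :: real and g :: "real \<Rightarrow> real \<Rightarrow> real" and \<phi> :: "real \<Rightarrow> real"
  assumes sg: "\<sigma> = 1 \<or> \<sigma> = -1" and r: "0 < r" "2 * r \<le> b0" "b0 \<le> b" and C: "0 \<le> C"
    and W_cont: "continuous_on {p. \<bar>fst p\<bar> < b \<and> \<bar>snd p\<bar> < b} W"
    and X_pos: "\<exists>c>0. \<forall>x y. \<bar>x\<bar> < b \<longrightarrow> \<bar>y\<bar> < b \<longrightarrow> c \<le> \<sigma> * fst (W (x, y))"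
    and slope_lip: "\<exists>K. \<forall>x y y'. \<bar>x\<bar> < b \<longrightarrow> \<bar>y\<bar> < b \<longrightarrow> \<bar>y'\<bar> < b \<longrightarrow>
      \<bar>snd (W (x, y)) / fst (W (x, y)) - snd (W (x, y')) / fst (W (x, y'))\<bar> \<le> K * \<bar>y - y'\<bar>"
    and Y_sign: "0 < \<bar>x\<bar> \<Longrightarrow> \<bar>x\<bar> < b0 \<Longrightarrow> \<sigma> * x * snd (W (x, 0)) < 0"
    and g_deriv: "0 < \<xi> \<Longrightarrow> \<xi> < r \<Longrightarrow> \<bar>x\<bar> < b0 \<Longrightarrow>
      (g \<xi> has_real_derivative snd (W (x, g \<xi> x)) / fst (W (x, g \<xi> x))) (at x)"
    and g_box: "0 < \<xi> \<Longrightarrow> \<xi> < r \<Longrightarrow> \<bar>x\<bar> < b0 \<Longrightarrow> \<bar>g \<xi> x\<bar> < b"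
    and g_cont: "continuous_on ({0<..<r} \<times> {-b0<..<b0}) (\<lambda>(\<xi>, x). g \<xi> x)"
    and g_pos: "0 < \<xi> \<Longrightarrow> \<xi> < r \<Longrightarrow> \<bar>x\<bar> < b0 \<Longrightarrow> 0 < g \<xi> x \<longleftrightarrow> \<phi> \<xi> < x \<and> x < \<xi>"
    and g_zero: "0 < \<xi> \<Longrightarrow> \<xi> < r \<Longrightarrow> \<bar>x\<bar> < b0 \<Longrightarrow> g \<xi> x = 0 \<longleftrightarrow> x = \<phi> \<xi> \<or> x = \<xi>"
    and g_mono: "0 < \<xi> \<Longrightarrow> \<xi> < \<xi>' \<Longrightarrow> \<xi>' < r \<Longrightarrow> \<bar>x\<bar> < b0 \<Longrightarrow> g \<xi> x < g \<xi>' x"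
    and g_small: "0 < \<xi> \<Longrightarrow> \<xi> < r \<Longrightarrow> \<bar>x\<bar> \<le> 2 * \<xi> \<Longrightarrow> \<bar>g \<xi> x\<bar> \<le> C * \<xi>"
    and \<phi>_bound: "0 < \<bar>x\<bar> \<Longrightarrow> \<bar>x\<bar> < r \<Longrightarrow> x * \<phi> x < 0 \<and> \<bar>\<phi> x\<bar> \<le> 2 * \<bar>x\<bar>"
    and \<phi>_inv: "0 < \<bar>x\<bar> \<Longrightarrow> \<bar>x\<bar> < r / 2 \<Longrightarrow> \<phi> (\<phi> x) = x"

text \<open>With \<open>g \<xi> x = picard f x (H \<xi>)\<close>, monotonicity in the initial value
  and \<open>picard f x (H x) = 0\<close> show that \<open>0 < g \<xi> x\<close> iff
  \<open>H x < H \<xi>\<close>. As \<open>H = w ^ m\<close> with \<open>m\<close> even, this means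
  \<open>\<bar>w x\<bar> < \<bar>w \<xi>\<bar>\<close>, that is, \<open>x\<close> lies between
  \<open>\<phi> \<xi>\<close> and \<open>\<xi>\<close>.\<close>

lemma half_system_intro:
  fixes W :: vfield
  assumes pic: "picard_rhs f b F K \<rho>" and ez: "even_zero u \<rho>2 a m" and \<rho>2: "\<rho>2 \<le> \<rho>"
    and fac: "\<And>z. norm z < \<rho>2 \<Longrightarrow> crossing f z = z ^ m * u z"
    and fW: "\<And>x y. \<bar>x\<bar> < b \<Longrightarrow> \<bar>y\<bar> < b \<Longrightarrow> f (of_real x) (of_real y) = of_real (snd (W (x, y)) / fst (W (x, y)))"
    and sg: "\<sigma> = 1 \<or> \<sigma> = -1" and c: "0 < c" "\<And>x y. \<bar>x\<bar> < b \<Longrightarrow> \<bar>y\<bar> < b \<Longrightarrow> c \<le> \<sigma> * fst (W (x, y))"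
    and W_cont: "continuous_on {p. \<bar>fst p\<bar> < b \<and> \<bar>snd p\<bar> < b} W"
  shows "half_system W \<sigma> b (\<rho>2/2) (\<rho>2/16) (4 * F)
    (\<lambda>\<xi> x. Re (picard f (of_real x) (crossing f (of_real \<xi>))))
    (\<lambda>x. Re (chart_involution a (chart m u) (of_real x)))"
proof -
  interpret picard_rhs f b F K \<rho> by fact
  interpret z: even_zero u \<rho>2 a m by fact
  define h where "h x = Re (crossing f (of_real x))" for x :: real
  define P where "P x k = Re (picard f (of_real x) (of_real k))" for x k :: real
  have f_real: "f (of_real x) (of_real y) \<in> \<real>" if "\<bar>x\<bar> < b" "\<bar>y\<bar> < b" for x y
    using fW[OF that] by simp
  have h: "crossing f (of_real x) = of_real (h x)" if "\<bar>x\<bar> < \<rho>" for x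
    using crossing_real[OF f_real that] by (simp add: h_def)
  have h_less: "\<bar>h x\<bar> < b/2" if "\<bar>x\<bar> < \<rho>" for x
    using crossing_less[of "of_real x"] h[OF that] that by simp
  have P: "picard f (of_real x) (of_real k) = of_real (P x k)" if "\<bar>x\<bar> < \<rho>" "\<bar>k\<bar> < b/2" for x k
    using picard_real[OF f_real that] by (simp add: P_def)
  have P_box: "\<bar>P x k\<bar> < b" if "\<bar>x\<bar> < \<rho>" "\<bar>k\<bar> < b/2" for x k
    using picard_box[of "of_real x" "of_real k"] P[OF that] that by simp
  have P_lip: "\<bar>P x k - P x k' - (k - k')\<bar> \<le> 1/2 * \<bar>k - k'\<bar>"
    if "\<bar>x\<bar> < \<rho>" "\<bar>k\<bar> < b/2" "\<bar>k'\<bar> < b/2" for x k k'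
  proof -
    have "norm (of_real (P x k - P x k' - (k - k')) :: complex) \<le> 1/2 * norm (of_real (k - k') :: complex)"
      using picard_lip_half[of "of_real x" "of_real k" "of_real k'"] that P by simp
    then show ?thesis by (simp only: norm_of_real)
  qed
  have P_mono: "P x k < P x k'" if "\<bar>x\<bar> < \<rho>" "\<bar>k\<bar> < b/2" "\<bar>k'\<bar> < b/2" "k < k'" for x k k'
    using abs_le_D2[OF P_lip[OF that(1,3,2)]] that(4) by simp
  have P_h: "P x (h x) = 0" if "\<bar>x\<bar> < \<rho>" for x
    using picard_crossing[of "of_real x"] P[OF that h_less[OF that]] h[OF that] that by simp
  have hw: "h x = z.wr x ^ m" if "\<bar>x\<bar> < \<rho>2" for x
  proof -
    have "of_real (h x) = (of_real (z.wr x ^ m) :: complex)"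
      using fac[of "of_real x"] h[of x] z.w_power[of "of_real x"] z.w_of_real[OF that] that \<rho>2 by simp
    then show ?thesis by (simp only: of_real_eq_iff)
  qed
  have evenpow: "h x < h y \<longleftrightarrow> \<bar>z.wr x\<bar> < \<bar>z.wr y\<bar>" "h x = h y \<longleftrightarrow> \<bar>z.wr x\<bar> = \<bar>z.wr y\<bar>"
    if "\<bar>x\<bar> < \<rho>2" "\<bar>y\<bar> < \<rho>2" for x y
  proof -
    have "h x = \<bar>z.wr x\<bar> ^ m" "h y = \<bar>z.wr y\<bar> ^ m"
      using hw that z.m(1) by (simp_all add: power_even_abs)
    then show "h x < h y \<longleftrightarrow> \<bar>z.wr x\<bar> < \<bar>z.wr y\<bar>" "h x = h y \<longleftrightarrow> \<bar>z.wr x\<bar> = \<bar>z.wr y\<bar>"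
      using z.m(2) by (auto simp: power_mono_iff power_eq_iff_eq_base power_strict_mono dest: power_less_imp_less_base)
  qed
  let ?g = "\<lambda>\<xi> x. Re (picard f (of_real x) (crossing f (of_real \<xi>)))"
  have g_P: "?g \<xi> x = P x (h \<xi>)" if "\<bar>\<xi>\<bar> < \<rho>" for \<xi> x
    using h[OF that] by (simp add: P_def)
  have g_c: "picard f (of_real x) (crossing f (of_real \<xi>)) = of_real (?g \<xi> x)" if "\<bar>\<xi>\<bar> < \<rho>" "\<bar>x\<bar> < \<rho>" for \<xi> x
    using P[OF that(2) h_less[OF that(1)]] h[OF that(1)] by simp
  have \<rho>2': "0 < \<rho>2" by (rule z.\<rho>)
  have wr_sgn: "0 < x * z.wr x" if "0 < \<bar>x\<bar>" "\<bar>x\<bar> < \<rho>2/2" for x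
    using z.wr_less[of 0 x] z.wr_less[of x 0] that \<rho>2' z.wr_0
    by (cases "x > 0") (auto simp: zero_less_mult_iff)
  have \<phi>r_le: "\<bar>z.\<phi>r x\<bar> \<le> 2 * \<bar>x\<bar>" if "\<bar>x\<bar> < \<rho>2/16" for x
    using z.\<phi>_le_2[of "of_real x"] z.\<phi>_of_real[OF that] that by simp
  have wr_eq: "z.wr x < z.wr y \<longleftrightarrow> x < y" "z.wr x = z.wr y \<longleftrightarrow> x = y" if "\<bar>x\<bar> < \<rho>2/2" "\<bar>y\<bar> < \<rho>2/2" for x y
    using z.wr_less[OF that] z.wr_less[OF that(2,1)] by (cases x y rule: linorder_cases; force)+
  have cmp: "\<bar>z.wr x\<bar> < z.wr \<xi> \<longleftrightarrow> z.\<phi>r \<xi> < x \<and> x < \<xi>" "\<bar>z.wr x\<bar> = z.wr \<xi> \<longleftrightarrow> x = z.\<phi>r \<xi> \<or> x = \<xi>"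
    if "0 < \<xi>" "\<xi> < \<rho>2/16" "\<bar>x\<bar> < \<rho>2/2" for x \<xi>
  proof -
    have p: "\<bar>z.\<phi>r \<xi>\<bar> < \<rho>2/2" using \<phi>r_le[of \<xi>] that by simp
    have w: "z.wr (z.\<phi>r \<xi>) = - z.wr \<xi>" using z.wr_\<phi>r[of \<xi>] that by simp
    have pos: "z.wr \<xi> > 0" using wr_sgn[of \<xi>] that \<rho>2' by (simp add: zero_less_mult_iff)
    have 1: "- z.wr \<xi> < z.wr x \<longleftrightarrow> z.\<phi>r \<xi> < x" "- z.wr \<xi> = z.wr x \<longleftrightarrow> z.\<phi>r \<xi> = x"
      using wr_eq[OF p that(3)] w by simp_all
    have 2: "z.wr x < z.wr \<xi> \<longleftrightarrow> x < \<xi>" "z.wr x = z.wr \<xi> \<longleftrightarrow> x = \<xi>"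
      using wr_eq[of x \<xi>] that \<rho>2' by simp_all
    show "\<bar>z.wr x\<bar> < z.wr \<xi> \<longleftrightarrow> z.\<phi>r \<xi> < x \<and> x < \<xi>" using 1 2 by (auto simp: abs_less_iff)
    show "\<bar>z.wr x\<bar> = z.wr \<xi> \<longleftrightarrow> x = z.\<phi>r \<xi> \<or> x = \<xi>" using 1 2 pos by (auto simp: abs_if)
  qed
  have \<phi>_b: "x * z.\<phi>r x < 0 \<and> \<bar>z.\<phi>r x\<bar> \<le> 2 * \<bar>x\<bar>" if "0 < \<bar>x\<bar>" "\<bar>x\<bar> < \<rho>2/16" for x
  proof -
    have p: "\<bar>z.\<phi>r x\<bar> < \<rho>2/2" using \<phi>r_le[of x] that by simp
    have w: "z.wr (z.\<phi>r x) = - z.wr x" using z.wr_\<phi>r[of x] that by simp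
    have x: "0 < x * z.wr x" using wr_sgn[of x] that by simp
    then have "z.\<phi>r x \<noteq> 0" using w z.wr_0 by auto
    then have "0 < z.\<phi>r x * z.wr (z.\<phi>r x)" using wr_sgn[of "z.\<phi>r x"] p by simp
    then have "x * z.\<phi>r x < 0" using x w by (auto simp: zero_less_mult_iff mult_less_0_iff)
    then show ?thesis using \<phi>r_le[OF that(2)] by blast
  qed
  have gs: "?g \<xi> x > 0 \<longleftrightarrow> h x < h \<xi>" "?g \<xi> x = 0 \<longleftrightarrow> h x = h \<xi>" if "\<bar>\<xi>\<bar> < \<rho>" "\<bar>x\<bar> < \<rho>" for \<xi> x
  proof -
    have e: "P x (h x) = 0" by (rule P_h[OF that(2)])
    have b: "\<bar>h x\<bar> < b/2" "\<bar>h \<xi>\<bar> < b/2" using h_less that by blast+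
    show "?g \<xi> x > 0 \<longleftrightarrow> h x < h \<xi>" "?g \<xi> x = 0 \<longleftrightarrow> h x = h \<xi>"
      using P_mono[OF that(2) b] P_mono[OF that(2) b(2,1)] e g_P[OF that(1), of x]
      by (cases "h x" "h \<xi>" rule: linorder_cases; force)+
  qed
  have wr_pos: "\<bar>z.wr \<xi>\<bar> = z.wr \<xi>" if "0 < \<xi>" "\<xi> < \<rho>2/16" for \<xi>
    using wr_sgn[of \<xi>] that \<rho>2' by (simp add: zero_less_mult_iff)
  have "half_system W \<sigma> b (\<rho>2/2) (\<rho>2/16) (4 * F) ?g z.\<phi>r"
  proof
    show "\<sigma> = 1 \<or> \<sigma> = -1" by (rule sg)
    show "0 < \<rho>2/16" "2 * (\<rho>2/16) \<le> \<rho>2/2" "\<rho>2/2 \<le> b" "0 \<le> 4 * F" using \<rho>2' \<rho>2 pos by auto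
    show "continuous_on {p. \<bar>fst p\<bar> < b \<and> \<bar>snd p\<bar> < b} W" by (rule W_cont)
    show "\<exists>c>0. \<forall>x y. \<bar>x\<bar> < b \<longrightarrow> \<bar>y\<bar> < b \<longrightarrow> c \<le> \<sigma> * fst (W (x, y))" using c by blast
    show "\<exists>K. \<forall>x y y'. \<bar>x\<bar> < b \<longrightarrow> \<bar>y\<bar> < b \<longrightarrow> \<bar>y'\<bar> < b \<longrightarrow>
      \<bar>snd (W (x, y)) / fst (W (x, y)) - snd (W (x, y')) / fst (W (x, y'))\<bar> \<le> K * \<bar>y - y'\<bar>"
    proof (intro exI allI impI)
      fix x y y' :: real assume *: "\<bar>x\<bar> < b" "\<bar>y\<bar> < b" "\<bar>y'\<bar> < b"
      have "norm (f (of_real x) (of_real y) - f (of_real x) (of_real y')) \<le> K * norm (of_real y - of_real y' :: complex)"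
        by (rule f_lip) (use * in auto)
      then show "\<bar>snd (W (x, y)) / fst (W (x, y)) - snd (W (x, y')) / fst (W (x, y'))\<bar> \<le> K * \<bar>y - y'\<bar>"
        using fW[OF *(1,2)] fW[OF *(1,3)] by (simp only: of_real_diff[symmetric] norm_of_real)
    qed
    \<comment> \<open>The slope \<open>s\<close> at \<open>(x, 0)\<close> is compared with the
      derivative \<open>t * q\<close> of \<open>H = w ^ m\<close>, where \<open>t\<close> is real
      with the sign of \<open>x\<close> and \<open>Re q > 0\<close>;
      \<open>crossing_deriv_half\<close> forces \<open>s\<close> to have the opposite sign.\<close>
    show "\<sigma> * x * snd (W (x, 0)) < 0" if x: "0 < \<bar>x\<bar>" "\<bar>x\<bar> < \<rho>2/2" for x
    proof -
      let ?x = "of_real x :: complex"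
      have xb: "\<bar>x\<bar> < b" "\<bar>0::real\<bar> < b" using x \<rho>2 pos b_pos by auto
      define s where "s = snd (W (x, 0)) / fst (W (x, 0))"
      have fs: "f ?x 0 = of_real s" using fW[OF xb] by (simp add: s_def)
      have "(z.w has_field_derivative deriv z.w ?x) (at ?x)"
        by (rule holomorphic_derivI[OF z.w_hol open_ball]) (use x \<rho>2' in auto)
      from DERIV_power[OF this, of m]
      have "((\<lambda>z. z.w z ^ m) has_field_derivative of_nat m * (deriv z.w ?x * z.w ?x ^ (m - Suc 0))) (at ?x)" .
      then have "(crossing f has_field_derivative of_nat m * (deriv z.w ?x * z.w ?x ^ (m - Suc 0))) (at ?x)"
        by (rule has_field_derivative_transform_within_open[where S = "ball 0 \<rho>2"])
          (use x \<rho>2' fac z.w_power in auto)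
      then have D: "deriv (crossing f) ?x = of_nat m * (deriv z.w ?x * z.w ?x ^ (m - Suc 0))"
        by (rule DERIV_imp_deriv)
      have w: "z.w ?x = of_real (z.wr x)" using z.w_of_real[of x] x \<rho>2' by simp
      define q where "q = deriv z.w ?x"
      have q: "Re q > 0" using z.w_deriv_real[OF x(2)] complex_Re_le_cmod[of "of_real a - q"] z.a
        by (simp add: q_def norm_minus_commute)
      have odd: "odd (m - Suc 0)" using z.m by auto
      define t where "t = real m * z.wr x ^ (m - Suc 0)"
      have D': "deriv (crossing f) ?x = of_real t * q" unfolding D w by (simp add: q_def t_def mult_ac)
      have xt: "0 < x * t"
      proof (cases "x > 0")
        case True
        then show ?thesis using wr_sgn[OF x] z.m(2) by (simp add: t_def zero_less_mult_iff)
      next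
        case False
        then have "z.wr x < 0" "x < 0" using wr_sgn[OF x] by (auto simp: zero_less_mult_iff)
        then have "z.wr x ^ (m - Suc 0) < 0" using odd by (simp add: power_less_zero_eq)
        then have "t < 0" using z.m(2) unfolding t_def by (intro mult_pos_neg) auto
        then show ?thesis using \<open>x < 0\<close> by (rule mult_neg_neg[rotated])
      qed
      have le: "norm (of_real t * q + of_real s) \<le> 1/2 * norm (of_real t * q)"
        using crossing_deriv_half[of ?x] x \<rho>2 \<rho>2' by (simp add: D' fs)
      \<comment> \<open>If \<open>s\<close> vanished or had the sign of \<open>t\<close>, adding it
        to \<open>t * q\<close> could not decrease the modulus, because \<open>Re q > 0\<close>; but
        \<open>le\<close> says that it at least halves it.\<close>
      have "x * s < 0"
      proof (rule ccontr)
        assume "\<not> x * s < 0"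
        then have "0 \<le> t * s" using xt by (auto simp: zero_le_mult_iff zero_less_mult_iff mult_less_0_iff not_less)
        then have st: "0 \<le> t * Re q * s" using q by (metis mult.assoc mult.commute mult_nonneg_nonneg less_imp_le)
        have sq: "(t * Re q + s)^2 = (t * Re q)^2 + 2 * (t * Re q * s) + s^2"
          by (simp add: power2_eq_square algebra_simps)
        have "norm (of_real t * q + of_real s)^2 = (t * Re q + s)^2 + (t * Im q)^2"
          by (simp add: cmod_power2)
        also have "\<dots> \<ge> (t * Re q)^2 + (t * Im q)^2" using st sq zero_le_power2[of s] by linarith
        also have "(t * Re q)^2 + (t * Im q)^2 = norm (of_real t * q)^2" by (simp add: cmod_power2)
        finally have "norm (of_real t * q) \<le> norm (of_real t * q + of_real s)"
          by (rule power2_le_imp_le) simp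
        then have "norm (of_real t * q) \<le> 0" using le by linarith
        then show False using q xt by auto
      qed
      moreover have "snd (W (x, 0)) = s * fst (W (x, 0))" using c(2)[OF xb] c(1) by (auto simp: s_def)
      moreover have "0 < \<sigma> * fst (W (x, 0))" using c(2)[OF xb] c(1) by linarith
      ultimately have 1: "(x * s) * (\<sigma> * fst (W (x, 0))) < 0" and 2: "\<sigma> * x * snd (W (x, 0)) = (x * s) * (\<sigma> * fst (W (x, 0)))"
        by (simp_all add: mult_neg_pos)
      show ?thesis unfolding 2 by (rule 1)
    qed
    fix \<xi> x :: real
    {
      assume *: "0 < \<xi>" "\<xi> < \<rho>2/16" "\<bar>x\<bar> < \<rho>2/2"
      have in\<rho>: "\<bar>\<xi>\<bar> < \<rho>" "\<bar>x\<bar> < \<rho>" "\<bar>x\<bar> < \<rho>2" "\<bar>\<xi>\<bar> < \<rho>2" using * \<rho>2 \<rho>2' by auto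
      show "\<bar>?g \<xi> x\<bar> < b" using P_box[OF in\<rho>(2) h_less[OF in\<rho>(1)]] g_P[OF in\<rho>(1)] by simp
      have xb: "\<bar>x\<bar> < b" using in\<rho> pos by linarith
      have "((\<lambda>z. picard f z (crossing f (of_real \<xi>))) has_field_derivative
         f (of_real x) (picard f (of_real x) (crossing f (of_real \<xi>)))) (at (of_real x))"
        by (rule picard_deriv) (use in\<rho> crossing_less[of "of_real \<xi>"] in auto)
      then have "((\<lambda>x. picard f (of_real x) (crossing f (of_real \<xi>))) has_vector_derivative
         f (of_real x) (picard f (of_real x) (crossing f (of_real \<xi>)))) (at x)"
        by (rule has_vector_derivative_real_field)
      from bounded_linear.has_vector_derivative[OF bounded_linear_Re this]
      have "(?g \<xi> has_real_derivative Re (f (of_real x) (of_real (?g \<xi> x)))) (at x)"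
        using g_c[OF in\<rho>(1,2)] by (simp add: has_real_derivative_iff_has_vector_derivative)
      then show "(?g \<xi> has_real_derivative snd (W (x, ?g \<xi> x)) / fst (W (x, ?g \<xi> x))) (at x)"
        using fW[OF xb \<open>\<bar>?g \<xi> x\<bar> < b\<close>] by simp
      show "0 < ?g \<xi> x \<longleftrightarrow> z.\<phi>r \<xi> < x \<and> x < \<xi>" "?g \<xi> x = 0 \<longleftrightarrow> x = z.\<phi>r \<xi> \<or> x = \<xi>"
        using gs[OF in\<rho>(1,2)] evenpow[OF in\<rho>(3,4)] wr_pos[OF *(1,2)] cmp[OF *] by simp_all
    }
    show "?g \<xi> x < ?g \<xi>' x" if *: "0 < \<xi>" "\<xi> < \<xi>'" "\<xi>' < \<rho>2/16" "\<bar>x\<bar> < \<rho>2/2" for \<xi>'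
    proof -
      have in\<rho>: "\<bar>\<xi>\<bar> < \<rho>" "\<bar>\<xi>'\<bar> < \<rho>" "\<bar>x\<bar> < \<rho>" using * \<rho>2 \<rho>2' by auto
      have "z.wr \<xi> < z.wr \<xi>'" using wr_eq(1)[of \<xi> \<xi>'] * \<rho>2' by simp
      then have "h \<xi> < h \<xi>'" using evenpow(1)[of \<xi> \<xi>'] wr_pos[of \<xi>] wr_pos[of \<xi>'] * \<rho>2' by simp
      then show ?thesis using P_mono[OF in\<rho>(3) h_less[OF in\<rho>(1)] h_less[OF in\<rho>(2)]] g_P in\<rho> by simp
    qed
    show "\<bar>?g \<xi> x\<bar> \<le> 4 * F * \<xi>" if *: "0 < \<xi>" "\<xi> < \<rho>2/16" "\<bar>x\<bar> \<le> 2 * \<xi>"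
    proof -
      have in\<rho>: "\<bar>\<xi>\<bar> < \<rho>" "\<bar>x\<bar> < \<rho>" using * \<rho>2 \<rho>2' by auto
      have c1: "norm (picard f (of_real x) (crossing f (of_real \<xi>)) - crossing f (of_real \<xi>)) \<le> norm (of_real x :: complex) * F"
        by (rule picard_le) (use in\<rho> crossing_less[of "of_real \<xi>"] in auto)
      have c2: "norm (crossing f (of_real \<xi>)) \<le> 2 * F * \<xi>" using crossing_le_2[of "of_real \<xi>"] in\<rho> * by simp
      have "\<bar>?g \<xi> x\<bar> \<le> norm (picard f (of_real x) (crossing f (of_real \<xi>)))" by (rule abs_Re_le_cmod)
      also have "\<dots> \<le> norm (crossing f (of_real \<xi>)) + norm (picard f (of_real x) (crossing f (of_real \<xi>)) - crossing f (of_real \<xi>))"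
        using norm_triangle_ineq[of "crossing f (of_real \<xi>)" "picard f (of_real x) (crossing f (of_real \<xi>)) - crossing f (of_real \<xi>)"] by simp
      also have "\<dots> \<le> 2 * F * \<xi> + \<bar>x\<bar> * F" using c1 c2 by simp
      also have "\<dots> \<le> 2 * F * \<xi> + 2 * \<xi> * F" using * pos by (intro add_left_mono mult_right_mono) auto
      finally show ?thesis by (simp add: algebra_simps)
    qed
    show "x * z.\<phi>r x < 0 \<and> \<bar>z.\<phi>r x\<bar> \<le> 2 * \<bar>x\<bar>" if "0 < \<bar>x\<bar>" "\<bar>x\<bar> < \<rho>2/16"
      by (rule \<phi>_b[OF that])
    \<comment> \<open>Half of the radius is used because \<open>\<phi>r x\<close> may be twice as
      large as \<open>x\<close> and must again lie in the domain.\<close>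
    show "z.\<phi>r (z.\<phi>r x) = x" if x: "0 < \<bar>x\<bar>" "\<bar>x\<bar> < \<rho>2/16/2"
    proof -
      have 1: "\<bar>z.\<phi>r x\<bar> < \<rho>2/16" using \<phi>_b[of x] x by simp
      then have 2: "\<bar>z.\<phi>r (z.\<phi>r x)\<bar> < \<rho>2/2" using \<phi>r_le[OF 1] by simp
      have "z.wr (z.\<phi>r (z.\<phi>r x)) = z.wr x" using z.wr_\<phi>r[OF 1] z.wr_\<phi>r[of x] x by simp
      then show ?thesis using wr_eq(2)[OF 2, of x] x \<rho>2' by simp
    qed
  next
    have "continuous_on ({0<..<\<rho>2/16} \<times> {- (\<rho>2/2)<..<\<rho>2/2}) (\<lambda>p. crossing f (of_real (fst p)))"
    proof (rule continuous_on_compose2[OF holomorphic_on_imp_continuous_on[OF crossing_holomorphic]])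
      show "continuous_on ({0<..<\<rho>2/16} \<times> {- (\<rho>2/2)<..<\<rho>2/2}) (\<lambda>p. of_real (fst p) :: complex)"
        by (intro continuous_intros)
    qed (use \<rho>2 \<rho>2' in auto)
    then have "continuous_on ({0<..<\<rho>2/16} \<times> {- (\<rho>2/2)<..<\<rho>2/2})
       (\<lambda>p. picard f (of_real (snd p)) (crossing f (of_real (fst p))))"
      by (intro hol2_cont[OF picard_hol2] crossing_less continuous_intros) (use \<rho>2 \<rho>2' in auto)
    then have "continuous_on ({0<..<\<rho>2/16} \<times> {- (\<rho>2/2)<..<\<rho>2/2})
       (\<lambda>p. Re (picard f (of_real (snd p)) (crossing f (of_real (fst p)))))"
      by (intro continuous_intros)
    then show "continuous_on ({0<..<\<rho>2/16} \<times> {- (\<rho>2/2)<..<\<rho>2/2}) (\<lambda>(\<xi>, x). ?g \<xi> x)"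
      by (simp add: case_prod_unfold)
  qed
  then show ?thesis unfolding z.\<phi>r_def .
qed

lemma taylor_quotient_limit:
  assumes F: "F holomorphic_on ball 0 r" and r: "0 < r" and z: "\<And>i. i < n \<Longrightarrow> (deriv ^^ i) F 0 = 0"
  shows "((\<lambda>z. F z / z ^ n) \<longlongrightarrow> (deriv ^^ n) F 0 / fact n) (at 0)"
proof -
  let ?c = "\<lambda>i. (deriv ^^ i) F 0 / fact i"
  have "((\<lambda>z. F z / z ^ n) \<longlongrightarrow> ?c (0 + n)) (at 0)"
  proof (rule powser_limit_0_strong[OF r, where a = "\<lambda>i. ?c (i + n)"])
    fix w :: complex assume w: "w \<noteq> 0" "norm w < r"
    have "(\<lambda>i. ?c i * (w - 0) ^ i) sums F w"
      by (rule holomorphic_power_series[OF F]) (use w in auto)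
    from sums_split_initial_segment[OF this, of n]
    have "(\<lambda>i. ?c (i + n) * w ^ (i + n)) sums (F w - (\<Sum>i<n. ?c i * w ^ i))" by simp
    also have "(\<Sum>i<n. ?c i * w ^ i) = 0" by (intro sum.neutral) (use z in auto)
    finally have "(\<lambda>i. ?c (i + n) * w ^ (i + n)) sums F w" by simp
    from sums_divide[OF this, of "w ^ n"] show "(\<lambda>i. ?c (i + n) * w ^ i) sums (F w / w ^ n)"
      using w by (simp add: power_add)
  qed
  then show ?thesis by simp
qed

lemma uniform_limit_pairD:
  assumes "uniform_limit (ball 0 r \<times> ball 0 r) (\<lambda>l (x, y). X l x y) (\<lambda>(x, y). X' x y) G" "0 < e"
  shows "\<forall>\<^sub>F l in G. \<forall>x y. norm x < r \<longrightarrow> norm y < r \<longrightarrow> norm (X l x y - X' x y) < (e :: real)"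
  using uniform_limitD[OF assms] by eventually_elim (auto simp: dist_norm)

text \<open>All constants are chosen at the base parameter \<open>m\<close> with a margin, and
  uniform convergence makes them valid nearby. The contact conditions enter through the leading
  coefficient: its order is the same for every parameter, and its sign makes \<open>u\<close>
  positive at 0, so that the root is available.\<close>

lemma half_family:
  assumes W: "analytic_family I W" and m: "m \<in> I" and k: "1 \<le> k"
    and con: "\<And>l. l \<in> I \<Longrightarrow> contact k (W l) \<and> X0 (W l) * dYdx (W l) (2 * k - 1) < 0"
  obtains b b0 r C g \<phi> where "0 < r"
    "\<forall>\<^sub>F l in near m I. sgn (X0 (W l)) = sgn (X0 (W m)) \<and>
       half_system (W l) (sgn (X0 (W m))) b b0 r C (g l) (\<lambda>x. Re (\<phi> l (of_real x))) \<and>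
       \<phi> l holomorphic_on ball 0 r \<and> (\<forall>z. norm z < r \<longrightarrow> norm (\<phi> l z) \<le> 2 * norm z) \<and>
       (\<forall>x. \<bar>x\<bar> < r \<longrightarrow> \<phi> l (of_real x) \<in> \<real>)"
    "uniform_limit (ball 0 r) \<phi> (\<phi> m) (near m I)"
proof -
  let ?N = "near m I"
  obtain r0 M X Y where r0: "0 < r0"
    and ev: "\<forall>\<^sub>F l in ?N. hol2 r0 r0 (X l) \<and> hol2 r0 r0 (Y l) \<and>
       (\<forall>x y. norm x < r0 \<longrightarrow> norm y < r0 \<longrightarrow> norm (X l x y) \<le> M \<and> norm (Y l x y) \<le> M) \<and>
       (\<forall>x y. \<bar>x\<bar> < r0 \<longrightarrow> \<bar>y\<bar> < r0 \<longrightarrow> X l (of_real x) (of_real y) = of_real (fst (W l (x, y))) \<and>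
          Y l (of_real x) (of_real y) = of_real (snd (W l (x, y))))"
    and ulX: "uniform_limit (ball 0 r0 \<times> ball 0 r0) (\<lambda>l (x, y). X l x y) (\<lambda>(x, y). X m x y) ?N"
    and ulY: "uniform_limit (ball 0 r0 \<times> ball 0 r0) (\<lambda>l (x, y). Y l x y) (\<lambda>(x, y). Y m x y) ?N"
    by (rule analytic_family_extension[OF W m])
  note evm = near_self[OF ev m]
  define xm where "xm = X0 (W m)"
  \<comment> \<open>Half of the modulus of \<open>X\<close> at the origin: on the polydisc of radius
    \<open>b1\<close> below, \<open>X\<close> stays within \<open>c\<close> of its central value at
    the base parameter, hence at least \<open>c\<close> in modulus.\<close>
  define c where "c = \<bar>xm\<bar> / 2"
  define s where "s = sgn xm"
  have "xm \<noteq> 0" using con[OF m] by (simp add: xm_def contact_def)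
  then have c: "0 < c" and s: "s = 1 \<or> s = -1" and sx: "s * xm = 2 * c" "norm (of_real xm :: complex) = 2 * c"
    by (auto simp: c_def s_def sgn_if)
  have Xm0: "X m 0 0 = of_real xm" using evm r0 by (metis X0_def abs_zero of_real_0 xm_def)
  obtain d where d: "0 < d" "\<And>p. p \<in> ball 0 r0 \<times> ball 0 r0 \<Longrightarrow> dist p (0, 0) < d \<Longrightarrow>
     dist (case p of (x, y) \<Rightarrow> X m x y) (X m 0 0) < c / 2"
  proof -
    have "continuous_on (ball 0 r0 \<times> ball 0 r0) (\<lambda>(x, y). X m x y)" using evm by (simp add: hol2_def)
    moreover have "(0, 0) \<in> ball (0::complex) r0 \<times> ball (0::complex) r0" using r0 by simp
    ultimately show ?thesis using that c unfolding continuous_on_iff by (metis (no_types, lifting) case_prod_conv half_gt_zero)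
  qed
  define b1 where "b1 = min r0 (d / 2)"
  have b1: "0 < b1" "b1 \<le> r0" using r0 d by (auto simp: b1_def)
  have Xm_near: "norm (X m x y - of_real xm) < c / 2" if "norm x < b1" "norm y < b1" for x y
  proof -
    have "dist (x, y) (0, 0) \<le> norm x + norm y" using norm_Pair_le[of x y] by (simp add: dist_norm)
    also have "\<dots> < d" using that by (simp add: b1_def)
    finally show ?thesis using d(2)[of "(x, y)"] that b1 by (simp add: Xm0 dist_norm)
  qed
  define good where "good l \<longleftrightarrow> l \<in> I \<and> hol2 r0 r0 (X l) \<and> hol2 r0 r0 (Y l) \<and>
       (\<forall>x y. norm x < r0 \<longrightarrow> norm y < r0 \<longrightarrow> norm (X l x y) \<le> M \<and> norm (Y l x y) \<le> M) \<and>
       (\<forall>x y. \<bar>x\<bar> < r0 \<longrightarrow> \<bar>y\<bar> < r0 \<longrightarrow> X l (of_real x) (of_real y) = of_real (fst (W l (x, y))) \<and>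
          Y l (of_real x) (of_real y) = of_real (snd (W l (x, y)))) \<and>
       (\<forall>x y. norm x < b1 \<longrightarrow> norm y < b1 \<longrightarrow> norm (X l x y - of_real xm) < c)" for l
  have evI: "\<forall>\<^sub>F l in ?N. l \<in> I" by (simp add: eventually_inf_principal)
  have "\<forall>\<^sub>F l in ?N. \<forall>x y. norm x < r0 \<longrightarrow> norm y < r0 \<longrightarrow> norm (X l x y - X m x y) < c / 2"
    by (rule uniform_limit_pairD[OF ulX]) (use c in simp)
  with ev evI have evg: "\<forall>\<^sub>F l in ?N. good l"
  proof eventually_elim
    case (elim l)
    have "norm (X l x y - of_real xm) < c" if "norm x < b1" "norm y < b1" for x y
    proof -
      have "norm (X l x y - X m x y) < c/2" using elim(3) that b1 by auto
      moreover have "norm (X l x y - of_real xm) \<le> norm (X l x y - X m x y) + norm (X m x y - of_real xm)"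
        using norm_triangle_ineq[of "X l x y - X m x y" "X m x y - of_real xm"] by simp
      ultimately show ?thesis using Xm_near[OF that] by linarith
    qed
    then show ?case using elim unfolding good_def by blast
  qed
  have gm: "good m" by (rule near_self[OF evg m])
  have M: "0 \<le> M" using evm r0 by (metis norm_ge_zero norm_zero order_trans)
  define f where "f l x y = Y l x y / X l x y" for l x y
  define F where "F = M / c"
  define b where "b = b1 / 2"
  \<comment> \<open>The Lipschitz constant from Cauchy's inequality on the half disc
    \<open>b = b1 / 2\<close>. In \<rho> below, the added ones avoid a division by 0.\<close>
  define K where "K = 4 * F / b1"
  define \<rho> where "\<rho> = min b (min (b / (8 * (F + 1))) (1 / (4 * (K + 1))))"
  have F: "0 \<le> F" and b: "0 < b" "b < b1" and K: "0 \<le> K"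
    using M c b1 by (auto simp: F_def b_def K_def)
  have \<rho>: "0 < \<rho>" "\<rho> \<le> b" "\<rho> * F \<le> b / 8" "\<rho> * K \<le> 1 / 4"
  proof -
    show "0 < \<rho>" "\<rho> \<le> b" using F b K by (auto simp: \<rho>_def)
    have "\<rho> * F \<le> (b / (8 * (F + 1))) * (F + 1)" using F b by (intro mult_mono) (auto simp: \<rho>_def)
    also have "\<dots> = b / 8" using F by (simp add: field_simps)
    finally show "\<rho> * F \<le> b / 8" .
    have "\<rho> * K \<le> (1 / (4 * (K + 1))) * (K + 1)" using K by (intro mult_mono) (auto simp: \<rho>_def)
    also have "\<dots> = 1 / 4" using K by (simp add: field_simps)
    finally show "\<rho> * K \<le> 1 / 4" .
  qed
  have Xge: "c \<le> norm (X l x y)" if "good l" "norm x < b1" "norm y < b1" for l x y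
  proof -
    have "norm (X l x y - of_real xm) < c" using that unfolding good_def by blast
    moreover have "norm (of_real xm :: complex) \<le> norm (X l x y) + norm (X l x y - of_real xm)"
      using norm_triangle_ineq4[of "X l x y" "X l x y - of_real xm"] by simp
    ultimately show ?thesis using sx by linarith
  qed
  have Yle: "norm (Y l x y) \<le> M" if "good l" "norm x < b1" "norm y < b1" for l x y
    using that b1 unfolding good_def by auto
  have f_hol: "hol2 b1 b1 (f l)" if "good l" for l
    unfolding f_def
  proof (rule hol2_divide)
    have "hol2 r0 r0 (Y l)" "hol2 r0 r0 (X l)" using that unfolding good_def by blast+
    then show "hol2 b1 b1 (Y l)" "hol2 b1 b1 (X l)" using b1(2) by (auto elim: hol2_mono)
    show "X l x y \<noteq> 0" if "norm x < b1" "norm y < b1" for x y using Xge[OF \<open>good l\<close> that] c by auto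
  qed
  have f_le: "norm (f l x y) \<le> F" if "good l" "norm x < b1" "norm y < b1" for l x y
    unfolding f_def F_def norm_divide using Xge[OF that] Yle[OF that] c M by (intro frac_le) auto
  have pic: "picard_rhs (f l) b F K \<rho>" if "good l" for l
  proof
    show "hol2 b b (f l)" by (rule hol2_mono[OF f_hol[OF that]]) (use b in auto)
    show "norm (f l x y) \<le> F" if "norm x < b" "norm y < b" for x y
      using that b by (intro f_le[OF \<open>good l\<close>]) auto
    show "norm (f l x y - f l x y') \<le> K * norm (y - y')" if "norm x < b" "norm y < b" "norm y' < b" for x y y'
      unfolding K_def
    proof (rule holomorphic_bounded_lipschitz)
      show "f l x holomorphic_on ball 0 b1" using hol2_section'[OF f_hol[OF \<open>good l\<close>], of x] that b by simp
      show "norm (f l x z) \<le> F" if "norm z < b1" for z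
        using that \<open>norm x < b\<close> b by (intro f_le[OF \<open>good l\<close>]) auto
    qed (use that in \<open>auto simp: b_def\<close>)
  qed (use \<rho> F K in auto)
  have real_eq: "X l (of_real x) (of_real y) = of_real (fst (W l (x, y)))"
     "Y l (of_real x) (of_real y) = of_real (snd (W l (x, y)))" if "good l" "\<bar>x\<bar> < b1" "\<bar>y\<bar> < b1" for l x y
    using that b1 unfolding good_def by auto
  have fW: "f l (of_real x) (of_real y) = of_real (snd (W l (x, y)) / fst (W l (x, y)))"
    if "good l" "\<bar>x\<bar> < b" "\<bar>y\<bar> < b" for l x y
    using real_eq[OF that(1), of x y] that b by (simp add: f_def)
  have X_pos: "c \<le> s * fst (W l (x, y))" if "good l" "\<bar>x\<bar> < b1" "\<bar>y\<bar> < b1" for l x y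
  proof -
    have "norm (X l (of_real x) (of_real y) - of_real xm) < c" using that unfolding good_def by simp
    then have "\<bar>fst (W l (x, y)) - xm\<bar> < c"
      unfolding real_eq[OF that] by (simp only: of_real_diff[symmetric] norm_of_real)
    then have "\<bar>s * fst (W l (x, y)) - s * xm\<bar> < c" using s by auto
    then show ?thesis using sx by linarith
  qed
  have W_cont: "continuous_on {p. \<bar>fst p\<bar> < b \<and> \<bar>snd p\<bar> < b} (W l)" if "good l" for l
  proof -
    let ?B = "{p :: real \<times> real. \<bar>fst p\<bar> < b \<and> \<bar>snd p\<bar> < b}"
    have c1: "continuous_on ?B (\<lambda>p. of_real (fst p) :: complex)" "continuous_on ?B (\<lambda>p. of_real (snd p) :: complex)"
      by (intro continuous_intros)+
    have hXY: "hol2 r0 r0 (X l)" "hol2 r0 r0 (Y l)" using that unfolding good_def by auto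
    have "continuous_on ?B (\<lambda>p. X l (of_real (fst p)) (of_real (snd p)))"
      "continuous_on ?B (\<lambda>p. Y l (of_real (fst p)) (of_real (snd p)))"
      by (rule hol2_cont[OF hXY(1) c1] hol2_cont[OF hXY(2) c1]; use b b1 in auto)+
    then have "continuous_on ?B (\<lambda>p. (Re (X l (of_real (fst p)) (of_real (snd p))), Re (Y l (of_real (fst p)) (of_real (snd p)))))"
      by (intro continuous_intros)
    then show ?thesis
      by (rule continuous_on_eq) (use real_eq[OF that] b in auto)
  qed
  define n where "n = 2 * k - 1"
  have n: "1 \<le> n" "Suc n = 2 * k" using k by (auto simp: n_def)
  \<comment> \<open>At 0, \<open>f l z 0\<close> behaves like \<open>v l * z ^ n\<close> with
    \<open>n = 2 * k - 1\<close>, so the crossing function has a zero of order \<open>2 * k\<close>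
    with \<open>2 * k * u 0 = - v l\<close>; invisibility of the contact makes \<open>v l\<close>
    negative.\<close>
  define v where "v l = dYdx (W l) n / fact n / X0 (W l)" for l
  have X0l: "X l 0 0 = of_real (X0 (W l))" "X0 (W l) \<noteq> 0" "sgn (X0 (W l)) = s" if "good l" for l
  proof -
    show "X l 0 0 = of_real (X0 (W l))" using real_eq[OF that, of 0 0] b1 by (simp add: X0_def)
    show "X0 (W l) \<noteq> 0" "sgn (X0 (W l)) = s"
      using X_pos[OF that, of 0 0] b1 c s by (auto simp: X0_def sgn_if)
  qed
  have v_neg: "v l < 0" if "good l" for l
  proof -
    have "X0 (W l) * dYdx (W l) n < 0" using con that unfolding good_def n_def by blast
    then show ?thesis by (auto simp: v_def divide_less_0_iff mult_less_0_iff)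
  qed
  have v_lim: "((\<lambda>z. f l z 0 / z ^ n) \<longlongrightarrow> of_real (v l)) (at 0)" if "good l" for l
  proof -
    have hY: "(\<lambda>z. Y l z 0) holomorphic_on ball 0 b1" and hX: "(\<lambda>z. X l z 0) holomorphic_on ball 0 b1"
      by (rule hol2_section[of b1 r0]; use that b1 r0 hol2_mono[of r0 r0 _ b1 r0] in \<open>auto simp: good_def\<close>)+
    have d: "(deriv ^^ i) (\<lambda>z. Y l z 0) 0 = of_real (dYdx (W l) i)" for i
    proof -
      have "(deriv ^^ i) (\<lambda>z. Y l z 0) (of_real 0) = of_real ((deriv ^^ i) (\<lambda>x. snd (W l (x, 0))) 0)"
        by (rule iterated_deriv_real[OF hY]) (use real_eq[OF that, of _ 0] b1 in auto)
      then show ?thesis by (simp add: dYdx_def)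
    qed
    have dz: "dYdx (W l) i = 0" if "i < n" for i
    proof (cases "i = 0")
      case True
      then show ?thesis using con[of l] \<open>good l\<close> by (simp add: good_def contact_def dYdx_def)
    next
      case False
      then have "i \<in> {1..2 * k - 2}" using that by (auto simp: n_def)
      then show ?thesis using con[of l] \<open>good l\<close> by (simp add: good_def contact_def)
    qed
    have 1: "((\<lambda>z. Y l z 0 / z ^ n) \<longlongrightarrow> of_real (dYdx (W l) n) / fact n) (at 0)"
      using taylor_quotient_limit[OF hY b1(1), of n] dz d by simp
    have "((\<lambda>z. X l z 0) \<longlongrightarrow> X l 0 0) (at 0)"
      using holomorphic_on_imp_continuous_on[OF hX] b1 by (simp add: continuous_on_eq_continuous_at isCont_def)
    from tendsto_divide[OF 1 this] show ?thesis
      using X0l[OF that] by (simp add: f_def v_def divide_simps mult_ac)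
  qed
  define Q where "Q l u \<longleftrightarrow> u holomorphic_on ball 0 \<rho> \<and> (\<forall>z. norm z < \<rho> \<longrightarrow> crossing (f l) z = z ^ (2 * k) * u z) \<and>
      of_nat (2 * k) * u 0 = - of_real (v l)" for l u
  have "\<exists>u. Q l u" if "good l" for l
    using picard_rhs.crossing_factor[OF pic[OF that] n(1) v_lim[OF that]] n(2) unfolding Q_def by metis
  then obtain u where u: "\<And>l. good l \<Longrightarrow> Q l (u l)" by metis
  have u_hol: "u l holomorphic_on ball 0 \<rho>" if "good l" for l using u[OF that] by (simp add: Q_def)
  have u_fac: "crossing (f l) z = z ^ (2 * k) * u l z" if "good l" "norm z < \<rho>" for l z
    using u[OF that(1)] that(2) by (simp add: Q_def)
  have u0: "u l 0 = of_real (- v l / real (2 * k))" if "good l" for l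
  proof -
    have "of_nat (2 * k) * u l 0 = - of_real (v l)" using u[OF that] by (simp add: Q_def)
    then have "u l 0 = - of_real (v l) / of_nat (2 * k)" using k by (simp add: field_simps)
    then show ?thesis by simp
  qed
  have f_conv: "\<forall>\<^sub>F l in ?N. \<forall>x y. norm x < b \<longrightarrow> norm y < b \<longrightarrow> norm (f l x y - f m x y) \<le> e" if "0 < e" for e
  proof -
    \<comment> \<open>From \<open>Y/X - Y'/X' = (Y - Y')/X + Y' (X' - X)/(X X')\<close> with both
      denominators at least \<open>c\<close> in modulus: deviations of \<open>e / q\<close> in the
      components cost at most \<open>e\<close> in the quotient.\<close>
    define q where "q = 1 / c + M / c^2"
    have q: "0 < q" using c M by (auto simp: q_def intro!: add_pos_nonneg)
    have "\<forall>\<^sub>F l in ?N. \<forall>x y. norm x < r0 \<longrightarrow> norm y < r0 \<longrightarrow> norm (X l x y - X m x y) < e / q"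
      "\<forall>\<^sub>F l in ?N. \<forall>x y. norm x < r0 \<longrightarrow> norm y < r0 \<longrightarrow> norm (Y l x y - Y m x y) < e / q"
      by (rule uniform_limit_pairD[OF ulX] uniform_limit_pairD[OF ulY]; use that q in simp)+
    with evg show ?thesis
    proof eventually_elim
      case (elim l)
      show ?case
      proof (intro allI impI)
        fix x y :: complex assume "norm x < b" "norm y < b"
        then have xy: "norm x < b1" "norm y < b1" using b by auto
        have nX: "X l x y \<noteq> 0" "X m x y \<noteq> 0" using Xge[OF elim(1) xy] Xge[OF gm xy] c by auto
        have dX: "norm (X m x y - X l x y) \<le> e / q" and dY: "norm (Y l x y - Y m x y) \<le> e / q"
          using elim(2,3) xy b1 by (auto simp: norm_minus_commute intro!: less_imp_le)
        have "f l x y - f m x y = (Y l x y - Y m x y) / X l x y + Y m x y * (X m x y - X l x y) / (X l x y * X m x y)"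
          using nX by (simp add: f_def field_simps)
        also have "norm \<dots> \<le> norm (Y l x y - Y m x y) / norm (X l x y) +
           norm (Y m x y) * norm (X m x y - X l x y) / (norm (X l x y) * norm (X m x y))"
          by (rule norm_triangle_le) (simp add: norm_divide norm_mult)
        also have "\<dots> \<le> (e / q) / c + M * (e / q) / (c * c)"
          using dX dY Xge[OF elim(1) xy] Xge[OF gm xy] Yle[OF gm xy] c M that q
          by (intro add_mono frac_le mult_mono) auto
        also have "\<dots> = (e / q) * q" using c by (simp add: q_def power2_eq_square distrib_left)
        also have "\<dots> = e" using q by simp
        finally show "norm (f l x y - f m x y) \<le> e" .
      qed
    qed
  qed
  have \<rho>4: "0 < 4 * \<rho>" using \<rho> by simp
  \<comment> \<open>The tolerance is divided by \<open>4 * \<rho>\<close>: a factor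
    \<open>2 * \<rho>\<close> is lost in \<open>picard_stable\<close> and a factor 2 in
    \<open>fixp_stable\<close>.\<close>
  have h_conv: "\<forall>\<^sub>F l in ?N. \<forall>z. norm z < \<rho> \<longrightarrow> norm (crossing (f l) z - crossing (f m) z) \<le> e" if "0 < e" for e
    using f_conv[OF divide_pos_pos[OF that \<rho>4]] evg
  proof eventually_elim
    case (elim l)
    interpret l: picard_rhs "f l" b F K \<rho> by (rule pic[OF elim(2)])
    interpret m: picard_rhs "f m" b F K \<rho> by (rule pic[OF gm])
    show ?case
    proof (intro allI impI)
      fix z :: complex assume z: "norm z < \<rho>"
      have "norm (crossing (f l) z - crossing (f m) z) \<le> 2 * (2 * \<rho> * (e / (4 * \<rho>)))"
        unfolding crossing_def
      proof (rule fixp_stable[OF l.lev.contraction_family_axioms m.lev.contraction_family_axioms _ z])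
        fix q :: complex assume "norm q \<le> b / 4"
        then have "norm (picard (f m) z q - picard (f l) z q) \<le> 2 * \<rho> * (e / (4 * \<rho>))"
          using elim(1) z b by (intro picard_stable[OF pic[OF gm] pic[OF elim(2)]]) (auto simp: norm_minus_commute)
        then show "norm (q - picard (f l) z q - (q - picard (f m) z q)) \<le> 2 * \<rho> * (e / (4 * \<rho>))" by simp
      qed
      then show "norm (crossing (f l) z - crossing (f m) z) \<le> e" using \<rho> by simp
    qed
  qed
  have u_conv: "\<forall>\<^sub>F l in ?N. \<forall>z. norm z \<le> \<rho> / 2 \<longrightarrow> norm (u l z - u m z) \<le> e" if "0 < e" for e
    using h_conv[OF mult_pos_pos[OF that zero_less_power[OF half_gt_zero[OF \<rho>(1)]]], of "2 * k"] evg
  proof eventually_elim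
    case (elim l)
    show ?case
    proof (intro allI impI)
      fix z :: complex assume z: "norm z \<le> \<rho> / 2"
      have "norm (u l z - u m z) \<le> (e * (\<rho> / 2) ^ (2 * k)) / (\<rho> / 2) ^ (2 * k)"
      proof (rule power_factor_stable[OF u_hol[OF elim(2)] u_hol[OF gm] \<rho>(1) _ z])
        fix w :: complex assume w: "norm w < \<rho>"
        show "norm (w ^ (2 * k) * u l w - w ^ (2 * k) * u m w) \<le> e * (\<rho> / 2) ^ (2 * k)"
          unfolding u_fac[OF elim(2) w, symmetric] u_fac[OF gm w, symmetric] using elim(1) w by blast
      qed
      then show "norm (u l z - u m z) \<le> e" using \<rho> by simp
    qed
  qed
  define q0 where "q0 = - v m / real (2 * k)"
  define p :: complex where "p = 1 / of_nat (2 * k)"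
  define a where "a = q0 powr (1 / real (2 * k))"
  have q0: "0 < q0" using v_neg[OF gm] k by (simp add: q0_def divide_less_0_iff)
  have a: "0 < a" using q0 by (simp add: a_def)
  have pa: "of_real q0 powr p = of_real a"
    using powr_of_real[of q0 "1 / real (2 * k)"] q0 by (simp add: a_def p_def)
  have "isCont (\<lambda>q. q powr p) (of_real q0)"
    using q0 by (intro isCont_powr_complex continuous_ident continuous_const) (auto simp: complex_nonpos_Reals_iff)
  then obtain \<eta>0 where \<eta>0: "0 < \<eta>0" "\<And>q. dist q (of_real q0) < \<eta>0 \<Longrightarrow> dist (q powr p) (of_real q0 powr p) < a / 16"
    using a unfolding continuous_at_eps_delta by (metis divide_pos_pos zero_less_numeral)
  \<comment> \<open>The bound \<open>q0 / 2\<close> keeps \<open>u\<close> in the right half-plane,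
    and \<open>\<eta>0\<close> keeps its root within \<open>a / 16\<close> of
    \<open>a\<close>.\<close>
  define \<eta> where "\<eta> = min \<eta>0 (q0 / 2)"
  have \<eta>: "0 < \<eta>" "\<eta> \<le> q0 / 2" "\<eta> \<le> \<eta>0" using \<eta>0 q0 by (auto simp: \<eta>_def)
  have um_cont: "isCont (u m) 0"
    using holomorphic_on_imp_continuous_on[OF u_hol[OF gm]] \<rho> by (simp add: continuous_on_eq_continuous_at)
  obtain \<rho>1 where \<rho>1: "0 < \<rho>1" "\<And>z. norm z < \<rho>1 \<Longrightarrow> norm (u m z - of_real q0) < \<eta> / 2"
  proof -
    obtain d where "0 < d" "\<And>z. dist z 0 < d \<Longrightarrow> dist (u m z) (u m 0) < \<eta> / 2"
      using um_cont \<eta>(1) unfolding continuous_at_eps_delta by (metis half_gt_zero)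
    then show ?thesis using that u0[OF gm] by (auto simp: dist_norm q0_def)
  qed
  \<comment> \<open>On radius \<open>\<rho>1\<close> the function \<open>u m\<close> varies by less
    than \<open>\<eta> / 2\<close>; on radius \<open>\<rho> / 2\<close> the estimate
    \<open>u_conv\<close> accounts for the other half.\<close>
  define \<rho>2 where "\<rho>2 = min \<rho>1 (\<rho> / 2)"
  have \<rho>2: "0 < \<rho>2" "\<rho>2 \<le> \<rho> / 2" "\<rho>2 \<le> \<rho>" using \<rho>1 \<rho> by (auto simp: \<rho>2_def)
  have u_near: "\<forall>\<^sub>F l in ?N. good l \<and> (\<forall>z. norm z < \<rho>2 \<longrightarrow> norm (u l z - of_real q0) < \<eta>)"
    using u_conv[OF half_gt_zero[OF \<eta>(1)]] evg
  proof eventually_elim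
    case (elim l)
    have "norm (u l z - of_real q0) < \<eta>" if "norm z < \<rho>2" for z
    proof -
      have "norm (u l z - u m z) \<le> \<eta> / 2" "norm (u m z - of_real q0) < \<eta> / 2"
        using elim(1) \<rho>1(2) that \<rho>2 by (auto simp: \<rho>2_def)
      then show ?thesis using norm_triangle_ineq[of "u l z - u m z" "u m z - of_real q0"] by simp
    qed
    then show ?case using elim by blast
  qed
  have ez: "even_zero (u l) \<rho>2 a (2 * k)"
    if "good l" "\<forall>z. norm z < \<rho>2 \<longrightarrow> norm (u l z - of_real q0) < \<eta>" for l
  proof
    show "u l holomorphic_on ball 0 \<rho>2" by (rule holomorphic_on_subset[OF u_hol[OF that(1)]]) (use \<rho>2 in auto)
    show "0 < a" "0 < \<rho>2" "even (2 * k)" "0 < 2 * k" using a \<rho>2 k by auto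
    fix z :: complex assume z: "norm z < \<rho>2"
    then have dz: "norm (u l z - of_real q0) < \<eta>" using that(2) by blast
    show "0 < Re (u l z)" using dz abs_Re_le_cmod[of "u l z - of_real q0"] \<eta> q0 by simp
    have "dist (u l z powr p) (of_real q0 powr p) < a / 16" using dz \<eta> by (intro \<eta>0(2)) (simp add: dist_norm)
    then show "norm (u l z powr (1 / of_nat (2 * k)) - of_real a) \<le> a / 16"
      unfolding pa dist_norm unfolding p_def by (rule less_imp_le)
  next
    fix x :: real assume x: "\<bar>x\<bar> < \<rho>2"
    show "u l (of_real x) \<in> \<real>"
    \<comment> \<open>Away from 0, \<open>u\<close> is the quotient of the real numbers
      \<open>crossing\<close> and \<open>x ^ (2 * k)\<close>; at 0 it is the explicit leading
      coefficient.\<close>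
    proof (cases "x = 0")
      case True
      then show ?thesis using u0[OF that(1)] by simp
    next
      case False
      interpret l: picard_rhs "f l" b F K \<rho> by (rule pic[OF that(1)])
      have "crossing (f l) (of_real x) \<in> \<real>"
        by (rule l.crossing_real) (use fW[OF that(1)] x \<rho>2 in auto)
      moreover have "u l (of_real x) = crossing (f l) (of_real x) / (of_real x) ^ (2 * k)"
        using u_fac[OF that(1), of "of_real x"] x \<rho>2 False by simp
      ultimately show ?thesis by simp
    qed
  qed
  define \<phi> where "\<phi> l = chart_involution a (chart (2 * k) (u l))" for l
  define g where "g l \<xi> x = Re (picard (f l) (of_real x) (crossing (f l) (of_real \<xi>)))" for l \<xi> x
  have um: "good m \<and> (\<forall>z. norm z < \<rho>2 \<longrightarrow> norm (u m z - of_real q0) < \<eta>)" by (rule near_self[OF u_near m])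
  show thesis
  proof (rule that)
    show "0 < \<rho>2 / 16" using \<rho>2 by simp
    show "\<forall>\<^sub>F l in ?N. sgn (X0 (W l)) = sgn (X0 (W m)) \<and>
       half_system (W l) (sgn (X0 (W m))) b (\<rho>2 / 2) (\<rho>2 / 16) (4 * F) (g l) (\<lambda>x. Re (\<phi> l (of_real x))) \<and>
       \<phi> l holomorphic_on ball 0 (\<rho>2 / 16) \<and> (\<forall>z. norm z < \<rho>2 / 16 \<longrightarrow> norm (\<phi> l z) \<le> 2 * norm z) \<and>
       (\<forall>x. \<bar>x\<bar> < \<rho>2 / 16 \<longrightarrow> \<phi> l (of_real x) \<in> \<real>)"
      using u_near
    proof eventually_elim
      case (elim l)
      then have gl: "good l" and ul: "\<forall>z. norm z < \<rho>2 \<longrightarrow> norm (u l z - of_real q0) < \<eta>" by auto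
      interpret z: even_zero "u l" \<rho>2 a "2 * k" by (rule ez[OF gl ul])
      have "half_system (W l) s b (\<rho>2 / 2) (\<rho>2 / 16) (4 * F) (\<lambda>\<xi> x. Re (picard (f l) (of_real x) (crossing (f l) (of_real \<xi>))))
         (\<lambda>x. Re (chart_involution a (chart (2 * k) (u l)) (of_real x)))"
        by (rule half_system_intro[OF pic[OF gl] ez[OF gl ul] \<rho>2(3) u_fac[OF gl] fW[OF gl] s c X_pos[OF gl] W_cont[OF gl]])
          (use \<rho>2 b in auto)
      then show ?case
        using X0l(3)[OF gl] z.\<phi>_holomorphic z.\<phi>_le_2 z.\<phi>_real
        by (simp add: \<phi>_def g_def[abs_def] s_def xm_def)
    qed
    \<comment> \<open>Convergence passes from \<open>u\<close> to its root by uniform continuity on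
      a compact disc in the right half-plane, from there to the chart, and to the involution by
      \<open>fixp_stable\<close>.\<close>
    show "uniform_limit (ball 0 (\<rho>2 / 16)) \<phi> (\<phi> m) ?N"
    proof (rule uniform_limitI)
      fix e :: real assume e: "0 < e"
      have "uniform_limit (ball 0 \<rho>2) (\<lambda>l z. u l z) (u m) ?N"
      proof (rule uniform_limitI)
        fix e :: real assume "0 < e"
        then have "\<forall>\<^sub>F l in ?N. \<forall>z. norm z \<le> \<rho> / 2 \<longrightarrow> norm (u l z - u m z) \<le> e / 2" by (intro u_conv) simp
        then show "\<forall>\<^sub>F l in ?N. \<forall>z\<in>ball 0 \<rho>2. dist (u l z) (u m z) < e"
        proof eventually_elim
          case (elim l)
          show ?case
          proof
            fix z :: complex assume "z \<in> ball 0 \<rho>2"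
            then have "norm (u l z - u m z) \<le> e / 2" using elim \<rho>2 by auto
            then show "dist (u l z) (u m z) < e" using \<open>0 < e\<close> by (simp add: dist_norm)
          qed
        qed
      qed
      moreover have "uniformly_continuous_on (cball (of_real q0) \<eta>) (\<lambda>q. q powr p)"
      proof (rule compact_uniformly_continuous)
        have "Re q > 0" if "q \<in> cball (of_real q0) \<eta>" for q
          using that abs_Re_le_cmod[of "q - of_real q0"] \<eta> q0 by (simp add: dist_norm norm_minus_commute)
        then show "continuous_on (cball (of_real q0) \<eta>) (\<lambda>q. q powr p)"
          by (intro continuous_on_powr_complex continuous_on_id continuous_on_const)
            (fastforce simp: complex_nonpos_Reals_iff)+
      qed simp
      moreover have "\<forall>\<^sub>F l in ?N. \<forall>z\<in>ball 0 \<rho>2. u l z \<in> cball (of_real q0) \<eta>"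
        using u_near by eventually_elim (auto simp: dist_norm norm_minus_commute intro: less_imp_le)
      ultimately have "uniform_limit (ball 0 \<rho>2) (\<lambda>l z. u l z powr p) (\<lambda>z. u m z powr p) ?N"
        by (rule uniform_limit_compose_uniformly_continuous_on) simp
      then have "\<forall>\<^sub>F l in ?N. \<forall>z\<in>ball 0 \<rho>2. dist (u l z powr p) (u m z powr p) < e * a / (8 * \<rho>2)"
        by (rule uniform_limitD) (use e a \<rho>2 in simp)
      with u_near show "\<forall>\<^sub>F l in ?N. \<forall>z\<in>ball 0 (\<rho>2 / 16). dist (\<phi> l z) (\<phi> m z) < e"
      proof eventually_elim
        case (elim l)
        then have gl: "good l" and ul: "\<forall>z. norm z < \<rho>2 \<longrightarrow> norm (u l z - of_real q0) < \<eta>" by auto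
        interpret l: even_zero "u l" \<rho>2 a "2 * k" by (rule ez[OF gl ul])
        interpret m: even_zero "u m" \<rho>2 a "2 * k" by (rule ez) (use um in auto)
        have wd: "norm (l.w z - m.w z) \<le> e * a / 8" if "norm z < \<rho>2" for z
        proof -
          have "l.w z - m.w z = z * (u l z powr p - u m z powr p)" by (simp add: chart_def p_def algebra_simps)
          then have "norm (l.w z - m.w z) = norm z * norm (u l z powr p - u m z powr p)" by (simp add: norm_mult)
          also have "\<dots> \<le> \<rho>2 * (e * a / (8 * \<rho>2))"
            using elim(2) that \<rho>2 by (intro mult_mono) (auto simp: dist_norm intro: less_imp_le)
          finally show ?thesis using \<rho>2 by simp
        qed
        show ?case
        proof
          fix z :: complex assume "z \<in> ball 0 (\<rho>2 / 16)"
          then have z: "norm z < \<rho>2 / 16" by simp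
          have "norm (\<phi> l z - \<phi> m z) \<le> 2 * (e / 4)"
            unfolding \<phi>_def chart_involution_def
          proof (rule fixp_stable[OF l.inv.contraction_family_axioms m.inv.contraction_family_axioms _ z])
            fix q :: complex assume q: "norm q \<le> \<rho>2 / 4"
            have "q - (l.w q + l.w z) / of_real a - (q - (m.w q + m.w z) / of_real a)
              = - (((l.w q - m.w q) + (l.w z - m.w z)) / of_real a)"
              using a by (simp add: field_simps)
            then have "norm (q - (l.w q + l.w z) / of_real a - (q - (m.w q + m.w z) / of_real a))
              = norm ((l.w q - m.w q) + (l.w z - m.w z)) / a" using a by (simp add: norm_divide)
            also have "\<dots> \<le> (e * a / 8 + e * a / 8) / a"
              using a q z \<rho>2 by (intro divide_right_mono norm_triangle_le add_mono wd) auto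
            also have "\<dots> = e / 4" using a by (simp add: field_simps)
            finally show "norm (q - (l.w q + l.w z) / of_real a - (q - (m.w q + m.w z) / of_real a)) \<le> e / 4" .
          qed
          then show "dist (\<phi> l z) (\<phi> m z) < e" using e by (simp add: dist_norm)
        qed
      qed
    qed
  qed
qed

text \<open>Induction along the time axis: at the infimum of the bad times the curve is still in the
  closed set, and \<open>step\<close> carries it further. A solution can thus be confined by purely
  local arguments.\<close>

lemma closed_continuation:
  fixes \<gamma> :: "real \<Rightarrow> 'a::topological_space"
  assumes cont: "continuous_on {a..c} \<gamma>" and K: "closed K" and a: "\<gamma> a \<in> K"
    and step: "\<And>t. a \<le> t \<Longrightarrow> t < c \<Longrightarrow> \<gamma> t \<in> K \<Longrightarrow> \<exists>d>0. \<forall>s. t < s \<longrightarrow> s < t + d \<longrightarrow> s \<le> c \<longrightarrow> \<gamma> s \<in> K"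
    and t: "t \<in> {a..c}"
  shows "\<gamma> t \<in> K"
proof (rule ccontr)
  assume nt: "\<gamma> t \<notin> K"
  define S where "S = {s \<in> {a..c}. \<gamma> s \<notin> K}"
  have S: "t \<in> S" "S \<noteq> {}" "bdd_below S" using t nt by (auto simp: S_def intro: bdd_belowI[of _ a])
  define u where "u = Inf S"
  have au: "a \<le> u" "u \<le> t"
    using S cInf_lower[OF S(1) S(3)] by (auto simp: u_def S_def intro: cInf_greatest)
  have below: "\<gamma> s \<in> K" if "a \<le> s" "s < u" for s
    using that au t cInf_lower[of s S] S by (force simp: u_def S_def)
  have u: "\<gamma> u \<in> K"
  proof (cases "u = a")
    case False
    have "closed ({a..c} \<inter> \<gamma> -` K)"
      by (rule continuous_closed_preimage[OF cont _ K]) simp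
    moreover have "{a..<u} \<subseteq> {a..c} \<inter> \<gamma> -` K" using below au t by auto
    ultimately have "closure {a..<u} \<subseteq> {a..c} \<inter> \<gamma> -` K" by (rule closure_minimal[rotated])
    moreover have "closure {a..<u} = {a..u}" using False au by (simp add: closure_atLeastLessThan)
    ultimately show ?thesis using au by auto
  qed (use a in simp)
  show False
  proof (cases "u = c")
    case True
    then have "S \<subseteq> {c}" using cInf_lower[OF _ S(3)] by (force simp: u_def S_def)
    then show False using S u True by (auto simp: S_def)
  next
    case False
    then have uc: "u < c" using au t by auto
    from step[OF au(1) uc u] obtain d where d: "d > 0" "\<And>s. u < s \<Longrightarrow> s < u + d \<Longrightarrow> s \<le> c \<Longrightarrow> \<gamma> s \<in> K" by blast
    have "u + d \<le> s" if "s \<in> S" for s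
    proof (rule ccontr)
      assume "\<not> u + d \<le> s"
      moreover have "u \<le> s" using that S(3) unfolding u_def by (rule cInf_lower)
      ultimately show False using d(2)[of s] u that by (cases "s = u") (auto simp: S_def)
    qed
    then have "u + d \<le> u" unfolding u_def using S(2) by (intro cInf_greatest) auto
    then show False using d(1) by simp
  qed
qed

text \<open>Gronwall's argument: \<open>(z t)\<^sup>2 * exp (- 2 * K * t)\<close> is non-increasing
  and starts at 0.\<close>

lemma linear_comparison_zero:
  fixes z :: "real \<Rightarrow> real"
  assumes cont: "continuous_on {a..c} z" and d: "\<And>t. a < t \<Longrightarrow> t < c \<Longrightarrow> (z has_real_derivative z' t) (at t)"
    and le: "\<And>t. a < t \<Longrightarrow> t < c \<Longrightarrow> \<bar>z' t\<bar> \<le> K * \<bar>z t\<bar>" and a: "z a = 0" and t: "t \<in> {a..c}"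
  shows "z t = 0"
proof -
  let ?q = "\<lambda>t. (z t)\<^sup>2 * exp (- 2 * K * t)"
  have "?q t \<le> ?q a"
  proof (rule DERIV_nonpos_imp_decreasing_open[where f = ?q])
    show "a \<le> t" using t by simp
    show "continuous_on {a..t} ?q" using cont t by (intro continuous_intros) (auto elim: continuous_on_subset)
    fix x assume x: "a < x" "x < t"
    have D: "(?q has_real_derivative (2 * z x * z' x * exp (- 2 * K * x) + (z x)\<^sup>2 * (exp (- 2 * K * x) * (- 2 * K)))) (at x)"
      using d[of x] x t by (auto intro!: derivative_eq_intros)
    have eq: "2 * z x * z' x * exp (- 2 * K * x) + (z x)\<^sup>2 * (exp (- 2 * K * x) * (- 2 * K))
       = 2 * exp (- 2 * K * x) * (z x * z' x - K * (z x)\<^sup>2)" by (simp add: algebra_simps)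
    have "z x * z' x \<le> K * (z x)\<^sup>2"
    proof -
      have "z x * z' x \<le> \<bar>z x\<bar> * \<bar>z' x\<bar>" by (metis abs_ge_self abs_mult)
      also have "\<dots> \<le> \<bar>z x\<bar> * (K * \<bar>z x\<bar>)" using le[of x] x t by (intro mult_left_mono) auto
      finally show ?thesis by (simp add: power2_eq_square algebra_simps)
    qed
    then have "2 * exp (- 2 * K * x) * (z x * z' x - K * (z x)\<^sup>2) \<le> 0"
      by (intro mult_nonneg_nonpos) auto
    then show "\<exists>y. (?q has_real_derivative y) (at x) \<and> y \<le> 0" using D unfolding eq by blast
  qed
  then have "(z t)\<^sup>2 * exp (- 2 * K * t) \<le> 0" using a by simp
  then show ?thesis by (simp add: mult_le_0_iff not_le)
qed

text \<open>Separation of variables: differences of \<open>q\<close> are travel times, and the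
  solution is the inverse of \<open>q\<close> up to a shift. The margins \<open>c < s0\<close> and
  \<open>s1 < d\<close> give two-sided derivatives at both ends.\<close>

lemma scalar_autonomous_solution:
  fixes p :: "real \<Rightarrow> real"
  assumes p: "continuous_on {-B<..<B} p" "\<And>s. \<bar>s\<bar> < B \<Longrightarrow> 0 < p s" and s: "-B < s0" "s0 < s1" "s1 < B"
  obtains T y where "0 < T" "y 0 = s0" "y T = s1"
    "\<And>t. t \<in> {0..T} \<Longrightarrow> (y has_real_derivative p (y t)) (at t)"
    "\<And>t. 0 < t \<Longrightarrow> t < T \<Longrightarrow> s0 < y t \<and> y t < s1"
proof -
  define c where "c = (s0 - B) / 2"
  define d where "d = (s1 + B) / 2"
  have cd: "-B < c" "c < s0" "s1 < d" "d < B" using s by (auto simp: c_def d_def)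
  define q where "q s = integral {c..s} (\<lambda>s. 1 / p s)" for s
  have cont: "continuous_on {c..d} (\<lambda>s. 1 / p s)"
    using cd p(2) by (intro continuous_intros continuous_on_subset[OF p(1)]) (force simp: less_imp_neq[symmetric])+
  have q': "(q has_real_derivative 1 / p s) (at s)" if "c < s" "s < d" for s
  proof -
    have "(q has_real_derivative 1 / p s) (at s within {c..d})"
      unfolding q_def by (rule integral_has_real_derivative[OF cont]) (use that in auto)
    moreover have "at s within {c..d} = at s" using that by (intro at_within_interior) simp
    ultimately show ?thesis by simp
  qed
  have mono: "q x < q y" if "c < x" "x < y" "y < d" for x y
  proof (rule DERIV_pos_imp_increasing[OF that(2)])
    fix z assume "x \<le> z" "z \<le> y"
    then show "\<exists>y. (q has_real_derivative y) (at z) \<and> 0 < y"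
      using that cd p(2)[of z] by (intro exI[of _ "1 / p z"] conjI q') auto
  qed
  have inj: "inj_on q {c<..<d}"
    by (rule linorder_inj_onI) (use mono in \<open>force simp: less_imp_neq\<close>)+
  define g where "g = the_inv_into {c<..<d} q"
  have gq: "g (q s) = s" if "c < s" "s < d" for s
    unfolding g_def by (rule the_inv_into_f_f[OF inj]) (use that in auto)
  have qc: "continuous_on {c<..<d} q"
    using q' DERIV_isCont by (fastforce simp: continuous_on_eq_continuous_at)
  have g': "(g has_real_derivative p s) (at (q s))" if "c < s" "s < d" for s
  proof -
    have "(g has_real_derivative inverse (1 / p s)) (at (q s))"
      by (rule has_field_derivative_inverse_strong[OF q'[OF that], of "{c<..<d}"])
        (use that p(2)[of s] cd qc gq in \<open>auto simp: abs_less_iff\<close>)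
    then show ?thesis by simp
  qed
  define y where "y t = g (t + q s0)" for t
  have onto: "\<exists>s. s0 \<le> s \<and> s \<le> s1 \<and> q s = t + q s0" if "0 \<le> t" "t \<le> q s1 - q s0" for t
  proof -
    have "continuous_on {s0..s1} q" by (rule continuous_on_subset[OF qc]) (use cd in auto)
    then show ?thesis using IVT'[of q s0 "t + q s0" s1] that s by auto
  qed
  show thesis
  proof (rule that[of "q s1 - q s0" y])
    show "0 < q s1 - q s0" using mono[of s0 s1] s cd by simp
    show "y 0 = s0" "y (q s1 - q s0) = s1" using gq[of s0] gq[of s1] s cd by (auto simp: y_def)
    fix t
    show "(y has_real_derivative p (y t)) (at t)" if "t \<in> {0..q s1 - q s0}"
    proof -
      from onto[of t] that obtain s where s': "s0 \<le> s" "s \<le> s1" "q s = t + q s0" by auto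
      then have "y t = s" using gq[of s] s cd by (simp add: y_def)
      moreover have "(g has_real_derivative p s) (at (t + q s0))" using g'[of s] s' s cd by simp
      then have "(y has_real_derivative p s) (at t)"
        unfolding y_def[abs_def] by (simp add: DERIV_shift)
      ultimately show ?thesis by simp
    qed
    show "s0 < y t \<and> y t < s1" if t: "0 < t" "t < q s1 - q s0"
    proof -
      from onto[of t] t obtain s where s': "s0 \<le> s" "s \<le> s1" "q s = t + q s0" by auto
      moreover have "y t = s" using gq[of s] s' s cd by (simp add: y_def)
      moreover have "s \<noteq> s0" "s \<noteq> s1" using s' t by auto
      ultimately show ?thesis by auto
    qed
  qed
qed

text \<open>Reversal of time keeps the orbits as sets: slope, graphs and half-return map are
  unchanged, and only the direction of motion flips.\<close>

lemma half_system_uminus: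
  assumes "half_system W \<sigma> b b0 r C g \<phi>"
  shows "half_system (\<lambda>p. - W p) (- \<sigma>) b b0 r C g \<phi>"
proof -
  interpret half_system W \<sigma> b b0 r C g \<phi> by fact
  show ?thesis
  proof
    show "- \<sigma> = 1 \<or> - \<sigma> = -1" using sg by auto
    show "continuous_on {p. \<bar>fst p\<bar> < b \<and> \<bar>snd p\<bar> < b} (\<lambda>p. - W p)" by (rule continuous_on_minus[OF W_cont])
    show "\<exists>c>0. \<forall>x y. \<bar>x\<bar> < b \<longrightarrow> \<bar>y\<bar> < b \<longrightarrow> c \<le> - \<sigma> * fst (- W (x, y))" using X_pos by simp
    show "\<exists>K. \<forall>x y y'. \<bar>x\<bar> < b \<longrightarrow> \<bar>y\<bar> < b \<longrightarrow> \<bar>y'\<bar> < b \<longrightarrow>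
      \<bar>snd (- W (x, y)) / fst (- W (x, y)) - snd (- W (x, y')) / fst (- W (x, y'))\<bar> \<le> K * \<bar>y - y'\<bar>"
      using slope_lip by simp
    show "- \<sigma> * x * snd (- W (x, 0)) < 0" if "0 < \<bar>x\<bar>" "\<bar>x\<bar> < b0" for x using Y_sign[OF that] by simp
    show "(g \<xi> has_real_derivative snd (- W (x, g \<xi> x)) / fst (- W (x, g \<xi> x))) (at x)"
      if "0 < \<xi>" "\<xi> < r" "\<bar>x\<bar> < b0" for \<xi> x using g_deriv[OF that] by simp
  qed (fact r C g_box g_cont g_pos g_zero g_mono g_small \<phi>_bound \<phi>_inv)+
qed

section \<open>Orbit arcs and the solutions that run along them\<close>

context half_system
begin

definition "oarc \<xi> = {(x, g \<xi> x) |x. \<phi> \<xi> \<le> x \<and> x \<le> \<xi>}"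

text \<open>The abscissa moves in the direction \<sigma>, so for \<open>\<sigma> = 1\<close> an arc
  is entered at its left end.\<close>

definition "entry \<xi> = (if \<sigma> = 1 then \<phi> \<xi> else \<xi>)"
definition "exit \<xi> = (if \<sigma> = 1 then \<xi> else \<phi> \<xi>)"

lemma \<phi>_neg: "0 < \<xi> \<Longrightarrow> \<xi> < r \<Longrightarrow> \<phi> \<xi> < 0 \<and> - 2 * \<xi> \<le> \<phi> \<xi>"
  using \<phi>_bound[of \<xi>] by (auto simp: mult_less_0_iff)

lemma \<phi>_pos: "x < 0 \<Longrightarrow> - r < x \<Longrightarrow> 0 < \<phi> x \<and> \<phi> x \<le> - 2 * x"
  using \<phi>_bound[of x] by (auto simp: mult_less_0_iff)

lemma arc_range:
  assumes "0 < \<xi>" "\<xi> < r" "p \<in> oarc \<xi>"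
  shows "\<bar>fst p\<bar> \<le> 2 * \<xi>" "\<bar>fst p\<bar> < b0" "0 \<le> snd p" "snd p < b" "snd p \<le> C * \<xi>" "snd p = g \<xi> (fst p)"
    "snd p = 0 \<longleftrightarrow> fst p = \<phi> \<xi> \<or> fst p = \<xi>"
proof -
  obtain x where x: "p = (x, g \<xi> x)" "\<phi> \<xi> \<le> x" "x \<le> \<xi>" using assms by (auto simp: oarc_def)
  then have 1: "\<bar>x\<bar> \<le> 2 * \<xi>" using \<phi>_neg[OF assms(1,2)] assms by auto
  then have 2: "\<bar>x\<bar> < b0" using assms r by linarith
  show "\<bar>fst p\<bar> \<le> 2 * \<xi>" "\<bar>fst p\<bar> < b0" "snd p = g \<xi> (fst p)" using 1 2 x by auto
  show "snd p = 0 \<longleftrightarrow> fst p = \<phi> \<xi> \<or> fst p = \<xi>" using g_zero[OF assms(1,2) 2] x by simp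
  show "0 \<le> snd p" using g_pos[OF assms(1,2) 2] g_zero[OF assms(1,2) 2] x by auto
  show "snd p < b" using g_box[OF assms(1,2) 2] x by auto
  show "snd p \<le> C * \<xi>" using g_small[OF assms(1,2) 1] x by auto
qed

lemma arcI:
  assumes "0 < \<xi>" "\<xi> < r" "\<bar>fst p\<bar> < b0" "snd p = g \<xi> (fst p)" "0 \<le> snd p"
  shows "p \<in> oarc \<xi>"
proof -
  have "0 < g \<xi> (fst p) \<or> g \<xi> (fst p) = 0" using assms(4,5) by linarith
  then have "\<phi> \<xi> \<le> fst p \<and> fst p \<le> \<xi>"
    unfolding g_pos[OF assms(1-3)] g_zero[OF assms(1-3)] using \<phi>_neg[OF assms(1,2)] assms(1) by linarith
  then show ?thesis using assms(4) by (cases p) (auto simp: oarc_def)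
qed

lemma arc_ends:
  assumes "0 < \<xi>" "\<xi> < r" shows "(\<phi> \<xi>, 0) \<in> oarc \<xi>" "(\<xi>, 0) \<in> oarc \<xi>"
  using \<phi>_neg[OF assms] assms r g_zero[OF assms, of "\<phi> \<xi>"] g_zero[OF assms, of \<xi>] by (auto simp: oarc_def)

lemma arc_unique:
  assumes "0 < \<xi>" "\<xi> < r" "0 < \<xi>'" "\<xi>' < r" "p \<in> oarc \<xi>" "p \<in> oarc \<xi>'" shows "\<xi> = \<xi>'"
proof -
  have "\<bar>fst p\<bar> < b0" "g \<xi> (fst p) = g \<xi>' (fst p)"
    using arc_range[OF assms(1,2,5)] arc_range[OF assms(3,4,6)] by auto
  then show ?thesis using g_mono[of \<xi> \<xi>' "fst p"] g_mono[of \<xi>' \<xi> "fst p"] assms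
    by (cases \<xi> \<xi>' rule: linorder_cases) auto
qed

lemma g_isCont: "0 < \<xi> \<Longrightarrow> \<xi> < r \<Longrightarrow> \<bar>x\<bar> < b0 \<Longrightarrow> isCont (g \<xi>) x"
  using g_deriv DERIV_isCont by blast

lemma g_continuous: "0 < \<xi> \<Longrightarrow> \<xi> < r \<Longrightarrow> continuous_on {-b0<..<b0} (g \<xi>)"
  by (intro continuous_at_imp_continuous_on ballI g_isCont) (auto simp: abs_less_iff)

text \<open>In the \<open>(\<xi>, x)\<close> plane the union corresponds to the closed part
  \<open>g \<ge> 0\<close> of a compact rectangle.\<close>

lemma arcs_compact:
  assumes "0 < \<alpha>" "\<beta> < r"
  shows "compact (\<Union>\<xi>\<in>{\<alpha>..\<beta>}. oarc \<xi>)"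
proof -
  let ?D = "{\<alpha>..\<beta>} \<times> {-2 * \<beta>..2 * \<beta>}"
  have sub: "?D \<subseteq> {0<..<r} \<times> {-b0<..<b0}" using assms r by auto
  have cont: "continuous_on ?D (\<lambda>p. g (fst p) (snd p))"
    using continuous_on_subset[OF g_cont sub] by (simp add: case_prod_unfold)
  let ?E = "?D \<inter> (\<lambda>p. g (fst p) (snd p)) -` {0..}"
  have "closed ?E" by (rule continuous_closed_preimage[OF cont]) (auto intro: closed_Times)
  moreover have "compact ?D" by (intro compact_Times) auto
  ultimately have "compact (?D \<inter> ?E)" by (rule compact_Int_closed[rotated])
  then have "compact ?E" by (simp add: Int_absorb1)
  then have "compact ((\<lambda>p. (snd p, g (fst p) (snd p))) ` ?E)"
    by (rule compact_continuous_image[rotated])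
      (intro continuous_on_Pair continuous_on_snd continuous_on_id continuous_on_subset[OF cont], auto)
  also have "(\<lambda>p. (snd p, g (fst p) (snd p))) ` ?E = (\<Union>\<xi>\<in>{\<alpha>..\<beta>}. oarc \<xi>)"
  proof (intro equalityI subsetI)
    fix q assume "q \<in> (\<lambda>p. (snd p, g (fst p) (snd p))) ` ?E"
    then obtain \<xi> x where *: "q = (x, g \<xi> x)" "\<xi> \<in> {\<alpha>..\<beta>}" "x \<in> {-2 * \<beta>..2 * \<beta>}" "0 \<le> g \<xi> x" by auto
    then have "q \<in> oarc \<xi>" using assms r by (intro arcI) auto
    then show "q \<in> (\<Union>\<xi>\<in>{\<alpha>..\<beta>}. oarc \<xi>)" using * by blast
  next
    fix q assume "q \<in> (\<Union>\<xi>\<in>{\<alpha>..\<beta>}. oarc \<xi>)"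
    then obtain \<xi> where *: "\<xi> \<in> {\<alpha>..\<beta>}" "q \<in> oarc \<xi>" by blast
    then have \<xi>: "0 < \<xi>" "\<xi> < r" using assms by auto
    note ar = arc_range[OF \<xi> *(2)]
    have "(\<xi>, fst q) \<in> ?E" using * ar by auto
    moreover have "q = (\<lambda>p. (snd p, g (fst p) (snd p))) (\<xi>, fst q)" using ar by (cases q) auto
    ultimately show "q \<in> (\<lambda>p. (snd p, g (fst p) (snd p))) ` ?E" by blast
  qed
  finally show ?thesis .
qed

lemma arc_compact: "0 < \<xi> \<Longrightarrow> \<xi> < r \<Longrightarrow> compact (oarc \<xi>)"
  using arcs_compact[of \<xi> \<xi>] by simp

text \<open>Uniqueness of orbits: along the curve, \<open>y - g \<xi> x\<close> satisfies a linear
  differential inequality and starts at 0. The derivative is asked for at interior times inside the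
  box, so the curve may begin and end on \<Sigma>, where a Filippov solution can have a corner;
  \<open>closed_continuation\<close> keeps it in the box.\<close>

lemma phase:
  fixes \<gamma> :: "real \<Rightarrow> real \<times> real"
  assumes \<xi>: "0 < \<xi>" "\<xi> < r" and cont: "continuous_on {a..c} \<gamma>"
    and d: "\<And>t. a < t \<Longrightarrow> t < c \<Longrightarrow> \<bar>fst (\<gamma> t)\<bar> < b0 \<Longrightarrow> snd (\<gamma> t) < b \<Longrightarrow> (\<gamma> has_vector_derivative W (\<gamma> t)) (at t)"
    and pos: "\<And>t. a < t \<Longrightarrow> t < c \<Longrightarrow> 0 < snd (\<gamma> t)" "0 \<le> snd (\<gamma> c)"
    and a: "\<gamma> a \<in> oarc \<xi>" and t: "t \<in> {a..c}"
  shows "\<gamma> t \<in> oarc \<xi>"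
proof (rule closed_continuation[OF cont compact_imp_closed[OF arc_compact[OF \<xi>]] a _ t])
  fix t assume t: "a \<le> t" "t < c" "\<gamma> t \<in> oarc \<xi>"
  let ?B = "{p :: real \<times> real. \<bar>fst p\<bar> < b0 \<and> \<bar>snd p\<bar> < b}"
  have "open ?B" by (intro open_Collect_conj open_Collect_less continuous_intros)
  moreover have "\<gamma> t \<in> ?B" using arc_range[OF \<xi> t(3)] by auto
  ultimately obtain e where e: "e > 0" "ball (\<gamma> t) e \<subseteq> ?B" by (meson open_contains_ball)
  obtain \<delta> where \<delta>: "\<delta> > 0" "\<And>s. s \<in> {a..c} \<Longrightarrow> dist s t < \<delta> \<Longrightarrow> dist (\<gamma> s) (\<gamma> t) < e"
    using cont e(1) t unfolding continuous_on_iff by (metis atLeastAtMost_iff less_imp_le)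
  have box: "\<bar>fst (\<gamma> s)\<bar> < b0" "\<bar>snd (\<gamma> s)\<bar> < b" "\<bar>fst (\<gamma> s)\<bar> < b" if "t \<le> s" "s < t + \<delta>" "s \<le> c" for s
  proof -
    have "\<gamma> s \<in> ball (\<gamma> t) e" using \<delta>(2)[of s] that t by (auto simp: dist_real_def dist_commute)
    then have "\<gamma> s \<in> ?B" using e(2) by blast
    then show "\<bar>fst (\<gamma> s)\<bar> < b0" "\<bar>snd (\<gamma> s)\<bar> < b" "\<bar>fst (\<gamma> s)\<bar> < b" using r by auto
  qed
  have "\<gamma> s \<in> oarc \<xi>" if s: "t < s" "s < t + \<delta>" "s \<le> c" for s
  proof -
    define z where "z \<tau> = snd (\<gamma> \<tau>) - g \<xi> (fst (\<gamma> \<tau>))" for \<tau>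
    have bs: "\<bar>fst (\<gamma> \<tau>)\<bar> < b0" "\<bar>snd (\<gamma> \<tau>)\<bar> < b" "\<bar>fst (\<gamma> \<tau>)\<bar> < b" if "\<tau> \<in> {t..s}" for \<tau>
      using box[of \<tau>] that s by auto
    have cs: "continuous_on {t..s} \<gamma>" using cont by (rule continuous_on_subset) (use s t in auto)
    have "continuous_on {t..s} (\<lambda>\<tau>. W (\<gamma> \<tau>))"
      by (rule continuous_on_compose2[OF W_cont cs]) (use bs in auto)
    then have "compact ((\<lambda>\<tau>. fst (W (\<gamma> \<tau>))) ` {t..s})"
      by (intro compact_continuous_image continuous_on_fst) auto
    then obtain M where M: "\<And>\<tau>. \<tau> \<in> {t..s} \<Longrightarrow> \<bar>fst (W (\<gamma> \<tau>))\<bar> \<le> M"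
      by (metis (no_types, lifting) bounded_iff compact_imp_bounded image_eqI real_norm_def)
    obtain K where K: "\<And>x y y'. \<bar>x\<bar> < b \<Longrightarrow> \<bar>y\<bar> < b \<Longrightarrow> \<bar>y'\<bar> < b \<Longrightarrow>
      \<bar>snd (W (x, y)) / fst (W (x, y)) - snd (W (x, y')) / fst (W (x, y'))\<bar> \<le> K * \<bar>y - y'\<bar>"
      using slope_lip by blast
    have "z s = 0"
    proof (rule linear_comparison_zero[where a = t and c = s and z = z])
      have bi: "fst (\<gamma> \<tau>) \<in> {-b0<..<b0}" if "\<tau> \<in> {t..s}" for \<tau>
        using bs(1)[OF that] by (auto simp: abs_if split: if_splits)
      have "continuous_on {t..s} (\<lambda>\<tau>. g \<xi> (fst (\<gamma> \<tau>)))"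
        by (rule continuous_on_compose2[OF g_continuous[OF \<xi>] continuous_on_fst[OF cs]])
          (use bi in blast)
      then show "continuous_on {t..s} z" unfolding z_def by (intro continuous_intros cs)
      fix \<tau> assume \<tau>: "t < \<tau>" "\<tau> < s"
      let ?x = "fst (\<gamma> \<tau>)" and ?y = "snd (\<gamma> \<tau>)"
      let ?f = "\<lambda>y. snd (W (?x, y)) / fst (W (?x, y))"
      have b\<tau>: "\<bar>?x\<bar> < b0" "\<bar>?y\<bar> < b" "\<bar>?x\<bar> < b" using bs[of \<tau>] \<tau> by auto
      have dv: "(\<gamma> has_vector_derivative W (\<gamma> \<tau>)) (at \<tau>)" using d[of \<tau>] b\<tau> \<tau> t s by auto
      have dx: "((\<lambda>\<tau>. fst (\<gamma> \<tau>)) has_real_derivative fst (W (\<gamma> \<tau>))) (at \<tau>)"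
        using bounded_linear.has_vector_derivative[OF bounded_linear_fst dv] by (simp add: has_real_derivative_iff_has_vector_derivative)
      have dy: "((\<lambda>\<tau>. snd (\<gamma> \<tau>)) has_real_derivative snd (W (\<gamma> \<tau>))) (at \<tau>)"
        using bounded_linear.has_vector_derivative[OF bounded_linear_snd dv] by (simp add: has_real_derivative_iff_has_vector_derivative)
      show "(z has_real_derivative (snd (W (\<gamma> \<tau>)) - ?f (g \<xi> ?x) * fst (W (\<gamma> \<tau>)))) (at \<tau>)"
        unfolding z_def by (intro DERIV_diff dy DERIV_chain2[OF g_deriv[OF \<xi> b\<tau>(1)] dx])
      obtain c where "c > 0" "c \<le> \<sigma> * fst (W (?x, ?y))" using X_pos b\<tau> by blast
      then have eqf: "snd (W (\<gamma> \<tau>)) = ?f ?y * fst (W (\<gamma> \<tau>))" by auto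
      have alg: "S = q * F \<Longrightarrow> \<bar>S - A * F\<bar> = \<bar>F\<bar> * \<bar>q - A\<bar>" for S q F A :: real
        by (metis abs_mult left_diff_distrib mult.commute)
      have "\<bar>snd (W (\<gamma> \<tau>)) - ?f (g \<xi> ?x) * fst (W (\<gamma> \<tau>))\<bar> = \<bar>fst (W (\<gamma> \<tau>))\<bar> * \<bar>?f ?y - ?f (g \<xi> ?x)\<bar>"
        by (rule alg[OF eqf])
      also have "\<dots> \<le> M * (\<bar>K\<bar> * \<bar>?y - g \<xi> ?x\<bar>)"
      proof (rule mult_mono)
        show M1: "\<bar>fst (W (\<gamma> \<tau>))\<bar> \<le> M" using M \<tau> by auto
        show "\<bar>?f ?y - ?f (g \<xi> ?x)\<bar> \<le> \<bar>K\<bar> * \<bar>?y - g \<xi> ?x\<bar>"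
          using K[OF b\<tau>(3,2) g_box[OF \<xi> b\<tau>(1)]] by (rule order_trans) (intro mult_right_mono, auto)
        show "0 \<le> M" using M1 by linarith
      qed simp
      finally show "\<bar>snd (W (\<gamma> \<tau>)) - ?f (g \<xi> ?x) * fst (W (\<gamma> \<tau>))\<bar> \<le> (M * \<bar>K\<bar>) * \<bar>z \<tau>\<bar>"
        by (simp add: z_def)
    next
      show "z t = 0" using arc_range(6)[OF \<xi> t(3)] by (simp add: z_def)
    qed (use s in auto)
    moreover have "0 \<le> snd (\<gamma> s)" using pos(1)[of s] pos(2) s t by (cases "s = c") auto
    ultimately show ?thesis using bs[of s] s by (intro arcI[OF \<xi>]) (auto simp: z_def)
  qed
  then show "\<exists>d>0. \<forall>s. t < s \<longrightarrow> s < t + d \<longrightarrow> s \<le> c \<longrightarrow> \<gamma> s \<in> oarc \<xi>" using \<delta>(1) by blast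
qed

text \<open>Mean value theorem for the abscissa. It bounds the time spent on an arc and excludes a
  return to the starting point.\<close>

lemma speed:
  fixes \<gamma> :: "real \<Rightarrow> real \<times> real"
  assumes c0: "\<And>x y. \<bar>x\<bar> < b \<Longrightarrow> \<bar>y\<bar> < b \<Longrightarrow> c0 \<le> \<sigma> * fst (W (x, y))"
    and cont: "continuous_on {s..t} \<gamma>"
    and d: "\<And>\<tau>. s < \<tau> \<Longrightarrow> \<tau> < t \<Longrightarrow> (\<gamma> has_vector_derivative W (\<gamma> \<tau>)) (at \<tau>)"
    and box: "\<And>\<tau>. s < \<tau> \<Longrightarrow> \<tau> < t \<Longrightarrow> \<bar>fst (\<gamma> \<tau>)\<bar> < b \<and> \<bar>snd (\<gamma> \<tau>)\<bar> < b" and st: "s < t"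
  shows "c0 * (t - s) \<le> \<sigma> * (fst (\<gamma> t) - fst (\<gamma> s))"
proof -
  let ?x = "\<lambda>\<tau>. \<sigma> * fst (\<gamma> \<tau>)"
  have dx: "(?x has_real_derivative \<sigma> * fst (W (\<gamma> \<tau>))) (at \<tau>)" if "s < \<tau>" "\<tau> < t" for \<tau>
    using bounded_linear.has_vector_derivative[OF bounded_linear_fst d[OF that]]
    by (intro DERIV_cmult) (simp add: has_real_derivative_iff_has_vector_derivative)
  have "\<exists>l z. s < z \<and> z < t \<and> (?x has_real_derivative l) (at z) \<and> ?x t - ?x s = (t - s) * l"
    by (rule MVT[OF st]) (use dx cont in \<open>auto intro!: continuous_intros simp: real_differentiable_def\<close>)
  then obtain l z where z: "s < z" "z < t" "(?x has_real_derivative l) (at z)" "?x t - ?x s = (t - s) * l" by blast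
  have "l = \<sigma> * fst (W (\<gamma> z))" using DERIV_unique[OF z(3) dx[OF z(1,2)]] .
  then have "c0 \<le> l" using c0[of "fst (\<gamma> z)" "snd (\<gamma> z)"] box[OF z(1,2)] by simp
  then have "(t - s) * c0 \<le> (t - s) * l" using st by (intro mult_left_mono) auto
  then show ?thesis using z(4) by (simp add: algebra_simps)
qed

text \<open>The arc is parametrised by \<open>\<sigma> * x\<close>, which increases along the orbit;
  what remains is a scalar autonomous equation with positive right-hand side
  \<open>p\<close>.\<close>

lemma arc_solution:
  assumes \<xi>: "0 < \<xi>" "\<xi> < r"
  obtains T \<gamma> where "0 < T" "\<gamma> 0 = (entry \<xi>, 0)" "\<gamma> T = (exit \<xi>, 0)"
    "\<forall>t\<in>{0..T}. (\<gamma> has_vector_derivative W (\<gamma> t)) (at t)"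
    "\<forall>t\<in>{0..T}. \<gamma> t \<in> oarc \<xi>" "\<forall>t. 0 < t \<longrightarrow> t < T \<longrightarrow> 0 < snd (\<gamma> t)"
proof -
  have ss: "\<sigma> * (\<sigma> * x) = x" "\<bar>\<sigma> * x\<bar> = \<bar>x\<bar>" for x using sg by auto
  define p where "p s = \<sigma> * fst (W (\<sigma> * s, g \<xi> (\<sigma> * s)))" for s
  have \<phi>\<xi>: "\<phi> \<xi> < 0" "-2 * \<xi> \<le> \<phi> \<xi>" using \<phi>_neg[OF \<xi>] by auto
  note gc = g_continuous[OF \<xi>]
  have bx: "\<bar>\<sigma> * s\<bar> < b \<and> \<bar>g \<xi> (\<sigma> * s)\<bar> < b" if "s \<in> {-b0<..<b0}" for s
  proof -
    have "\<bar>\<sigma> * s\<bar> < b0" using that ss(2)[of s] by (auto simp: abs_if)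
    then show ?thesis using g_box[OF \<xi>, of "\<sigma> * s"] r by auto
  qed
  have "continuous_on {-b0<..<b0} (\<lambda>s. (\<sigma> * s, g \<xi> (\<sigma> * s)))"
    by (intro continuous_intros continuous_on_compose2[OF gc]) (use sg in auto)
  then have "continuous_on {-b0<..<b0} (\<lambda>s. W (\<sigma> * s, g \<xi> (\<sigma> * s)))"
    by (rule continuous_on_compose2[OF W_cont]) (use bx in auto)
  then have pc: "continuous_on {-b0<..<b0} p" unfolding p_def by (intro continuous_intros)
  have pp: "0 < p s" if "\<bar>s\<bar> < b0" for s
  proof -
    have "\<bar>\<sigma> * s\<bar> < b0" using that ss by simp
    then obtain c where "c > 0" "c \<le> \<sigma> * fst (W (\<sigma> * s, g \<xi> (\<sigma> * s)))" using X_pos g_box[OF \<xi>] r by fastforce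
    then show ?thesis by (simp add: p_def)
  qed
  have s01: "- b0 < \<sigma> * entry \<xi>" "\<sigma> * entry \<xi> < \<sigma> * exit \<xi>" "\<sigma> * exit \<xi> < b0"
    using sg \<phi>\<xi> \<xi> r by (auto simp: entry_def exit_def)
  obtain T y where y: "0 < T" "y 0 = \<sigma> * entry \<xi>" "y T = \<sigma> * exit \<xi>"
    "\<And>t. t \<in> {0..T} \<Longrightarrow> (y has_real_derivative p (y t)) (at t)"
    "\<And>t. 0 < t \<Longrightarrow> t < T \<Longrightarrow> \<sigma> * entry \<xi> < y t \<and> y t < \<sigma> * exit \<xi>"
    using scalar_autonomous_solution[OF pc pp s01] by blast
  define \<gamma> where "\<gamma> t = (\<sigma> * y t, g \<xi> (\<sigma> * y t))" for t
  have range: "\<phi> \<xi> \<le> \<sigma> * y t \<and> \<sigma> * y t \<le> \<xi>" if "t \<in> {0..T}" for t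
  proof -
    have "\<sigma> * entry \<xi> \<le> y t \<and> y t \<le> \<sigma> * exit \<xi>"
      using y(5)[of t] y(2,3) s01(2) that by (cases "t = 0"; cases "t = T") auto
    then show ?thesis using sg \<phi>\<xi> \<xi> by (auto simp: entry_def exit_def)
  qed
  show thesis
  proof (rule that[of T \<gamma>]; (intro ballI allI impI)?)
    show "0 < T" by fact
    show "\<gamma> 0 = (entry \<xi>, 0)" "\<gamma> T = (exit \<xi>, 0)"
      using g_zero[OF \<xi>, of "entry \<xi>"] g_zero[OF \<xi>, of "exit \<xi>"] \<phi>\<xi> \<xi> r
      by (auto simp: \<gamma>_def y ss entry_def exit_def)
    fix t
    show "\<gamma> t \<in> oarc \<xi>" if "t \<in> {0..T}" using range[OF that] by (auto simp: \<gamma>_def oarc_def)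
    show "0 < snd (\<gamma> t)" if "0 < t" "t < T"
    proof -
      have "\<phi> \<xi> < \<sigma> * y t \<and> \<sigma> * y t < \<xi>" using y(5)[OF that] sg by (auto simp: entry_def exit_def)
      then show ?thesis using g_pos[OF \<xi>, of "\<sigma> * y t"] \<phi>\<xi> \<xi> r by (auto simp: \<gamma>_def)
    qed
    show "(\<gamma> has_vector_derivative W (\<gamma> t)) (at t)" if t: "t \<in> {0..T}"
    proof -
      let ?x = "\<sigma> * y t"
      have xb: "\<bar>?x\<bar> < b0" using range[OF t] \<phi>\<xi> \<xi> r by auto
      have 1: "((\<lambda>t. \<sigma> * y t) has_real_derivative fst (W (\<gamma> t))) (at t)"
        using DERIV_cmult[OF y(4)[OF t], of \<sigma>] by (simp add: p_def \<gamma>_def ss)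
      from DERIV_chain2[OF g_deriv[OF \<xi> xb] this]
      have 2: "((\<lambda>t. g \<xi> (\<sigma> * y t)) has_real_derivative snd (W (\<gamma> t)) / fst (W (\<gamma> t)) * fst (W (\<gamma> t))) (at t)"
        by (simp add: \<gamma>_def)
      have "fst (W (\<gamma> t)) \<noteq> 0" using pp[of "y t"] xb ss(2) by (auto simp: p_def \<gamma>_def)
      then have "((\<lambda>t. g \<xi> (\<sigma> * y t)) has_real_derivative snd (W (\<gamma> t))) (at t)" using 2 by simp
      then show ?thesis
        using has_vector_derivative_Pair[of "\<lambda>t. \<sigma> * y t" "fst (W (\<gamma> t))" t UNIV "\<lambda>t. g \<xi> (\<sigma> * y t)" "snd (W (\<gamma> t))"] 1
        unfolding has_real_derivative_iff_has_vector_derivative \<gamma>_def by simp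
    qed
  qed
qed

text \<open>The orbit stays on the arc through \<open>(x, 0)\<close> and ends on \<Sigma>, so at one
  of the two ends of the arc, and by \<open>speed\<close> not at the one where it started.\<close>

lemma arc_end_unique:
  fixes \<gamma> :: "real \<Rightarrow> real \<times> real"
  assumes T: "0 < T" and x: "0 < \<bar>x\<bar>" "\<bar>x\<bar> < r / 2"
    and d: "\<And>t. t \<in> {0..T} \<Longrightarrow> (\<gamma> has_vector_derivative W (\<gamma> t)) (at t within {0..T})"
    and e: "\<gamma> 0 = (x, 0)" "\<gamma> T = (x', 0)" and pos: "\<And>t. 0 < t \<Longrightarrow> t < T \<Longrightarrow> 0 < snd (\<gamma> t)"
  shows "x' = \<phi> x"
proof -
  define \<xi> where "\<xi> = (if 0 < x then x else \<phi> x)"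
  have \<xi>: "0 < \<xi>" "\<xi> < r" using x \<phi>_pos[of x] by (auto simp: \<xi>_def)
  have ends: "x = \<xi> \<and> \<phi> x = \<phi> \<xi> \<or> x = \<phi> \<xi> \<and> \<phi> x = \<xi>" using \<phi>_inv[OF x] by (auto simp: \<xi>_def)
  have cont: "continuous_on {0..T} \<gamma>" 
    unfolding continuous_on_eq_continuous_within by (intro ballI has_vector_derivative_continuous[OF d])
  have d': "(\<gamma> has_vector_derivative W (\<gamma> t)) (at t)" if "0 < t" "t < T" for t
    using d[of t] at_within_Icc_at[OF that] that by simp
  have a0: "\<gamma> 0 \<in> oarc \<xi>" using ends arc_ends[OF \<xi>] e by auto
  have arc: "\<gamma> t \<in> oarc \<xi>" if "t \<in> {0..T}" for t
    by (rule phase[OF \<xi> cont _ _ _ a0 that]) (use d' pos e in auto)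
  have "\<gamma> T \<in> oarc \<xi>" using arc T by simp
  from arc_range(7)[OF \<xi> this] have x': "x' = \<phi> \<xi> \<or> x' = \<xi>" using e by simp
  obtain c0 where c0: "c0 > 0" "\<And>x y. \<bar>x\<bar> < b \<Longrightarrow> \<bar>y\<bar> < b \<Longrightarrow> c0 \<le> \<sigma> * fst (W (x, y))" using X_pos by blast
  have abox: "\<bar>fst (\<gamma> \<tau>)\<bar> < b \<and> \<bar>snd (\<gamma> \<tau>)\<bar> < b" if "0 < \<tau>" "\<tau> < T" for \<tau>
    using arc_range[OF \<xi> arc[of \<tau>]] that r by auto
  have "c0 * (T - 0) \<le> \<sigma> * (fst (\<gamma> T) - fst (\<gamma> 0))"
    by (rule speed[OF c0(2) cont d' _ T]) (use abox in auto)
  then have "x' \<noteq> x" using e c0 T by (auto simp: mult_le_0_iff)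
  then show ?thesis using x' ends by auto
qed

end

text \<open>A half orbit in negative time is a forward one of \<open>- W\<close>, which has the same
  \<phi>. Conversely, the arc is run forwards or backwards according to which of its ends is
  \<open>x\<close>.\<close>

lemma half_orbit_iff:
  assumes hs: "half_system W \<sigma> b b0 r C g \<phi>" and x: "0 < \<bar>x\<bar>" "\<bar>x\<bar> < r / 2"
  shows "half_orbit 1 W x x' \<longleftrightarrow> x' = \<phi> x"
proof
  interpret half_system W \<sigma> b b0 r C g \<phi> by fact
  interpret m: half_system "\<lambda>p. - W p" "- \<sigma>" b b0 r C g \<phi> by (rule half_system_uminus[OF hs])
  assume "half_orbit 1 W x x'"
  then obtain \<gamma> T where *: "T \<noteq> 0 \<and>
      (\<forall>t\<in>closed_segment 0 T. (\<gamma> has_vector_derivative W (\<gamma> t)) (at t within closed_segment 0 T)) \<and>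
      \<gamma> 0 = (x, 0) \<and> \<gamma> T = (x', 0) \<and> (\<forall>t\<in>open_segment 0 T. 1 * snd (\<gamma> t) > 0)"
    unfolding half_orbit_def by blast
  from * have T: "T \<noteq> 0" and e: "\<gamma> 0 = (x, 0)" "\<gamma> T = (x', 0)" by simp_all
  from * have d: "(\<gamma> has_vector_derivative W (\<gamma> t)) (at t within closed_segment 0 T)"
    if "t \<in> closed_segment 0 T" for t using that by blast
  from * have pos: "snd (\<gamma> t) > 0" if "t \<in> open_segment 0 T" for t using that by simp
  show "x' = \<phi> x"
  proof (cases "0 < T")
    case True
    then show ?thesis
      by (intro arc_end_unique[OF True x _ e])
        (use d pos in \<open>auto simp: closed_segment_eq_real_ivl open_segment_eq_real_ivl\<close>)
  next
    case False
    then have T: "T < 0" using T by simp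
    have "((\<lambda>t. \<gamma> (- t)) has_vector_derivative - W (\<gamma> (- t))) (at t within {0..- T})" if "t \<in> {0..- T}" for t
    proof -
      have "(\<gamma> has_vector_derivative W (\<gamma> (- t))) (at (- t) within uminus ` {0..- T})"
        using d[of "- t"] that T by (simp add: closed_segment_eq_real_ivl)
      moreover have "(uminus has_vector_derivative (- 1 :: real)) (at t within {0..- T})"
        by (auto intro!: derivative_eq_intros)
      ultimately show ?thesis
        using vector_diff_chain_within[of uminus "-1" t "{0..- T}" \<gamma> "W (\<gamma> (- t))"] by (simp add: o_def)
    qed
    then show ?thesis
      by (intro m.arc_end_unique[of "- T" x "\<lambda>t. \<gamma> (- t)"])
        (use T x e pos in \<open>auto simp: open_segment_eq_real_ivl\<close>)
  qed
next
  interpret half_system W \<sigma> b b0 r C g \<phi> by fact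
  assume x': "x' = \<phi> x"
  define \<xi> where "\<xi> = (if 0 < x then x else \<phi> x)"
  have \<xi>: "0 < \<xi>" "\<xi> < r" using x \<phi>_pos[of x] by (auto simp: \<xi>_def)
  have ends: "x = \<xi> \<and> \<phi> x = \<phi> \<xi> \<or> x = \<phi> \<xi> \<and> \<phi> x = \<xi>" using \<phi>_inv[OF x] by (auto simp: \<xi>_def)
  then have ends': "x = entry \<xi> \<and> x' = exit \<xi> \<or> x = exit \<xi> \<and> x' = entry \<xi>" using x' by (auto simp: entry_def exit_def)
  obtain T \<gamma> where \<gamma>: "0 < T" "\<gamma> 0 = (entry \<xi>, 0)" "\<gamma> T = (exit \<xi>, 0)"
    "\<forall>t\<in>{0..T}. (\<gamma> has_vector_derivative W (\<gamma> t)) (at t)"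
    "\<forall>t\<in>{0..T}. \<gamma> t \<in> oarc \<xi>" "\<forall>t. 0 < t \<longrightarrow> t < T \<longrightarrow> 0 < snd (\<gamma> t)"
    by (rule arc_solution[OF \<xi>])
  from ends' show "half_orbit 1 W x x'"
  proof
    assume e: "x = entry \<xi> \<and> x' = exit \<xi>"
    show ?thesis unfolding half_orbit_def
    proof (intro exI[of _ \<gamma>] exI[of _ T] conjI ballI)
      fix t
      show "(\<gamma> has_vector_derivative W (\<gamma> t)) (at t within closed_segment 0 T)" if "t \<in> closed_segment 0 T"
        by (rule has_vector_derivative_at_within) (use \<gamma>(1,4) that in \<open>simp add: closed_segment_eq_real_ivl\<close>)
      show "0 < 1 * snd (\<gamma> t)" if "t \<in> open_segment 0 T"
        using \<gamma>(1,6) that by (simp add: open_segment_eq_real_ivl)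
    qed (use \<gamma>(1-3) e in simp_all)
  next
    assume e: "x = exit \<xi> \<and> x' = entry \<xi>"
    have d: "((\<lambda>t. \<gamma> (t + T)) has_vector_derivative W (\<gamma> (t + T))) (at t within S)" if "t \<in> {- T..0}" for t S
    proof -
      have "((\<lambda>t. t + T) has_vector_derivative 1) (at t within S)" by (auto intro!: derivative_eq_intros)
      moreover have "(\<gamma> has_vector_derivative W (\<gamma> (t + T))) (at (t + T) within (\<lambda>t. t + T) ` S)"
        by (rule has_vector_derivative_at_within) (use \<gamma>(4) that in auto)
      ultimately show ?thesis
        using vector_diff_chain_within[of "\<lambda>t. t + T" 1 t S \<gamma> "W (\<gamma> (t + T))"] by (simp add: o_def)
    qed
    show ?thesis unfolding half_orbit_def
    proof (intro exI[of _ "\<lambda>t. \<gamma> (t + T)"] exI[of _ "- T"] conjI ballI)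
      fix t
      show "((\<lambda>t. \<gamma> (t + T)) has_vector_derivative W (\<gamma> (t + T))) (at t within closed_segment 0 (- T))"
        if "t \<in> closed_segment 0 (- T)"
        by (rule d) (use \<gamma>(1) that in \<open>simp add: closed_segment_eq_real_ivl\<close>)
      show "0 < 1 * snd (\<gamma> (t + T))" if "t \<in> open_segment 0 (- T)"
        using \<gamma>(1) \<gamma>(6)[rule_format, of "t + T"] that by (simp add: open_segment_eq_real_ivl)
    qed (use \<gamma>(1-3) e in simp_all)
  qed
qed

subsection \<open>Filippov solutions\<close>

text \<open>The integral condition for a single interval, split off so that velocities can be
  altered on finite sets, shifted, reversed and glued.\<close>

definition travels :: "(real \<Rightarrow> real \<times> real) \<Rightarrow> (real \<Rightarrow> real \<times> real) \<Rightarrow> real \<Rightarrow> real \<Rightarrow> bool" where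
  "travels v \<gamma> s t \<longleftrightarrow> v absolutely_integrable_on {s..t} \<and> integral {s..t} v = \<gamma> t - \<gamma> s"

lemma filippov_solution_travels:
  "filippov_solution Z D \<gamma> \<longleftrightarrow>
     (\<exists>v. (\<forall>t\<in>D. v t \<in> filippov_set Z (\<gamma> t)) \<and> (\<forall>s\<in>D. \<forall>t\<in>D. s \<le> t \<longrightarrow> travels v \<gamma> s t))"
  by (simp add: filippov_solution_def travels_def)

lemma travels_cong:
  assumes "travels v \<gamma> s t" "finite N" "\<And>x. x \<in> {s..t} - N \<Longrightarrow> w x = v x" "\<delta> s = \<gamma> s" "\<delta> t = \<gamma> t"
  shows "travels w \<delta> s t"
proof -
  have "w absolutely_integrable_on {s..t}"
    by (rule absolutely_integrable_spike[where f = v and S = N]) (use assms in \<open>auto simp: travels_def\<close>)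
  moreover have "integral {s..t} w = integral {s..t} v"
    by (rule integral_spike[where S = N]) (use assms in auto)
  ultimately show ?thesis using assms by (simp add: travels_def)
qed

lemma travels_trans:
  assumes "travels v \<gamma> s t" "travels v \<gamma> t u" "s \<le> t" "t \<le> u"
  shows "travels v \<gamma> s u"
proof -
  have un: "{s..t} \<union> {t..u} = {s..u}" using assms by auto
  have "v absolutely_integrable_on ({s..t} \<union> {t..u})"
    using assms unfolding travels_def by (intro absolutely_integrable_Un) auto
  then have 1: "v absolutely_integrable_on {s..u}" unfolding un .
  then have "v integrable_on {s..u}" by (rule set_lebesgue_integral_eq_integral(1))
  then have "integral {s..t} v + integral {t..u} v = integral {s..u} v"
    using assms by (intro Henstock_Kurzweil_Integration.integral_combine) auto
  from this[symmetric] have "integral {s..u} v = \<gamma> u - \<gamma> s" using assms by (simp add: travels_def)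
  then show ?thesis using 1 by (simp add: travels_def)
qed

lemma travels_affine:
  assumes "travels v \<gamma> s t" "s \<le> t"
  shows "travels (\<lambda>x. v (x + d)) (\<lambda>x. \<gamma> (x + d)) (s - d) (t - d)"
    and "travels (\<lambda>x. - v (d - x)) (\<lambda>x. \<gamma> (d - x)) (d - t) (d - s)"
proof -
  have v: "(v has_integral (\<gamma> t - \<gamma> s)) (cbox s t)" "(\<lambda>x. norm (v x)) integrable_on cbox s t"
    using assms(1) unfolding travels_def absolutely_integrable_on_def by (auto simp: has_integral_iff)
  then obtain n where n: "((\<lambda>x. norm (v x)) has_integral n) (cbox s t)" by blast
  have im1: "(\<lambda>x. (1 / 1) *\<^sub>R x + - ((1 / 1) *\<^sub>R d)) ` cbox s t = {s - d..t - d}"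
    using image_add_atLeastAtMost[of "-d" s t] by (simp add: add.commute)
  have im2: "(\<lambda>x. (1 / - 1) *\<^sub>R x + - ((1 / - 1) *\<^sub>R d)) ` cbox s t = {d - t..d - s}"
  proof -
    have "(\<lambda>x. d - x) ` {s..t} = {d - t..d - s}" by simp
    then show ?thesis by simp
  qed
  have "((\<lambda>x. v (x + d)) has_integral (\<gamma> t - \<gamma> s)) {s - d..t - d}"
    "((\<lambda>x. norm (v (x + d))) has_integral n) {s - d..t - d}"
    using has_integral_affinity[OF v(1), of 1 d] has_integral_affinity[OF n, of 1 d] unfolding im1 by simp_all
  then show "travels (\<lambda>x. v (x + d)) (\<lambda>x. \<gamma> (x + d)) (s - d) (t - d)"
    unfolding travels_def absolutely_integrable_on_def by (auto simp: has_integral_iff)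
  have "((\<lambda>x. v (d - x)) has_integral (\<gamma> t - \<gamma> s)) {d - t..d - s}"
    "((\<lambda>x. norm (v (d - x))) has_integral n) {d - t..d - s}"
    using has_integral_affinity[OF v(1), of "-1" d] has_integral_affinity[OF n, of "-1" d] unfolding im2 by simp_all
  from has_integral_neg[OF this(1)] this(2)
  show "travels (\<lambda>x. - v (d - x)) (\<lambda>x. \<gamma> (d - x)) (d - t) (d - s)"
    unfolding travels_def absolutely_integrable_on_def by (auto simp: has_integral_iff)
qed

lemma filippov_subset: "filippov_solution Z D \<gamma> \<Longrightarrow> D' \<subseteq> D \<Longrightarrow> filippov_solution Z D' \<gamma>"
  unfolding filippov_solution_def by blast

lemma filippov_shift:
  assumes "filippov_solution Z {a..c} \<gamma>"
  shows "filippov_solution Z {a - d..c - d} (\<lambda>t. \<gamma> (t + d))"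
proof -
  from assms obtain v where v: "\<forall>t\<in>{a..c}. v t \<in> filippov_set Z (\<gamma> t)"
    "\<forall>s\<in>{a..c}. \<forall>t\<in>{a..c}. s \<le> t \<longrightarrow> travels v \<gamma> s t" unfolding filippov_solution_travels by blast
  have "travels (\<lambda>x. v (x + d)) (\<lambda>x. \<gamma> (x + d)) s t" if "s \<in> {a - d..c - d}" "t \<in> {a - d..c - d}" "s \<le> t" for s t
    using travels_affine(1)[of v \<gamma> "s + d" "t + d" d] v(2) that by simp
  then show ?thesis using v(1) unfolding filippov_solution_travels by (intro exI[of _ "\<lambda>x. v (x + d)"]) auto
qed

lemma filippov_set_reversed: "filippov_set (time_reversed Z) p = uminus ` filippov_set Z p"
proof -
  have "closed_segment (- x) (- y) = uminus ` closed_segment x y" for x y :: "real \<times> real"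
    using closed_segment_linear_image[of uminus x y] by (simp add: linear_uminus)
  then show ?thesis by (simp add: filippov_set_def time_reversed_def)
qed

lemma filippov_reverse:
  assumes "filippov_solution Z D \<gamma>" "\<And>t. t \<in> D' \<Longrightarrow> d - t \<in> D"
  shows "filippov_solution (time_reversed Z) D' (\<lambda>t. \<gamma> (d - t))"
proof -
  from assms(1) obtain v where v: "\<forall>t\<in>D. v t \<in> filippov_set Z (\<gamma> t)"
    "\<forall>s\<in>D. \<forall>t\<in>D. s \<le> t \<longrightarrow> travels v \<gamma> s t" unfolding filippov_solution_travels by blast
  have "travels (\<lambda>x. - v (d - x)) (\<lambda>x. \<gamma> (d - x)) s t" if "s \<in> D'" "t \<in> D'" "s \<le> t" for s t
    using travels_affine(2)[of v \<gamma> "d - t" "d - s" d] v(2) that assms(2)[of s] assms(2)[of t] by simp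
  moreover have "- v (d - t) \<in> filippov_set (time_reversed Z) (\<gamma> (d - t))" if "t \<in> D'" for t
    using v(1) assms(2)[OF that] by (simp add: filippov_set_reversed)
  ultimately show ?thesis unfolding filippov_solution_travels by (intro exI[of _ "\<lambda>x. - v (d - x)"]) auto
qed

lemma filippov_glue:
  assumes "filippov_solution Z {a..b} \<gamma>" "filippov_solution Z {b..c} \<gamma>" "a \<le> b" "b \<le> c"
  shows "filippov_solution Z {a..c} \<gamma>"
proof -
  from assms(1) obtain v where v: "\<forall>t\<in>{a..b}. v t \<in> filippov_set Z (\<gamma> t)"
    "\<forall>s\<in>{a..b}. \<forall>t\<in>{a..b}. s \<le> t \<longrightarrow> travels v \<gamma> s t" unfolding filippov_solution_travels by blast
  from assms(2) obtain w where w: "\<forall>t\<in>{b..c}. w t \<in> filippov_set Z (\<gamma> t)"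
    "\<forall>s\<in>{b..c}. \<forall>t\<in>{b..c}. s \<le> t \<longrightarrow> travels w \<gamma> s t" unfolding filippov_solution_travels by blast
  define u where "u t = (if t \<le> b then v t else w t)" for t
  have 1: "travels u \<gamma> s t" if "a \<le> s" "s \<le> t" "t \<le> b" for s t
    by (rule travels_cong[of v \<gamma> _ _ "{}"]) (use v that assms in \<open>auto simp: u_def\<close>)
  have 2: "travels u \<gamma> s t" if "b \<le> s" "s \<le> t" "t \<le> c" for s t
    by (rule travels_cong[of w \<gamma> _ _ "{b}"]) (use w that assms in \<open>auto simp: u_def\<close>)
  have "travels u \<gamma> s t" if "s \<in> {a..c}" "t \<in> {a..c}" "s \<le> t" for s t
  proof -
    consider "t \<le> b" | "b \<le> s" | "s \<le> b" "b \<le> t" by linarith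
    then show ?thesis
    proof cases
      case 3
      then show ?thesis using travels_trans[of u \<gamma> s b t] 1[of s b] 2[of b t] that by simp
    qed (use 1 2 that in auto)
  qed
  then show ?thesis using v(1) w(1) unfolding filippov_solution_travels by (intro exI[of _ u]) (auto simp: u_def)
qed

lemma filippov_cong:
  assumes "filippov_solution Z {a..c} \<gamma>" "\<And>t. t \<in> {a..c} \<Longrightarrow> \<delta> t = \<gamma> t"
  shows "filippov_solution Z {a..c} \<delta>"
proof -
  from assms(1) obtain v where v: "\<forall>t\<in>{a..c}. v t \<in> filippov_set Z (\<gamma> t)"
    "\<forall>s\<in>{a..c}. \<forall>t\<in>{a..c}. s \<le> t \<longrightarrow> travels v \<gamma> s t" unfolding filippov_solution_travels by blast
  have "travels v \<delta> s t" if "s \<in> {a..c}" "t \<in> {a..c}" "s \<le> t" for s t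
    by (rule travels_cong[of v \<gamma> _ _ "{}"]) (use v assms(2) that in auto)
  then show ?thesis using v(1) assms(2) unfolding filippov_solution_travels by (intro exI[of _ v]) auto
qed

lemma filippov_concat:
  assumes 1: "filippov_solution Z {0..S} \<alpha>" and 2: "filippov_solution Z {0..T} \<beta>" and "0 \<le> S" "0 \<le> T" "\<alpha> S = \<beta> 0"
  shows "filippov_solution Z {0..S + T} (\<lambda>t. if t \<le> S then \<alpha> t else \<beta> (t - S))"
proof (rule filippov_glue)
  show "filippov_solution Z {0..S} (\<lambda>t. if t \<le> S then \<alpha> t else \<beta> (t - S))"
    by (rule filippov_cong[OF 1]) auto
  have "filippov_solution Z {S..S + T} (\<lambda>t. \<beta> (t - S))"
    using filippov_shift[OF 2, of "- S"] by (simp add: add.commute)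
  then show "filippov_solution Z {S..S + T} (\<lambda>t. if t \<le> S then \<alpha> t else \<beta> (t - S))"
    by (rule filippov_cong) (use assms in auto)
qed (use assms in auto)

text \<open>Solution and velocity are both wrapped modulo \<open>T\<close>. At a multiple of
  \<open>T\<close> the wrapped velocity may differ from the one of the previous period, but this is
  a finite set within each period; longer intervals are composed one period at a time.\<close>

lemma filippov_periodic:
  assumes \<gamma>: "filippov_solution Z {0..T} \<gamma>" and T: "0 < T" and per: "\<gamma> T = \<gamma> 0"
  shows "filippov_solution Z UNIV (\<lambda>t. \<gamma> (t - T * \<lfloor>t / T\<rfloor>))"
proof -
  from \<gamma> obtain v0 where v0: "\<forall>t\<in>{0..T}. v0 t \<in> filippov_set Z (\<gamma> t)"
    "\<forall>s\<in>{0..T}. \<forall>t\<in>{0..T}. s \<le> t \<longrightarrow> travels v0 \<gamma> s t" unfolding filippov_solution_travels by blast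
  define v where "v t = v0 (t - T * \<lfloor>t / T\<rfloor>)" for t
  define \<delta> where "\<delta> t = \<gamma> (t - T * \<lfloor>t / T\<rfloor>)" for t
  have in0: "t - T * \<lfloor>t / T\<rfloor> \<in> {0..T}" for t
  proof -
    have "of_int \<lfloor>t / T\<rfloor> * T \<le> t" "t < (of_int \<lfloor>t / T\<rfloor> + 1) * T"
      using floor_divide_lower[OF T, of t] floor_divide_upper[OF T, of t] by simp_all
    then show ?thesis using T by (simp add: algebra_simps)
  qed
  have fl: "\<lfloor>t / T\<rfloor> = n" if "T * n \<le> t" "t < T * (n + 1)" for t and n :: int
    using that T by (simp add: floor_eq_iff field_simps)
  have \<delta>_eq: "\<delta> t = \<gamma> (t - T * n)" if "T * n \<le> t" "t \<le> T * (n + 1)" for t and n :: int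
  proof (cases "t = T * (n + 1)")
    case True
    then have "\<lfloor>t / T\<rfloor> = n + 1" using T by (intro fl) (auto simp: algebra_simps)
    then show ?thesis using True per by (simp add: \<delta>_def algebra_simps)
  next
    case False
    then show ?thesis using that fl[of n t] by (simp add: \<delta>_def)
  qed
  have one: "travels v \<delta> s t" if "T * n \<le> s" "s \<le> t" "t \<le> T * (n + 1)" for s t and n :: int
  proof (rule travels_cong[where N = "{T * (n + 1)}"])
    show "travels (\<lambda>x. v0 (x + - T * n)) (\<lambda>x. \<gamma> (x + - T * n)) s t"
      using travels_affine(1)[of v0 \<gamma> "s - T * n" "t - T * n" "- T * n"] v0(2) that by (simp add: algebra_simps)
    show "v x = v0 (x + - T * n)" if "x \<in> {s..t} - {T * (n + 1)}" for x
      using fl[of n x] that \<open>T * n \<le> s\<close> \<open>t \<le> T * (n + 1)\<close> by (simp add: v_def)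
    show "\<delta> s = \<gamma> (s + - T * n)" "\<delta> t = \<gamma> (t + - T * n)"
      using \<delta>_eq[of n s] \<delta>_eq[of n t] that by simp_all
  qed simp
  have many: "travels v \<delta> s t" if "T * n \<le> s" "s \<le> t" "t \<le> T * (n + int m)" for s t and n :: int and m :: nat
    using that
  proof (induction m arbitrary: t)
    case 0
    then show ?case using one[of n s t] T by (simp add: algebra_simps)
  next
    case (Suc m)
    let ?u = "T * (n + int m)"
    consider "t \<le> ?u" | "?u \<le> s" | "s \<le> ?u" "?u \<le> t" by linarith
    then show ?case
    proof cases
      case 1
      then show ?thesis using Suc by simp
    next
      case 2
      then show ?thesis using one[of "n + int m" s t] Suc.prems by (simp add: algebra_simps)
    next
      case 3
      have "travels v \<delta> s ?u" using Suc.IH[of ?u] Suc.prems 3 by simp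
      moreover have "travels v \<delta> ?u t" using one[of "n + int m" ?u t] Suc.prems 3 by (simp add: algebra_simps)
      ultimately show ?thesis using 3 by (rule travels_trans)
    qed
  qed
  have "travels v \<delta> s t" if "s \<le> t" for s t
  proof (rule many[OF _ that])
    show "T * \<lfloor>s / T\<rfloor> \<le> s" using in0[of s] by simp
    have "s / T \<le> t / T" using that T by (simp add: divide_right_mono)
    then have "\<lfloor>s / T\<rfloor> \<le> \<lfloor>t / T\<rfloor>" by (rule floor_mono)
    then have "int (nat (\<lfloor>t / T\<rfloor> - \<lfloor>s / T\<rfloor> + 1)) = \<lfloor>t / T\<rfloor> - \<lfloor>s / T\<rfloor> + 1" by simp
    then show "t \<le> T * real_of_int (\<lfloor>s / T\<rfloor> + int (nat (\<lfloor>t / T\<rfloor> - \<lfloor>s / T\<rfloor> + 1)))"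
      using in0[of t] by (simp add: algebra_simps)
  qed
  moreover have "v t \<in> filippov_set Z (\<delta> t)" for t
    unfolding v_def \<delta>_def using v0(1) in0[of t] by blast
  ultimately have "filippov_solution Z UNIV \<delta>" unfolding filippov_solution_travels by blast
  then show ?thesis by (simp only: \<delta>_def[abs_def])
qed

lemma filippov_of_derivative:
  assumes d: "\<And>t. t \<in> {a..c} \<Longrightarrow> (\<gamma> has_vector_derivative V t) (at t)"
    and V: "continuous_on {a..c} V" and m: "\<And>t. t \<in> {a..c} \<Longrightarrow> V t \<in> filippov_set Z (\<gamma> t)"
  shows "filippov_solution Z {a..c} \<gamma>"
  unfolding filippov_solution_def
proof (intro exI[of _ V] conjI ballI impI)
  fix s t assume st: "s \<in> {a..c}" "t \<in> {a..c}" "s \<le> t"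
  have "continuous_on {s..t} V" by (rule continuous_on_subset[OF V]) (use st in auto)
  then show "V absolutely_integrable_on {s..t}" by (rule absolutely_integrable_continuous_real)
  have "(V has_integral (\<gamma> t - \<gamma> s)) {s..t}"
    by (rule fundamental_theorem_of_calculus[OF st(3)]) (use st d in \<open>auto intro: has_vector_derivative_at_within\<close>)
  then show "integral {s..t} V = \<gamma> t - \<gamma> s" by (rule integral_unique)
qed (use m in auto)

lemma filippov_continuous:
  assumes "filippov_solution Z {a..c} \<gamma>" shows "continuous_on {a..c} \<gamma>"
proof (cases "a \<le> c")
  case True
  from assms obtain v where v: "\<forall>s\<in>{a..c}. \<forall>t\<in>{a..c}. s \<le> t \<longrightarrow>
     v absolutely_integrable_on {s..t} \<and> integral {s..t} v = \<gamma> t - \<gamma> s" unfolding filippov_solution_def by blast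
  then have "v absolutely_integrable_on {a..c}" using True by auto
  then have "v integrable_on {a..c}" by (rule set_lebesgue_integral_eq_integral(1))
  then have "continuous_on {a..c} (\<lambda>t. \<gamma> a + integral {a..t} v)"
    by (intro continuous_intros indefinite_integral_continuous_1)
  moreover have "\<gamma> a + integral {a..t} v = \<gamma> t" if "t \<in> {a..c}" for t
    using v[rule_format, of a t] that True by simp
  ultimately show ?thesis by (rule continuous_on_eq)
qed simp

text \<open>Above \<Sigma> the Filippov set is a singleton, so near \<open>t\<close> the velocity is
  the continuous function \<open>fst Z (\<gamma> s)\<close>, whose integral is
  differentiable.\<close>

lemma filippov_derivative:
  assumes \<gamma>: "filippov_solution Z {a..c} \<gamma>" and t: "a < t" "t < c" "0 < snd (\<gamma> t)"
    and U: "open U" "\<gamma> t \<in> U" "continuous_on U (fst Z)"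
  shows "(\<gamma> has_vector_derivative fst Z (\<gamma> t)) (at t)"
proof -
  have cont: "continuous_on {a..c} \<gamma>" by (rule filippov_continuous[OF \<gamma>])
  have "open (U \<inter> {p. 0 < snd p})"
    by (intro open_Int U open_Collect_less continuous_intros)
  moreover have "\<gamma> t \<in> U \<inter> {p. 0 < snd p}" using U(2) t(3) by simp
  ultimately obtain e where e: "e > 0" "ball (\<gamma> t) e \<subseteq> U \<inter> {p. 0 < snd p}"
    unfolding open_contains_ball by blast
  have "t \<in> {a..c}" using t by simp
  from cont[unfolded continuous_on_iff, rule_format, OF this e(1)]
  obtain d where d: "d > 0" "\<And>s. s \<in> {a..c} \<Longrightarrow> dist s t < d \<Longrightarrow> dist (\<gamma> s) (\<gamma> t) < e" by blast
  define h where "h = min (d / 2) (min (t - a) (c - t))"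
  have h: "0 < h" "h < d" "a \<le> t - h" "t + h \<le> c" using d(1) t by (auto simp: h_def)
  have inU: "\<gamma> s \<in> U \<and> 0 < snd (\<gamma> s)" if "s \<in> {t - h..t + h}" for s
  proof -
    have "\<gamma> s \<in> ball (\<gamma> t) e" using d(2)[of s] that h by (auto simp: dist_real_def dist_commute)
    then show ?thesis using e(2) by auto
  qed
  from \<gamma> obtain v where v: "\<forall>t\<in>{a..c}. v t \<in> filippov_set Z (\<gamma> t)"
    "\<forall>s\<in>{a..c}. \<forall>t\<in>{a..c}. s \<le> t \<longrightarrow> v absolutely_integrable_on {s..t} \<and> integral {s..t} v = \<gamma> t - \<gamma> s"
    unfolding filippov_solution_def by blast
  have vW: "v s = fst Z (\<gamma> s)" if "s \<in> {t - h..t + h}" for s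
    using v(1)[rule_format, of s] inU[OF that] that h by (simp add: filippov_set_def)
  have cW: "continuous_on {t - h..t + h} (\<lambda>s. fst Z (\<gamma> s))"
    by (rule continuous_on_compose2[OF U(3) continuous_on_subset[OF cont]]) (use h inU in auto)
  have "((\<lambda>u. integral {t - h..u} (\<lambda>s. fst Z (\<gamma> s))) has_vector_derivative fst Z (\<gamma> t)) (at t within {t - h..t + h})"
    by (rule integral_has_vector_derivative[OF cW]) (use h in auto)
  then have "((\<lambda>u. integral {t - h..u} (\<lambda>s. fst Z (\<gamma> s))) has_vector_derivative fst Z (\<gamma> t)) (at t)"
    using at_within_Icc_at[of "t - h" t "t + h"] h by simp
  then have "((\<lambda>u. \<gamma> (t - h) + integral {t - h..u} (\<lambda>s. fst Z (\<gamma> s))) has_vector_derivative fst Z (\<gamma> t)) (at t)"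
    by (auto intro!: derivative_eq_intros)
  then show ?thesis
  proof (rule has_vector_derivative_transform_within_open[where S = "{t - h<..<t + h}"])
    fix u assume u: "u \<in> {t - h<..<t + h}"
    have "integral {t - h..u} (\<lambda>s. fst Z (\<gamma> s)) = integral {t - h..u} v"
      by (rule integral_cong) (use vW u in auto)
    then show "\<gamma> (t - h) + integral {t - h..u} (\<lambda>s. fst Z (\<gamma> s)) = \<gamma> u" using v(2) u h by auto
  qed (use h in auto)
qed

text \<open>Near a point of \<Sigma> where both fields point to the same side, every convex
  combination of them has vertical component at least \<open>m\<close> in that direction, so the
  height changes at least at that rate and no sliding is possible. The factor \<open>e\<close>
  treats both directions at once.\<close>

lemma filippov_crossing:
  assumes \<gamma>: "filippov_solution Z {a..c} \<gamma>" and t0: "t0 \<in> {a..c}" and y0: "snd (\<gamma> t0) = 0"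
    and cont: "isCont (fst Z) (\<gamma> t0)" "isCont (snd Z) (\<gamma> t0)"
    and sgn: "0 < e * snd (fst Z (\<gamma> t0))" "0 < e * snd (snd Z (\<gamma> t0))"
  shows "\<exists>d>0. \<forall>t\<in>{a..c}. (t0 < t \<longrightarrow> t < t0 + d \<longrightarrow> 0 < e * snd (\<gamma> t)) \<and> (t0 - d < t \<longrightarrow> t < t0 \<longrightarrow> e * snd (\<gamma> t) < 0)"
proof -
  define m where "m = min (e * snd (fst Z (\<gamma> t0))) (e * snd (snd Z (\<gamma> t0))) / 2"
  have m: "0 < m" "m < e * snd (fst Z (\<gamma> t0))" "m < e * snd (snd Z (\<gamma> t0))" using sgn by (auto simp: m_def)
  have "\<forall>\<^sub>F p in nhds (\<gamma> t0). m < e * snd (fst Z p)" "\<forall>\<^sub>F p in nhds (\<gamma> t0). m < e * snd (snd Z p)"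
  proof -
    have "((\<lambda>p. e * snd (fst Z p)) \<longlongrightarrow> e * snd (fst Z (\<gamma> t0))) (nhds (\<gamma> t0))"
      "((\<lambda>p. e * snd (snd Z p)) \<longlongrightarrow> e * snd (snd Z (\<gamma> t0))) (nhds (\<gamma> t0))"
      using cont by (auto intro!: tendsto_intros simp: continuous_at tendsto_at_iff_tendsto_nhds)
    then show "\<forall>\<^sub>F p in nhds (\<gamma> t0). m < e * snd (fst Z p)" "\<forall>\<^sub>F p in nhds (\<gamma> t0). m < e * snd (snd Z p)"
      using m by (auto dest: order_tendstoD(1))
  qed
  then have "\<forall>\<^sub>F p in nhds (\<gamma> t0). m < e * snd (fst Z p) \<and> m < e * snd (snd Z p)" by (rule eventually_conj)
  then obtain r where r: "r > 0" "\<And>p. dist p (\<gamma> t0) < r \<Longrightarrow> m < e * snd (fst Z p) \<and> m < e * snd (snd Z p)"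
    unfolding eventually_nhds_metric by blast
  have fs: "m \<le> e * snd w" if dp: "dist p (\<gamma> t0) < r" and wp: "w \<in> filippov_set Z p" for p w
  proof (cases "snd p = 0")
    case True
    then obtain u where u: "0 \<le> u" "u \<le> 1" "w = (1 - u) *\<^sub>R fst Z p + u *\<^sub>R snd Z p"
      using wp by (auto simp: filippov_set_def closed_segment_def)
    have "(1 - u) * m + u * m \<le> (1 - u) * (e * snd (fst Z p)) + u * (e * snd (snd Z p))"
      using u r(2)[OF dp] by (intro add_mono mult_left_mono) auto
    moreover have sw: "snd w = (1 - u) * snd (fst Z p) + u * snd (snd Z p)" using u(3) by simp
    have "(1 - u) * (e * snd (fst Z p)) + u * (e * snd (snd Z p)) = e * snd w"
      unfolding sw distrib_left by (simp only: mult.left_commute)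
    moreover have "(1 - u) * m + u * m = m" by (simp add: algebra_simps)
    ultimately show ?thesis by linarith
  next
    case False
    then show ?thesis using wp r(2)[OF dp] by (auto simp: filippov_set_def split: if_splits)
  qed
  have gc: "continuous_on {a..c} \<gamma>" by (rule filippov_continuous[OF \<gamma>])
  obtain d where d: "d > 0" "\<And>s. s \<in> {a..c} \<Longrightarrow> dist s t0 < d \<Longrightarrow> dist (\<gamma> s) (\<gamma> t0) < r"
    using gc[unfolded continuous_on_iff, rule_format, OF t0 r(1)] by blast
  from \<gamma> obtain v where v: "\<forall>t\<in>{a..c}. v t \<in> filippov_set Z (\<gamma> t)"
    "\<forall>s\<in>{a..c}. \<forall>t\<in>{a..c}. s \<le> t \<longrightarrow> v absolutely_integrable_on {s..t} \<and> integral {s..t} v = \<gamma> t - \<gamma> s"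
    unfolding filippov_solution_def by blast
  have grow: "m * (t - s) \<le> e * (snd (\<gamma> t) - snd (\<gamma> s))"
    if "s \<in> {a..c}" "t \<in> {a..c}" "s \<le> t" "t0 - d < s" "t < t0 + d" for s t
  proof -
    have "v absolutely_integrable_on {s..t}" "integral {s..t} v = \<gamma> t - \<gamma> s" using v(2)[rule_format, of s t] that by simp_all
    then have "(v has_integral (\<gamma> t - \<gamma> s)) {s..t}"
      using set_lebesgue_integral_eq_integral(1) by (auto simp: has_integral_iff)
    from has_integral_mult_right[OF has_integral_linear[OF this bounded_linear_snd], of e]
    have i: "((\<lambda>x. e * snd (v x)) has_integral e * snd (\<gamma> t - \<gamma> s)) {s..t}" by (simp add: o_def)
    have "m * (t - s) \<le> e * snd (\<gamma> t - \<gamma> s)"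
    proof (rule has_integral_le[OF _ i])
      show "((\<lambda>x. m) has_integral m * (t - s)) {s..t}"
        using has_integral_const_real[of m s t] that by (simp add: mult.commute)
      fix x assume "x \<in> {s..t}"
      then show "m \<le> e * snd (v x)" using that v(1) by (intro fs[of "\<gamma> x"] d(2)) (auto simp: dist_real_def)
    qed
    then show ?thesis by simp
  qed
  show ?thesis
  proof (intro exI[of _ d] conjI ballI impI d)
    fix t assume t: "t \<in> {a..c}"
    show "0 < e * snd (\<gamma> t)" if "t0 < t" "t < t0 + d"
    proof -
      have "m * (t - t0) \<le> e * snd (\<gamma> t)" using grow[of t0 t] t t0 that y0 d by simp
      moreover have "0 < m * (t - t0)" using m that by simp
      ultimately show ?thesis by linarith
    qed
    show "e * snd (\<gamma> t) < 0" if "t0 - d < t" "t < t0"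
    proof -
      have "m * (t0 - t) \<le> e * (0 - snd (\<gamma> t))" using grow[of t t0] t t0 that y0 d by simp
      moreover have "0 < m * (t0 - t)" using m that by simp
      ultimately show ?thesis by simp
    qed
  qed
qed

subsection \<open>Reflection in the discontinuity line\<close>

definition refl :: "real \<times> real \<Rightarrow> real \<times> real" where "refl p = (fst p, - snd p)"
definition refl_field :: "vfield \<Rightarrow> vfield" where "refl_field W p = refl (W (refl p))"
text \<open>The components change places because reflection exchanges the half-planes. The sense of
  rotation is reversed as well.\<close>

definition refl_system :: "pw_field \<Rightarrow> pw_field" where "refl_system Z = (refl_field (snd Z), refl_field (fst Z))"

lemma refl_simps [simp]: "fst (refl p) = fst p" "snd (refl p) = - snd p" "refl (refl p) = p" "refl (x, y) = (x, - y)"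
  by (simp_all add: refl_def)

lemma refl_field_refl_field [simp]: "refl_field (refl_field W) = W"
  by (simp add: fun_eq_iff refl_field_def)

lemma refl_system_refl_system [simp]: "refl_system (refl_system Z) = Z"
  by (simp add: refl_system_def)

lemma refl_reversed: "refl_system (time_reversed Z) = time_reversed (refl_system Z)"
  by (auto simp: refl_system_def time_reversed_def refl_field_def refl_def fun_eq_iff)

lemma refl_linear: "bounded_linear refl"
  unfolding refl_def by (intro bounded_linear_Pair bounded_linear_fst bounded_linear_minus bounded_linear_snd)

lemma refl_image_iff: "p \<in> refl ` S \<longleftrightarrow> refl p \<in> S"
  by (metis image_iff refl_simps(3))

lemma filippov_set_refl: "filippov_set (refl_system Z) (refl p) = refl ` filippov_set Z p"
proof -
  have "closed_segment (refl x) (refl y) = refl ` closed_segment x y" for x y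
    using closed_segment_linear_image[of refl x y] refl_linear by (simp add: bounded_linear.linear)
  then show ?thesis by (auto simp: filippov_set_def refl_system_def refl_field_def closed_segment_commute)
qed

lemma filippov_refl:
  assumes "filippov_solution Z D \<gamma>" shows "filippov_solution (refl_system Z) D (\<lambda>t. refl (\<gamma> t))"
proof -
  from assms obtain v where v: "\<forall>t\<in>D. v t \<in> filippov_set Z (\<gamma> t)"
    "\<forall>s\<in>D. \<forall>t\<in>D. s \<le> t \<longrightarrow> v absolutely_integrable_on {s..t} \<and> integral {s..t} v = \<gamma> t - \<gamma> s"
    unfolding filippov_solution_def by blast
  show ?thesis unfolding filippov_solution_def
  proof (intro exI[of _ "\<lambda>t. refl (v t)"] conjI ballI impI)
    fix s t assume st: "s \<in> D" "t \<in> D" "s \<le> t"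
    then have 1: "v absolutely_integrable_on {s..t}" "integral {s..t} v = \<gamma> t - \<gamma> s" using v(2) by auto
    then show "(\<lambda>t. refl (v t)) absolutely_integrable_on {s..t}"
      using absolutely_integrable_linear[OF 1(1) refl_linear] by (simp add: o_def)
    have "integral {s..t} (refl \<circ> v) = refl (integral {s..t} v)"
      by (rule integral_linear[OF set_lebesgue_integral_eq_integral(1)[OF 1(1)] refl_linear])
    then show "integral {s..t} (\<lambda>t. refl (v t)) = refl (\<gamma> t) - refl (\<gamma> s)"
      using 1(2) refl_linear by (simp add: o_def bounded_linear.linear linear_diff)
  qed (use v(1) in \<open>simp add: filippov_set_refl\<close>)
qed

section \<open>Filippov solutions on the arcs of one half-plane\<close>

context half_system
begin

text \<open>Intermediate value theorem for the abscissa, which determines a point of the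
  arc.\<close>

lemma arc_cover:
  fixes \<gamma> :: "real \<Rightarrow> real \<times> real"
  assumes \<xi>: "0 < \<xi>" "\<xi> < r" and cont: "continuous_on {a..c} \<gamma>" and ac: "a \<le> c"
    and arc: "\<And>t. t \<in> {a..c} \<Longrightarrow> \<gamma> t \<in> oarc \<xi>" and e: "\<gamma> a = (entry \<xi>, 0)" "\<gamma> c = (exit \<xi>, 0)"
  shows "oarc \<xi> \<subseteq> \<gamma> ` {a..c}"
proof
  fix p assume p: "p \<in> oarc \<xi>"
  then have fp: "\<phi> \<xi> \<le> fst p" "fst p \<le> \<xi>" by (auto simp: oarc_def)
  have c1: "continuous_on {a..c} (\<lambda>t. fst (\<gamma> t))" by (intro continuous_on_fst cont)
  have "\<exists>t. a \<le> t \<and> t \<le> c \<and> fst (\<gamma> t) = fst p"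
  proof (cases "\<sigma> = 1")
    case True
    then have "entry \<xi> = \<phi> \<xi>" "exit \<xi> = \<xi>" unfolding entry_def exit_def by simp_all
    then show ?thesis using IVT'[of "\<lambda>t. fst (\<gamma> t)" a "fst p" c] e fp ac c1 by simp
  next
    case False
    then have "entry \<xi> = \<xi>" "exit \<xi> = \<phi> \<xi>" unfolding entry_def exit_def by simp_all
    then show ?thesis using IVT2'[of "\<lambda>t. fst (\<gamma> t)" c "fst p" a] e fp ac c1 by simp
  qed
  then obtain t where t: "t \<in> {a..c}" "fst (\<gamma> t) = fst p" by auto
  have "snd (\<gamma> t) = snd p" using arc_range(6)[OF \<xi> p] arc_range(6)[OF \<xi> arc[OF t(1)]] t(2) by simp
  then have "\<gamma> t = p" using t(2) by (simp add: prod_eq_iff)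
  then show "p \<in> \<gamma> ` {a..c}" using t(1) by blast
qed

lemma arc_solution_inj:
  fixes \<gamma> :: "real \<Rightarrow> real \<times> real"
  assumes \<xi>: "0 < \<xi>" "\<xi> < r" and d: "\<forall>t\<in>{0..T}. (\<gamma> has_vector_derivative W (\<gamma> t)) (at t)"
    and arc: "\<forall>t\<in>{0..T}. \<gamma> t \<in> oarc \<xi>"
  shows "inj_on \<gamma> {0..T}"
proof -
  obtain c0 where c0: "c0 > 0" "\<And>x y. \<bar>x\<bar> < b \<Longrightarrow> \<bar>y\<bar> < b \<Longrightarrow> c0 \<le> \<sigma> * fst (W (x, y))" using X_pos by blast
  have lt: "\<gamma> s \<noteq> \<gamma> t" if st: "s \<in> {0..T}" "t \<in> {0..T}" "s < t" for s t
  proof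
    assume eq: "\<gamma> s = \<gamma> t"
    have "c0 * (t - s) \<le> \<sigma> * (fst (\<gamma> t) - fst (\<gamma> s))"
    proof (rule speed[OF c0(2) _ _ _ st(3)])
      show "continuous_on {s..t} \<gamma>"
        unfolding continuous_on_eq_continuous_within
      proof
        fix u assume "u \<in> {s..t}"
        then have "u \<in> {0..T}" using st(1,2) by simp
        then have "(\<gamma> has_vector_derivative W (\<gamma> u)) (at u)" by (rule bspec[OF d])
        then show "continuous (at u within {s..t}) \<gamma>"
          by (rule has_vector_derivative_continuous[OF has_vector_derivative_at_within])
      qed
      fix u assume u: "s < u" "u < t"
      then have uT: "u \<in> {0..T}" using st by simp
      show "(\<gamma> has_vector_derivative W (\<gamma> u)) (at u)" by (rule bspec[OF d uT])
      have "\<gamma> u \<in> oarc \<xi>" by (rule bspec[OF arc uT])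
      from arc_range[OF \<xi> this] show "\<bar>fst (\<gamma> u)\<bar> < b \<and> \<bar>snd (\<gamma> u)\<bar> < b" using r by simp
    qed
    moreover have "0 < c0 * (t - s)" using c0 st by simp
    ultimately show False using eq by simp
  qed
  show ?thesis
  proof (rule inj_onI)
    fix s t assume *: "s \<in> {0..T}" "t \<in> {0..T}" "\<gamma> s = \<gamma> t"
    show "s = t" using lt[OF *(1,2)] lt[OF *(2,1)] *(3) by (cases s t rule: linorder_cases) auto
  qed
qed

end

text \<open>The solution may start on \<Sigma>, so positivity of the height is asked just after time
  \<open>a\<close>, not at \<open>a\<close>; this decides which half-plane is entered.\<close>

definition rises :: "(real \<Rightarrow> real \<times> real) \<Rightarrow> real \<Rightarrow> real \<Rightarrow> bool" where
  "rises \<gamma> a c \<longleftrightarrow> (\<exists>d>0. \<forall>t. a < t \<longrightarrow> t < a + d \<longrightarrow> t \<le> c \<longrightarrow> 0 < snd (\<gamma> t))"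

lemma rises_subset: "rises \<gamma> a c \<Longrightarrow> c' \<le> c \<Longrightarrow> rises \<gamma> a c'"
  unfolding rises_def by (meson order_trans)

lemma rises_pos:
  assumes "continuous_on {a..c} \<gamma>" "a \<le> c" "0 < snd (\<gamma> a)" shows "rises \<gamma> a c"
proof -
  have c: "continuous_on {a..c} (\<lambda>t. snd (\<gamma> t))" by (intro continuous_on_snd assms(1))
  have "a \<in> {a..c}" using assms(2) by simp
  from c[unfolded continuous_on_iff, rule_format, OF this assms(3)]
  obtain d where d: "d > 0" "\<And>t. t \<in> {a..c} \<Longrightarrow> dist t a < d \<Longrightarrow> dist (snd (\<gamma> t)) (snd (\<gamma> a)) < snd (\<gamma> a)" by blast
  show ?thesis unfolding rises_def
  proof (intro exI[of _ d] conjI allI impI d(1))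
    fix t assume "a < t" "t < a + d" "t \<le> c"
    then have "dist (snd (\<gamma> t)) (snd (\<gamma> a)) < snd (\<gamma> a)" by (intro d(2)) (auto simp: dist_real_def)
    then show "0 < snd (\<gamma> t)" unfolding dist_real_def by linarith
  qed
qed

text \<open>Both halves are described in the upper half-plane, the lower one after reflection. The
  opposite signs \<sigma> and \<open>- \<sigma>\<close> make the two motions turn around the origin
  in the same sense.\<close>

locale turning =
  fixes Z :: pw_field and \<sigma> b1 b01 r1 C1 :: real and g1 :: "real \<Rightarrow> real \<Rightarrow> real" and \<phi>1 :: "real \<Rightarrow> real"
    and b2 b02 r2 C2 :: real and g2 :: "real \<Rightarrow> real \<Rightarrow> real" and \<phi>2 :: "real \<Rightarrow> real"
  assumes upH: "half_system (fst Z) \<sigma> b1 b01 r1 C1 g1 \<phi>1"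
    and loH: "half_system (refl_field (snd Z)) (- \<sigma>) b2 b02 r2 C2 g2 \<phi>2"
begin

sublocale up: half_system "fst Z" \<sigma> b1 b01 r1 C1 g1 \<phi>1 by (rule upH)
sublocale lo: half_system "refl_field (snd Z)" "- \<sigma>" b2 b02 r2 C2 g2 \<phi>2 by (rule loH)

definition "rr = min r1 r2"

lemma rr: "0 < rr" "rr \<le> r1" "rr \<le> r2" using up.r lo.r by (auto simp: rr_def)

lemma open_box: "open {p :: real \<times> real. \<bar>fst p\<bar> < B \<and> \<bar>snd p\<bar> < B}"
  by (intro open_Collect_conj open_Collect_less continuous_intros)

text \<open>The conditions \<open>Y_sign\<close> of the two halves give both fields on \<Sigma> the
  vertical direction of \<open>- (\<sigma> * x)\<close>. The range \<open>2 * rr\<close> includes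
  both ends of every arc with parameter below \<open>rr\<close>.\<close>

lemma crossing:
  assumes \<gamma>: "filippov_solution Z {a..c} \<gamma>" and t0: "t0 \<in> {a..c}" and x: "\<gamma> t0 = (x, 0)" "0 < \<bar>x\<bar>" "\<bar>x\<bar> < 2 * rr"
  shows "\<exists>d>0. \<forall>t\<in>{a..c}. (t0 < t \<longrightarrow> t < t0 + d \<longrightarrow> 0 < - (\<sigma> * x) * snd (\<gamma> t)) \<and>
    (t0 - d < t \<longrightarrow> t < t0 \<longrightarrow> - (\<sigma> * x) * snd (\<gamma> t) < 0)"
proof (rule filippov_crossing[OF \<gamma> t0])
  have xb: "\<bar>x\<bar> < b01" "\<bar>x\<bar> < b02" "\<bar>x\<bar> < b1" "\<bar>x\<bar> < b2" using x rr up.r lo.r by auto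
  show "snd (\<gamma> t0) = 0" using x by simp
  show "isCont (fst Z) (\<gamma> t0)"
    using up.W_cont unfolding continuous_on_eq_continuous_at[OF open_box] using xb x(1) by simp
  have "isCont (refl_field (snd Z)) (refl (x, 0))"
    using lo.W_cont unfolding continuous_on_eq_continuous_at[OF open_box] using xb by simp
  then have "isCont (\<lambda>p. refl_field (snd Z) (refl p)) (x, 0)"
    by (rule isCont_o2[OF linear_continuous_at[OF refl_linear]])
  from bounded_linear.isCont[OF refl_linear this] show "isCont (snd Z) (\<gamma> t0)"
    using x(1) by (simp add: refl_field_def)
  show "0 < - (\<sigma> * x) * snd (fst Z (\<gamma> t0))" using up.Y_sign[OF x(2) xb(1)] x(1) by simp
  show "0 < - (\<sigma> * x) * snd (snd Z (\<gamma> t0))" using lo.Y_sign[OF x(2) xb(2)] x(1) by (simp add: refl_field_def)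
qed

lemma rises_entry:
  assumes \<gamma>: "filippov_solution Z {a..c} \<gamma>" and ac: "a \<le> c" and \<xi>: "0 < \<xi>" "\<xi> < rr" and e: "\<gamma> a = (up.entry \<xi>, 0)"
  shows "rises \<gamma> a c"
proof -
  have \<xi>1: "\<xi> < r1" using \<xi> rr by simp
  note p = up.\<phi>_neg[OF \<xi>(1) \<xi>1]
  have pos: "0 < - (\<sigma> * up.entry \<xi>)" "0 < \<bar>up.entry \<xi>\<bar>" "\<bar>up.entry \<xi>\<bar> < 2 * rr"
    unfolding up.entry_def using up.sg p \<xi> by auto
  obtain d where d: "d > 0" "\<forall>t\<in>{a..c}. (a < t \<longrightarrow> t < a + d \<longrightarrow> 0 < - (\<sigma> * up.entry \<xi>) * snd (\<gamma> t)) \<and>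
    (a - d < t \<longrightarrow> t < a \<longrightarrow> - (\<sigma> * up.entry \<xi>) * snd (\<gamma> t) < 0)"
    using crossing[OF \<gamma> _ e pos(2,3)] ac by auto
  have "0 < snd (\<gamma> t)" if "a < t" "t < a + d" "t \<le> c" for t
  proof -
    have "0 < - (\<sigma> * up.entry \<xi>) * snd (\<gamma> t)" using d(2)[rule_format, of t] that by simp
    then show ?thesis using pos(1) by (simp only: zero_less_mult_pos)
  qed
  then show ?thesis unfolding rises_def using d(1) by blast
qed

lemma up_phase:
  assumes \<gamma>: "filippov_solution Z {a..c} \<gamma>" and \<xi>: "0 < \<xi>" "\<xi> < rr" and a: "\<gamma> a \<in> up.oarc \<xi>"
    and pos: "\<And>t. a < t \<Longrightarrow> t < c \<Longrightarrow> 0 < snd (\<gamma> t)" "0 \<le> snd (\<gamma> c)" and t: "t \<in> {a..c}"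
  shows "\<gamma> t \<in> up.oarc \<xi>"
proof (rule up.phase[OF \<xi>(1) _ filippov_continuous[OF \<gamma>] _ pos a t])
  show "\<xi> < r1" using \<xi> rr by simp
  fix t assume *: "a < t" "t < c" "\<bar>fst (\<gamma> t)\<bar> < b01" "snd (\<gamma> t) < b1"
  show "(\<gamma> has_vector_derivative fst Z (\<gamma> t)) (at t)"
    by (rule filippov_derivative[OF \<gamma> *(1,2) pos(1)[OF *(1,2)] open_box _ up.W_cont])
      (use * pos(1)[OF *(1,2)] up.r in simp)
qed

lemma up_speed:
  assumes \<gamma>: "filippov_solution Z {a..c} \<gamma>" and \<xi>: "0 < \<xi>" "\<xi> < rr" and ac: "a < c"
    and pos: "\<And>t. a < t \<Longrightarrow> t < c \<Longrightarrow> 0 < snd (\<gamma> t)" and arc: "\<And>t. t \<in> {a..c} \<Longrightarrow> \<gamma> t \<in> up.oarc \<xi>"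
    and c0: "\<And>x y. \<bar>x\<bar> < b1 \<Longrightarrow> \<bar>y\<bar> < b1 \<Longrightarrow> c0 \<le> \<sigma> * fst (fst Z (x, y))"
  shows "c0 * (c - a) \<le> \<sigma> * (fst (\<gamma> c) - fst (\<gamma> a))"
proof (rule up.speed[OF c0 filippov_continuous[OF \<gamma>] _ _ ac])
  fix t assume t: "a < t" "t < c"
  have \<xi>1: "\<xi> < r1" using \<xi> rr by simp
  have "\<gamma> t \<in> up.oarc \<xi>" using arc t by simp
  note ar = up.arc_range[OF \<xi>(1) \<xi>1 this]
  show bx: "\<bar>fst (\<gamma> t)\<bar> < b1 \<and> \<bar>snd (\<gamma> t)\<bar> < b1" using ar up.r by simp
  show "(\<gamma> has_vector_derivative fst Z (\<gamma> t)) (at t)"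
    by (rule filippov_derivative[OF \<gamma> t pos[OF t] open_box _ up.W_cont]) (use bx in simp)
qed

text \<open>The first time \<open>t1\<close> after the rise at which the height is not positive is
  an infimum over a closed set. Until then the solution is on the arc, so \<open>\<gamma> t1\<close>
  is one of its ends, and \<open>speed\<close> selects the exit.\<close>

lemma up_leave:
  assumes \<gamma>: "filippov_solution Z {a..c} \<gamma>" and \<xi>: "0 < \<xi>" "\<xi> < rr" and a: "\<gamma> a \<in> up.oarc \<xi>"
    and ri: "rises \<gamma> a c" and t': "a < t'" "t' \<le> c" "snd (\<gamma> t') \<le> 0"
  obtains t1 where "a < t1" "t1 \<le> t'" "\<gamma> t1 = (up.exit \<xi>, 0)" "\<forall>t. a < t \<longrightarrow> t < t1 \<longrightarrow> 0 < snd (\<gamma> t)"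
    "\<forall>t\<in>{a..t1}. \<gamma> t \<in> up.oarc \<xi>"
proof -
  have \<xi>1: "\<xi> < r1" using \<xi> rr by simp
  obtain d where d: "d > 0" "\<And>t. a < t \<Longrightarrow> t < a + d \<Longrightarrow> t \<le> c \<Longrightarrow> 0 < snd (\<gamma> t)" using ri unfolding rises_def by blast
  have cont: "continuous_on {a..c} (\<lambda>t. snd (\<gamma> t))" by (intro continuous_on_snd filippov_continuous[OF \<gamma>])
  have t'd: "a + d \<le> t'" using d(2)[of t'] t' by linarith
  define S where "S = {a + d..t'} \<inter> (\<lambda>t. snd (\<gamma> t)) -` {..0}"
  have "continuous_on {a + d..t'} (\<lambda>t. snd (\<gamma> t))" by (rule continuous_on_subset[OF cont]) (use d t' in auto)
  then have "closed S" unfolding S_def by (rule continuous_closed_preimage) auto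
  moreover have St': "t' \<in> S" using t' t'd by (simp add: S_def)
  moreover have bS: "bdd_below S" by (rule bdd_belowI[of _ "a + d"]) (simp add: S_def)
  ultimately have "Inf S \<in> S" by (intro closed_contains_Inf) auto
  define t1 where "t1 = Inf S"
  have t1: "a + d \<le> t1" "t1 \<le> t'" "snd (\<gamma> t1) \<le> 0" using \<open>Inf S \<in> S\<close> by (auto simp: t1_def S_def)
  have at1: "a < t1" using t1 d by simp
  have pos: "0 < snd (\<gamma> t)" if "a < t" "t < t1" for t
  proof (cases "t < a + d")
    case True
    then show ?thesis using d(2)[of t] that t1 t' by simp
  next
    case False
    have "t \<notin> S" using cInf_lower[OF _ bS, of t] that by (auto simp: t1_def)
    then show ?thesis using False that t1 by (simp add: S_def)
  qed
  have "0 \<le> snd (\<gamma> t1)"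
  proof (rule continuous_ge_on_closure[where S = "{a<..<t1}" and f = "\<lambda>t. snd (\<gamma> t)" and x = t1])
    have cl: "closure {a<..<t1} = {a..t1}" using at1 by (simp add: closure_greaterThanLessThan)
    show "continuous_on (closure {a<..<t1}) (\<lambda>t. snd (\<gamma> t))"
      unfolding cl by (rule continuous_on_subset[OF cont]) (use t1 t' in auto)
    show "t1 \<in> closure {a<..<t1}" unfolding cl using at1 by simp
    show "0 \<le> snd (\<gamma> t)" if "t \<in> {a<..<t1}" for t using pos[of t] that by simp
  qed
  have \<gamma>1: "filippov_solution Z {a..t1} \<gamma>" by (rule filippov_subset[OF \<gamma>]) (use t1 t' in auto)
  have arc: "\<gamma> t \<in> up.oarc \<xi>" if "t \<in> {a..t1}" for t
    by (rule up_phase[OF \<gamma>1 \<xi> a pos \<open>0 \<le> snd (\<gamma> t1)\<close> that])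
  have "\<gamma> t1 \<in> up.oarc \<xi>" using arc at1 by simp
  moreover have y1: "snd (\<gamma> t1) = 0" using t1(3) \<open>0 \<le> snd (\<gamma> t1)\<close> by simp
  ultimately have ends: "fst (\<gamma> t1) = \<phi>1 \<xi> \<or> fst (\<gamma> t1) = \<xi>" using up.arc_range(7)[OF \<xi>(1) \<xi>1] by simp
  obtain c0 where c0: "c0 > 0" "\<And>x y. \<bar>x\<bar> < b1 \<Longrightarrow> \<bar>y\<bar> < b1 \<Longrightarrow> c0 \<le> \<sigma> * fst (fst Z (x, y))" using up.X_pos by blast
  have "c0 * (t1 - a) \<le> \<sigma> * (fst (\<gamma> t1) - fst (\<gamma> a))" by (rule up_speed[OF \<gamma>1 \<xi> at1 pos arc c0(2)])
  moreover have "0 < c0 * (t1 - a)" using c0 at1 by simp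
  ultimately have lt: "0 < \<sigma> * (fst (\<gamma> t1) - fst (\<gamma> a))" by linarith
  have ra: "\<phi>1 \<xi> \<le> fst (\<gamma> a)" "fst (\<gamma> a) \<le> \<xi>" using a by (auto simp: up.oarc_def)
  have "fst (\<gamma> t1) = up.exit \<xi>" unfolding up.exit_def using up.sg lt ra ends by auto
  then have "\<gamma> t1 = (up.exit \<xi>, 0)" using y1 by (simp add: prod_eq_iff)
  then show thesis using that[OF at1 t1(2)] pos arc by blast
qed

text \<open>The abscissae of an arc stay within \<open>b1\<close> and move at speed at least
  \<open>c0\<close>, so time \<open>2 * b1 / c0\<close> suffices for every arc and every starting
  point; the added 1 makes the inequality strict.\<close>

lemma up_pass:
  "\<exists>Tm>0. \<forall>\<gamma> a c \<xi>. filippov_solution Z {a..c} \<gamma> \<longrightarrow> 0 < \<xi> \<longrightarrow> \<xi> < rr \<longrightarrow> \<gamma> a \<in> up.oarc \<xi> \<longrightarrow> rises \<gamma> a c \<longrightarrow>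
     a + Tm \<le> c \<longrightarrow> (\<exists>t1. a < t1 \<and> t1 \<le> a + Tm \<and> \<gamma> t1 = (up.exit \<xi>, 0) \<and> (\<forall>t\<in>{a..t1}. \<gamma> t \<in> up.oarc \<xi>))"
proof -
  obtain c0 where c0: "c0 > 0" "\<And>x y. \<bar>x\<bar> < b1 \<Longrightarrow> \<bar>y\<bar> < b1 \<Longrightarrow> c0 \<le> \<sigma> * fst (fst Z (x, y))" using up.X_pos by blast
  define Tm where "Tm = 2 * b1 / c0 + 1"
  have b1: "0 < b1" using up.r by linarith
  have Tm: "0 < Tm" "2 * b1 < c0 * Tm"
    using b1 c0 by (auto simp: Tm_def distrib_left intro: add_pos_pos)
  show ?thesis
  proof (rule exI[of _ Tm], intro conjI allI impI Tm(1))
    fix \<gamma> a c \<xi>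
    assume \<gamma>: "filippov_solution Z {a..c} \<gamma>" and \<xi>: "0 < \<xi>" "\<xi> < rr" and a: "\<gamma> a \<in> up.oarc \<xi>"
      and ri: "rises \<gamma> a c" and ac: "a + Tm \<le> c"
    have \<xi>1: "\<xi> < r1" using \<xi> rr by simp
    have \<gamma>1: "filippov_solution Z {a..a + Tm} \<gamma>" by (rule filippov_subset[OF \<gamma>]) (use ac in auto)
    have ri1: "rises \<gamma> a (a + Tm)" by (rule rises_subset[OF ri ac])
    have "\<exists>t'. a < t' \<and> t' \<le> a + Tm \<and> snd (\<gamma> t') \<le> 0"
    proof (rule ccontr)
      assume "\<not> ?thesis"
      then have pos: "0 < snd (\<gamma> t)" if "a < t" "t \<le> a + Tm" for t using that not_le by blast
      have p1: "0 < snd (\<gamma> t)" if "a < t" "t < a + Tm" for t using pos that by simp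
      have p2: "0 \<le> snd (\<gamma> (a + Tm))" using pos[of "a + Tm"] Tm by simp
      have arc: "\<gamma> t \<in> up.oarc \<xi>" if "t \<in> {a..a + Tm}" for t by (rule up_phase[OF \<gamma>1 \<xi> a p1 p2 that])
      have le: "c0 * (a + Tm - a) \<le> \<sigma> * (fst (\<gamma> (a + Tm)) - fst (\<gamma> a))"
        by (rule up_speed[OF \<gamma>1 \<xi> _ p1 arc c0(2)]) (use Tm in simp)
      have bd: "\<bar>fst (\<gamma> (a + Tm))\<bar> < b1" "\<bar>fst (\<gamma> a)\<bar> < b1"
        using up.arc_range(2)[OF \<xi>(1) \<xi>1 arc[of "a + Tm"]] up.arc_range(2)[OF \<xi>(1) \<xi>1 a] Tm up.r by simp_all
      have ab: "\<sigma> * (x - y) \<le> \<bar>x\<bar> + \<bar>y\<bar>" for x y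
      proof -
        have "\<sigma> * (x - y) = x - y \<or> \<sigma> * (x - y) = y - x" using up.sg by force
        then show ?thesis by linarith
      qed
      have e: "a + Tm - a = Tm" by simp
      have "c0 * Tm \<le> \<bar>fst (\<gamma> (a + Tm))\<bar> + \<bar>fst (\<gamma> a)\<bar>"
        by (rule order_trans[OF le[unfolded e] ab])
      then show False using Tm(2) bd by linarith
    qed
    then obtain t' where t': "a < t'" "t' \<le> a + Tm" "snd (\<gamma> t') \<le> 0" by blast
    obtain t1 where t1: "a < t1" "t1 \<le> t'" "\<gamma> t1 = (up.exit \<xi>, 0)" "\<forall>t. a < t \<longrightarrow> t < t1 \<longrightarrow> 0 < snd (\<gamma> t)"
      "\<forall>t\<in>{a..t1}. \<gamma> t \<in> up.oarc \<xi>"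
      by (rule up_leave[OF \<gamma>1 \<xi> a ri1 t'])
    show "\<exists>t1. a < t1 \<and> t1 \<le> a + Tm \<and> \<gamma> t1 = (up.exit \<xi>, 0) \<and> (\<forall>t\<in>{a..t1}. \<gamma> t \<in> up.oarc \<xi>)"
      by (intro exI[of _ t1] conjI t1(1,3,5) order_trans[OF t1(2) t'(2)])
  qed
qed

lemma up_arc_filippov:
  assumes \<xi>: "0 < \<xi>" "\<xi> < rr"
  obtains T \<gamma> where "0 < T" "filippov_solution Z {0..T} \<gamma>" "\<gamma> 0 = (up.entry \<xi>, 0)" "\<gamma> T = (up.exit \<xi>, 0)"
    "\<forall>t\<in>{0..T}. \<gamma> t \<in> up.oarc \<xi>" "\<forall>t. 0 < t \<longrightarrow> t < T \<longrightarrow> 0 < snd (\<gamma> t)" "inj_on \<gamma> {0..T}"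
proof -
  have \<xi>1: "\<xi> < r1" using \<xi> rr by simp
  obtain T \<gamma> where \<gamma>: "0 < T" "\<gamma> 0 = (up.entry \<xi>, 0)" "\<gamma> T = (up.exit \<xi>, 0)"
    "\<forall>t\<in>{0..T}. (\<gamma> has_vector_derivative fst Z (\<gamma> t)) (at t)"
    "\<forall>t\<in>{0..T}. \<gamma> t \<in> up.oarc \<xi>" "\<forall>t. 0 < t \<longrightarrow> t < T \<longrightarrow> 0 < snd (\<gamma> t)"
    by (rule up.arc_solution[OF \<xi>(1) \<xi>1])
  have inj: "inj_on \<gamma> {0..T}" by (rule up.arc_solution_inj[OF \<xi>(1) \<xi>1 \<gamma>(4,5)])
  have cont: "continuous_on {0..T} \<gamma>"
    unfolding continuous_on_eq_continuous_within
    by (intro ballI has_vector_derivative_continuous[OF has_vector_derivative_at_within[OF bspec[OF \<gamma>(4)]]])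
  have ar: "\<bar>fst (\<gamma> t)\<bar> < b1 \<and> \<bar>snd (\<gamma> t)\<bar> < b1 \<and> 0 \<le> snd (\<gamma> t)" if "t \<in> {0..T}" for t
    using up.arc_range[OF \<xi>(1) \<xi>1 \<gamma>(5)[rule_format, OF that]] up.r by simp
  have "filippov_solution Z {0..T} \<gamma>"
  proof (rule filippov_of_derivative)
    show "continuous_on {0..T} (\<lambda>t. fst Z (\<gamma> t))"
      by (rule continuous_on_compose2[OF up.W_cont cont]) (use ar in blast)
    show "(\<gamma> has_vector_derivative fst Z (\<gamma> t)) (at t)" if "t \<in> {0..T}" for t by (rule bspec[OF \<gamma>(4) that])
    show "fst Z (\<gamma> t) \<in> filippov_set Z (\<gamma> t)" if "t \<in> {0..T}" for t
      using ar[OF that] by (simp add: filippov_set_def)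
  qed
  then show thesis by (rule that[OF \<gamma>(1) _ \<gamma>(2,3,5,6) inj])
qed

lemma swapped: "turning (refl_system Z) (- \<sigma>) b2 b02 r2 C2 g2 \<phi>2 b1 b01 r1 C1 g1 \<phi>1"
  unfolding turning_def refl_system_def using upH loH by simp

end

section \<open>One turn around the origin: return map, invariant annuli, closed orbit\<close>

locale clockwise = turning Z 1 b1 b01 r1 C1 g1 \<phi>1 b2 b02 r2 C2 g2 \<phi>2
  for Z :: pw_field and b1 b01 r1 C1 :: real and g1 :: "real \<Rightarrow> real \<Rightarrow> real" and \<phi>1 :: "real \<Rightarrow> real"
    and b2 b02 r2 C2 :: real and g2 :: "real \<Rightarrow> real \<Rightarrow> real" and \<phi>2 :: "real \<Rightarrow> real"
begin

sublocale sw: turning "refl_system Z" "- 1" b2 b02 r2 C2 g2 \<phi>2 b1 b01 r1 C1 g1 \<phi>1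
  by (rule swapped)

text \<open>The lower arc from \<open>(x, 0)\<close>, \<open>x > 0\<close>, leads to the negative
  axis, and the upper arc leads back: \<open>P\<close> is the first-return map, see
  \<open>return_map_eq\<close>.\<close>

definition "P x = \<phi>1 (\<phi>2 x)"

lemma entries: "up.entry \<xi> = \<phi>1 \<xi>" "up.exit \<xi> = \<xi>" "sw.up.entry \<xi> = \<xi>" "sw.up.exit \<xi> = \<phi>2 \<xi>"
  unfolding up.entry_def up.exit_def sw.up.entry_def sw.up.exit_def by simp_all

lemma sw_rr: "sw.rr = rr" by (simp add: rr_def sw.rr_def min.commute)

text \<open>Each half-return map at most doubles, so for \<open>x < rr / 4\<close> the point
  \<open>\<phi>2 x\<close> is within \<open>rr / 2\<close>, where \<open>\<phi>1\<close> is an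
  involution, and \<open>P x\<close> is below \<open>rr\<close>. The last equation says that the
  upper arc of parameter \<open>P x\<close> starts where the lower arc of \<open>x\<close>
  ends.\<close>

lemma P_props:
  assumes "0 < x" "x < rr / 4"
  shows "\<phi>2 x < 0" "0 < P x" "P x < rr" "\<phi>1 (P x) = \<phi>2 x"
proof -
  have 1: "\<phi>2 x < 0" "- 2 * x \<le> \<phi>2 x" using lo.\<phi>_neg[of x] assms rr by auto
  then have 2: "0 < P x" "P x \<le> - 2 * \<phi>2 x" using up.\<phi>_pos[of "\<phi>2 x"] assms rr by (auto simp: P_def)
  show "\<phi>2 x < 0" "0 < P x" "P x < rr" using 1 2 assms by auto
  show "\<phi>1 (P x) = \<phi>2 x" unfolding P_def by (rule up.\<phi>_inv) (use 1 assms rr in auto)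
qed

text \<open>At a fixed point \<open>x\<close> of \<open>P\<close>, \<open>A {x}\<close> is the
  cycle; over an interval around it, \<open>A\<close> is an annulus around the origin.\<close>

definition "A S = {p. \<exists>\<xi>\<in>S. p \<in> up.oarc \<xi> \<or> refl p \<in> lo.oarc \<xi>}"

lemma A_up: "\<xi> \<in> S \<Longrightarrow> p \<in> up.oarc \<xi> \<Longrightarrow> p \<in> A S" and A_lo: "\<xi> \<in> S \<Longrightarrow> refl p \<in> lo.oarc \<xi> \<Longrightarrow> p \<in> A S"
  unfolding A_def by auto

lemma small: "0 < x \<Longrightarrow> x < rr / 4 \<Longrightarrow> x < rr" "0 < x \<Longrightarrow> x < rr / 4 \<Longrightarrow> x < r1" "0 < x \<Longrightarrow> x < rr / 4 \<Longrightarrow> x < r2"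
  using rr by auto

text \<open>Every point is assigned an arc along which it still moves forward: the exit of one arc
  is read as the entry of the next. From a lower to an upper arc the parameter changes from
  \<open>\<xi>\<close> to \<open>P \<xi>\<close>, hence the invariance of \<open>S\<close>.\<close>

lemma A_cases:
  assumes S: "S \<subseteq> {0<..<rr/4}" and PS: "\<And>x. x \<in> S \<Longrightarrow> P x \<in> S" and p: "p \<in> A S"
  obtains \<xi> where "\<xi> \<in> S" "p \<in> up.oarc \<xi>" "0 < snd p \<or> p = (\<phi>1 \<xi>, 0)"
  | \<xi> where "\<xi> \<in> S" "refl p \<in> lo.oarc \<xi>" "snd p < 0 \<or> p = (\<xi>, 0)"
proof -
  from p obtain \<xi> where \<xi>S: "\<xi> \<in> S" and o: "p \<in> up.oarc \<xi> \<or> refl p \<in> lo.oarc \<xi>" unfolding A_def by blast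
  then have \<xi>: "0 < \<xi>" "\<xi> < rr/4" using S by auto
  from o show thesis
  proof
    assume u: "p \<in> up.oarc \<xi>"
    note ar = up.arc_range[OF \<xi>(1) small(2)[OF \<xi>] u]
    show thesis
    proof (cases "snd p = 0")
      case True
      then consider "fst p = \<phi>1 \<xi>" | "fst p = \<xi>" using ar(7) by auto
      then show thesis
      proof cases
        case 1
        then show thesis using that(1)[OF \<xi>S u] True by (simp add: prod_eq_iff)
      next
        case 2
        then have "p = (\<xi>, 0)" using True by (simp add: prod_eq_iff)
        then show thesis using that(2)[OF \<xi>S] lo.arc_ends(2)[OF \<xi>(1) small(3)[OF \<xi>]] by simp
      qed
    next
      case False
      then show thesis using that(1)[OF \<xi>S u] ar(3) by linarith
    qed
  next
    assume u: "refl p \<in> lo.oarc \<xi>"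
    note ar = lo.arc_range[OF \<xi>(1) small(3)[OF \<xi>] u]
    show thesis
    proof (cases "snd p = 0")
      case True
      then consider "fst p = \<phi>2 \<xi>" | "fst p = \<xi>" using ar(7) by auto
      then show thesis
      proof cases
        case 1
        then have "p = (\<phi>1 (P \<xi>), 0)" using True P_props(4)[OF \<xi>] by (simp add: prod_eq_iff)
        then show thesis using that(1)[OF PS[OF \<xi>S]] up.arc_ends(1)[of "P \<xi>"] P_props[OF \<xi>] rr by simp
      next
        case 2
        then show thesis using that(2)[OF \<xi>S u] True by (simp add: prod_eq_iff)
      qed
    next
      case False
      then show thesis using that(2)[OF \<xi>S u] ar(3) by simp
    qed
  qed
qed

lemma rises_up:
  assumes \<gamma>: "filippov_solution Z {a..c} \<gamma>" "a \<le> c" and \<xi>: "0 < \<xi>" "\<xi> < rr" and t: "0 < snd (\<gamma> a) \<or> \<gamma> a = (\<phi>1 \<xi>, 0)"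
  shows "rises \<gamma> a c"
  using t
proof
  assume "0 < snd (\<gamma> a)"
  then show ?thesis by (rule rises_pos[OF filippov_continuous[OF \<gamma>(1)] \<gamma>(2)])
next
  assume "\<gamma> a = (\<phi>1 \<xi>, 0)"
  then show ?thesis using rises_entry[OF \<gamma> \<xi>] by (simp add: entries)
qed

lemma rises_down:
  assumes \<gamma>: "filippov_solution Z {a..c} \<gamma>" "a \<le> c" and \<xi>: "0 < \<xi>" "\<xi> < rr" and t: "snd (\<gamma> a) < 0 \<or> \<gamma> a = (\<xi>, 0)"
  shows "rises (\<lambda>t. refl (\<gamma> t)) a c"
  using t
proof
  assume "snd (\<gamma> a) < 0"
  then show ?thesis by (intro rises_pos[OF filippov_continuous[OF filippov_refl[OF \<gamma>(1)]] \<gamma>(2)]) simp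
next
  assume "\<gamma> a = (\<xi>, 0)"
  then show ?thesis using sw.rises_entry[OF filippov_refl[OF \<gamma>(1)] \<gamma>(2) \<xi>(1)] \<xi>(2) by (simp add: entries sw_rr)
qed

lemma down_pass:
  "\<exists>Tm>0. \<forall>\<gamma> a c \<xi>. filippov_solution Z {a..c} \<gamma> \<longrightarrow> 0 < \<xi> \<longrightarrow> \<xi> < rr \<longrightarrow> refl (\<gamma> a) \<in> lo.oarc \<xi> \<longrightarrow>
     rises (\<lambda>t. refl (\<gamma> t)) a c \<longrightarrow> a + Tm \<le> c \<longrightarrow>
     (\<exists>t1. a < t1 \<and> t1 \<le> a + Tm \<and> \<gamma> t1 = (\<phi>2 \<xi>, 0) \<and> (\<forall>t\<in>{a..t1}. refl (\<gamma> t) \<in> lo.oarc \<xi>))"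
proof -
  obtain Tm where Tm: "Tm > 0" and T: "\<forall>\<gamma> a c \<xi>. filippov_solution (refl_system Z) {a..c} \<gamma> \<longrightarrow> 0 < \<xi> \<longrightarrow> \<xi> < sw.rr \<longrightarrow>
     \<gamma> a \<in> lo.oarc \<xi> \<longrightarrow> rises \<gamma> a c \<longrightarrow>
     a + Tm \<le> c \<longrightarrow> (\<exists>t1. a < t1 \<and> t1 \<le> a + Tm \<and> \<gamma> t1 = (sw.up.exit \<xi>, 0) \<and> (\<forall>t\<in>{a..t1}. \<gamma> t \<in> lo.oarc \<xi>))"
    using sw.up_pass by blast
  show ?thesis
  proof (rule exI[of _ Tm], intro conjI allI impI Tm)
    fix \<gamma> a c \<xi>
    assume *: "filippov_solution Z {a..c} \<gamma>" "0 < \<xi>" "\<xi> < rr" "refl (\<gamma> a) \<in> lo.oarc \<xi>"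
      "rises (\<lambda>t. refl (\<gamma> t)) a c" "a + Tm \<le> c"
    have "\<xi> < sw.rr" using *(3) by (simp add: sw_rr)
    from T[rule_format, OF filippov_refl[OF *(1)] *(2) this *(4-6)]
    obtain t1 where t1: "a < t1" "t1 \<le> a + Tm" "refl (\<gamma> t1) = (\<phi>2 \<xi>, 0)" "\<forall>t\<in>{a..t1}. refl (\<gamma> t) \<in> lo.oarc \<xi>"
      unfolding entries by blast
    have "\<gamma> t1 = (\<phi>2 \<xi>, 0)" using arg_cong[OF t1(3), of refl] by simp
    then show "\<exists>t1. a < t1 \<and> t1 \<le> a + Tm \<and> \<gamma> t1 = (\<phi>2 \<xi>, 0) \<and> (\<forall>t\<in>{a..t1}. refl (\<gamma> t) \<in> lo.oarc \<xi>)"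
      using t1(1,2,4) by blast
  qed
qed

lemma A_compact:
  assumes "0 < \<alpha>" "\<beta> < rr" shows "compact (A {\<alpha>..\<beta>})"
proof -
  have "A {\<alpha>..\<beta>} = (\<Union>\<xi>\<in>{\<alpha>..\<beta>}. up.oarc \<xi>) \<union> refl ` (\<Union>\<xi>\<in>{\<alpha>..\<beta>}. lo.oarc \<xi>)"
    unfolding A_def set_eq_iff Un_iff refl_image_iff by blast
  moreover have "compact (\<Union>\<xi>\<in>{\<alpha>..\<beta>}. up.oarc \<xi>)" by (rule up.arcs_compact) (use assms rr in auto)
  moreover have "compact (\<Union>\<xi>\<in>{\<alpha>..\<beta>}. lo.oarc \<xi>)" by (rule lo.arcs_compact) (use assms rr in auto)
  then have "compact (refl ` (\<Union>\<xi>\<in>{\<alpha>..\<beta>}. lo.oarc \<xi>))"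
    by (rule compact_continuous_image[OF linear_continuous_on[OF refl_linear]])
  ultimately show ?thesis by (simp only: compact_Un)
qed

text \<open>By \<open>A_cases\<close> and the crossing directions, a solution in the set follows one
  arc of the set for a short time; \<open>closed_continuation\<close> does the rest.\<close>

lemma invariant:
  assumes \<alpha>\<beta>: "0 < \<alpha>" "\<beta> < rr / 4" and PS: "\<And>x. x \<in> {\<alpha>..\<beta>} \<Longrightarrow> P x \<in> {\<alpha>..\<beta>}"
    and \<gamma>: "filippov_solution Z {a..c} \<gamma>" and a: "\<gamma> a \<in> A {\<alpha>..\<beta>}" and t: "t \<in> {a..c}"
  shows "\<gamma> t \<in> A {\<alpha>..\<beta>}"
proof (rule closed_continuation[OF filippov_continuous[OF \<gamma>] compact_imp_closed a _ t])
  show "compact (A {\<alpha>..\<beta>})" by (rule A_compact) (use \<alpha>\<beta> rr in auto)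
  fix t assume t: "a \<le> t" "t < c" "\<gamma> t \<in> A {\<alpha>..\<beta>}"
  have S: "{\<alpha>..\<beta>} \<subseteq> {0<..<rr/4}" using \<alpha>\<beta> by auto
  have \<gamma>t: "filippov_solution Z {t..c} \<gamma>" by (rule filippov_subset[OF \<gamma>]) (use t in auto)
  have sub: "filippov_solution Z {t..s} \<gamma>" if "s \<le> c" for s by (rule filippov_subset[OF \<gamma>t]) (use that in auto)
  show "\<exists>d>0. \<forall>s. t < s \<longrightarrow> s < t + d \<longrightarrow> s \<le> c \<longrightarrow> \<gamma> s \<in> A {\<alpha>..\<beta>}"
  proof (rule A_cases[OF S PS t(3)])
    fix \<xi> assume \<xi>S: "\<xi> \<in> {\<alpha>..\<beta>}" and u: "\<gamma> t \<in> up.oarc \<xi>" "0 < snd (\<gamma> t) \<or> \<gamma> t = (\<phi>1 \<xi>, 0)"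
    have \<xi>: "0 < \<xi>" "\<xi> < rr" using \<xi>S \<alpha>\<beta> rr by auto
    have "rises \<gamma> t c" by (rule rises_up[OF \<gamma>t less_imp_le[OF t(2)] \<xi> u(2)])
    then obtain d where d: "d > 0" "\<And>s. t < s \<Longrightarrow> s < t + d \<Longrightarrow> s \<le> c \<Longrightarrow> 0 < snd (\<gamma> s)" unfolding rises_def by blast
    have "\<gamma> s \<in> A {\<alpha>..\<beta>}" if s: "t < s" "s < t + d" "s \<le> c" for s
    proof (rule A_up[OF \<xi>S])
      show "\<gamma> s \<in> up.oarc \<xi>"
        by (rule up_phase[OF sub[OF s(3)] \<xi> u(1)]) (use d(2) s less_imp_le[OF d(2)[OF s]] in auto)
    qed
    then show ?thesis using d(1) by blast
  next
    fix \<xi> assume \<xi>S: "\<xi> \<in> {\<alpha>..\<beta>}" and u: "refl (\<gamma> t) \<in> lo.oarc \<xi>" "snd (\<gamma> t) < 0 \<or> \<gamma> t = (\<xi>, 0)"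
    have \<xi>: "0 < \<xi>" "\<xi> < rr" "\<xi> < sw.rr" using \<xi>S \<alpha>\<beta> rr by (auto simp: sw_rr)
    have "rises (\<lambda>t. refl (\<gamma> t)) t c" by (rule rises_down[OF \<gamma>t less_imp_le[OF t(2)] \<xi>(1,2) u(2)])
    then obtain d where d: "d > 0" "\<And>s. t < s \<Longrightarrow> s < t + d \<Longrightarrow> s \<le> c \<Longrightarrow> 0 < snd (refl (\<gamma> s))" unfolding rises_def by blast
    have "\<gamma> s \<in> A {\<alpha>..\<beta>}" if s: "t < s" "s < t + d" "s \<le> c" for s
    proof (rule A_lo[OF \<xi>S])
      show "refl (\<gamma> s) \<in> lo.oarc \<xi>"
        by (rule sw.up_phase[OF filippov_refl[OF sub[OF s(3)]] \<xi>(1,3) u(1)])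
          (use d(2) s less_imp_le[OF d(2)[OF s]] in auto)
    qed
    then show ?thesis using d(1) by blast
  qed
qed

text \<open>The time bound is the same for all invariant \<open>S\<close>, so the lemma can be
  iterated on shrinking intervals. The target \<open>(\<phi>2 \<xi>, 0)\<close> is the entry of the
  upper arc of parameter \<open>P \<xi>\<close>: there one application of \<open>P\<close> is
  gained.\<close>

lemma turn:
  "\<exists>Tm>0. \<forall>S \<gamma> a c. S \<subseteq> {0<..<rr/4} \<longrightarrow> (\<forall>x\<in>S. P x \<in> S) \<longrightarrow> filippov_solution Z {a..c} \<gamma> \<longrightarrow> \<gamma> a \<in> A S \<longrightarrow>
     a + Tm \<le> c \<longrightarrow> (\<exists>t1 \<xi>. \<xi> \<in> S \<and> a \<le> t1 \<and> t1 \<le> a + Tm \<and> \<gamma> t1 = (\<phi>2 \<xi>, 0))"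
proof -
  obtain Tu where Tu: "Tu > 0" and U: "\<forall>\<gamma> a c \<xi>. filippov_solution Z {a..c} \<gamma> \<longrightarrow> 0 < \<xi> \<longrightarrow> \<xi> < rr \<longrightarrow> \<gamma> a \<in> up.oarc \<xi> \<longrightarrow> rises \<gamma> a c \<longrightarrow>
     a + Tu \<le> c \<longrightarrow> (\<exists>t1. a < t1 \<and> t1 \<le> a + Tu \<and> \<gamma> t1 = (up.exit \<xi>, 0) \<and> (\<forall>t\<in>{a..t1}. \<gamma> t \<in> up.oarc \<xi>))"
    using up_pass by blast
  obtain Td where Td: "Td > 0" and D: "\<forall>\<gamma> a c \<xi>. filippov_solution Z {a..c} \<gamma> \<longrightarrow> 0 < \<xi> \<longrightarrow> \<xi> < rr \<longrightarrow> refl (\<gamma> a) \<in> lo.oarc \<xi> \<longrightarrow>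
     rises (\<lambda>t. refl (\<gamma> t)) a c \<longrightarrow> a + Td \<le> c \<longrightarrow>
     (\<exists>t1. a < t1 \<and> t1 \<le> a + Td \<and> \<gamma> t1 = (\<phi>2 \<xi>, 0) \<and> (\<forall>t\<in>{a..t1}. refl (\<gamma> t) \<in> lo.oarc \<xi>))"
    using down_pass by blast
  show ?thesis
  proof (rule exI[of _ "Tu + Td"], intro conjI allI impI)
    show "0 < Tu + Td" using Tu Td by simp
    fix S \<gamma> a c
    assume S: "S \<subseteq> {0<..<rr/4}" and PS: "\<forall>x\<in>S. P x \<in> S" and \<gamma>: "filippov_solution Z {a..c} \<gamma>" and a: "\<gamma> a \<in> A S"
      and ac: "a + (Tu + Td) \<le> c"
    have down: "\<exists>t1. s \<le> t1 \<and> t1 \<le> s + Td \<and> \<gamma> t1 = (\<phi>2 \<xi>, 0)"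
      if s: "a \<le> s" "s \<le> a + Tu" and \<xi>S: "\<xi> \<in> S" and l: "refl (\<gamma> s) \<in> lo.oarc \<xi>" "snd (\<gamma> s) < 0 \<or> \<gamma> s = (\<xi>, 0)" for s \<xi>
    proof -
      have \<xi>: "0 < \<xi>" "\<xi> < rr" using \<xi>S S rr by auto
      have sc: "s \<le> c" "s + Td \<le> c" using s ac Td by auto
      have \<gamma>s: "filippov_solution Z {s..c} \<gamma>" by (rule filippov_subset[OF \<gamma>]) (use s in auto)
      have ri: "rises (\<lambda>t. refl (\<gamma> t)) s c" by (rule rises_down[OF \<gamma>s sc(1) \<xi> l(2)])
      from D[rule_format, OF \<gamma>s \<xi> l(1) ri sc(2)] obtain t1 where "s < t1" "t1 \<le> s + Td" "\<gamma> t1 = (\<phi>2 \<xi>, 0)" by blast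
      then show ?thesis by (intro exI[of _ t1]) simp
    qed
    show "\<exists>t1 \<xi>. \<xi> \<in> S \<and> a \<le> t1 \<and> t1 \<le> a + (Tu + Td) \<and> \<gamma> t1 = (\<phi>2 \<xi>, 0)"
    proof (rule A_cases[OF S PS[rule_format] a])
      fix \<xi> assume \<xi>S: "\<xi> \<in> S" and u: "\<gamma> a \<in> up.oarc \<xi>" "0 < snd (\<gamma> a) \<or> \<gamma> a = (\<phi>1 \<xi>, 0)"
      have \<xi>: "0 < \<xi>" "\<xi> < rr" using \<xi>S S rr by auto
      have ac': "a \<le> c" "a + Tu \<le> c" using ac Tu Td by auto
      have ri: "rises \<gamma> a c" by (rule rises_up[OF \<gamma> ac'(1) \<xi> u(2)])
      from U[rule_format, OF \<gamma> \<xi> u(1) ri ac'(2)] obtain s where s: "a < s" "s \<le> a + Tu" "\<gamma> s = (\<xi>, 0)" unfolding entries by blast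
      have "refl (\<gamma> s) \<in> lo.oarc \<xi>" using lo.arc_ends(2)[OF \<xi>(1)] \<xi>(2) rr s(3) by simp
      from down[OF less_imp_le[OF s(1)] s(2) \<xi>S this disjI2[OF s(3)]] obtain t1 where "s \<le> t1" "t1 \<le> s + Td" "\<gamma> t1 = (\<phi>2 \<xi>, 0)" by blast
      then show ?thesis using s \<xi>S by (intro exI[of _ t1] exI[of _ \<xi>]) simp
    next
      fix \<xi> assume \<xi>S: "\<xi> \<in> S" and l: "refl (\<gamma> a) \<in> lo.oarc \<xi>" "snd (\<gamma> a) < 0 \<or> \<gamma> a = (\<xi>, 0)"
      from down[OF _ _ \<xi>S l] Tu obtain t1 where "a \<le> t1" "t1 \<le> a + Td" "\<gamma> t1 = (\<phi>2 \<xi>, 0)" by auto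
      then show ?thesis using Tu \<xi>S by (intro exI[of _ t1] exI[of _ \<xi>]) simp
    qed
  qed
qed

lemma entry_point: "0 < \<xi> \<Longrightarrow> \<xi> < rr / 4 \<Longrightarrow> (\<phi>2 \<xi>, 0) \<in> up.oarc (P \<xi>)"
  using up.arc_ends(1)[of "P \<xi>"] P_props[of \<xi>] rr by simp

text \<open>Brought by \<open>turn\<close> to the entry of the upper arc, the solution then runs
  through the whole upper and the whole lower arc. This identifies any closed orbit inside the cycle
  with the cycle.\<close>

lemma covers:
  "\<exists>Tm>0. \<forall>x \<gamma> a c. 0 < x \<longrightarrow> x < rr / 4 \<longrightarrow> P x = x \<longrightarrow> filippov_solution Z {a..c} \<gamma> \<longrightarrow> \<gamma> a \<in> A {x} \<longrightarrow> a + Tm \<le> c \<longrightarrow>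
     A {x} \<subseteq> \<gamma> ` {a..c}"
proof -
  obtain Tu where Tu: "Tu > 0" and U: "\<forall>\<gamma> a c \<xi>. filippov_solution Z {a..c} \<gamma> \<longrightarrow> 0 < \<xi> \<longrightarrow> \<xi> < rr \<longrightarrow> \<gamma> a \<in> up.oarc \<xi> \<longrightarrow> rises \<gamma> a c \<longrightarrow>
     a + Tu \<le> c \<longrightarrow> (\<exists>t1. a < t1 \<and> t1 \<le> a + Tu \<and> \<gamma> t1 = (up.exit \<xi>, 0) \<and> (\<forall>t\<in>{a..t1}. \<gamma> t \<in> up.oarc \<xi>))"
    using up_pass by blast
  obtain Td where Td: "Td > 0" and D: "\<forall>\<gamma> a c \<xi>. filippov_solution Z {a..c} \<gamma> \<longrightarrow> 0 < \<xi> \<longrightarrow> \<xi> < rr \<longrightarrow> refl (\<gamma> a) \<in> lo.oarc \<xi> \<longrightarrow>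
     rises (\<lambda>t. refl (\<gamma> t)) a c \<longrightarrow> a + Td \<le> c \<longrightarrow>
     (\<exists>t1. a < t1 \<and> t1 \<le> a + Td \<and> \<gamma> t1 = (\<phi>2 \<xi>, 0) \<and> (\<forall>t\<in>{a..t1}. refl (\<gamma> t) \<in> lo.oarc \<xi>))"
    using down_pass by blast
  obtain Tt where Tt: "Tt > 0" and T: "\<forall>S \<gamma> a c. S \<subseteq> {0<..<rr/4} \<longrightarrow> (\<forall>x\<in>S. P x \<in> S) \<longrightarrow> filippov_solution Z {a..c} \<gamma> \<longrightarrow> \<gamma> a \<in> A S \<longrightarrow>
     a + Tt \<le> c \<longrightarrow> (\<exists>t1 \<xi>. \<xi> \<in> S \<and> a \<le> t1 \<and> t1 \<le> a + Tt \<and> \<gamma> t1 = (\<phi>2 \<xi>, 0))"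
    using turn by blast
  show ?thesis
  proof (rule exI[of _ "Tt + Tu + Td"], intro conjI allI impI)
    show "0 < Tt + Tu + Td" using Tt Tu Td by simp
    fix x \<gamma> a c
    assume x: "0 < x" "x < rr/4" and Px: "P x = x" and \<gamma>: "filippov_solution Z {a..c} \<gamma>" and a: "\<gamma> a \<in> A {x}"
      and ac: "a + (Tt + Tu + Td) \<le> c"
    have xr: "x < rr" "x < r1" "x < r2" using x rr by auto
    have S1: "{x} \<subseteq> {0<..<rr/4}" using x by auto
    have S2: "P y \<in> {x}" if "y \<in> {x}" for y using that Px by simp
    have cx: "a + Tt \<le> c" using ac Tu Td by simp
    from T[rule_format, OF S1 S2 \<gamma> a cx]
    obtain t1 where t1: "a \<le> t1" "t1 \<le> a + Tt" "\<gamma> t1 = (\<phi>2 x, 0)" by auto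
    have e1: "\<gamma> t1 = (\<phi>1 x, 0)" using t1(3) P_props(4)[OF x] Px by simp
    have \<gamma>1: "filippov_solution Z {t1..c} \<gamma>" by (rule filippov_subset[OF \<gamma>]) (use t1 in auto)
    have c1: "t1 \<le> c" "t1 + Tu \<le> c" using t1 ac Tu Td by auto
    have ri1: "rises \<gamma> t1 c" by (rule rises_up[OF \<gamma>1 c1(1) x(1) xr(1) disjI2[OF e1]])
    have "\<gamma> t1 \<in> up.oarc x" using up.arc_ends(1)[OF x(1) xr(2)] e1 by simp
    from U[rule_format, OF \<gamma>1 x(1) xr(1) this ri1 c1(2)] obtain t2 where
      t2: "t1 < t2" "t2 \<le> t1 + Tu" "\<gamma> t2 = (x, 0)" "\<forall>t\<in>{t1..t2}. \<gamma> t \<in> up.oarc x" unfolding entries by blast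
    have \<gamma>2: "filippov_solution Z {t2..c} \<gamma>" by (rule filippov_subset[OF \<gamma>]) (use t1 t2 in auto)
    have c2: "t2 \<le> c" "t2 + Td \<le> c" using t1 t2 ac Td by auto
    have ri2: "rises (\<lambda>t. refl (\<gamma> t)) t2 c" by (rule rises_down[OF \<gamma>2 c2(1) x(1) xr(1) disjI2[OF t2(3)]])
    have "refl (\<gamma> t2) \<in> lo.oarc x" using lo.arc_ends(2)[OF x(1) xr(3)] t2(3) by simp
    from D[rule_format, OF \<gamma>2 x(1) xr(1) this ri2 c2(2)] obtain t3 where
      t3: "t2 < t3" "t3 \<le> t2 + Td" "\<gamma> t3 = (\<phi>2 x, 0)" "\<forall>t\<in>{t2..t3}. refl (\<gamma> t) \<in> lo.oarc x" by blast
    have up: "up.oarc x \<subseteq> \<gamma> ` {t1..t2}"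
    proof (rule up.arc_cover[OF x(1) xr(2)])
      show "continuous_on {t1..t2} \<gamma>"
        by (rule continuous_on_subset[OF filippov_continuous[OF \<gamma>1]]) (use c2 in auto)
      show "\<gamma> t \<in> up.oarc x" if "t \<in> {t1..t2}" for t by (rule bspec[OF t2(4) that])
      show "\<gamma> t1 = (up.entry x, 0)" "\<gamma> t2 = (up.exit x, 0)" using e1 t2(3) by (simp_all add: entries)
    qed (use t2 in simp)
    have lo: "lo.oarc x \<subseteq> (\<lambda>t. refl (\<gamma> t)) ` {t2..t3}"
    proof (rule sw.up.arc_cover[OF x(1) xr(3)])
      have "continuous_on {t2..t3} \<gamma>"
        by (rule continuous_on_subset[OF filippov_continuous[OF \<gamma>2]]) (use c2 t3 in auto)
      then show "continuous_on {t2..t3} (\<lambda>t. refl (\<gamma> t))" by (rule bounded_linear.continuous_on[OF refl_linear])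
      show "refl (\<gamma> t) \<in> lo.oarc x" if "t \<in> {t2..t3}" for t by (rule bspec[OF t3(4) that])
      show "refl (\<gamma> t2) = (sw.up.entry x, 0)" "refl (\<gamma> t3) = (sw.up.exit x, 0)" using t2(3) t3(3) by (simp_all add: entries)
    qed (use t3 in simp)
    have s1: "{t1..t2} \<subseteq> {a..c}" "{t2..t3} \<subseteq> {a..c}" using t1 t2 t3 ac Tt Tu Td by auto
    show "A {x} \<subseteq> \<gamma> ` {a..c}"
    proof
      fix p assume "p \<in> A {x}"
      then consider "p \<in> up.oarc x" | "refl p \<in> lo.oarc x" unfolding A_def by blast
      then show "p \<in> \<gamma> ` {a..c}"
      proof cases
        case 1
        then show ?thesis using up s1(1) by blast
      next
        case 2
        then obtain t where t: "t \<in> {t2..t3}" "refl p = refl (\<gamma> t)" using lo by blast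
        have "p = \<gamma> t" using arg_cong[OF t(2), of refl] by simp
        then show ?thesis using t(1) s1(2) by blast
      qed
    qed
  qed
qed

lemma loop:
  assumes x: "0 < x" "x < rr / 4"
  obtains T1 T \<gamma> where "0 < T1" "T1 < T" "filippov_solution Z {0..T} \<gamma>" "\<gamma> 0 = (x, 0)" "\<gamma> T = (P x, 0)" "\<gamma> T1 = (\<phi>2 x, 0)"
    "\<forall>t. 0 < t \<longrightarrow> t < T1 \<longrightarrow> snd (\<gamma> t) < 0" "\<forall>t. T1 < t \<longrightarrow> t < T \<longrightarrow> 0 < snd (\<gamma> t)"
    "\<forall>t\<in>{0..T1}. refl (\<gamma> t) \<in> lo.oarc x" "\<forall>t\<in>{T1..T}. \<gamma> t \<in> up.oarc (P x)"
    "inj_on \<gamma> {0..T1}" "inj_on \<gamma> {T1..T}"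
proof -
  have xr: "x < sw.rr" using x rr by (simp add: sw_rr)
  obtain T1 \<alpha> where \<alpha>: "0 < T1" "filippov_solution (refl_system Z) {0..T1} \<alpha>" "\<alpha> 0 = (sw.up.entry x, 0)" "\<alpha> T1 = (sw.up.exit x, 0)"
    "\<forall>t\<in>{0..T1}. \<alpha> t \<in> lo.oarc x" "\<forall>t. 0 < t \<longrightarrow> t < T1 \<longrightarrow> 0 < snd (\<alpha> t)" "inj_on \<alpha> {0..T1}"
    by (rule sw.up_arc_filippov[OF x(1) xr])
  have Px: "0 < P x" "P x < rr" using P_props[OF x] by auto
  obtain T2 \<beta> where \<beta>: "0 < T2" "filippov_solution Z {0..T2} \<beta>" "\<beta> 0 = (up.entry (P x), 0)" "\<beta> T2 = (up.exit (P x), 0)"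
    "\<forall>t\<in>{0..T2}. \<beta> t \<in> up.oarc (P x)" "\<forall>t. 0 < t \<longrightarrow> t < T2 \<longrightarrow> 0 < snd (\<beta> t)" "inj_on \<beta> {0..T2}"
    by (rule up_arc_filippov[OF Px])
  have l: "filippov_solution Z {0..T1} (\<lambda>t. refl (\<alpha> t))" using filippov_refl[OF \<alpha>(2)] by simp
  define \<gamma> where "\<gamma> t = (if t \<le> T1 then refl (\<alpha> t) else \<beta> (t - T1))" for t
  have j: "refl (\<alpha> T1) = \<beta> 0" using \<alpha>(4) \<beta>(3) P_props(4)[OF x] by (simp add: entries)
  have \<gamma>a: "\<gamma> t = refl (\<alpha> t)" if "t \<le> T1" for t using that by (simp add: \<gamma>_def)
  have \<gamma>b: "\<gamma> t = \<beta> (t - T1)" if "T1 \<le> t" for t using that j by (auto simp: \<gamma>_def)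
  show thesis
  proof (rule that[of T1 "T1 + T2" \<gamma>])
    show "0 < T1" "T1 < T1 + T2" using \<alpha>(1) \<beta>(1) by auto
    show "filippov_solution Z {0..T1 + T2} \<gamma>"
      unfolding \<gamma>_def by (rule filippov_concat[OF l \<beta>(2) _ _ j]) (use \<alpha>(1) \<beta>(1) in auto)
    show "\<gamma> 0 = (x, 0)" "\<gamma> T1 = (\<phi>2 x, 0)" using \<gamma>a[of 0] \<gamma>a[of T1] \<alpha>(1,3,4) by (simp_all add: entries)
    show "\<gamma> (T1 + T2) = (P x, 0)" using \<gamma>b[of "T1 + T2"] \<beta>(1,4) by (simp add: entries)
    show "\<forall>t. 0 < t \<longrightarrow> t < T1 \<longrightarrow> snd (\<gamma> t) < 0" using \<alpha>(6) \<gamma>a by simp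
    show "\<forall>t. T1 < t \<longrightarrow> t < T1 + T2 \<longrightarrow> 0 < snd (\<gamma> t)" using \<beta>(6) \<gamma>b by simp
    show "\<forall>t\<in>{0..T1}. refl (\<gamma> t) \<in> lo.oarc x" using \<alpha>(5) \<gamma>a by simp
    show "\<forall>t\<in>{T1..T1 + T2}. \<gamma> t \<in> up.oarc (P x)" using \<beta>(5) \<gamma>b by simp
    show "inj_on \<gamma> {0..T1}"
    proof (rule inj_onI)
      fix s t assume *: "s \<in> {0..T1}" "t \<in> {0..T1}" "\<gamma> s = \<gamma> t"
      then have "refl (refl (\<alpha> s)) = refl (refl (\<alpha> t))" using \<gamma>a by simp
      then show "s = t" using inj_onD[OF \<alpha>(7) _ *(1,2)] by simp
    qed
    show "inj_on \<gamma> {T1..T1 + T2}"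
    proof (rule inj_onI)
      fix s t assume *: "s \<in> {T1..T1 + T2}" "t \<in> {T1..T1 + T2}" "\<gamma> s = \<gamma> t"
      then have "\<beta> (s - T1) = \<beta> (t - T1)" using \<gamma>b by simp
      then have "s - T1 = t - T1" by (rule inj_onD[OF \<beta>(7)]) (use * in auto)
      then show "s = t" by simp
    qed
  qed
qed

text \<open>A solution from \<open>(x, 0)\<close> must go down and has no choice until it is back on
  the positive axis. The end time cannot lie before that, by the sign of \<open>x'\<close>, nor
  after it, since \<open>first_return\<close> forbids an earlier visit to that side.\<close>

lemma first_return_iff:
  assumes x: "0 < x" "x < rr / 4"
  shows "first_return Z x x' \<longleftrightarrow> x' = P x"
proof
  have xr: "x < rr" "x < r1" "x < r2" "x < sw.rr" using x rr by (auto simp: sw_rr)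
  assume "first_return Z x x'"
  then obtain \<gamma> T where T: "0 < T" and \<gamma>: "filippov_solution Z {0..T} \<gamma>" and e: "\<gamma> 0 = (x, 0)" "\<gamma> T = (x', 0)" and xx: "x * x' > 0"
    and nh: "\<forall>t\<in>{0<..<T}. \<not> (snd (\<gamma> t) = 0 \<and> x * fst (\<gamma> t) > 0)" unfolding first_return_def by blast
  let ?\<delta> = "\<lambda>t. refl (\<gamma> t)"
  have ri: "rises ?\<delta> 0 T" by (rule rises_down[OF \<gamma> less_imp_le[OF T] x(1) xr(1) disjI2[OF e(1)]])
  have a: "?\<delta> 0 \<in> lo.oarc x" using lo.arc_ends(2)[OF x(1) xr(3)] e by simp
  have "snd (?\<delta> T) \<le> 0" using e by simp
  then obtain t1 where t1: "0 < t1" "t1 \<le> T" "?\<delta> t1 = (sw.up.exit x, 0)"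
    by (rule sw.up_leave[OF filippov_refl[OF \<gamma>] x(1) xr(4) a ri T order_refl])
  have g1: "\<gamma> t1 = (\<phi>2 x, 0)" using arg_cong[OF t1(3), of refl] by (simp add: entries)
  have neg: "\<phi>2 x < 0" by (rule P_props(1)[OF x])
  have x'pos: "0 < x'" using xx x(1) by (simp add: zero_less_mult_iff)
  have t1T: "t1 < T" using t1(2) g1 e(2) neg x'pos by (cases "t1 = T") auto
  have Px: "0 < P x" "P x < rr" "P x < r1" using P_props[OF x] rr by auto
  have g1': "\<gamma> t1 = (\<phi>1 (P x), 0)" using g1 P_props(4)[OF x] by simp
  have \<gamma>1: "filippov_solution Z {t1..T} \<gamma>" by (rule filippov_subset[OF \<gamma>]) (use t1 in auto)
  have ri1: "rises \<gamma> t1 T" by (rule rises_up[OF \<gamma>1 t1(2) Px(1,2) disjI2[OF g1']])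
  have a1: "\<gamma> t1 \<in> up.oarc (P x)" using up.arc_ends(1)[OF Px(1,3)] g1' by simp
  have "snd (\<gamma> T) \<le> 0" using e by simp
  then obtain t2 where t2: "t1 < t2" "t2 \<le> T" "\<gamma> t2 = (up.exit (P x), 0)"
    by (rule up_leave[OF \<gamma>1 Px(1,2) a1 ri1 t1T order_refl])
  have "\<not> t2 < T"
  proof
    assume "t2 < T"
    then have "t2 \<in> {0<..<T}" using t1 t2 by simp
    from nh[rule_format, OF this] show False using t2(3) x Px by (simp add: entries)
  qed
  then have "t2 = T" using t2(2) by simp
  then show "x' = P x" using t2(3) e(2) by (simp add: entries)
next
  assume x': "x' = P x"
  obtain T1 T \<gamma> where \<gamma>: "0 < T1" "T1 < T" "filippov_solution Z {0..T} \<gamma>" "\<gamma> 0 = (x, 0)" "\<gamma> T = (P x, 0)" "\<gamma> T1 = (\<phi>2 x, 0)"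
    "\<forall>t. 0 < t \<longrightarrow> t < T1 \<longrightarrow> snd (\<gamma> t) < 0" "\<forall>t. T1 < t \<longrightarrow> t < T \<longrightarrow> 0 < snd (\<gamma> t)"
    by (rule loop[OF x])
  have "\<not> (snd (\<gamma> t) = 0 \<and> x * fst (\<gamma> t) > 0)" if t: "t \<in> {0<..<T}" for t
  proof (cases t T1 rule: linorder_cases)
    case less
    then show ?thesis using \<gamma>(7)[rule_format, of t] t by simp
  next
    case equal
    have "x * \<phi>2 x < 0" using P_props(1)[OF x] x by (simp add: mult_pos_neg)
    then show ?thesis using equal \<gamma>(6) by simp
  next
    case greater
    then show ?thesis using \<gamma>(8)[rule_format, of t] t by simp
  qed
  moreover have "0 < x * x'" using P_props(2)[OF x] x x' by simp
  moreover have "0 < T" using \<gamma>(1,2) by simp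
  ultimately show "first_return Z x x'" unfolding first_return_def
    using \<gamma>(3-5) x' by (intro exI[of _ \<gamma>] exI[of _ T]) simp
qed

lemma return_map_eq: "0 < x \<Longrightarrow> x < rr / 4 \<Longrightarrow> return_map Z x = P x"
  unfolding return_map_def by (rule the_equality) (simp_all add: first_return_iff)

text \<open>Over one period injectivity holds because each arc is run injectively and the sign of
  the height separates the two.\<close>

lemma closed_orbit_A:
  assumes x: "0 < x" "x < rr / 4" and Px: "P x = x"
  shows "closed_orbit Z (A {x})"
proof -
  obtain T1 T \<gamma> where \<gamma>: "0 < T1" "T1 < T" "filippov_solution Z {0..T} \<gamma>" "\<gamma> 0 = (x, 0)" "\<gamma> T = (P x, 0)" "\<gamma> T1 = (\<phi>2 x, 0)"
    "\<forall>t. 0 < t \<longrightarrow> t < T1 \<longrightarrow> snd (\<gamma> t) < 0" "\<forall>t. T1 < t \<longrightarrow> t < T \<longrightarrow> 0 < snd (\<gamma> t)"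
    "\<forall>t\<in>{0..T1}. refl (\<gamma> t) \<in> lo.oarc x" "\<forall>t\<in>{T1..T}. \<gamma> t \<in> up.oarc (P x)"
    "inj_on \<gamma> {0..T1}" "inj_on \<gamma> {T1..T}"
    by (rule loop[OF x])
  have T: "0 < T" using \<gamma> by simp
  define \<delta> where "\<delta> t = \<gamma> (t - T * \<lfloor>t / T\<rfloor>)" for t
  have \<delta>: "filippov_solution Z UNIV \<delta>"
    unfolding \<delta>_def by (rule filippov_periodic[OF \<gamma>(3) T]) (use \<gamma>(4,5) Px in simp)
  have per: "\<delta> (t + T) = \<delta> t" for t
  proof -
    have "(t + T) / T = t / T + 1" using T by (simp add: add_divide_distrib)
    then have "\<lfloor>(t + T) / T\<rfloor> = \<lfloor>t / T\<rfloor> + 1" by simp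
    then show ?thesis unfolding \<delta>_def by (simp add: algebra_simps)
  qed
  have eq: "\<delta> t = \<gamma> t" if "t \<in> {0..<T}" for t
  proof -
    have "\<lfloor>t / T\<rfloor> = 0" using that T by (simp add: floor_eq_iff)
    then show ?thesis by (simp add: \<delta>_def)
  qed
  have in0: "t - T * \<lfloor>t / T\<rfloor> \<in> {0..<T}" for t
    using floor_divide_lower[OF T, of t] floor_divide_upper[OF T, of t] by (simp add: algebra_simps)
  have lt: "\<gamma> s \<noteq> \<gamma> t" if st: "s \<in> {0..<T}" "t \<in> {0..<T}" "s < t" for s t
  proof -
    consider "t \<le> T1" | "T1 \<le> s" | "s < T1" "T1 < t" by linarith
    then show ?thesis
    proof cases
      case 1
      then show ?thesis using inj_onD[OF \<gamma>(11), of s t] st by auto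
    next
      case 2
      then show ?thesis using inj_onD[OF \<gamma>(12), of s t] st by auto
    next
      case 3
      have "0 < snd (\<gamma> t)" using \<gamma>(8)[rule_format, of t] 3 st by simp
      moreover have "snd (\<gamma> s) \<le> 0" using \<gamma>(7)[rule_format, of s] \<gamma>(4) 3 st by (cases "s = 0") auto
      ultimately show ?thesis by auto
    qed
  qed
  have inj: "inj_on \<delta> {0..<T}"
  proof (rule inj_onI)
    fix s t assume *: "s \<in> {0..<T}" "t \<in> {0..<T}" "\<delta> s = \<delta> t"
    then have "\<gamma> s = \<gamma> t" using eq by simp
    then show "s = t" using lt[OF *(1,2)] lt[OF *(2,1)] by (cases s t rule: linorder_cases) auto
  qed
  have sub: "\<gamma> t \<in> A {x}" if "t \<in> {0..T}" for t
  proof (cases "t \<le> T1")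
    case True
    then show ?thesis using A_lo[of x "{x}" "\<gamma> t"] bspec[OF \<gamma>(9), of t] that by simp
  next
    case False
    then show ?thesis using A_up[of x "{x}" "\<gamma> t"] bspec[OF \<gamma>(10), of t] that Px by simp
  qed
  have "range \<delta> \<subseteq> A {x}"
  proof
    fix p assume "p \<in> range \<delta>"
    then obtain t where "p = \<delta> t" by blast
    then show "p \<in> A {x}" using sub[of "t - T * \<lfloor>t / T\<rfloor>"] in0[of t] by (simp add: \<delta>_def)
  qed
  moreover have "A {x} \<subseteq> range \<delta>"
  proof -
    obtain Tm where Tm: "\<forall>x \<gamma> a c. 0 < x \<longrightarrow> x < rr / 4 \<longrightarrow> P x = x \<longrightarrow> filippov_solution Z {a..c} \<gamma> \<longrightarrow> \<gamma> a \<in> A {x} \<longrightarrow> a + Tm \<le> c \<longrightarrow>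
       A {x} \<subseteq> \<gamma> ` {a..c}" using covers by blast
    have "\<delta> 0 \<in> A {x}" using eq[of 0] sub[of 0] T by simp
    from Tm[rule_format, OF x Px filippov_subset[OF \<delta> subset_UNIV] this, of Tm] show ?thesis by auto
  qed
  ultimately have "A {x} = range \<delta>" by (rule antisym[rotated])
  then show ?thesis unfolding closed_orbit_def using T \<delta> per inj by (intro exI[of _ \<delta>] exI[of _ T]) simp
qed

end

section \<open>Neighbourhoods, stability and isolation of the cycle\<close>

context half_system
begin

lemma between_arcs:
  assumes "0 < \<alpha>" "\<alpha> < \<beta>" "\<beta> < r" "\<bar>fst p\<bar> < b0" "0 \<le> snd p" "g \<alpha> (fst p) < snd p" "snd p < g \<beta> (fst p)"
  shows "\<exists>\<xi>\<in>{\<alpha>..\<beta>}. p \<in> oarc \<xi>"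
proof -
  have "continuous_on {\<alpha>..\<beta>} (\<lambda>\<xi>. (\<lambda>(\<xi>, x). g \<xi> x) (\<xi>, fst p))"
    by (rule continuous_on_compose2[OF g_cont])
      (use assms in \<open>auto intro!: continuous_intros simp: abs_less_iff\<close>)
  then have c: "continuous_on {\<alpha>..\<beta>} (\<lambda>\<xi>. g \<xi> (fst p))" by simp
  obtain \<xi> where \<xi>: "\<alpha> \<le> \<xi>" "\<xi> \<le> \<beta>" "g \<xi> (fst p) = snd p"
    using IVT'[of "\<lambda>\<xi>. g \<xi> (fst p)" \<alpha> "snd p" \<beta>] assms c by auto
  have "p \<in> oarc \<xi>" by (rule arcI) (use \<xi> assms in auto)
  then show ?thesis using \<xi> by auto
qed

text \<open>Unlike the arcs, the graphs continue below \<Sigma>; this makes the strip an open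
  neighbourhood of the arcs in between, including their ends.\<close>

definition "strip \<alpha> \<beta> = {p. \<bar>fst p\<bar> < b0 \<and> g \<alpha> (fst p) < snd p \<and> snd p < g \<beta> (fst p)}"

lemma open_strip:
  assumes "0 < \<alpha>" "\<alpha> < r" "0 < \<beta>" "\<beta> < r" shows "open (strip \<alpha> \<beta>)"
proof -
  let ?B = "{p :: real \<times> real. \<bar>fst p\<bar> < b0}"
  have oB: "open ?B" by (intro open_Collect_less continuous_intros)
  have c: "continuous_on ?B (\<lambda>p. g \<xi> (fst p))" if "0 < \<xi>" "\<xi> < r" for \<xi>
    by (rule continuous_on_compose2[OF g_continuous[OF that]]) (auto intro!: continuous_intros simp: abs_less_iff)
  have "open (?B \<inter> (\<lambda>p. snd p - g \<alpha> (fst p)) -` {0<..})" "open (?B \<inter> (\<lambda>p. g \<beta> (fst p) - snd p) -` {0<..})"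
    by (intro continuous_open_preimage[OF _ oB] continuous_on_diff continuous_on_snd continuous_on_id c assms open_greaterThan)+
  from open_Int[OF this] have "open ((?B \<inter> (\<lambda>p. snd p - g \<alpha> (fst p)) -` {0<..}) \<inter> (?B \<inter> (\<lambda>p. g \<beta> (fst p) - snd p) -` {0<..}))" .
  also have "(?B \<inter> (\<lambda>p. snd p - g \<alpha> (fst p)) -` {0<..}) \<inter> (?B \<inter> (\<lambda>p. g \<beta> (fst p) - snd p) -` {0<..}) = strip \<alpha> \<beta>"
    by (auto simp: strip_def)
  finally show ?thesis .
qed

lemma arc_in_strip:
  assumes "0 < \<alpha>" "\<alpha> < \<xi>" "\<xi> < \<beta>" "\<beta> < r" "p \<in> oarc \<xi>" shows "p \<in> strip \<alpha> \<beta>"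
proof -
  have \<xi>: "0 < \<xi>" "\<xi> < r" using assms by auto
  note ar = arc_range[OF \<xi> assms(5)]
  show ?thesis
    using g_mono[OF assms(1,2) \<xi>(2) ar(2)] g_mono[OF \<xi>(1) assms(3,4) ar(2)] ar(2,6) by (simp add: strip_def)
qed

end

context clockwise
begin

lemma A_mono: "S \<subseteq> S' \<Longrightarrow> A S \<subseteq> A S'"
  unfolding A_def by blast

lemma A_range:
  assumes x: "0 < x" "x < rr" and p: "p \<in> A {x}" shows "norm p \<le> (2 + C1 + C2) * x"
proof -
  have xr: "x < r1" "x < r2" using x rr by auto
  have C: "0 \<le> C1 * x" "0 \<le> C2 * x" using up.C lo.C x by auto
  from p have "\<bar>fst p\<bar> \<le> 2 * x \<and> \<bar>snd p\<bar> \<le> C1 * x + C2 * x"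
    unfolding A_def using up.arc_range(1,3,5)[OF x(1) xr(1), of p] lo.arc_range(1,3,5)[OF x(1) xr(2), of "refl p"] C by auto
  moreover have "norm p \<le> \<bar>fst p\<bar> + \<bar>snd p\<bar>" using norm_Pair_le[of "fst p" "snd p"] by simp
  ultimately show ?thesis by (simp add: algebra_simps)
qed

lemma base_point: "0 < x \<Longrightarrow> x < rr \<Longrightarrow> (x, 0) \<in> A {x}"
  using up.arc_ends(2)[of x] rr A_up[of x "{x}"] by simp

lemma A_nbhd:
  assumes ab: "0 < \<alpha>" "\<alpha> < x" "x < \<beta>" "\<beta> < rr / 4" and Px: "P x = x"
  shows "\<exists>\<eta>>0. \<forall>p. infdist p (A {x}) < \<eta> \<longrightarrow> p \<in> A {\<alpha>..\<beta>}"
proof -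
  have x: "0 < x" "x < rr" "x < r1" "x < r2" "x < rr/4" using ab rr by auto
  have abr: "\<alpha> < r1" "\<beta> < r1" "\<alpha> < r2" "\<beta> < r2" "0 < \<beta>" "\<alpha> < \<beta>" using ab rr by auto
  \<comment> \<open>Points above \<Sigma> must lie in the upper strip, points below in the reflected
    lower strip, points of \<Sigma> in both. The two points of the cycle on \<Sigma> qualify because
    \<open>\<phi>1 x = \<phi>2 x\<close>.\<close>
  define U where "U = ({p. 0 < snd p} \<union> refl -` lo.strip \<alpha> \<beta>) \<inter> ({p. snd p < 0} \<union> up.strip \<alpha> \<beta>)"
  have e: "\<phi>1 x = \<phi>2 x" using P_props(4)[OF x(1,5)] Px by simp
  have "open U" unfolding U_def
  proof (intro open_Int open_Un)
    show "open {p :: real \<times> real. 0 < snd p}" "open {p :: real \<times> real. snd p < 0}"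
      by (intro open_Collect_less continuous_intros)+
    show "open (up.strip \<alpha> \<beta>)" by (rule up.open_strip) (use ab abr in auto)
    show "open (refl -` lo.strip \<alpha> \<beta>)"
      by (rule open_vimage[OF lo.open_strip linear_continuous_on[OF refl_linear]]) (use ab abr in auto)
  qed
  moreover have "A {x} \<subseteq> U"
  proof
    fix p assume "p \<in> A {x}"
    then consider "p \<in> up.oarc x" | "refl p \<in> lo.oarc x" unfolding A_def by blast
    then show "p \<in> U"
    proof cases
      case 1
      note ar = up.arc_range[OF x(1,3) 1]
      have s1: "p \<in> up.strip \<alpha> \<beta>" by (rule up.arc_in_strip[OF ab(1-3) abr(2) 1])
      show ?thesis
      proof (cases "snd p = 0")
        case True
        then have "refl p = (\<phi>2 x, 0) \<or> refl p = (x, 0)" using ar(7) e by (auto simp: prod_eq_iff)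
        then have "refl p \<in> lo.oarc x" using lo.arc_ends[OF x(1,4)] by auto
        then have "refl p \<in> lo.strip \<alpha> \<beta>" by (rule lo.arc_in_strip[OF ab(1-3) abr(4)])
        then show ?thesis using s1 by (simp add: U_def)
      next
        case False
        then show ?thesis using s1 ar(3) by (simp add: U_def)
      qed
    next
      case 2
      note ar = lo.arc_range[OF x(1,4) 2]
      have s1: "refl p \<in> lo.strip \<alpha> \<beta>" by (rule lo.arc_in_strip[OF ab(1-3) abr(4) 2])
      show ?thesis
      proof (cases "snd p = 0")
        case True
        then have "p = (\<phi>1 x, 0) \<or> p = (x, 0)" using ar(7) e by (auto simp: prod_eq_iff)
        then have "p \<in> up.oarc x" using up.arc_ends[OF x(1,3)] by auto
        then have "p \<in> up.strip \<alpha> \<beta>" by (rule up.arc_in_strip[OF ab(1-3) abr(2)])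
        then show ?thesis using s1 by (simp add: U_def)
      next
        case False
        then show ?thesis using s1 ar(3) by (simp add: U_def)
      qed
    qed
  qed
  moreover have cA: "compact (A {x})" using A_compact[OF x(1,2)] by simp
  ultimately obtain \<eta> where \<eta>: "\<eta> > 0" "(\<Union>q\<in>A {x}. ball q \<eta>) \<subseteq> U"
    using compact_subset_open_imp_ball_epsilon_subset[of "A {x}" U] by metis
  have UA: "U \<subseteq> A {\<alpha>..\<beta>}"
  proof
    fix p assume p: "p \<in> U"
    show "p \<in> A {\<alpha>..\<beta>}"
    proof (cases "snd p < 0")
      case True
      then have "refl p \<in> lo.strip \<alpha> \<beta>" using p by (simp add: U_def)
      then have "\<exists>\<xi>\<in>{\<alpha>..\<beta>}. refl p \<in> lo.oarc \<xi>"
        using lo.between_arcs[OF ab(1) abr(6,4), of "refl p"] True by (simp add: lo.strip_def)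
      then show ?thesis unfolding A_def by blast
    next
      case False
      then have "p \<in> up.strip \<alpha> \<beta>" using p by (simp add: U_def)
      then have "\<exists>\<xi>\<in>{\<alpha>..\<beta>}. p \<in> up.oarc \<xi>"
        using up.between_arcs[OF ab(1) abr(6,2), of p] False by (simp add: up.strip_def)
      then show ?thesis unfolding A_def by blast
    qed
  qed
  have ne: "A {x} \<noteq> {}" using base_point[OF x(1,2)] by blast
  show ?thesis
  proof (rule exI[of _ \<eta>], intro conjI allI impI \<eta>(1))
    fix p assume p: "infdist p (A {x}) < \<eta>"
    obtain q where "q \<in> A {x}" "infdist p (A {x}) = dist p q"
      using infdist_attains_inf[OF compact_imp_closed[OF cA] ne] by metis
    then have "p \<in> (\<Union>q\<in>A {x}. ball q \<eta>)" using p by (auto simp: dist_commute)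
    then show "p \<in> A {\<alpha>..\<beta>}" using \<eta>(2) UA by blast
  qed
qed

text \<open>Otherwise the nested compact sets \<open>F n\<close> have a common point off the cycle.
  It lies on at most one upper and one lower arc, so the parameters of the arcs through it keep a
  positive distance from \<open>x\<close>, which contradicts its membership in arbitrarily thin
  annuli.\<close>

lemma A_shrinks:
  assumes x: "0 < x - \<epsilon>0" "x + \<epsilon>0 < rr / 4" "0 < \<epsilon>0" and e: "0 < e"
  shows "\<exists>\<epsilon>>0. \<epsilon> \<le> \<epsilon>0 \<and> (\<forall>p\<in>A {x - \<epsilon>..x + \<epsilon>}. infdist p (A {x}) < e)"
proof (rule ccontr)
  assume no: "\<not> ?thesis"
  have xr: "0 < x" "x < rr" using x rr by auto
  define \<epsilon> where "\<epsilon> n = \<epsilon>0 / real (Suc n)" for n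
  have \<epsilon>: "0 < \<epsilon> n" "\<epsilon> n \<le> \<epsilon>0" for n using x(3) by (auto simp: \<epsilon>_def field_simps)
  define F where "F n = A {x - \<epsilon> n..x + \<epsilon> n} \<inter> {p. e \<le> infdist p (A {x})}" for n
  have "\<Inter> (range F) \<noteq> {}"
  proof (rule compact_nest)
    fix n
    have "compact (A {x - \<epsilon> n..x + \<epsilon> n})" by (rule A_compact) (use x rr \<epsilon>[of n] in auto)
    moreover have "closed {p. e \<le> infdist p (A {x})}" by (intro closed_Collect_le continuous_intros)
    ultimately show "compact (F n)" unfolding F_def by (rule compact_Int_closed)
    show "F n \<noteq> {}" using no \<epsilon>[of n] unfolding F_def by (auto simp: not_less)
  next
    fix m n :: nat assume "m \<le> n"
    then have "\<epsilon> n \<le> \<epsilon> m" using x(3) by (simp add: \<epsilon>_def frac_le)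
    then have "{x - \<epsilon> n..x + \<epsilon> n} \<subseteq> {x - \<epsilon> m..x + \<epsilon> m}" by auto
    from A_mono[OF this] show "F n \<subseteq> F m" unfolding F_def by blast
  qed
  then obtain p where p: "\<And>n. p \<in> F n" by blast
  have "infdist p (A {x}) > 0" using p[of 0] e by (simp add: F_def)
  then have pA: "p \<notin> A {x}" by auto
  have "\<exists>d>0. \<forall>\<xi>. 0 < \<xi> \<longrightarrow> \<xi> < r1 \<longrightarrow> p \<in> up.oarc \<xi> \<longrightarrow> d \<le> \<bar>\<xi> - x\<bar>"
  proof (cases "\<exists>\<xi>. 0 < \<xi> \<and> \<xi> < r1 \<and> p \<in> up.oarc \<xi>")
    case True
    then obtain \<xi> where \<xi>: "0 < \<xi>" "\<xi> < r1" "p \<in> up.oarc \<xi>" by blast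
    then have "\<xi> \<noteq> x" using pA A_up by blast
    moreover have "\<bar>\<xi> - x\<bar> \<le> \<bar>\<zeta> - x\<bar>" if "0 < \<zeta>" "\<zeta> < r1" "p \<in> up.oarc \<zeta>" for \<zeta>
      using up.arc_unique[OF \<xi>(1,2) that(1,2) \<xi>(3) that(3)] by simp
    ultimately show ?thesis by (intro exI[of _ "\<bar>\<xi> - x\<bar>"]) simp
  qed (auto intro: exI[of _ 1])
  then obtain d1 where d1: "d1 > 0" "\<And>\<xi>. 0 < \<xi> \<Longrightarrow> \<xi> < r1 \<Longrightarrow> p \<in> up.oarc \<xi> \<Longrightarrow> d1 \<le> \<bar>\<xi> - x\<bar>" by blast
  have "\<exists>d>0. \<forall>\<xi>. 0 < \<xi> \<longrightarrow> \<xi> < r2 \<longrightarrow> refl p \<in> lo.oarc \<xi> \<longrightarrow> d \<le> \<bar>\<xi> - x\<bar>"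
  proof (cases "\<exists>\<xi>. 0 < \<xi> \<and> \<xi> < r2 \<and> refl p \<in> lo.oarc \<xi>")
    case True
    then obtain \<xi> where \<xi>: "0 < \<xi>" "\<xi> < r2" "refl p \<in> lo.oarc \<xi>" by blast
    then have "\<xi> \<noteq> x" using pA A_lo by blast
    moreover have "\<bar>\<xi> - x\<bar> \<le> \<bar>\<zeta> - x\<bar>" if "0 < \<zeta>" "\<zeta> < r2" "refl p \<in> lo.oarc \<zeta>" for \<zeta>
      using lo.arc_unique[OF \<xi>(1,2) that(1,2) \<xi>(3) that(3)] by simp
    ultimately show ?thesis by (intro exI[of _ "\<bar>\<xi> - x\<bar>"]) simp
  qed (auto intro: exI[of _ 1])
  then obtain d2 where d2: "d2 > 0" "\<And>\<xi>. 0 < \<xi> \<Longrightarrow> \<xi> < r2 \<Longrightarrow> refl p \<in> lo.oarc \<xi> \<Longrightarrow> d2 \<le> \<bar>\<xi> - x\<bar>" by blast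
  have "\<epsilon> \<longlonglongrightarrow> 0" unfolding \<epsilon>_def using tendsto_mult[OF tendsto_const LIMSEQ_inverse_real_of_nat, of \<epsilon>0]
    by (simp add: divide_inverse)
  then have "\<forall>\<^sub>F n in sequentially. \<epsilon> n < min d1 d2" by (rule order_tendstoD(2)) (use d1 d2 in simp)
  then obtain n where n: "\<epsilon> n < d1" "\<epsilon> n < d2" by (auto simp: eventually_sequentially)
  from p[of n] obtain \<xi> where \<xi>: "\<xi> \<in> {x - \<epsilon> n..x + \<epsilon> n}" "p \<in> up.oarc \<xi> \<or> refl p \<in> lo.oarc \<xi>"
    unfolding F_def A_def by blast
  have "\<bar>\<xi> - x\<bar> \<le> \<epsilon> n" using \<xi>(1) by (simp add: abs_le_iff)
  moreover have "0 < \<xi>" "\<xi> < r1" "\<xi> < r2" using \<xi>(1) \<epsilon>[of n] x rr by auto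
  ultimately show False using \<xi>(2) d1(2)[of \<xi>] d2(2)[of \<xi>] n by linarith
qed

text \<open>Some solutions come from a fixed distance arbitrarily close to the cycle. Read backwards
  in time they start close to it and get away, which shows that the time-reversed system is not
  stable.\<close>

definition expels :: "real \<Rightarrow> bool" where
  "expels x \<longleftrightarrow> (\<exists>e>0. \<forall>\<eta>>0. \<exists>\<gamma> T. 0 \<le> T \<and> filippov_solution Z {0..T} \<gamma> \<and>
     infdist (\<gamma> T) (A {x}) < \<eta> \<and> e \<le> infdist (\<gamma> 0) (A {x}))"

text \<open>The interval of radius \<epsilon> about \<open>x\<close> is mapped into the one of
  radius \<open>q * \<epsilon>\<close>, so the annulus over it is invariant and each turn shrinks
  it. A closed orbit nearby is attracted and periodic, hence contained in \<open>A {x}\<close>, and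
  by \<open>covers\<close> it is all of it.\<close>

lemma contraction_cycle:
  assumes x: "0 < x - \<epsilon>0" "x + \<epsilon>0 < rr / 4" "0 < \<epsilon>0" and Px: "P x = x" and q: "0 \<le> q" "q < 1"
    and con: "\<And>y. \<bar>y - x\<bar> \<le> \<epsilon>0 \<Longrightarrow> \<bar>P y - x\<bar> \<le> q * \<bar>y - x\<bar>"
  shows "limit_cycle Z (A {x})" "asymptotically_stable Z (A {x})" "expels x"
proof -
  have xr: "0 < x" "x < rr" "x < rr / 4" using x rr by auto
  have PS: "P y \<in> {x - q * \<epsilon>..x + q * \<epsilon>}" if "\<epsilon> \<le> \<epsilon>0" "y \<in> {x - \<epsilon>..x + \<epsilon>}" for y \<epsilon>
  proof -
    have y: "\<bar>y - x\<bar> \<le> \<epsilon>" using that(2) by (simp add: abs_le_iff)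
    then have "\<bar>P y - x\<bar> \<le> q * \<bar>y - x\<bar>" using that(1) by (intro con) simp
    also have "\<dots> \<le> q * \<epsilon>" using y q by (intro mult_left_mono) auto
    finally show ?thesis by (simp add: abs_le_iff)
  qed
  have PS': "P y \<in> {x - \<epsilon>..x + \<epsilon>}" if "0 \<le> \<epsilon>" "\<epsilon> \<le> \<epsilon>0" "y \<in> {x - \<epsilon>..x + \<epsilon>}" for y \<epsilon>
    using PS[OF that(2,3)] mult_right_mono[of q 1 \<epsilon>] q that(1) by simp
  have inv: "\<gamma> t \<in> A {x - \<epsilon>..x + \<epsilon>}"
    if "0 \<le> \<epsilon>" "\<epsilon> \<le> \<epsilon>0" "filippov_solution Z {a..c} \<gamma>" "\<gamma> a \<in> A {x - \<epsilon>..x + \<epsilon>}" "t \<in> {a..c}" for \<epsilon> \<gamma> a c t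
    by (rule invariant[OF _ _ PS'[OF that(1,2)] that(3-5)]) (use that(1,2) x in auto)
  have cA: "compact (A {x})" using A_compact[OF xr(1,2)] by simp
  have ne: "A {x} \<noteq> {}" using base_point[OF xr(1,2)] by blast
  have stable: "orbitally_stable Z (A {x})"
    unfolding orbitally_stable_def
  proof (intro allI impI)
    fix e :: real assume "0 < e"
    from A_shrinks[OF x this] obtain \<epsilon> where \<epsilon>: "\<epsilon> > 0" "\<epsilon> \<le> \<epsilon>0" "\<forall>p\<in>A {x - \<epsilon>..x + \<epsilon>}. infdist p (A {x}) < e" by blast
    have "\<exists>\<eta>>0. \<forall>p. infdist p (A {x}) < \<eta> \<longrightarrow> p \<in> A {x - \<epsilon>..x + \<epsilon>}"
      by (rule A_nbhd[OF _ _ _ _ Px]) (use \<epsilon> x in auto)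
    then obtain \<eta> where \<eta>: "\<eta> > 0" "\<And>p. infdist p (A {x}) < \<eta> \<Longrightarrow> p \<in> A {x - \<epsilon>..x + \<epsilon>}" by blast
    show "\<exists>\<eta>>0. \<forall>\<gamma> T. 0 \<le> T \<longrightarrow> filippov_solution Z {0..T} \<gamma> \<longrightarrow> infdist (\<gamma> 0) (A {x}) < \<eta> \<longrightarrow>
        (\<forall>t\<in>{0..T}. infdist (\<gamma> t) (A {x}) < e)"
    proof (rule exI[of _ \<eta>], intro conjI allI impI ballI \<eta>(1))
      fix \<gamma> and T t :: real assume \<gamma>: "filippov_solution Z {0..T} \<gamma>" "infdist (\<gamma> 0) (A {x}) < \<eta>" and t: "t \<in> {0..T}"
      have "\<gamma> t \<in> A {x - \<epsilon>..x + \<epsilon>}" by (rule inv[OF less_imp_le[OF \<epsilon>(1)] \<epsilon>(2) \<gamma>(1) \<eta>(2)[OF \<gamma>(2)] t])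
      then show "infdist (\<gamma> t) (A {x}) < e" by (rule bspec[OF \<epsilon>(3)])
    qed
  qed
  have "\<exists>\<eta>>0. \<forall>p. infdist p (A {x}) < \<eta> \<longrightarrow> p \<in> A {x - \<epsilon>0..x + \<epsilon>0}"
    by (rule A_nbhd[OF _ _ _ _ Px]) (use x in auto)
  then obtain \<eta> where \<eta>: "\<eta> > 0" "\<And>p. infdist p (A {x}) < \<eta> \<Longrightarrow> p \<in> A {x - \<epsilon>0..x + \<epsilon>0}" by blast
  obtain Tt where Tt: "Tt > 0" and T: "\<forall>S \<gamma> a c. S \<subseteq> {0<..<rr/4} \<longrightarrow> (\<forall>x\<in>S. P x \<in> S) \<longrightarrow> filippov_solution Z {a..c} \<gamma> \<longrightarrow> \<gamma> a \<in> A S \<longrightarrow>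
     a + Tt \<le> c \<longrightarrow> (\<exists>t1 \<xi>. \<xi> \<in> S \<and> a \<le> t1 \<and> t1 \<le> a + Tt \<and> \<gamma> t1 = (\<phi>2 \<xi>, 0))"
    using turn by blast
  have attract: "((\<lambda>t. infdist (\<gamma> t) (A {x})) \<longlongrightarrow> 0) at_top"
    if \<gamma>: "filippov_solution Z {0..} \<gamma>" and \<gamma>0: "infdist (\<gamma> 0) (A {x}) < \<eta>" for \<gamma>
  proof -
    have seg: "filippov_solution Z {a..c} \<gamma>" if "0 \<le> a" for a c by (rule filippov_subset[OF \<gamma>]) (use that in auto)
    have qn: "0 \<le> q ^ n * \<epsilon>0" "q ^ n * \<epsilon>0 \<le> \<epsilon>0" for n
      using q x(3) power_le_one[of q n] mult_right_mono[of "q ^ n" 1 \<epsilon>0] by auto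
    \<comment> \<open>The solution reaches the entry of an upper arc whose parameter
      \<open>P \<xi>\<close> already belongs to the next smaller interval; invariance keeps it
      there.\<close>
    have "\<exists>s\<ge>0. \<forall>t\<ge>s. \<gamma> t \<in> A {x - q ^ n * \<epsilon>0..x + q ^ n * \<epsilon>0}" for n
    proof (induction n)
      case 0
      have "\<gamma> t \<in> A {x - \<epsilon>0..x + \<epsilon>0}" if "0 \<le> t" for t
        by (rule inv[OF less_imp_le[OF x(3)] order_refl seg[OF order_refl] \<eta>(2)[OF \<gamma>0]]) (use that in auto)
      then show ?case by (intro exI[of _ 0]) simp
    next
      case (Suc n)
      then obtain s where s: "0 \<le> s" "\<And>t. s \<le> t \<Longrightarrow> \<gamma> t \<in> A {x - q ^ n * \<epsilon>0..x + q ^ n * \<epsilon>0}" by blast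
      let ?S = "{x - q ^ n * \<epsilon>0..x + q ^ n * \<epsilon>0}"
      have S1: "?S \<subseteq> {0<..<rr/4}"
      proof
        fix y assume "y \<in> ?S"
        then have "x - q ^ n * \<epsilon>0 \<le> y" "y \<le> x + q ^ n * \<epsilon>0" by simp_all
        then have "0 < y" "y < rr/4" using qn(2)[of n] x by linarith+
        then show "y \<in> {0<..<rr/4}" by simp
      qed
      have S2: "P y \<in> ?S" if "y \<in> ?S" for y by (rule PS'[OF qn that])
      from T[rule_format, OF S1 S2 seg[OF s(1)] s(2)[OF order_refl] order_refl]
      obtain t1 \<xi> where t1: "\<xi> \<in> ?S" "s \<le> t1" "\<gamma> t1 = (\<phi>2 \<xi>, 0)" by blast
      have \<xi>: "0 < \<xi>" "\<xi> < rr/4" using t1(1) S1 by auto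
      have "P \<xi> \<in> {x - q ^ Suc n * \<epsilon>0..x + q ^ Suc n * \<epsilon>0}" using PS[OF qn(2) t1(1)] by (simp add: mult.assoc)
      from A_up[OF this entry_point[OF \<xi>]] t1(3)
      have g1: "\<gamma> t1 \<in> A {x - q ^ Suc n * \<epsilon>0..x + q ^ Suc n * \<epsilon>0}" by simp
      have t10: "0 \<le> t1" using t1(2) s(1) by linarith
      have "\<gamma> t \<in> A {x - q ^ Suc n * \<epsilon>0..x + q ^ Suc n * \<epsilon>0}" if "t1 \<le> t" for t
        by (rule inv[OF qn(1)[of "Suc n"] qn(2)[of "Suc n"] seg[OF t10, of t] g1]) (simp add: that)
      then show ?case using t1(2) s(1) by (intro exI[of _ t1]) simp
    qed
    note reach = this
    show ?thesis
    proof (rule tendstoI)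
      fix e :: real assume "0 < e"
      from A_shrinks[OF x this] obtain \<epsilon> where \<epsilon>: "\<epsilon> > 0" "\<forall>p\<in>A {x - \<epsilon>..x + \<epsilon>}. infdist p (A {x}) < e" by blast
      have "(\<lambda>n. q ^ n * \<epsilon>0) \<longlonglongrightarrow> 0 * \<epsilon>0" by (intro tendsto_mult tendsto_const LIMSEQ_realpow_zero q)
      then have "\<forall>\<^sub>F n in sequentially. q ^ n * \<epsilon>0 < \<epsilon>" using \<epsilon>(1) by (intro order_tendstoD(2)) auto
      then obtain n where n: "q ^ n * \<epsilon>0 < \<epsilon>" by (auto simp: eventually_sequentially)
      then have sub: "A {x - q ^ n * \<epsilon>0..x + q ^ n * \<epsilon>0} \<subseteq> A {x - \<epsilon>..x + \<epsilon>}" by (intro A_mono) auto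
      obtain s where s: "\<And>t. s \<le> t \<Longrightarrow> \<gamma> t \<in> A {x - q ^ n * \<epsilon>0..x + q ^ n * \<epsilon>0}" using reach[of n] by blast
      have "dist (infdist (\<gamma> t) (A {x})) 0 < e" if "s \<le> t" for t
        using bspec[OF \<epsilon>(2) subsetD[OF sub s[OF that]]] by (simp add: infdist_nonneg)
      then show "\<forall>\<^sub>F t in at_top. dist (infdist (\<gamma> t) (A {x})) 0 < e"
        unfolding eventually_at_top_linorder by blast
    qed
  qed
  show "asymptotically_stable Z (A {x})"
    unfolding asymptotically_stable_def using stable \<eta>(1) attract by blast
  show "limit_cycle Z (A {x})"
    unfolding limit_cycle_def
  proof (intro conjI closed_orbit_A[OF xr(1,3) Px] exI[of _ "{p. infdist p (A {x}) < \<eta>}"] allI impI)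
    show "open {p. infdist p (A {x}) < \<eta>}" by (intro open_Collect_less continuous_intros)
    show "A {x} \<subseteq> {p. infdist p (A {x}) < \<eta>}" using \<eta>(1) by auto
    fix \<Gamma>' assume "closed_orbit Z \<Gamma>' \<and> \<Gamma>' \<subseteq> {p. infdist p (A {x}) < \<eta>}"
    then obtain \<gamma> and T :: real where T: "0 < T" and \<gamma>: "filippov_solution Z UNIV \<gamma>" and per: "\<forall>t. \<gamma> (t + T) = \<gamma> t"
      and \<Gamma>': "\<Gamma>' = range \<gamma>" and sub: "\<Gamma>' \<subseteq> {p. infdist p (A {x}) < \<eta>}" unfolding closed_orbit_def by blast
    have "infdist (\<gamma> 0) (A {x}) < \<eta>" using sub \<Gamma>' by blast
    then have lim: "((\<lambda>t. infdist (\<gamma> t) (A {x})) \<longlongrightarrow> 0) at_top"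
      by (rule attract[OF filippov_subset[OF \<gamma> subset_UNIV]])
    have pern: "\<gamma> (t + real n * T) = \<gamma> t" for t n
    proof (induction n)
      case (Suc n)
      have "t + real (Suc n) * T = (t + real n * T) + T" by (simp add: algebra_simps)
      then show ?case using Suc per[rule_format, of "t + real n * T"] by metis
    qed simp
    have in\<Gamma>: "\<gamma> t \<in> A {x}" for t
    proof -
      \<comment> \<open>Along the times \<open>t + n * T\<close> the distance to the cycle is
        constant and tends to 0.\<close>
      have "filterlim (\<lambda>n. t + real n * T) at_top sequentially"
        by (intro filterlim_tendsto_add_at_top[OF tendsto_const] filterlim_at_top_mult_tendsto_pos[OF tendsto_const T] filterlim_real_sequentially)
      from filterlim_compose[OF lim this] have "(\<lambda>n. infdist (\<gamma> t) (A {x})) \<longlonglongrightarrow> 0" by (simp add: pern)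
      then have "infdist (\<gamma> t) (A {x}) = 0" by (simp add: LIMSEQ_const_iff)
      then show ?thesis using in_closed_iff_infdist_zero[OF compact_imp_closed[OF cA] ne] by simp
    qed
    obtain Tm where Tm: "\<forall>x \<gamma> a c. 0 < x \<longrightarrow> x < rr / 4 \<longrightarrow> P x = x \<longrightarrow> filippov_solution Z {a..c} \<gamma> \<longrightarrow> \<gamma> a \<in> A {x} \<longrightarrow> a + Tm \<le> c \<longrightarrow>
       A {x} \<subseteq> \<gamma> ` {a..c}" using covers by blast
    have "A {x} \<subseteq> \<gamma> ` {0..0 + Tm}"
      by (rule Tm[rule_format, OF xr(1,3) Px filippov_subset[OF \<gamma> subset_UNIV] in\<Gamma> order_refl])
    then show "\<Gamma>' = A {x}" using in\<Gamma> \<Gamma>' by blast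
  qed
  show "expels x"
  proof -
    \<comment> \<open>A point off the cycle whose iterates under \<open>P\<close> converge to
      \<open>x\<close>; concatenated loops join it to points as close to the cycle as
      desired.\<close>
    let ?x1 = "x + \<epsilon>0"
    have iter: "\<exists>\<gamma> T y. 0 \<le> T \<and> filippov_solution Z {0..T} \<gamma> \<and> \<gamma> 0 = (?x1, 0) \<and> \<gamma> T = (y, 0) \<and> \<bar>y - x\<bar> \<le> q ^ n * \<epsilon>0" for n
    proof (induction n)
      case 0
      have x1: "0 < ?x1" "?x1 < rr/4" using x by auto
      obtain T1 T \<gamma> where "0 < T1" "T1 < T" "filippov_solution Z {0..T} \<gamma>" "\<gamma> 0 = (?x1, 0)"
        by (rule loop[OF x1]) (rule that; assumption)
      from this(3) have "filippov_solution Z {0..0} \<gamma>" by (rule filippov_subset) (use \<open>0 < T1\<close> \<open>T1 < T\<close> in auto)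
      then show ?case using \<open>\<gamma> 0 = (?x1, 0)\<close> x(3) by (intro exI[of _ \<gamma>] exI[of _ 0] exI[of _ ?x1]) simp
    next
      case (Suc n)
      then obtain \<alpha> S y where \<alpha>: "0 \<le> S" "filippov_solution Z {0..S} \<alpha>" "\<alpha> 0 = (?x1, 0)" "\<alpha> S = (y, 0)" "\<bar>y - x\<bar> \<le> q ^ n * \<epsilon>0" by blast
      have "q ^ n * \<epsilon>0 \<le> \<epsilon>0" using q x(3) power_le_one[of q n] mult_right_mono[of "q ^ n" 1 \<epsilon>0] by auto
      then have ye: "\<bar>y - x\<bar> \<le> \<epsilon>0" using \<alpha>(5) by linarith
      then have y: "0 < y" "y < rr/4" using x by (auto simp: abs_le_iff)
      obtain T1 T \<beta> where "0 < T1" "T1 < T" and \<beta>': "filippov_solution Z {0..T} \<beta>" "\<beta> 0 = (y, 0)" "\<beta> T = (P y, 0)"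
        by (rule loop[OF y]) (rule that; assumption)
      then have \<beta>: "0 < T" "filippov_solution Z {0..T} \<beta>" "\<beta> 0 = (y, 0)" "\<beta> T = (P y, 0)" by simp_all
      have "filippov_solution Z {0..S + T} (\<lambda>t. if t \<le> S then \<alpha> t else \<beta> (t - S))"
        by (rule filippov_concat[OF \<alpha>(2) \<beta>(2)]) (use \<alpha> \<beta> in auto)
      moreover have "\<bar>P y - x\<bar> \<le> q ^ Suc n * \<epsilon>0"
      proof -
        have "\<bar>P y - x\<bar> \<le> q * \<bar>y - x\<bar>" by (rule con[OF ye])
        also have "\<dots> \<le> q * (q ^ n * \<epsilon>0)" using \<alpha>(5) q by (intro mult_left_mono) auto
        finally show ?thesis by (simp add: mult.assoc)
      qed
      ultimately show ?case using \<alpha> \<beta>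
        by (intro exI[of _ "\<lambda>t. if t \<le> S then \<alpha> t else \<beta> (t - S)"] exI[of _ "S + T"] exI[of _ "P y"]) simp
    qed
    have "(?x1, 0) \<notin> A {x}"
    proof
      assume "(?x1, 0) \<in> A {x}"
      then have "?x1 = \<phi>1 x \<or> ?x1 = \<phi>2 x \<or> ?x1 = x"
        unfolding A_def using up.arc_range(7)[OF xr(1), of "(?x1, 0)"] lo.arc_range(7)[OF xr(1), of "(?x1, 0)"] xr rr by auto
      moreover have "\<phi>1 x < 0" "\<phi>2 x < 0" using up.\<phi>_neg[OF xr(1)] lo.\<phi>_neg[OF xr(1)] xr rr by auto
      ultimately show False using xr(1) x(3) by auto
    qed
    then have e: "0 < infdist (?x1, 0) (A {x})"
      by (rule infdist_pos_not_in_closed[OF compact_imp_closed[OF cA] ne])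
    show ?thesis unfolding expels_def
    proof (rule exI[of _ "infdist (?x1, 0) (A {x})"], intro conjI allI impI e)
      fix \<eta>' :: real assume "0 < \<eta>'"
      have "(\<lambda>n. q ^ n * \<epsilon>0) \<longlonglongrightarrow> 0 * \<epsilon>0" by (intro tendsto_mult tendsto_const LIMSEQ_realpow_zero q)
      then have "\<forall>\<^sub>F n in sequentially. q ^ n * \<epsilon>0 < \<eta>'" using \<open>0 < \<eta>'\<close> by (intro order_tendstoD(2)) auto
      then obtain n where n: "q ^ n * \<epsilon>0 < \<eta>'" by (auto simp: eventually_sequentially)
      from iter[of n] obtain \<gamma> T y where \<gamma>: "0 \<le> T" "filippov_solution Z {0..T} \<gamma>" "\<gamma> 0 = (?x1, 0)" "\<gamma> T = (y, 0)" "\<bar>y - x\<bar> \<le> q ^ n * \<epsilon>0" by blast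
      have "infdist (y, 0) (A {x}) \<le> dist (y, 0) (x, 0 :: real)" by (rule infdist_le[OF base_point[OF xr(1,2)]])
      also have "\<dots> = \<bar>y - x\<bar>" by (simp add: dist_Pair_Pair dist_real_def)
      finally have "infdist (\<gamma> T) (A {x}) < \<eta>'" using \<gamma>(4,5) n by simp
      then show "\<exists>\<gamma> T. 0 \<le> T \<and> filippov_solution Z {0..T} \<gamma> \<and> infdist (\<gamma> T) (A {x}) < \<eta>' \<and> infdist (?x1, 0) (A {x}) \<le> infdist (\<gamma> 0) (A {x})"
        using \<gamma> by (intro exI[of _ \<gamma>] exI[of _ T]) simp
    qed
  qed
qed

lemma derivative_cycle:
  assumes x: "0 < x" "x < rr / 4" and Px: "P x = x" and D: "(P has_real_derivative D) (at x)" and D1: "\<bar>D\<bar> < 1"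
  shows "limit_cycle Z (A {x})" "asymptotically_stable Z (A {x})" "expels x"
proof -
  \<comment> \<open>The midpoint between \<open>\<bar>D\<bar>\<close> and 1; near \<open>x\<close>
    the difference quotients of \<open>P\<close> stay below it.\<close>
  define q where "q = (1 + \<bar>D\<bar>) / 2"
  have q: "0 \<le> q" "q < 1" "\<bar>D\<bar> < q" using D1 by (auto simp: q_def)
  have "((\<lambda>y. \<bar>(P y - x) / (y - x)\<bar>) \<longlongrightarrow> \<bar>D\<bar>) (at x)"
    using tendsto_rabs[OF D[unfolded has_field_derivative_iff]] by (simp add: Px)
  then have "\<forall>\<^sub>F y in at x. \<bar>(P y - x) / (y - x)\<bar> < q" by (rule order_tendstoD(2)[OF _ q(3)])
  then obtain d where d: "d > 0" "\<And>y. y \<noteq> x \<Longrightarrow> dist y x < d \<Longrightarrow> \<bar>(P y - x) / (y - x)\<bar> < q"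
    unfolding eventually_at by auto
  define \<epsilon>0 where "\<epsilon>0 = min (d / 2) (min (x / 2) ((rr / 4 - x) / 2))"
  have e1: "0 < \<epsilon>0" unfolding \<epsilon>0_def using d(1) x by simp
  have e2: "\<epsilon>0 \<le> d / 2" "\<epsilon>0 \<le> x / 2" "\<epsilon>0 \<le> (rr / 4 - x) / 2"
    unfolding \<epsilon>0_def by (rule min.cobounded1 min.coboundedI2[OF min.cobounded1] min.coboundedI2[OF min.cobounded2])+
  have "0 < rr / 4 - x" using x by simp
  then have "x + \<epsilon>0 < rr / 4" using e2(3) by argo
  moreover have "\<epsilon>0 < d" "0 < x - \<epsilon>0" using e1 e2(1,2) d(1) x(1) by simp_all
  ultimately have \<epsilon>0: "0 < \<epsilon>0" "\<epsilon>0 < d" "0 < x - \<epsilon>0" "x + \<epsilon>0 < rr / 4" using e1 by simp_all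
  have con: "\<bar>P y - x\<bar> \<le> q * \<bar>y - x\<bar>" if "\<bar>y - x\<bar> \<le> \<epsilon>0" for y
  proof (cases "y = x")
    case False
    then have "\<bar>(P y - x) / (y - x)\<bar> < q" using that \<epsilon>0 by (intro d(2)) (auto simp: dist_real_def)
    then show ?thesis using False by (simp add: abs_divide divide_less_eq)
  qed (simp add: Px)
  show "limit_cycle Z (A {x})" "asymptotically_stable Z (A {x})" "expels x"
    by (rule contraction_cycle[OF \<epsilon>0(3,4,1) Px q(1,2) con]; assumption)+
qed

lemma hyperbolic_A:
  assumes x: "0 < x" "x < rr / 4" and Px: "P x = x" and D: "(P has_real_derivative D) (at x)" and D1: "\<bar>D\<bar> \<noteq> 1"
  shows "hyperbolic_cycle Z (A {x})"
proof -
  have "(return_map Z has_real_derivative D) (at x)"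
    by (rule has_field_derivative_transform_within_open[OF D, of "{0<..<rr/4}"]) (use x return_map_eq in auto)
  moreover have "(x, 0) \<in> A {x}" using base_point x rr by simp
  ultimately show ?thesis
    unfolding hyperbolic_cycle_def using D1 first_return_iff[OF x] return_map_eq[OF x] Px
    by (intro exI[of _ x] exI[of _ D]) simp
qed

end

subsection \<open>Reflection and reversal of time\<close>

lemma infdist_refl: "infdist (refl p) (refl ` \<Gamma>) = infdist p \<Gamma>"
proof -
  have "dist (refl p) (refl q) = dist p q" for q
    by (simp add: dist_prod_def refl_def dist_minus)
  then show ?thesis by (simp add: infdist_def image_image)
qed

lemma infdist_refl': "infdist (refl p) \<Gamma> = infdist p (refl ` \<Gamma>)"
  using infdist_refl[of p "refl ` \<Gamma>"] by (simp add: image_image)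

lemma closed_orbit_refl:
  assumes "closed_orbit Z \<Gamma>" shows "closed_orbit (refl_system Z) (refl ` \<Gamma>)"
proof -
  obtain \<gamma> and T :: real where T: "0 < T" and \<gamma>: "filippov_solution Z UNIV \<gamma>" and per: "\<forall>t. \<gamma> (t + T) = \<gamma> t"
    and inj: "inj_on \<gamma> {0..<T}" and \<Gamma>: "\<Gamma> = range \<gamma>" using assms unfolding closed_orbit_def by blast
  have "inj_on (\<lambda>t. refl (\<gamma> t)) {0..<T}"
    by (rule inj_onI) (metis inj inj_onD refl_simps(3))
  moreover have "refl ` \<Gamma> = range (\<lambda>t. refl (\<gamma> t))" by (simp add: \<Gamma> image_image)
  ultimately show ?thesis unfolding closed_orbit_def
    using T filippov_refl[OF \<gamma>] per by (intro exI[of _ "\<lambda>t. refl (\<gamma> t)"] exI[of _ T]) simp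
qed

lemma refl_refl_image [simp]: "refl ` refl ` S = S"
  by (simp add: image_image)

lemma limit_cycle_refl:
  assumes "limit_cycle Z \<Gamma>" shows "limit_cycle (refl_system Z) (refl ` \<Gamma>)"
proof -
  obtain U where U: "open U" "\<Gamma> \<subseteq> U" and iso: "\<And>\<Gamma>'. closed_orbit Z \<Gamma>' \<Longrightarrow> \<Gamma>' \<subseteq> U \<Longrightarrow> \<Gamma>' = \<Gamma>"
    and c: "closed_orbit Z \<Gamma>" using assms unfolding limit_cycle_def by blast
  have "refl ` U = refl -` U" by (auto simp: refl_image_iff)
  then have "open (refl ` U)" using open_vimage[OF U(1), of refl] linear_continuous_on[OF refl_linear] by simp
  moreover have "refl ` \<Gamma> \<subseteq> refl ` U" using U(2) by (rule image_mono)
  moreover have "\<forall>\<Gamma>'. closed_orbit (refl_system Z) \<Gamma>' \<and> \<Gamma>' \<subseteq> refl ` U \<longrightarrow> \<Gamma>' = refl ` \<Gamma>"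
  proof (intro allI impI)
    fix \<Gamma>' assume that: "closed_orbit (refl_system Z) \<Gamma>' \<and> \<Gamma>' \<subseteq> refl ` U"
    have "refl ` \<Gamma>' = \<Gamma>"
    proof (rule iso)
      show "closed_orbit Z (refl ` \<Gamma>')" using closed_orbit_refl[of "refl_system Z" \<Gamma>'] that by simp
      show "refl ` \<Gamma>' \<subseteq> U" using image_mono[of \<Gamma>' "refl ` U" refl] that by simp
    qed
    then show "\<Gamma>' = refl ` \<Gamma>" using refl_refl_image[of \<Gamma>'] by simp
  qed
  ultimately show ?thesis
    unfolding limit_cycle_def using closed_orbit_refl[OF c] by (intro conjI exI[of _ "refl ` U"])
qed

lemma orbitally_stable_refl:
  assumes "orbitally_stable Z \<Gamma>" shows "orbitally_stable (refl_system Z) (refl ` \<Gamma>)"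
  unfolding orbitally_stable_def
proof (intro allI impI)
  fix \<epsilon> :: real assume "0 < \<epsilon>"
  with assms obtain \<eta> where \<eta>: "\<eta> > 0" "\<forall>\<gamma> T. 0 \<le> T \<longrightarrow> filippov_solution Z {0..T} \<gamma> \<longrightarrow> infdist (\<gamma> 0) \<Gamma> < \<eta> \<longrightarrow>
        (\<forall>t\<in>{0..T}. infdist (\<gamma> t) \<Gamma> < \<epsilon>)" unfolding orbitally_stable_def by blast
  show "\<exists>\<eta>>0. \<forall>\<gamma> T. 0 \<le> T \<longrightarrow> filippov_solution (refl_system Z) {0..T} \<gamma> \<longrightarrow> infdist (\<gamma> 0) (refl ` \<Gamma>) < \<eta> \<longrightarrow>
        (\<forall>t\<in>{0..T}. infdist (\<gamma> t) (refl ` \<Gamma>) < \<epsilon>)"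
  proof (rule exI[of _ \<eta>], intro conjI allI impI ballI, rule \<eta>(1))
    fix \<gamma> T t assume T: "0 \<le> T" and \<gamma>: "filippov_solution (refl_system Z) {0..T} \<gamma>"
      and i0: "infdist (\<gamma> 0) (refl ` \<Gamma>) < \<eta>" and t: "t \<in> {0..T}"
    have \<gamma>': "filippov_solution Z {0..T} (\<lambda>t. refl (\<gamma> t))" using filippov_refl[OF \<gamma>] by simp
    have d0: "infdist (refl (\<gamma> 0)) \<Gamma> < \<eta>" using i0 by (simp add: infdist_refl')
    show "infdist (\<gamma> t) (refl ` \<Gamma>) < \<epsilon>"
      using \<eta>(2)[rule_format, OF T \<gamma>' d0 t] by (simp add: infdist_refl')
  qed
qed

lemma asymptotically_stable_refl:
  assumes "asymptotically_stable Z \<Gamma>" shows "asymptotically_stable (refl_system Z) (refl ` \<Gamma>)"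
proof -
  obtain \<eta> where \<eta>: "\<eta> > 0" "\<forall>\<gamma>. filippov_solution Z {0..} \<gamma> \<longrightarrow> infdist (\<gamma> 0) \<Gamma> < \<eta> \<longrightarrow>
        ((\<lambda>t. infdist (\<gamma> t) \<Gamma>) \<longlongrightarrow> 0) at_top" and st: "orbitally_stable Z \<Gamma>"
    using assms unfolding asymptotically_stable_def by blast
  have "((\<lambda>t. infdist (\<gamma> t) (refl ` \<Gamma>)) \<longlongrightarrow> 0) at_top"
    if \<gamma>: "filippov_solution (refl_system Z) {0..} \<gamma>" and i0: "infdist (\<gamma> 0) (refl ` \<Gamma>) < \<eta>" for \<gamma>
  proof -
    have \<gamma>': "filippov_solution Z {0..} (\<lambda>t. refl (\<gamma> t))" using filippov_refl[OF \<gamma>] by simp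
    have d0: "infdist (refl (\<gamma> 0)) \<Gamma> < \<eta>" using i0 by (simp add: infdist_refl')
    show ?thesis using \<eta>(2)[rule_format, OF \<gamma>' d0] by (simp add: infdist_refl')
  qed
  then show ?thesis
    unfolding asymptotically_stable_def using orbitally_stable_refl[OF st] \<eta>(1)
    by (intro conjI exI[of _ \<eta>] allI impI) assumption+
qed

lemma first_return_refl:
  assumes "first_return Z x x'" shows "first_return (refl_system Z) x x'"
proof -
  obtain \<gamma> T where *: "0 < T" "filippov_solution Z {0..T} \<gamma>" "\<gamma> 0 = (x, 0)" "\<gamma> T = (x', 0)" "x * x' > 0"
    "\<forall>t\<in>{0<..<T}. \<not> (snd (\<gamma> t) = 0 \<and> x * fst (\<gamma> t) > 0)" using assms unfolding first_return_def by blast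
  then show ?thesis unfolding first_return_def
    using filippov_refl[OF *(2)] by (intro exI[of _ "\<lambda>t. refl (\<gamma> t)"] exI[of _ T]) simp
qed

lemma first_return_refl_iff: "first_return (refl_system Z) x x' \<longleftrightarrow> first_return Z x x'"
  using first_return_refl[of Z x x'] first_return_refl[of "refl_system Z" x x'] by auto

lemma hyperbolic_cycle_refl:
  assumes "hyperbolic_cycle Z \<Gamma>" shows "hyperbolic_cycle (refl_system Z) (refl ` \<Gamma>)"
proof -
  have "return_map (refl_system Z) = return_map Z"
    by (simp add: fun_eq_iff return_map_def first_return_refl_iff)
  moreover have "(x, 0) \<in> refl ` \<Gamma> \<longleftrightarrow> (x, 0) \<in> \<Gamma>" for x by (simp add: refl_image_iff)
  ultimately show ?thesis using assms unfolding hyperbolic_cycle_def by (simp add: first_return_refl_iff)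
qed

lemma unstable_refl:
  assumes "unstable Z \<Gamma>" shows "unstable (refl_system Z) (refl ` \<Gamma>)"
proof -
  have "\<not> orbitally_stable (refl_system Z) (refl ` \<Gamma>)"
  proof
    assume "orbitally_stable (refl_system Z) (refl ` \<Gamma>)"
    from orbitally_stable_refl[OF this] show False using assms by (simp add: unstable_def)
  qed
  moreover have "asymptotically_stable (time_reversed (refl_system Z)) (refl ` \<Gamma>)"
    using asymptotically_stable_refl[of "time_reversed Z" \<Gamma>] assms by (simp add: unstable_def refl_reversed)
  ultimately show ?thesis by (simp add: unstable_def)
qed

lemma reversed_reversed [simp]: "time_reversed (time_reversed Z) = Z"
  by (simp add: time_reversed_def)

lemma closed_orbit_reversed:
  assumes "closed_orbit Z \<Gamma>" shows "closed_orbit (time_reversed Z) \<Gamma>"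
proof -
  obtain \<gamma> and T :: real where T: "0 < T" and \<gamma>: "filippov_solution Z UNIV \<gamma>" and per: "\<forall>t. \<gamma> (t + T) = \<gamma> t"
    and inj: "inj_on \<gamma> {0..<T}" and \<Gamma>: "\<Gamma> = range \<gamma>" using assms unfolding closed_orbit_def by blast
  have sol: "filippov_solution (time_reversed Z) UNIV (\<lambda>t. \<gamma> (0 - t))"
    by (rule filippov_reverse[OF \<gamma>]) simp
  have per': "\<gamma> (0 - (t + T)) = \<gamma> (0 - t)" for t
  proof -
    have "\<gamma> (0 - (t + T) + T) = \<gamma> (0 - (t + T))" using per by (rule spec)
    then show ?thesis by simp
  qed
  have u: "\<gamma> (0 - s) = \<gamma> (if s = 0 then 0 else T - s)" for s
    using per[rule_format, of "0 - s"] by (simp add: algebra_simps)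
  have "inj_on (\<lambda>t. \<gamma> (0 - t)) {0..<T}"
  proof (rule inj_onI)
    fix s t assume st: "s \<in> {0..<T}" "t \<in> {0..<T}" "\<gamma> (0 - s) = \<gamma> (0 - t)"
    have "(if s = 0 then 0 else T - s) = (if t = 0 then 0 else T - t)"
      by (rule inj_onD[OF inj st(3)[unfolded u]]) (use st(1,2) in auto)
    then show "s = t" using st(1,2) by (auto split: if_splits)
  qed
  moreover have "\<Gamma> = range (\<lambda>t. \<gamma> (0 - t))"
  proof -
    have "\<gamma> t \<in> range (\<lambda>t. \<gamma> (0 - t))" for t by (rule range_eqI[of _ _ "- t"]) simp
    then show ?thesis unfolding \<Gamma> by (auto simp del: diff_0)
  qed
  ultimately show ?thesis unfolding closed_orbit_def using T sol per'
    by (intro exI[of _ "\<lambda>t. \<gamma> (0 - t)"] exI[of _ T] conjI allI)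
qed

lemma limit_cycle_reversed:
  assumes "limit_cycle (time_reversed Z) \<Gamma>" shows "limit_cycle Z \<Gamma>"
proof -
  obtain U where U: "open U" "\<Gamma> \<subseteq> U" and iso: "\<And>\<Gamma>'. closed_orbit (time_reversed Z) \<Gamma>' \<Longrightarrow> \<Gamma>' \<subseteq> U \<Longrightarrow> \<Gamma>' = \<Gamma>"
    and c: "closed_orbit (time_reversed Z) \<Gamma>" using assms unfolding limit_cycle_def by blast
  have "\<forall>\<Gamma>'. closed_orbit Z \<Gamma>' \<and> \<Gamma>' \<subseteq> U \<longrightarrow> \<Gamma>' = \<Gamma>"
  proof (intro allI impI)
    fix \<Gamma>' assume a: "closed_orbit Z \<Gamma>' \<and> \<Gamma>' \<subseteq> U"
    show "\<Gamma>' = \<Gamma>" by (rule iso[OF closed_orbit_reversed[OF conjunct1[OF a]] conjunct2[OF a]])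
  qed
  moreover have "closed_orbit Z \<Gamma>" using closed_orbit_reversed[OF c] by simp
  ultimately show ?thesis unfolding limit_cycle_def using U by (intro conjI exI[of _ U])
qed

subsection \<open>Limit cycles from fixed points of the return map\<close>

definition admits_cycle :: "pw_field \<Rightarrow> real \<Rightarrow> real \<Rightarrow> bool" where
  "admits_cycle Z L R \<longleftrightarrow> (\<exists>\<Gamma>. limit_cycle Z \<Gamma> \<and> hyperbolic_cycle Z \<Gamma> \<and> \<Gamma> \<subseteq> ball (0, 0) R \<and>
     (L < 0 \<longrightarrow> asymptotically_stable Z \<Gamma>) \<and> (L > 0 \<longrightarrow> unstable Z \<Gamma>))"

lemma admits_cycle_refl:
  assumes "admits_cycle Z L R" shows "admits_cycle (refl_system Z) L R"
proof -
  obtain \<Gamma> where \<Gamma>: "limit_cycle Z \<Gamma>" "hyperbolic_cycle Z \<Gamma>" "\<Gamma> \<subseteq> ball (0, 0) R"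
     "L < 0 \<Longrightarrow> asymptotically_stable Z \<Gamma>" "L > 0 \<Longrightarrow> unstable Z \<Gamma>" using assms unfolding admits_cycle_def by blast
  have "refl ` \<Gamma> \<subseteq> ball (0, 0) R"
  proof
    fix p assume "p \<in> refl ` \<Gamma>"
    then obtain q where q: "q \<in> \<Gamma>" "p = refl q" by blast
    then have "dist (0, 0) q < R" using \<Gamma>(3) by auto
    then show "p \<in> ball (0, 0) R" using q(2) by (simp add: dist_prod_def dist_real_def refl_def)
  qed
  then show ?thesis unfolding admits_cycle_def
    using limit_cycle_refl[OF \<Gamma>(1)] hyperbolic_cycle_refl[OF \<Gamma>(2)] asymptotically_stable_refl[OF \<Gamma>(4)] unstable_refl[OF \<Gamma>(5)]
    by (intro exI[of _ "refl ` \<Gamma>"] conjI impI)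
qed

lemma (in half_system) involution_derivative:
  assumes x: "0 < \<bar>x\<bar>" "\<bar>x\<bar> < r / 2" and D: "(\<phi> has_real_derivative D) (at x)" "(\<phi> has_real_derivative D') (at (\<phi> x))"
  shows "D' * D = 1"
proof -
  let ?S = "{y. 0 < \<bar>y\<bar>} \<inter> {y. \<bar>y\<bar> < r / 2}"
  have "open ?S" by (intro open_Int open_Collect_less continuous_intros)
  then have "((\<lambda>y. y) has_real_derivative D' * D) (at x)"
    by (rule has_field_derivative_transform_within_open[OF DERIV_chain2[OF D(2,1)]]) (use x \<phi>_inv in auto)
  then show ?thesis by (rule DERIV_unique) (rule DERIV_ident)
qed

context clockwise
begin

text \<open>Reversal of time changes the sense of rotation and reflection restores it, at the price
  of exchanging the two half-return maps.\<close>

lemma reversed_clockwise: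
  "clockwise (refl_system (time_reversed Z)) b2 b02 r2 C2 g2 \<phi>2 b1 b01 r1 C1 g1 \<phi>1"
proof -
  have 1: "fst (refl_system (time_reversed Z)) = (\<lambda>p. - refl_field (snd Z) p)"
    by (simp add: refl_system_def time_reversed_def refl_field_def refl_def fun_eq_iff)
  have 2: "refl_field (snd (refl_system (time_reversed Z))) = (\<lambda>p. - fst Z p)"
    by (simp add: refl_system_def time_reversed_def)
  have 3: "half_system (\<lambda>p. - refl_field (snd Z) p) 1 b2 b02 r2 C2 g2 \<phi>2"
    using half_system_uminus[OF loH] by simp
  have 4: "half_system (\<lambda>p. - fst Z p) (- 1) b1 b01 r1 C1 g1 \<phi>1"
    using half_system_uminus[OF upH] by simp
  show ?thesis unfolding clockwise_def turning_def 1 2 using 3 4 by blast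
qed

text \<open>The reversed and reflected system has return map \<open>\<phi>2 \<circ> \<phi>1\<close>,
  the local inverse of \<open>P\<close>, and the mirror image of \<open>A {x}\<close> as its cycle,
  which is attracting. A solution provided by \<open>expels\<close> there, run backwards and
  reflected, refutes stability here.\<close>

lemma repelling_cycle:
  assumes x: "0 < x" "x < rr / 4" and Px: "\<phi>2 (\<phi>1 x) = x"
    and E: "((\<lambda>y. \<phi>2 (\<phi>1 y)) has_real_derivative E) (at x)" and E1: "\<bar>E\<bar> < 1"
  shows "limit_cycle Z (A {x})" "unstable Z (A {x})"
proof -
  interpret R: clockwise "refl_system (time_reversed Z)" b2 b02 r2 C2 g2 \<phi>2 b1 b01 r1 C1 g1 \<phi>1
    by (rule reversed_clockwise)
  have RP: "R.P = (\<lambda>y. \<phi>2 (\<phi>1 y))" by (simp add: fun_eq_iff R.P_def)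
  have Rrr: "R.rr = rr" by (simp add: rr_def R.rr_def min.commute)
  have RA: "R.A {x} = refl ` A {x}"
    by (auto simp: A_def R.A_def refl_image_iff)
  have x': "x < R.rr / 4" using x Rrr by simp
  note cyc = R.derivative_cycle[OF x(1) x' Px[folded R.P_def] E[folded RP] E1]
  have "limit_cycle (time_reversed Z) (A {x})" using limit_cycle_refl[OF cyc(1)] by (simp add: RA)
  then show "limit_cycle Z (A {x})" by (rule limit_cycle_reversed)
  have as: "asymptotically_stable (time_reversed Z) (A {x})" using asymptotically_stable_refl[OF cyc(2)] by (simp add: RA)
  have "\<not> orbitally_stable Z (A {x})"
  proof
    assume st: "orbitally_stable Z (A {x})"
    from cyc(3) obtain e where e: "e > 0" and ex: "\<forall>\<eta>>0. \<exists>\<gamma> T. 0 \<le> T \<and> filippov_solution (refl_system (time_reversed Z)) {0..T} \<gamma> \<and>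
       infdist (\<gamma> T) (R.A {x}) < \<eta> \<and> e \<le> infdist (\<gamma> 0) (R.A {x})" unfolding R.expels_def by blast
    from st e obtain \<eta> where \<eta>: "\<eta> > 0" "\<forall>\<gamma> T. 0 \<le> T \<longrightarrow> filippov_solution Z {0..T} \<gamma> \<longrightarrow> infdist (\<gamma> 0) (A {x}) < \<eta> \<longrightarrow>
        (\<forall>t\<in>{0..T}. infdist (\<gamma> t) (A {x}) < e)" unfolding orbitally_stable_def by blast
    from ex \<eta>(1) obtain \<gamma> T where T: "0 \<le> T" and \<gamma>: "filippov_solution (refl_system (time_reversed Z)) {0..T} \<gamma>"
      and i: "infdist (\<gamma> T) (R.A {x}) < \<eta>" "e \<le> infdist (\<gamma> 0) (R.A {x})" by blast
    have "filippov_solution (time_reversed (time_reversed Z)) {0..T} (\<lambda>t. refl (\<gamma> (T - t)))"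
      using filippov_reverse[OF filippov_refl[OF \<gamma>], of "{0..T}" T] by simp
    then have sol: "filippov_solution Z {0..T} (\<lambda>t. refl (\<gamma> (T - t)))" by simp
    have i0: "infdist (refl (\<gamma> (T - 0))) (A {x}) < \<eta>" using i(1) by (simp add: infdist_refl' RA)
    have "infdist (refl (\<gamma> (T - T))) (A {x}) < e"
      by (rule \<eta>(2)[rule_format, OF T sol i0]) (use T in simp)
    then show False using i(2) by (simp add: infdist_refl' RA)
  qed
  then show "unstable Z (A {x})" using as by (simp add: unstable_def)
qed

text \<open>Since \<open>\<phi>1\<close> is an involution, \<open>\<phi>1 x = \<phi>2 x\<close>
  makes \<open>x\<close> a fixed point of \<open>P\<close>, with derivative \<open>D2 / D1\<close>.
  Stability is thus a comparison of \<open>\<bar>D1\<bar>\<close> with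
  \<open>\<bar>D2\<bar>\<close>.\<close>

lemma cycle:
  assumes x: "0 < x" "x < rr / 4" and eq: "\<phi>1 x = \<phi>2 x"
    and D1: "(\<phi>1 has_real_derivative D1) (at x)" "(\<phi>1 has_real_derivative D1') (at (\<phi>1 x))"
    and D2: "(\<phi>2 has_real_derivative D2) (at x)" "(\<phi>2 has_real_derivative D2') (at (\<phi>1 x))"
    and L: "L < 0 \<Longrightarrow> \<bar>D2\<bar> < \<bar>D1\<bar>" "L > 0 \<Longrightarrow> \<bar>D1\<bar> < \<bar>D2\<bar>" "L \<noteq> 0"
  shows "admits_cycle Z L ((3 + C1 + C2) * x)"
proof -
  have x': "0 < \<bar>x\<bar>" "\<bar>x\<bar> < r1 / 2" "\<bar>x\<bar> < r2 / 2" using x rr by auto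
  have inv: "\<phi>1 (\<phi>2 x) = x" "\<phi>2 (\<phi>1 x) = x"
    using up.\<phi>_inv[OF x'(1,2)] lo.\<phi>_inv[OF x'(1,3)] eq by simp_all
  have D11: "D1' * D1 = 1" by (rule up.involution_derivative[OF x'(1,2) D1])
  have D22: "D2' * D2 = 1" by (rule lo.involution_derivative[OF x'(1,3) D2(1)]) (use D2(2) eq in simp)
  have P': "(P has_real_derivative D1' * D2) (at x)"
    using DERIV_chain2[of \<phi>1 D1' \<phi>2 x D2 UNIV] D1(2) D2(1) eq by (simp add: P_def[abs_def])
  have E: "((\<lambda>y. \<phi>2 (\<phi>1 y)) has_real_derivative D2' * D1) (at x)"
    by (rule DERIV_chain2[OF D2(2) D1(1)])
  have nz: "D1 \<noteq> 0" "D2 \<noteq> 0" using D11 D22 by auto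
  then have D': "D1' = 1 / D1" "D2' = 1 / D2" using D11 D22 by (simp_all add: field_simps)
  have a: "\<bar>D1' * D2\<bar> = \<bar>D2\<bar> / \<bar>D1\<bar>" "\<bar>D2' * D1\<bar> = \<bar>D1\<bar> / \<bar>D2\<bar>" using D' by (simp_all add: abs_mult abs_divide)
  have "\<bar>D2\<bar> \<noteq> \<bar>D1\<bar>" using L by (metis less_irrefl linorder_neqE_linordered_idom)
  then have ne: "\<bar>D1' * D2\<bar> \<noteq> 1" using a nz by simp
  have Px: "P x = x" using inv by (simp add: P_def)
  have neg: "limit_cycle Z (A {x})" "asymptotically_stable Z (A {x})" if "L < 0"
    using derivative_cycle(1,2)[OF x Px P'] L(1)[OF that] a nz by simp_all
  have pos: "limit_cycle Z (A {x})" "unstable Z (A {x})" if "L > 0"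
    using repelling_cycle[OF x inv(2) E] L(2)[OF that] a nz by simp_all
  \<comment> \<open>The constant in \<open>A_range\<close> is raised from 2 to 3 to get into the
    open ball.\<close>
  have "A {x} \<subseteq> ball (0, 0) ((3 + C1 + C2) * x)"
  proof
    fix p assume "p \<in> A {x}"
    then have "norm p \<le> (2 + C1 + C2) * x" using x rr by (intro A_range) auto
    also have "\<dots> < (3 + C1 + C2) * x" using x by simp
    finally show "p \<in> ball (0, 0) ((3 + C1 + C2) * x)" by (simp add: dist_norm flip: zero_prod_def)
  qed
  moreover have "limit_cycle Z (A {x})" using neg(1) pos(1) L(3) by linarith
  ultimately show ?thesis unfolding admits_cycle_def
    using hyperbolic_A[OF x Px P' ne] neg(2) pos(2) by (intro exI[of _ "A {x}"] conjI impI)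
qed

end

text \<open>For \<open>\<delta> = -1\<close> the reflected system is clockwise with the two halves
  exchanged, which reverses the comparison of \<open>D1\<close> with \<open>D2\<close>; hence the
  factor \<delta> in the hypotheses.\<close>

lemma turning_cycle:
  assumes hs: "half_system (fst Z) \<delta> b1 b01 r1 C1 g1 \<phi>1" "half_system (refl_field (snd Z)) (- \<delta>) b2 b02 r2 C2 g2 \<phi>2"
    and x: "0 < x" "x < min r1 r2 / 4" and eq: "\<phi>1 x = \<phi>2 x"
    and D1: "(\<phi>1 has_real_derivative D1) (at x)" "(\<phi>1 has_real_derivative D1') (at (\<phi>1 x))"
    and D2: "(\<phi>2 has_real_derivative D2) (at x)" "(\<phi>2 has_real_derivative D2') (at (\<phi>1 x))"
    and L: "\<delta> * L < 0 \<Longrightarrow> \<bar>D2\<bar> < \<bar>D1\<bar>" "\<delta> * L > 0 \<Longrightarrow> \<bar>D1\<bar> < \<bar>D2\<bar>" "L \<noteq> 0"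
  shows "admits_cycle Z L ((3 + C1 + C2) * x)"
proof -
  consider "\<delta> = 1" | "\<delta> = -1" using hs(1) by (auto simp: half_system_def)
  then show ?thesis
  proof cases
    case 1
    interpret clockwise Z b1 b01 r1 C1 g1 \<phi>1 b2 b02 r2 C2 g2 \<phi>2
      using hs 1 by (simp add: clockwise_def turning_def)
    show ?thesis by (rule cycle[OF x[folded rr_def] eq D1 D2]) (use L 1 in auto)
  next
    case 2
    interpret clockwise "refl_system Z" b2 b02 r2 C2 g2 \<phi>2 b1 b01 r1 C1 g1 \<phi>1
      using hs 2 by (simp add: clockwise_def turning_def refl_system_def)
    have "admits_cycle (refl_system Z) L ((3 + C2 + C1) * x)"
    proof (rule cycle[OF x(1) _ eq[symmetric] D2(1) _ D1(1)])
      show "x < rr / 4" using x by (simp add: rr_def min.commute)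
      show "(\<phi>2 has_real_derivative D2') (at (\<phi>2 x))" "(\<phi>1 has_real_derivative D1') (at (\<phi>2 x))"
        using D1(2) D2(2) eq by simp_all
    qed (use L 2 in auto)
    from admits_cycle_refl[OF this] show ?thesis by (simp add: add_ac)
  qed
qed

subsection \<open>Passing to the lower half-plane\<close>

lemma half_orbit_refl:
  assumes "half_orbit \<sigma> W x x'" shows "half_orbit (- \<sigma>) (refl_field W) x x'"
proof -
  obtain \<gamma> T where *: "T \<noteq> 0"
    "\<forall>t\<in>closed_segment 0 T. (\<gamma> has_vector_derivative W (\<gamma> t)) (at t within closed_segment 0 T)"
    "\<gamma> 0 = (x, 0)" "\<gamma> T = (x', 0)" "\<forall>t\<in>open_segment 0 T. \<sigma> * snd (\<gamma> t) > 0"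
    using assms unfolding half_orbit_def by blast
  have "((\<lambda>t. refl (\<gamma> t)) has_vector_derivative refl_field W (refl (\<gamma> t))) (at t within closed_segment 0 T)"
    if "t \<in> closed_segment 0 T" for t
    using bounded_linear.has_vector_derivative[OF refl_linear bspec[OF *(2) that]] by (simp add: refl_field_def)
  then show ?thesis unfolding half_orbit_def
    using * by (intro exI[of _ "\<lambda>t. refl (\<gamma> t)"] exI[of _ T]) simp
qed

lemma half_return_refl: "half_return (-1) W = half_return 1 (refl_field W)"
proof -
  have e: "half_orbit (-1) W x x' \<longleftrightarrow> half_orbit 1 (refl_field W) x x'" for x x'
    using half_orbit_refl[of "-1" W x x'] half_orbit_refl[of 1 "refl_field W" x x'] by auto
  have "half_orbit (-1) W = half_orbit 1 (refl_field W)" by (intro ext e)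
  then have "half_return (-1) W x = half_return 1 (refl_field W) x" for x
    by (simp only: half_return_def)
  then show ?thesis by (rule ext)
qed

lemma analytic_family_refl:
  assumes "analytic_family I W" shows "analytic_family I (\<lambda>l. refl_field (W l))"
  unfolding analytic_family_def
proof
  fix m assume "m \<in> I"
  from bspec[OF assms[unfolded analytic_family_def] this]
  obtain S r M and a :: "real \<Rightarrow> nat \<Rightarrow> nat \<Rightarrow> real \<times> real" where
    S: "openin (top_of_set I) S" "m \<in> S" "0 < r" and a: "\<forall>i j. continuous_on S (\<lambda>l. a l i j)"
    "\<forall>l\<in>S. \<forall>i j. norm (a l i j) * r ^ (i + j) \<le> M"
    and s: "\<forall>l\<in>S. \<forall>x y. \<bar>x\<bar> < r \<longrightarrow> \<bar>y\<bar> < r \<longrightarrow> ((\<lambda>(i, j). (x ^ i * y ^ j) *\<^sub>R a l i j) has_sum W l (x, y)) UNIV"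
    by (elim exE conjE) (rule that)
  let ?a = "\<lambda>l i j. ((-1) ^ j) *\<^sub>R refl (a l i j)"
  have "norm (refl p) = norm p" for p by (simp add: norm_prod_def refl_def)
  then have n: "norm (?a l i j) = norm (a l i j)" for l i j by (simp add: power_abs)
  have "continuous_on S (\<lambda>l. ?a l i j)" for i j
    by (rule continuous_on_scaleR[OF continuous_on_const bounded_linear.continuous_on[OF refl_linear a(1)[rule_format]]])
  note c = this
  have s': "((\<lambda>(i, j). (x ^ i * y ^ j) *\<^sub>R ?a l i j) has_sum refl_field (W l) (x, y)) UNIV"
    if "l \<in> S" "\<bar>x\<bar> < r" "\<bar>y\<bar> < r" for l x y
  proof -
    have y: "\<bar>- y\<bar> < r" using that by simp
    have "((\<lambda>(i, j). (x ^ i * (- y) ^ j) *\<^sub>R a l i j) has_sum W l (x, - y)) UNIV"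
      using s[rule_format, OF that(1,2) y] .
    from has_sum_bounded_linear[OF refl_linear this]
    have "((\<lambda>p. refl (case p of (i, j) \<Rightarrow> (x ^ i * (- y) ^ j) *\<^sub>R a l i j)) has_sum refl_field (W l) (x, y)) UNIV"
      by (simp add: refl_field_def o_def)
    also have "(\<lambda>p. refl (case p of (i, j) \<Rightarrow> (x ^ i * (- y) ^ j) *\<^sub>R a l i j)) = (\<lambda>(i, j). (x ^ i * y ^ j) *\<^sub>R ?a l i j)"
      by (auto simp: fun_eq_iff linear_scale[OF bounded_linear.linear[OF refl_linear]] power_minus[of y])
    finally show ?thesis .
  qed
  show "\<exists>S r M (a :: real \<Rightarrow> nat \<Rightarrow> nat \<Rightarrow> real \<times> real).
        openin (top_of_set I) S \<and> m \<in> S \<and> 0 < r \<and> (\<forall>i j. continuous_on S (\<lambda>l. a l i j)) \<and>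
        (\<forall>l\<in>S. \<forall>i j. norm (a l i j) * r ^ (i + j) \<le> M) \<and>
        (\<forall>l\<in>S. \<forall>x y. \<bar>x\<bar> < r \<longrightarrow> \<bar>y\<bar> < r \<longrightarrow>
           ((\<lambda>(i, j). (x ^ i * y ^ j) *\<^sub>R a l i j) has_sum refl_field (W l) (x, y)) UNIV)"
  proof (rule exI[of _ S], rule exI[of _ r], rule exI[of _ M], rule exI[of _ ?a], intro conjI allI ballI impI)
    show "norm (?a l i j) * r ^ (i + j) \<le> M" if "l \<in> S" for l i j
      unfolding n by (rule a(2)[rule_format, OF that])
  qed (fact S c s')+
qed

lemma X0_refl [simp]: "X0 (refl_field W) = X0 W"
  by (simp add: X0_def refl_field_def)

text \<open>The value of \<open>deriv\<close> is unspecified where a function is not differentiable,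
  so the sign is pulled out of the iterated derivative by way of the holomorphic extension.\<close>

lemma dYdx_refl:
  assumes W: "analytic_family I W" and m: "m \<in> I" shows "dYdx (refl_field (W m)) i = - dYdx (W m) i"
proof -
  obtain r M X Y where r: "0 < r" and ev: "\<forall>\<^sub>F l in near m I. hol2 r r (X l) \<and> hol2 r r (Y l) \<and>
       (\<forall>x y. norm x < r \<longrightarrow> norm y < r \<longrightarrow> norm (X l x y) \<le> M \<and> norm (Y l x y) \<le> M) \<and>
       (\<forall>x y. \<bar>x\<bar> < r \<longrightarrow> \<bar>y\<bar> < r \<longrightarrow> X l (of_real x) (of_real y) = of_real (fst (W l (x, y))) \<and>
          Y l (of_real x) (of_real y) = of_real (snd (W l (x, y))))"
    by (rule analytic_family_extension[OF W m]) (rule that; assumption)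
  from near_self[OF ev m] have h: "hol2 r r (Y m)"
    and re: "\<forall>x y. \<bar>x\<bar> < r \<longrightarrow> \<bar>y\<bar> < r \<longrightarrow> X m (of_real x) (of_real y) = of_real (fst (W m (x, y))) \<and>
          Y m (of_real x) (of_real y) = of_real (snd (W m (x, y)))" by simp_all
  have hol: "(\<lambda>z. Y m z 0) holomorphic_on ball 0 r"
    by (rule hol2_comp[OF h open_ball, where g = "\<lambda>z. z" and h = "\<lambda>z. 0"]) (use r in \<open>auto intro: holomorphic_intros\<close>)
  have Y0: "Y m (of_real x) 0 = of_real (snd (W m (x, 0)))" if "\<bar>x\<bar> < r" for x
    using re[rule_format, of x 0] that r by simp
  have 1: "(deriv ^^ i) (\<lambda>z. Y m z 0) (of_real 0) = of_real (dYdx (W m) i)"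
    unfolding dYdx_def by (rule iterated_deriv_real[OF hol]) (use Y0 r in simp_all)
  have 2: "(deriv ^^ i) (\<lambda>z. - Y m z 0) (of_real 0) = of_real (dYdx (refl_field (W m)) i)"
    unfolding dYdx_def
    by (rule iterated_deriv_real[OF holomorphic_on_minus[OF hol]]) (use Y0 r in \<open>simp_all add: refl_field_def\<close>)
  have "of_real (dYdx (refl_field (W m)) i) = (of_real (- dYdx (W m) i) :: complex)"
    using 1 2 higher_deriv_uminus[OF hol open_ball, of 0 i] r by simp
  then show ?thesis by (simp only: of_real_eq_iff)
qed

lemma contact_refl:
  assumes "analytic_family I W" "m \<in> I" "contact k (W m)" shows "contact k (refl_field (W m))"
proof -
  have "snd (refl_field (W m) (0, 0)) = - snd (W m (0, 0))" by (simp add: refl_field_def)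
  then show ?thesis using assms(3) unfolding contact_def X0_refl dYdx_refl[OF assms(1,2)] by simp
qed

text \<open>By \<open>half_orbit_iff\<close> the description operator in \<open>half_return\<close>
  is well defined for \<open>0 < \<bar>x\<bar> < r / 2\<close>, and at 0 both sides vanish; the
  coefficients are then Taylor coefficients of a holomorphic function.\<close>

lemma half_return_coeff_eq:
  assumes hs: "half_system W \<sigma> b b0 r C g (\<lambda>x. Re (\<phi> (of_real x)))" and hol: "\<phi> holomorphic_on ball 0 r"
    and b: "\<forall>z. norm z < r \<longrightarrow> norm (\<phi> z) \<le> 2 * norm z" and re: "\<forall>x. \<bar>x\<bar> < r \<longrightarrow> \<phi> (of_real x) \<in> \<real>"
  shows "half_return_coeff 1 W n = Re ((deriv ^^ n) \<phi> 0) / fact n"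
proof -
  interpret half_system W \<sigma> b b0 r C g "\<lambda>x. Re (\<phi> (of_real x))" by fact
  have "\<phi> (of_real x) = of_real (half_return 1 W x)" if x: "\<bar>x\<bar> < r / 2" for x
  proof (cases "x = 0")
    case True
    then show ?thesis using b[rule_format, of 0] r by (simp add: half_return_def)
  next
    case False
    then have "half_orbit 1 W x = (\<lambda>x'. x' = Re (\<phi> (of_real x)))"
      using half_orbit_iff[OF hs, of x] x by (simp add: fun_eq_iff)
    then have "half_return 1 W x = Re (\<phi> (of_real x))" using False by (simp add: half_return_def)
    moreover have "\<phi> (of_real x) \<in> \<real>" using re x r by auto
    ultimately show ?thesis by simp
  qed
  note e = this
  have "\<phi> holomorphic_on ball 0 (r / 2)" by (rule holomorphic_on_subset[OF hol]) (use r in auto)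
  from iterated_deriv_real[OF this e, of 0 n]
  have "(deriv ^^ n) \<phi> (of_real 0) = of_real ((deriv ^^ n) (half_return 1 W) 0)" using r by simp
  then show ?thesis by (simp add: half_return_coeff_def)
qed

subsection \<open>Taylor estimates on the real axis\<close>

lemma deriv_bound:
  assumes F: "F holomorphic_on ball 0 r" and B: "\<And>z. norm z < r \<Longrightarrow> norm (F z) \<le> B" and z: "norm z \<le> r / 2" and r: "0 < r"
  shows "norm ((deriv ^^ n) F z) \<le> fact n * B / (r / 4) ^ n"
proof (rule Cauchy_inequality)
  have sub: "cball z (r/4) \<subseteq> ball 0 r"
  proof
    fix w assume "w \<in> cball z (r/4)"
    then have "norm (w - z) \<le> r/4" by (simp add: dist_norm norm_minus_commute)
    moreover have "norm w \<le> norm z + norm (w - z)" using norm_triangle_ineq[of z "w - z"] by simp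
    ultimately show "w \<in> ball 0 r" using z r by auto
  qed
  show "F holomorphic_on ball z (r/4)" using F sub ball_subset_cball by (meson holomorphic_on_subset order_trans)
  show "continuous_on (cball z (r/4)) F" using F sub by (meson holomorphic_on_imp_continuous_on continuous_on_subset)
  show "norm (F w) \<le> B" if "norm (z - w) = r/4" for w
  proof -
    have "w \<in> cball z (r/4)" using that by (simp add: dist_norm)
    then have "w \<in> ball 0 r" using sub by blast
    then show ?thesis using B by simp
  qed
qed (use r in auto)

lemma holomorphic_taylor:
  assumes F: "F holomorphic_on ball 0 r" and B: "\<And>z. norm z < r \<Longrightarrow> norm (F z) \<le> B" and z: "norm z \<le> r / 2" and r: "0 < r"
  shows "norm ((deriv ^^ k) F z - (\<Sum>i\<le>n. (deriv ^^ (i + k)) F 0 * z ^ i / fact i))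
    \<le> (fact (Suc n + k) * B / (r / 4) ^ (Suc n + k)) * norm z ^ Suc n / fact n"
proof -
  have "norm ((deriv ^^ (0 + k)) F z - (\<Sum>i\<le>n. (deriv ^^ (i + k)) F 0 * (z - 0) ^ i / fact i))
    \<le> (fact (Suc n + k) * B / (r / 4) ^ (Suc n + k)) * norm (z - 0) ^ Suc n / fact n"
  proof (rule complex_Taylor[where S = "cball 0 (r/2)" and f = "\<lambda>i. (deriv ^^ (i + k)) F"])
    fix i and x :: complex assume x: "x \<in> cball 0 (r/2)"
    have "(deriv ^^ (i + k)) F holomorphic_on ball 0 r" by (rule holomorphic_higher_deriv[OF F open_ball])
    from holomorphic_derivI[OF this open_ball, of x] x r
    show "((deriv ^^ (i + k)) F has_field_derivative (deriv ^^ (Suc i + k)) F x) (at x within cball 0 (r/2))"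
      by simp
  next
    fix x :: complex assume "x \<in> cball 0 (r/2)"
    then show "norm ((deriv ^^ (Suc n + k)) F x) \<le> fact (Suc n + k) * B / (r / 4) ^ (Suc n + k)"
      by (intro deriv_bound[OF F B _ r]) auto
  qed (use z r in auto)
  then show ?thesis by simp
qed

lemma Re_derivative:
  assumes "F holomorphic_on ball 0 r" "\<bar>x\<bar> < r"
  shows "((\<lambda>x. Re (F (of_real x))) has_real_derivative Re (deriv F (of_real x))) (at x)"
proof -
  have "(F has_field_derivative deriv F (of_real x)) (at (of_real x))"
    by (rule holomorphic_derivI[OF assms(1) open_ball]) (use assms(2) in simp)
  then have "((\<lambda>x. F (of_real x)) has_vector_derivative deriv F (of_real x)) (at x)"
    by (rule has_vector_derivative_real_field)
  from bounded_linear.has_vector_derivative[OF bounded_linear_Re this]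
  show ?thesis by (simp add: has_real_derivative_iff_has_vector_derivative)
qed

definition coef :: "(complex \<Rightarrow> complex) \<Rightarrow> nat \<Rightarrow> real" where
  "coef F n = Re ((deriv ^^ n) F 0) / fact n"

text \<open>The remainder constants depend on \<open>r\<close>, \<open>B\<close> and
  \<open>n\<close> alone, which makes the expansions uniform in the parameter.\<close>

lemma real_taylor:
  assumes F: "F holomorphic_on ball 0 r" and B: "\<And>z. norm z < r \<Longrightarrow> norm (F z) \<le> B" and x: "\<bar>x\<bar> \<le> r / 2" and r: "0 < r"
  shows "\<bar>Re (F (of_real x)) - (\<Sum>i\<le>n. coef F i * x ^ i)\<bar> \<le> (fact (Suc n) * B / (r / 4) ^ (Suc n)) * \<bar>x\<bar> ^ Suc n"
    and "\<bar>Re (deriv F (of_real x)) - (\<Sum>i\<le>n. real (Suc i) * coef F (Suc i) * x ^ i)\<bar>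
      \<le> (fact (n + 2) * B / (r / 4) ^ (n + 2)) * \<bar>x\<bar> ^ Suc n"
proof -
  have z: "norm (of_real x :: complex) \<le> r / 2" using x by simp
  have B0: "0 \<le> B" using B[of 0] r norm_ge_zero[of "F 0"] by (simp del: norm_ge_zero)
  \<comment> \<open>The Taylor theorem offers a remainder divided by \<open>fact n\<close>; this
    gain is given away for a simpler constant.\<close>
  have d: "a * c / fact n \<le> a * c" if "0 \<le> a" "0 \<le> c" for a c :: real
    using divide_left_mono[of 1 "fact n" "a * c"] that fact_ge_1[of n, where 'a = real] by simp
  have s: "Re (\<Sum>i\<le>n. c i * of_real x ^ i / fact i) = (\<Sum>i\<le>n. Re (c i) / fact i * x ^ i)" for c :: "nat \<Rightarrow> complex"
  proof -
    have "Re (c i * of_real x ^ i / fact i) = Re (c i * of_real (x ^ i / fact i))" for i by simp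
    also have "Re (c i * of_real (x ^ i / fact i)) = Re (c i) / fact i * x ^ i" for i
      by (simp only: times_complex.sel Re_complex_of_real Im_complex_of_real) simp
    finally have "Re (c i * of_real x ^ i / fact i) = Re (c i) / fact i * x ^ i" for i .
    then show ?thesis by simp
  qed
  have "\<bar>Re (F (of_real x)) - (\<Sum>i\<le>n. coef F i * x ^ i)\<bar> = \<bar>Re ((deriv ^^ 0) F (of_real x) - (\<Sum>i\<le>n. (deriv ^^ (i + 0)) F 0 * of_real x ^ i / fact i))\<bar>"
    unfolding coef_def by (simp only: minus_complex.simps s add_0_right funpow_0)
  also have "\<dots> \<le> (fact (Suc n + 0) * B / (r / 4) ^ (Suc n + 0)) * norm (of_real x :: complex) ^ Suc n / fact n"
    by (rule order_trans[OF abs_Re_le_cmod holomorphic_taylor[OF F B z r]])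
  also have "\<dots> \<le> (fact (Suc n + 0) * B / (r / 4) ^ (Suc n + 0)) * norm (of_real x :: complex) ^ Suc n"
    by (rule d) (use B0 r in simp_all)
  finally show "\<bar>Re (F (of_real x)) - (\<Sum>i\<le>n. coef F i * x ^ i)\<bar> \<le> (fact (Suc n) * B / (r / 4) ^ (Suc n)) * \<bar>x\<bar> ^ Suc n" by simp
  have c: "real (Suc i) * coef F (Suc i) = Re ((deriv ^^ (i + 1)) F 0) / fact i" for i
    unfolding coef_def fact_Suc Suc_eq_plus1[symmetric] of_nat_mult by simp
  have "\<bar>Re (deriv F (of_real x)) - (\<Sum>i\<le>n. real (Suc i) * coef F (Suc i) * x ^ i)\<bar> = \<bar>Re ((deriv ^^ 1) F (of_real x) - (\<Sum>i\<le>n. (deriv ^^ (i + 1)) F 0 * of_real x ^ i / fact i))\<bar>"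
    unfolding c by (simp only: minus_complex.simps s One_nat_def funpow.simps o_apply id_apply)
  also have "\<dots> \<le> (fact (Suc n + 1) * B / (r / 4) ^ (Suc n + 1)) * norm (of_real x :: complex) ^ Suc n / fact n"
    by (rule order_trans[OF abs_Re_le_cmod holomorphic_taylor[OF F B z r]])
  also have "\<dots> \<le> (fact (Suc n + 1) * B / (r / 4) ^ (Suc n + 1)) * norm (of_real x :: complex) ^ Suc n"
    by (rule d) (use B0 r in simp_all)
  finally show "\<bar>Re (deriv F (of_real x)) - (\<Sum>i\<le>n. real (Suc i) * coef F (Suc i) * x ^ i)\<bar>
      \<le> (fact (n + 2) * B / (r / 4) ^ (n + 2)) * \<bar>x\<bar> ^ Suc n" by (simp add: eval_nat_numeral)
qed

text \<open>Comparing \<open>\<rho> x = (\<phi> x + x - a x\<^sup>2) / x\<^sup>3\<close> at \<open>x\<close> and at \<open>\<phi> x\<close>, where the numerators differ by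
  \<open>a (x\<^sup>2 - (\<phi> x)\<^sup>2)\<close>, determines the cubic coefficient of an involution.\<close>

lemma involution_coef:
  assumes F: "F holomorphic_on ball 0 r" and B: "\<And>z. norm z < r \<Longrightarrow> norm (F z) \<le> B" and r: "0 < r" and F0: "F 0 = 0"
    and inv: "\<And>x. 0 < \<bar>x\<bar> \<Longrightarrow> \<bar>x\<bar> < r / 2 \<Longrightarrow> Re (F (of_real (Re (F (of_real x))))) = x"
    and neg: "\<And>x. 0 < \<bar>x\<bar> \<Longrightarrow> \<bar>x\<bar> < r / 2 \<Longrightarrow> x * Re (F (of_real x)) < 0"
  shows "coef F 0 = 0" "coef F 1 = -1" "coef F 3 = - (coef F 2)\<^sup>2"
proof -
  define f where "f x = Re (F (of_real x))" for x
  let ?D = "Re (deriv F 0)"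
  have f0: "f 0 = 0" by (simp add: f_def F0)
  have D: "(f has_real_derivative ?D) (at 0)" using Re_derivative[OF F, of 0] r by (simp add: f_def[abs_def])
  have ev: "\<forall>\<^sub>F x in at 0. 0 < \<bar>x\<bar> \<and> \<bar>x\<bar> < r / 2"
    unfolding eventually_at by (rule exI[of _ "r / 2"]) (use r in \<open>simp add: dist_real_def\<close>)
  \<comment> \<open>The derivative at 0 of an involution squares to 1; that \<open>f x\<close> and
    \<open>x\<close> have opposite signs leaves the value \<open>-1\<close>.\<close>
  have "((\<lambda>x. x) has_real_derivative ?D * ?D) (at 0)"
  proof (rule has_field_derivative_transform_within_open[where f = "\<lambda>x. f (f x)" and S = "{- r/2<..<r/2}"])
    show "((\<lambda>x. f (f x)) has_real_derivative ?D * ?D) (at 0)" by (rule DERIV_chain2) (use D f0 in simp_all)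
    show "f (f x) = x" if "x \<in> {- r/2<..<r/2}" for x
      using inv[of x] that f0 by (cases "x = 0") (auto simp: f_def)
  qed (use r in auto)
  then have DD: "?D * ?D = 1" by (rule DERIV_unique) (rule DERIV_ident)
  have q: "((\<lambda>x. f x / x) \<longlongrightarrow> ?D) (at 0)" using D by (simp add: has_field_derivative_iff f0)
  have "f x / x \<le> 0" if "0 < \<bar>x\<bar> \<and> \<bar>x\<bar> < r / 2" for x
  proof -
    have "x * f x < 0" using neg[of x] that by (simp add: f_def)
    then show ?thesis by (auto simp: mult_less_0_iff divide_le_0_iff)
  qed
  then have "\<forall>\<^sub>F x in at 0. f x / x \<le> 0" by (rule eventually_mono[OF ev])
  then have "?D \<le> 0" by (rule tendsto_upperbound[OF q]) simp
  moreover have "?D = 1 \<or> ?D = -1" using DD by (simp only: square_eq_1_iff)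
  ultimately have D1: "?D = -1" by auto
  then show c1: "coef F 1 = -1" by (simp add: coef_def)
  show c0: "coef F 0 = 0" by (simp add: coef_def F0)
  define a b where "a = coef F 2" and "b = coef F 3"
  define \<rho> where "\<rho> x = (f x + x - a * x\<^sup>2) / x ^ 3" for x
  define K where "K = fact (Suc 3) * B / (r / 4) ^ (Suc 3)"
  have est: "\<bar>\<rho> x - b\<bar> \<le> K * \<bar>x\<bar>" if "0 < \<bar>x\<bar> \<and> \<bar>x\<bar> < r / 2" for x
  proof -
    have s: "(\<Sum>i\<le>3. g i) = g 0 + g 1 + g 2 + g 3" for g :: "nat \<Rightarrow> real" by (simp add: eval_nat_numeral)
    have "\<bar>f x - (- x + a * x\<^sup>2 + b * x ^ 3)\<bar> \<le> K * \<bar>x\<bar> ^ 4"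
      using real_taylor(1)[OF F B, of x 3] that r c0 c1 unfolding K_def f_def a_def b_def s by simp
    then have "\<bar>f x - (- x + a * x\<^sup>2 + b * x ^ 3)\<bar> / \<bar>x\<bar> ^ 3 \<le> K * \<bar>x\<bar> ^ 4 / \<bar>x\<bar> ^ 3" by (rule divide_right_mono) simp
    also have "K * \<bar>x\<bar> ^ 4 / \<bar>x\<bar> ^ 3 = K * \<bar>x\<bar>" using that by (simp add: eval_nat_numeral)
    also have "\<bar>f x - (- x + a * x\<^sup>2 + b * x ^ 3)\<bar> / \<bar>x\<bar> ^ 3 = \<bar>(f x - (- x + a * x\<^sup>2 + b * x ^ 3)) / x ^ 3\<bar>"
      by (simp add: abs_divide power_abs)
    also have "(f x - (- x + a * x\<^sup>2 + b * x ^ 3)) / x ^ 3 = \<rho> x - b"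
      using that by (simp add: \<rho>_def field_simps)
    finally show ?thesis .
  qed
  have \<rho>: "(\<rho> \<longlongrightarrow> b) (at 0)"
  proof (rule LIM_zero_cancel, rule Lim_null_comparison)
    show "\<forall>\<^sub>F x in at 0. norm (\<rho> x - b) \<le> K * \<bar>x\<bar>" by (rule eventually_mono[OF ev]) (simp add: est)
    show "((\<lambda>x. K * \<bar>x\<bar>) \<longlongrightarrow> 0) (at 0)" by (intro tendsto_mult_right_zero tendsto_rabs_zero tendsto_ident_at)
  qed
  have "filterlim f (at 0) (at 0)"
  proof -
    have "f \<midarrow>0\<rightarrow> 0" using DERIV_isCont[OF D] f0 by (simp add: isCont_def)
    moreover have "\<forall>\<^sub>F x in at 0. f x \<noteq> 0"
    proof (rule eventually_mono[OF ev])
      fix x assume "0 < \<bar>x\<bar> \<and> \<bar>x\<bar> < r / 2"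
      then show "f x \<noteq> 0" using neg[of x] by (auto simp: f_def)
    qed
    ultimately show ?thesis by (simp add: filterlim_at)
  qed
  then have \<rho>f: "((\<lambda>x. \<rho> (f x)) \<longlongrightarrow> b) (at 0)" by (rule filterlim_compose[OF \<rho>])
  have "((\<lambda>x. \<rho> x - \<rho> (f x) * (f x / x) ^ 3) \<longlongrightarrow> b - b * (-1) ^ 3) (at 0)"
    by (intro tendsto_intros \<rho> \<rho>f q[unfolded D1])
  note lim1 = this
  have lim2: "((\<lambda>x. - a * (1 - f x / x) * (a + x * \<rho> x)) \<longlongrightarrow> - a * (1 - (-1)) * (a + 0 * b)) (at 0)"
    by (intro tendsto_intros \<rho> q[unfolded D1])
  have eq: "\<forall>\<^sub>F x in at 0. \<rho> x - \<rho> (f x) * (f x / x) ^ 3 = - a * (1 - f x / x) * (a + x * \<rho> x)"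
  proof (rule eventually_mono[OF ev])
    fix x assume elim: "0 < \<bar>x\<bar> \<and> \<bar>x\<bar> < r / 2"
    have nz: "x \<noteq> 0" "f x \<noteq> 0" using elim neg[of x] by (auto simp: f_def)
    have ff: "f (f x) = x" using inv[of x] elim by (simp add: f_def)
    define y where "y = f x"
    have 1: "\<rho> x * x ^ 3 = y + x - a * x\<^sup>2" "\<rho> y * y ^ 3 = x + y - a * y\<^sup>2"
      using nz ff by (simp_all add: \<rho>_def y_def)
    have "(\<rho> x - \<rho> y * (y / x) ^ 3) * x ^ 3 = \<rho> x * x ^ 3 - \<rho> y * y ^ 3"
      using nz by (simp add: field_simps)
    also have "\<dots> = - a * (x - y) * (x + y)" unfolding 1 by (simp add: algebra_simps power2_eq_square)
    also have "x + y = a * x\<^sup>2 + \<rho> x * x ^ 3" unfolding 1 by simp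
    also have "- a * (x - y) * (a * x\<^sup>2 + \<rho> x * x ^ 3) = (- a * (1 - y / x) * (a + x * \<rho> x)) * x ^ 3"
      using nz by (simp add: field_simps eval_nat_numeral)
    finally have e: "(\<rho> x - \<rho> y * (y / x) ^ 3) * x ^ 3 = (- a * (1 - y / x) * (a + x * \<rho> x)) * x ^ 3" .
    have x3: "x ^ 3 \<noteq> 0" using nz by simp
    show "\<rho> x - \<rho> (f x) * (f x / x) ^ 3 = - a * (1 - f x / x) * (a + x * \<rho> x)"
      using e unfolding mult_right_cancel[OF x3] by (simp only: y_def)
  qed
  have "((\<lambda>x. \<rho> x - \<rho> (f x) * (f x / x) ^ 3) \<longlongrightarrow> - a * (1 - (-1)) * (a + 0 * b)) (at 0)"
    by (rule iffD2[OF tendsto_cong[OF eq] lim2])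
  from LIM_unique[OF lim1 this] have "2 * b = - 2 * (a * a)" by simp
  then have "b = - (a * a)" by linarith
  then show "coef F 3 = - (coef F 2)\<^sup>2" by (simp only: a_def b_def power2_eq_square)
qed

text \<open>Normalised to \<open>V2 < 0 < V4\<close>. With \<open>V2\<close> near
  \<open>- d * \<epsilon>\<^sup>2\<close>, the sum \<open>V2 * x\<^sup>2 + V4 * x ^ 4\<close>
  changes sign at an \<open>x\<close> of order \<epsilon>, and the bound on \<open>V3\<close> lets
  at most half of \<open>V2\<close> be lost to the cubic term.\<close>

lemma quartic_root:
  fixes d L K :: real
  assumes d: "0 < d" and L: "0 < L" and K: "0 \<le> K"
  obtains m M e0 where "0 < m" "m \<le> M" "0 < e0"
    "\<forall>\<epsilon> V2 V3 V4 F F'. 0 < \<epsilon> \<longrightarrow> \<epsilon> < e0 \<longrightarrow> - (3/2) * (d * \<epsilon>\<^sup>2) \<le> V2 \<longrightarrow> V2 \<le> - (1/2) * (d * \<epsilon>\<^sup>2) \<longrightarrow>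
       L / 2 \<le> V4 \<longrightarrow> V4 \<le> 2 * L \<longrightarrow> \<bar>V3\<bar> \<le> K * \<bar>V2\<bar> \<longrightarrow>
       (\<forall>x. 0 \<le> x \<longrightarrow> x \<le> M * \<epsilon> \<longrightarrow> (F has_real_derivative F' x) (at x)) \<longrightarrow>
       (\<forall>x. 0 \<le> x \<longrightarrow> x \<le> M * \<epsilon> \<longrightarrow> \<bar>F x - (V2 * x\<^sup>2 + V3 * x ^ 3 + V4 * x ^ 4)\<bar> \<le> K * x ^ 5) \<longrightarrow>
       (\<forall>x. 0 \<le> x \<longrightarrow> x \<le> M * \<epsilon> \<longrightarrow> \<bar>F' x - (2 * V2 * x + 3 * V3 * x\<^sup>2 + 4 * V4 * x ^ 3)\<bar> \<le> K * x ^ 4) \<longrightarrow>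
       (\<exists>x. m * \<epsilon> \<le> x \<and> x \<le> M * \<epsilon> \<and> F x = 0 \<and> 0 < F' x)"
proof -
  \<comment> \<open>The balance is near \<open>\<epsilon> * sqrt (d / L)\<close>. The factors 16
    leave room for the tolerances: after division by \<open>x\<^sup>2\<close>, the quartic term is
    at most \<open>d * \<epsilon>\<^sup>2 / 8\<close> at \<open>m * \<epsilon>\<close> and at least
    \<open>8 * d * \<epsilon>\<^sup>2\<close> at \<open>M * \<epsilon>\<close>.\<close>
  define m M where "m = sqrt (d / (16 * L))" and "M = sqrt (16 * d / L)"
  \<comment> \<open>An upper bound for \<open>K * x\<close> on the range considered:
    \<open>1/2\<close> absorbs the cubic term, \<open>L / 16\<close> the remainder at the two ends,
    and \<open>L / (4 + 24 * L)\<close> the error terms in the derivative.\<close>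
  define c where "c = min (1/2) (min (L / 16) (L / (4 + 24 * L)))"
  define e0 where "e0 = c / ((K + 1) * M)"
  have m2: "m\<^sup>2 = d / (16 * L)" and M2: "M\<^sup>2 = 16 * d / L" using d L by (simp_all add: m_def M_def)
  have mM: "0 < m" "0 < M" "m \<le> M" using d L by (auto simp: m_def M_def divide_simps)
  have c: "0 < c" "c \<le> 1/2" "c \<le> L / 16" "c \<le> L / (4 + 24 * L)" 
  proof -
    show "0 < c" using L by (simp add: c_def)
    show "c \<le> 1/2" "c \<le> L / 16" "c \<le> L / (4 + 24 * L)"
      unfolding c_def by (rule min.cobounded1 min.coboundedI2[OF min.cobounded1] min.coboundedI2[OF min.cobounded2])+
  qed
  have e0: "0 < e0" using c(1) K mM by (simp add: e0_def)
  show ?thesis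
  proof (rule that[OF mM(1,3) e0], intro allI impI)
    fix \<epsilon> V2 V3 V4 :: real and F F' :: "real \<Rightarrow> real"
    assume \<epsilon>: "0 < \<epsilon>" "\<epsilon> < e0" and V2: "- (3/2) * (d * \<epsilon>\<^sup>2) \<le> V2" "V2 \<le> - (1/2) * (d * \<epsilon>\<^sup>2)"
      and V4: "L / 2 \<le> V4" "V4 \<le> 2 * L" and V3: "\<bar>V3\<bar> \<le> K * \<bar>V2\<bar>"
      and DF0: "\<forall>x. 0 \<le> x \<longrightarrow> x \<le> M * \<epsilon> \<longrightarrow> (F has_real_derivative F' x) (at x)"
      and F0: "\<forall>x. 0 \<le> x \<longrightarrow> x \<le> M * \<epsilon> \<longrightarrow> \<bar>F x - (V2 * x\<^sup>2 + V3 * x ^ 3 + V4 * x ^ 4)\<bar> \<le> K * x ^ 5"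
      and F'0: "\<forall>x. 0 \<le> x \<longrightarrow> x \<le> M * \<epsilon> \<longrightarrow> \<bar>F' x - (2 * V2 * x + 3 * V3 * x\<^sup>2 + 4 * V4 * x ^ 3)\<bar> \<le> K * x ^ 4"
    note DF = DF0[rule_format] and F = F0[rule_format] and F' = F'0[rule_format]
    have de: "0 < d * \<epsilon>\<^sup>2" using d \<epsilon> by simp
    have V2n: "V2 < 0" using V2(2) de by linarith
    have Kx: "K * x \<le> c" if "0 \<le> x" "x \<le> M * \<epsilon>" for x
    proof -
      have "K * x \<le> (K + 1) * (M * \<epsilon>)" using that K by (intro mult_mono) auto
      also have "\<dots> \<le> (K + 1) * (M * e0)" using \<epsilon> K mM by (intro mult_left_mono) auto
      also have "\<dots> = c" using K mM by (simp add: e0_def)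
      finally show ?thesis .
    qed
    have V3x: "\<bar>V3 * x\<bar> \<le> - V2 / 2" if "0 \<le> x" "x \<le> M * \<epsilon>" for x
    proof -
      have "\<bar>V3 * x\<bar> = \<bar>V3\<bar> * x" using that by (simp add: abs_mult)
      also have "\<dots> \<le> K * \<bar>V2\<bar> * x" by (rule mult_right_mono[OF V3 that(1)])
      also have "\<dots> = \<bar>V2\<bar> * (K * x)" by simp
      also have "\<dots> \<le> \<bar>V2\<bar> * (1/2)" using Kx[OF that] c(2) by (intro mult_left_mono) auto
      finally show ?thesis using V2n by simp
    qed
    have fac: "V2 * x\<^sup>2 + V3 * x ^ 3 + V4 * x ^ 4 = x\<^sup>2 * (V2 + V3 * x + V4 * x\<^sup>2)" "K * x ^ 5 = x\<^sup>2 * (K * x * x\<^sup>2)" for x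
      by (simp_all add: algebra_simps eval_nat_numeral)
    have m\<epsilon>: "0 < m * \<epsilon>" "m * \<epsilon> \<le> M * \<epsilon>" using mM \<epsilon> by simp_all
    have lo: "F (m * \<epsilon>) \<le> 0"
    proof -
      let ?x = "m * \<epsilon>"
      have x2: "?x\<^sup>2 = d * \<epsilon>\<^sup>2 / (16 * L)" by (simp add: power_mult_distrib m2)
      have "V4 * ?x\<^sup>2 \<le> 2 * L * ?x\<^sup>2" by (rule mult_right_mono[OF V4(2)]) simp
      then have 1: "V4 * ?x\<^sup>2 \<le> d * \<epsilon>\<^sup>2 / 8" using L by (simp add: x2)
      have "K * ?x * ?x\<^sup>2 \<le> L / 16 * ?x\<^sup>2" using Kx[of ?x] m\<epsilon> c(3) by (intro mult_right_mono) auto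
      then have 2: "K * ?x * ?x\<^sup>2 \<le> d * \<epsilon>\<^sup>2 / 256" using L by (simp add: x2)
      have 3: "V3 * ?x \<le> - V2 / 2" using V3x[of ?x] m\<epsilon> by linarith
      have "F ?x \<le> ?x\<^sup>2 * (V2 + V3 * ?x + V4 * ?x\<^sup>2) + ?x\<^sup>2 * (K * ?x * ?x\<^sup>2)"
        using F[of ?x] m\<epsilon> unfolding fac by linarith
      also have "\<dots> = ?x\<^sup>2 * ((V2 + V3 * ?x + V4 * ?x\<^sup>2) + K * ?x * ?x\<^sup>2)" by (simp only: distrib_left)
      also have "\<dots> \<le> 0" using 1 2 3 V2(2) de by (intro mult_nonneg_nonpos) (simp, linarith)
      finally show ?thesis .
    qed
    have hi: "0 \<le> F (M * \<epsilon>)"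
    proof -
      let ?x = "M * \<epsilon>"
      have x0: "0 \<le> ?x" using m\<epsilon> by linarith
      have x2: "?x\<^sup>2 = 16 * (d * \<epsilon>\<^sup>2) / L" by (simp add: power_mult_distrib M2)
      have "L / 2 * ?x\<^sup>2 \<le> V4 * ?x\<^sup>2" by (rule mult_right_mono[OF V4(1)]) simp
      then have 1: "8 * (d * \<epsilon>\<^sup>2) \<le> V4 * ?x\<^sup>2" using L by (simp add: x2)
      have "K * ?x * ?x\<^sup>2 \<le> L / 16 * ?x\<^sup>2" using Kx[OF x0] c(3) by (intro mult_right_mono) auto
      then have 2: "K * ?x * ?x\<^sup>2 \<le> d * \<epsilon>\<^sup>2" using L by (simp add: x2)
      have 3: "V2 / 2 \<le> V3 * ?x" using V3x[OF x0] by linarith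
      have "0 \<le> ?x\<^sup>2 * ((V2 + V3 * ?x + V4 * ?x\<^sup>2) - K * ?x * ?x\<^sup>2)"
        using 1 2 3 V2(1) de by (intro mult_nonneg_nonneg) (simp, linarith)
      also have "\<dots> = ?x\<^sup>2 * (V2 + V3 * ?x + V4 * ?x\<^sup>2) - ?x\<^sup>2 * (K * ?x * ?x\<^sup>2)" by (simp only: right_diff_distrib)
      also have "\<dots> \<le> F ?x" using F[OF x0] unfolding fac by linarith
      finally show ?thesis .
    qed
    have "continuous_on {m * \<epsilon>..M * \<epsilon>} F"
      by (rule continuous_at_imp_continuous_on, rule ballI, rule DERIV_isCont, rule DF) (use m\<epsilon> in auto)
    from IVT'[OF lo hi m\<epsilon>(2) this] obtain x where x: "m * \<epsilon> \<le> x" "x \<le> M * \<epsilon>" "F x = 0" by blast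
    have x0: "0 < x" using x m\<epsilon> by linarith
    \<comment> \<open>For the derivative the cubic term has to be small against
      \<open>L * x ^ 4\<close>: from \<open>m * \<epsilon> \<le> x\<close> follows
      \<open>V2 = O(x\<^sup>2)\<close>, and so does \<open>V3\<close>.\<close>
    have "\<bar>V3\<bar> \<le> 24 * K * L * x\<^sup>2"
    proof -
      have "(m * \<epsilon>)\<^sup>2 \<le> x\<^sup>2" using x m\<epsilon> by (intro power_mono) auto
      then have "d * \<epsilon>\<^sup>2 \<le> 16 * L * x\<^sup>2" using L by (simp add: power_mult_distrib m2 field_simps)
      then have "\<bar>V2\<bar> \<le> 24 * L * x\<^sup>2" using V2 V2n by linarith
      then have "K * \<bar>V2\<bar> \<le> K * (24 * L * x\<^sup>2)" by (rule mult_left_mono[OF _ K])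
      then show ?thesis using V3 by (simp add: mult_ac)
    qed
    then have "\<bar>V3\<bar> * x ^ 3 \<le> 24 * K * L * x\<^sup>2 * x ^ 3" using x0 by (intro mult_right_mono) auto
    then have v3: "- (24 * L * (K * x ^ 5)) \<le> V3 * x ^ 3"
    proof -
      assume a: "\<bar>V3\<bar> * x ^ 3 \<le> 24 * K * L * x\<^sup>2 * x ^ 3"
      have "24 * K * L * x\<^sup>2 * x ^ 3 = 24 * L * (K * x ^ 5)" by (simp add: eval_nat_numeral)
      moreover have "- (\<bar>V3\<bar> * x ^ 3) \<le> V3 * x ^ 3" using x0 mult_right_mono[of "- \<bar>V3\<bar>" V3 "x ^ 3"] by simp
      ultimately show ?thesis using a by linarith
    qed
    have root: "- (K * x ^ 5) \<le> V2 * x\<^sup>2 + V3 * x ^ 3 + V4 * x ^ 4" using F[of x] x x0 by linarith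
    \<comment> \<open>Subtracting twice the polynomial from \<open>x\<close> times its derivative
      eliminates \<open>V2\<close>. At a zero of \<open>F\<close> the polynomial is no larger than
      the remainder, so the term \<open>2 * V4 * x ^ 4\<close> decides the sign.\<close>
    have "(2 * V2 * x + 3 * V3 * x\<^sup>2 + 4 * V4 * x ^ 3 - K * x ^ 4) * x \<le> F' x * x"
      using F'[of x] x x0 by (intro mult_right_mono) auto
    moreover have "(2 * V2 * x + 3 * V3 * x\<^sup>2 + 4 * V4 * x ^ 3 - K * x ^ 4) * x
       = 2 * (V2 * x\<^sup>2 + V3 * x ^ 3 + V4 * x ^ 4) + V3 * x ^ 3 + 2 * (V4 * x ^ 4) - K * x ^ 5"
      by (simp add: algebra_simps eval_nat_numeral)
    moreover have "L / 2 * x ^ 4 \<le> V4 * x ^ 4" by (rule mult_right_mono[OF V4(1)]) simp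
    ultimately have "L * x ^ 4 - (3 + 24 * L) * (K * x ^ 5) \<le> F' x * x" using root v3 by (simp add: algebra_simps)
    moreover have "0 < L * x ^ 4 - (3 + 24 * L) * (K * x ^ 5)"
    proof -
      have "(3 + 24 * L) * (K * x) \<le> (3 + 24 * L) * (L / (4 + 24 * L))"
        using Kx[of x] x x0 c(4) L by (intro mult_left_mono) auto
      also have "\<dots> < L" using L by (simp add: field_simps)
      finally have "0 < (L - (3 + 24 * L) * (K * x)) * x ^ 4" using x0 by simp
      then show ?thesis by (simp add: algebra_simps eval_nat_numeral)
    qed
    ultimately have "0 < F' x * x" by linarith
    then have "0 < F' x" using x0 by (simp add: zero_less_mult_iff)
    then show "\<exists>x. m * \<epsilon> \<le> x \<and> x \<le> M * \<epsilon> \<and> F x = 0 \<and> 0 < F' x" using x by blast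
  qed
qed

subsection \<open>The displacement function\<close>

text \<open>What the displacement function requires of a half-return map, detached from the vector
  field and on a radius that both halves can share.\<close>

definition half_map :: "real \<Rightarrow> (complex \<Rightarrow> complex) \<Rightarrow> bool" where
  "half_map r \<phi> \<longleftrightarrow> 0 < r \<and> \<phi> holomorphic_on ball 0 r \<and> (\<forall>z. norm z < r \<longrightarrow> norm (\<phi> z) \<le> 2 * norm z) \<and>
     (\<forall>x. 0 < \<bar>x\<bar> \<longrightarrow> \<bar>x\<bar> < r / 2 \<longrightarrow>
        Re (\<phi> (of_real (Re (\<phi> (of_real x))))) = x \<and> x * Re (\<phi> (of_real x)) < 0)"

lemma half_mapI:
  assumes hs: "half_system W \<sigma> b b0 r' C g (\<lambda>x. Re (\<phi> (of_real x)))" and hol: "\<phi> holomorphic_on ball 0 r'"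
    and b: "\<forall>z. norm z < r' \<longrightarrow> norm (\<phi> z) \<le> 2 * norm z" and rr: "0 < r" "r \<le> r'"
  shows "half_map r \<phi>"
proof -
  interpret half_system W \<sigma> b b0 r' C g "\<lambda>x. Re (\<phi> (of_real x))" by (rule hs)
  have 1: "\<phi> holomorphic_on ball 0 r" by (rule holomorphic_on_subset[OF hol]) (use rr in auto)
  have 2: "norm (\<phi> z) \<le> 2 * norm z" if "norm z < r" for z by (rule b[rule_format]) (use that rr in linarith)
  have 3: "Re (\<phi> (of_real (Re (\<phi> (of_real x))))) = x" if "0 < \<bar>x\<bar>" "\<bar>x\<bar> < r / 2" for x
    by (rule \<phi>_inv[OF that(1)]) (use that rr(2) in linarith)
  have 4: "x * Re (\<phi> (of_real x)) < 0" if "0 < \<bar>x\<bar>" "\<bar>x\<bar> < r / 2" for x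
    by (rule conjunct1[OF \<phi>_bound[OF that(1)]]) (use that rr in linarith)
  show ?thesis unfolding half_map_def using rr(1) 1 2 3 4 by (intro conjI allI impI)
qed

lemma half_mapD:
  assumes "half_map r \<phi>"
  shows "0 < r" "\<phi> holomorphic_on ball 0 r" "norm z < r \<Longrightarrow> norm (\<phi> z) \<le> 2 * norm z"
    "norm z < r \<Longrightarrow> norm (\<phi> z) \<le> 2 * r"
    "0 < \<bar>x\<bar> \<Longrightarrow> \<bar>x\<bar> < r / 2 \<Longrightarrow> Re (\<phi> (of_real (Re (\<phi> (of_real x))))) = x"
    "0 < \<bar>x\<bar> \<Longrightarrow> \<bar>x\<bar> < r / 2 \<Longrightarrow> x * Re (\<phi> (of_real x)) < 0"
proof -
  show "0 < r" "\<phi> holomorphic_on ball 0 r" using assms by (simp_all add: half_map_def)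
  show b: "norm (\<phi> z) \<le> 2 * norm z" if "norm z < r" using assms that by (simp add: half_map_def)
  show "norm (\<phi> z) \<le> 2 * r" if "norm z < r" using b[OF that] that by linarith
  show "Re (\<phi> (of_real (Re (\<phi> (of_real x))))) = x" "x * Re (\<phi> (of_real x)) < 0" if "0 < \<bar>x\<bar>" "\<bar>x\<bar> < r / 2"
    using assms that by (simp_all add: half_map_def)
qed

lemma half_map_coef:
  assumes "half_map r \<phi>"
  shows "coef \<phi> 0 = 0" "coef \<phi> 1 = -1" "coef \<phi> 3 = - (coef \<phi> 2)\<^sup>2"
proof -
  note h = half_mapD[OF assms]
  have F0: "\<phi> 0 = 0" using h(3)[of 0] h(1) by simp
  show "coef \<phi> 0 = 0" "coef \<phi> 1 = -1" "coef \<phi> 3 = - (coef \<phi> 2)\<^sup>2"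
    using involution_coef[OF h(2,4,1) F0 h(5,6)] by simp_all
qed

lemma coef_bound:
  assumes "F holomorphic_on ball 0 r" "\<And>z. norm z < r \<Longrightarrow> norm (F z) \<le> B" "0 < r"
  shows "\<bar>coef F n\<bar> \<le> B / (r / 4) ^ n"
proof -
  have "\<bar>Re ((deriv ^^ n) F 0)\<bar> \<le> fact n * B / (r / 4) ^ n"
    by (rule order_trans[OF abs_Re_le_cmod deriv_bound[OF assms(1,2)]]) (use assms(3) in auto)
  then have "\<bar>Re ((deriv ^^ n) F 0)\<bar> / fact n \<le> fact n * B / (r / 4) ^ n / fact n" by (rule divide_right_mono) simp
  then show ?thesis by (simp add: coef_def abs_divide)
qed

lemma coef_diff:
  assumes "F holomorphic_on ball 0 r" "G holomorphic_on ball 0 r" "0 < r"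
  shows "coef (\<lambda>z. F z - G z) n = coef F n - coef G n"
  using higher_deriv_diff[OF assms(1,2) open_ball, of 0 n] assms(3) by (simp add: coef_def diff_divide_distrib)

text \<open>Cauchy's inequality for the difference: uniform convergence on a disc implies
  convergence of every Taylor coefficient.\<close>

lemma coef_tendsto:
  assumes ul: "uniform_limit (ball 0 r) \<phi> \<psi> N" and ev: "\<forall>\<^sub>F l in N. \<phi> l holomorphic_on ball 0 r"
    and hol: "\<psi> holomorphic_on ball 0 r" and r: "0 < r"
  shows "((\<lambda>l. coef (\<phi> l) n) \<longlongrightarrow> coef \<psi> n) N"
proof (rule tendstoI)
  fix e :: real assume e: "0 < e"
  define e' where "e' = e / 2 * (r / 4) ^ n"
  have e': "0 < e'" using e r by (simp add: e'_def)
  have *: "dist (coef (\<phi> l) n) (coef \<psi> n) < e"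
    if "\<phi> l holomorphic_on ball 0 r" "\<forall>z\<in>ball 0 r. dist (\<phi> l z) (\<psi> z) < e'" for l
  proof -
    have "\<bar>coef (\<lambda>z. \<phi> l z - \<psi> z) n\<bar> \<le> e' / (r / 4) ^ n"
      by (rule coef_bound[OF holomorphic_on_diff[OF that(1) hol] _ r])
        (use that(2) in \<open>auto simp: dist_norm intro: less_imp_le\<close>)
    also have "\<dots> = e / 2" using r by (simp add: e'_def)
    finally show ?thesis using e by (simp add: coef_diff[OF that(1) hol r] dist_real_def)
  qed
  show "\<forall>\<^sub>F l in N. dist (coef (\<phi> l) n) (coef \<psi> n) < e"
    by (rule eventually_mono[OF eventually_conj[OF ev uniform_limitD[OF ul e']]]) (use * in auto)
qed

text \<open>One constant for all estimates. The first summand is the remainder constant for the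
  difference of two half maps, which is bounded by \<open>4 * r\<close>. The second bounds the sum
  of two quadratic coefficients, and also the first-order remainder of the derivative of one half
  map.\<close>

definition taylor_const :: "real \<Rightarrow> real" where
  "taylor_const r = fact 5 * (4 * r) / (r / 4) ^ 5 + 4 * r / (r / 4) ^ 2"

text \<open>The derivative is \<open>-1 + O(x)\<close>, with the error constant contained in
  \<open>taylor_const\<close>.\<close>

lemma half_map_deriv_neg:
  assumes h: "half_map r \<phi>" and x: "0 < x" "x \<le> r / 2" "taylor_const r * x < 1"
  shows "Re (deriv \<phi> (of_real x)) < 0"
proof -
  note h' = half_mapD[OF h]
  have "\<bar>Re (deriv \<phi> (of_real x)) - (\<Sum>i\<le>0. real (Suc i) * coef \<phi> (Suc i) * x ^ i)\<bar>
      \<le> (fact (0 + 2) * (2 * r) / (r / 4) ^ (0 + 2)) * \<bar>x\<bar> ^ Suc 0"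
    by (rule real_taylor(2)[OF h'(2,4) _ h'(1)]) (use x in auto)
  moreover have "(\<Sum>i\<le>0. real (Suc i) * coef \<phi> (Suc i) * x ^ i) = - 1" using half_map_coef(2)[OF h] by simp
  moreover have "(fact (0 + 2) * (2 * r) / (r / 4) ^ (0 + 2)) * \<bar>x\<bar> ^ Suc 0 = (4 * r / (r / 4) ^ 2) * x"
  proof -
    have "fact (0 + 2) * (2 * r) = 4 * r" by simp
    moreover have "\<bar>x\<bar> ^ Suc 0 = x" using x(1) by simp
    ultimately show ?thesis by (simp only: add_0)
  qed
  ultimately have 1: "\<bar>Re (deriv \<phi> (of_real x)) + 1\<bar> \<le> (4 * r / (r / 4) ^ 2) * x"
    by (simp only: diff_minus_eq_add)
  have "(4 * r / (r / 4) ^ 2) * x \<le> taylor_const r * x"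
    unfolding taylor_const_def using x(1) h'(1) by (intro mult_right_mono) simp_all
  then show ?thesis using 1 x(3) by linarith
qed

text \<open>Both cubic coefficients are minus the squares of the quadratic ones, so
  \<open>V 3 = - (coef \<phi> 2 + coef \<psi> 2) * V 2\<close>; the other two claims are Taylor
  expansions of the difference, whose terms of order 0 and 1 cancel.\<close>

lemma displacement_estimates:
  assumes \<phi>: "half_map r \<phi>" and \<psi>: "half_map r \<psi>"
  defines "V n \<equiv> coef \<phi> n - coef \<psi> n"
  shows "\<bar>V 3\<bar> \<le> taylor_const r * \<bar>V 2\<bar>"
    "0 \<le> x \<Longrightarrow> x \<le> r / 2 \<Longrightarrow> \<bar>Re (\<phi> (of_real x)) - Re (\<psi> (of_real x)) - (V 2 * x\<^sup>2 + V 3 * x ^ 3 + V 4 * x ^ 4)\<bar>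
       \<le> taylor_const r * x ^ 5"
    "0 \<le> x \<Longrightarrow> x \<le> r / 2 \<Longrightarrow> \<bar>Re (deriv \<phi> (of_real x)) - Re (deriv \<psi> (of_real x)) - (2 * V 2 * x + 3 * V 3 * x\<^sup>2 + 4 * V 4 * x ^ 3)\<bar>
       \<le> taylor_const r * x ^ 4"
proof -
  note p = half_mapD[OF \<phi>] and q = half_mapD[OF \<psi>]
  let ?F = "\<lambda>z. \<phi> z - \<psi> z"
  have r: "0 < r" by (rule p(1))
  have tc: "fact 5 * (4 * r) / (r / 4) ^ 5 \<le> taylor_const r" "4 * r / (r / 4) ^ 2 \<le> taylor_const r"
    using r by (simp_all add: taylor_const_def)
  have F: "?F holomorphic_on ball 0 r" by (rule holomorphic_on_diff[OF p(2) q(2)])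
  have B: "norm (?F z) \<le> 4 * r" if "norm z < r" for z
    using norm_triangle_ineq4[of "\<phi> z" "\<psi> z"] p(4)[OF that] q(4)[OF that] by linarith
  have c: "coef ?F n = V n" for n unfolding V_def by (rule coef_diff[OF p(2) q(2) r])
  have V01: "V 0 = 0" "V 1 = 0" "V (Suc 0) = 0" using half_map_coef[OF \<phi>] half_map_coef[OF \<psi>] by (simp_all add: V_def)
  have "V 3 = - ((coef \<phi> 2 + coef \<psi> 2) * V 2)"
    using half_map_coef(3)[OF \<phi>] half_map_coef(3)[OF \<psi>] by (simp add: V_def algebra_simps power2_eq_square)
  then have "\<bar>V 3\<bar> = \<bar>coef \<phi> 2 + coef \<psi> 2\<bar> * \<bar>V 2\<bar>" by (simp add: abs_mult)
  also have "\<dots> \<le> taylor_const r * \<bar>V 2\<bar>"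
  proof (rule mult_right_mono)
    have "\<bar>coef \<phi> 2\<bar> \<le> 2 * r / (r / 4) ^ 2" by (rule coef_bound[OF p(2) p(4) r])
    moreover have "\<bar>coef \<psi> 2\<bar> \<le> 2 * r / (r / 4) ^ 2" by (rule coef_bound[OF q(2) q(4) r])
    moreover have "2 * r / (r / 4) ^ 2 + 2 * r / (r / 4) ^ 2 = 4 * r / (r / 4) ^ 2" by (simp flip: add_divide_distrib)
    ultimately show "\<bar>coef \<phi> 2 + coef \<psi> 2\<bar> \<le> taylor_const r" using tc(2) by linarith
  qed simp
  finally show "\<bar>V 3\<bar> \<le> taylor_const r * \<bar>V 2\<bar>" .
  assume x: "0 \<le> x" "x \<le> r / 2"
  then have x': "\<bar>x\<bar> \<le> r / 2" by simp
  have s4: "(\<Sum>i\<le>4. g i) = g 0 + g 1 + g 2 + g 3 + g 4" and s3: "(\<Sum>i\<le>3. g i) = g 0 + g 1 + g 2 + g 3" for g :: "nat \<Rightarrow> real"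
    by (simp_all add: eval_nat_numeral)
  have "\<bar>Re (?F (of_real x)) - (\<Sum>i\<le>4. coef ?F i * x ^ i)\<bar> \<le> (fact (Suc 4) * (4 * r) / (r / 4) ^ (Suc 4)) * \<bar>x\<bar> ^ Suc 4"
    by (rule real_taylor(1)[OF F B x' r])
  then have "\<bar>Re (?F (of_real x)) - (V 2 * x\<^sup>2 + V 3 * x ^ 3 + V 4 * x ^ 4)\<bar> \<le> (fact 5 * (4 * r) / (r / 4) ^ 5) * x ^ 5"
    unfolding c s4 using V01 x(1) by simp
  also have "\<dots> \<le> taylor_const r * x ^ 5" by (rule mult_right_mono[OF tc(1)]) (use x in simp)
  finally show "\<bar>Re (\<phi> (of_real x)) - Re (\<psi> (of_real x)) - (V 2 * x\<^sup>2 + V 3 * x ^ 3 + V 4 * x ^ 4)\<bar> \<le> taylor_const r * x ^ 5"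
    by simp
  have "\<phi> field_differentiable at (of_real x)" "\<psi> field_differentiable at (of_real x)"
    by (rule holomorphic_on_imp_differentiable_at[OF p(2) open_ball] holomorphic_on_imp_differentiable_at[OF q(2) open_ball];
        use x r in simp)+
  then have D: "deriv ?F (of_real x) = deriv \<phi> (of_real x) - deriv \<psi> (of_real x)" by simp
  have "\<bar>Re (deriv ?F (of_real x)) - (\<Sum>i\<le>3. real (Suc i) * coef ?F (Suc i) * x ^ i)\<bar>
      \<le> (fact (3 + 2) * (4 * r) / (r / 4) ^ (3 + 2)) * \<bar>x\<bar> ^ Suc 3"
    by (rule real_taylor(2)[OF F B x' r])
  moreover have "(\<Sum>i\<le>3. real (Suc i) * coef ?F (Suc i) * x ^ i) = 2 * V 2 * x + 3 * V 3 * x\<^sup>2 + 4 * V 4 * x ^ 3"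
    unfolding c s3 using V01 by (simp add: eval_nat_numeral)
  moreover have "(fact (3 + 2) * (4 * r) / (r / 4) ^ (3 + 2)) * \<bar>x\<bar> ^ Suc 3 = (fact 5 * (4 * r) / (r / 4) ^ 5) * x ^ 4"
    using x(1) by simp
  ultimately have "\<bar>Re (deriv ?F (of_real x)) - (2 * V 2 * x + 3 * V 3 * x\<^sup>2 + 4 * V 4 * x ^ 3)\<bar> \<le> (fact 5 * (4 * r) / (r / 4) ^ 5) * x ^ 4"
    by argo
  also have "\<dots> \<le> taylor_const r * x ^ 4" by (rule mult_right_mono[OF tc(1)]) (use x in simp)
  finally show "\<bar>Re (deriv \<phi> (of_real x)) - Re (deriv \<psi> (of_real x)) - (2 * V 2 * x + 3 * V 3 * x\<^sup>2 + 4 * V 4 * x ^ 3)\<bar> \<le> taylor_const r * x ^ 4"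
    by (simp add: D)
qed

lemma admits_cycle_mono:
  assumes "admits_cycle Z L R" "R \<le> R'" shows "admits_cycle Z L R'"
proof -
  have "ball (0, 0) R \<subseteq> (ball (0, 0) R' :: (real \<times> real) set)" by (rule subset_ball[OF assms(2)])
  then show ?thesis using assms(1) unfolding admits_cycle_def by (meson subset_trans)
qed

text \<open>For small \<open>x\<close> both derivatives are negative, so the sign of their
  difference orders their absolute values, as \<open>turning_cycle\<close> demands.\<close>

lemma root_gives_cycle:
  assumes hs: "half_system (fst Z) \<delta> b1 b01 r1 C1 g1 (\<lambda>x. Re (\<phi> (of_real x)))"
      "half_system (refl_field (snd Z)) (- \<delta>) b2 b02 r2 C2 g2 (\<lambda>x. Re (\<psi> (of_real x)))"
    and h: "half_map r \<phi>" "half_map r \<psi>" and r: "r = min r1 r2"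
    and x: "0 < x" "x < r / 4" "taylor_const r * x < 1" and eq: "Re (\<phi> (of_real x)) = Re (\<psi> (of_real x))"
    and D: "0 < sgn (\<delta> * L) * (Re (deriv \<phi> (of_real x)) - Re (deriv \<psi> (of_real x)))" and L: "L \<noteq> 0"
  shows "admits_cycle Z L ((3 + C1 + C2) * x)"
proof -
  note p = half_mapD[OF h(1)] and q = half_mapD[OF h(2)]
  have neg: "Re (deriv \<phi> (of_real x)) < 0" "Re (deriv \<psi> (of_real x)) < 0"
    by (rule half_map_deriv_neg[OF h(1)] half_map_deriv_neg[OF h(2)]; use x in simp)+
  let ?y = "Re (\<phi> (of_real x))"
  have "norm (\<phi> (of_real x)) \<le> 2 * norm (of_real x :: complex)" by (rule p(3)) (use x in simp)
  then have "\<bar>?y\<bar> \<le> 2 * x" using abs_Re_le_cmod[of "\<phi> (of_real x)"] x(1) by simp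
  then have y: "\<bar>?y\<bar> < r" and xr: "\<bar>x\<bar> < r" using x by auto
  show ?thesis
    by (rule turning_cycle[OF hs x(1) x(2)[unfolded r] eq Re_derivative[OF p(2) xr] Re_derivative[OF p(2) y]
          Re_derivative[OF q(2) xr] Re_derivative[OF q(2) y] _ _ L])
      (use D neg in auto)
qed

theorem theoremD:
  fixes kp km :: nat and I :: "real set" and Z :: "real \<Rightarrow> pw_field"
    and l0 d L :: real
  assumes "kp \<ge> 1" and "km \<ge> 1"
    and "is_interval I"
    and "analytic_family I (\<lambda>l. fst (Z l))" and "analytic_family I (\<lambda>l. snd (Z l))"
    and "\<forall>l\<in>I. monodromic_tangential kp km (Z l)"
    and "l0 \<in> I"
    and "lyapunov_coeff (Z l0) 2 = 0"
    and "((\<lambda>l. lyapunov_coeff (Z l) 2) has_real_derivative d) (at l0 within I)" and "d \<noteq> 0"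
    and "L = lyapunov_coeff (Z l0) 4" and "L \<noteq> 0"
  shows "\<exists>J C. openin (top_of_set I) J \<and> l0 \<in> J \<and> C > 0 \<and>
    (\<forall>l\<in>J. d * L * (l - l0) < 0 \<longrightarrow>
      (\<exists>\<Gamma>. limit_cycle (Z l) \<Gamma> \<and> hyperbolic_cycle (Z l) \<Gamma> \<and>
         \<Gamma> \<subseteq> ball (0, 0) (C * sqrt \<bar>l - l0\<bar>) \<and>
         (L < 0 \<longrightarrow> asymptotically_stable (Z l) \<Gamma>) \<and>
         (L > 0 \<longrightarrow> unstable (Z l) \<Gamma>)))"
proof -
  have mono: "contact kp (fst (Z l)) \<and> X0 (fst (Z l)) * dYdx (fst (Z l)) (2 * kp - 1) < 0"
    "contact km (refl_field (snd (Z l))) \<and> X0 (refl_field (snd (Z l))) * dYdx (refl_field (snd (Z l))) (2 * km - 1) < 0"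
    "X0 (fst (Z l)) * X0 (snd (Z l)) < 0" if "l \<in> I" for l
  proof -
    have M: "contact kp (fst (Z l))" "contact km (snd (Z l))" "X0 (fst (Z l)) * dYdx (fst (Z l)) (2 * kp - 1) < 0"
      "X0 (snd (Z l)) * dYdx (snd (Z l)) (2 * km - 1) > 0" "X0 (fst (Z l)) * X0 (snd (Z l)) < 0"
      using bspec[OF assms(6) that] by (simp_all add: monodromic_tangential_def)
    show "contact kp (fst (Z l)) \<and> X0 (fst (Z l)) * dYdx (fst (Z l)) (2 * kp - 1) < 0"
      "X0 (fst (Z l)) * X0 (snd (Z l)) < 0" using M by simp_all
    \<comment> \<open>Reflection keeps \<open>X0\<close> and changes the sign of every
      \<open>dYdx\<close>, so the invisibility condition of the lower half becomes that of the upper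
      one.\<close>
    show "contact km (refl_field (snd (Z l))) \<and> X0 (refl_field (snd (Z l))) * dYdx (refl_field (snd (Z l))) (2 * km - 1) < 0"
      using contact_refl[OF assms(5) that M(2)] M(4) by (simp add: dYdx_refl[OF assms(5) that])
  qed
  let ?N = "near l0 I"
  define \<delta> where "\<delta> = sgn (X0 (fst (Z l0)))"
  have \<delta>: "sgn (X0 (refl_field (snd (Z l0)))) = - \<delta>" "\<delta> = 1 \<or> \<delta> = -1"
    using mono(3)[OF assms(7)] by (auto simp: \<delta>_def mult_less_0_iff)
  obtain b1 b01 r1 C1 g1 \<phi> where r1: "0 < r1" and ev1: "\<forall>\<^sub>F l in ?N. sgn (X0 (fst (Z l))) = \<delta> \<and>
       half_system (fst (Z l)) \<delta> b1 b01 r1 C1 (g1 l) (\<lambda>x. Re (\<phi> l (of_real x))) \<and>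
       \<phi> l holomorphic_on ball 0 r1 \<and> (\<forall>z. norm z < r1 \<longrightarrow> norm (\<phi> l z) \<le> 2 * norm z) \<and>
       (\<forall>x. \<bar>x\<bar> < r1 \<longrightarrow> \<phi> l (of_real x) \<in> \<real>)" and ul1: "uniform_limit (ball 0 r1) \<phi> (\<phi> l0) ?N"
    by (rule half_family[OF assms(4,7,1) mono(1), folded \<delta>_def])
  obtain b2 b02 r2 C2 g2 \<psi> where r2: "0 < r2" and ev2: "\<forall>\<^sub>F l in ?N. sgn (X0 (refl_field (snd (Z l)))) = - \<delta> \<and>
       half_system (refl_field (snd (Z l))) (- \<delta>) b2 b02 r2 C2 (g2 l) (\<lambda>x. Re (\<psi> l (of_real x))) \<and>
       \<psi> l holomorphic_on ball 0 r2 \<and> (\<forall>z. norm z < r2 \<longrightarrow> norm (\<psi> l z) \<le> 2 * norm z) \<and>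
       (\<forall>x. \<bar>x\<bar> < r2 \<longrightarrow> \<psi> l (of_real x) \<in> \<real>)" and ul2: "uniform_limit (ball 0 r2) \<psi> (\<psi> l0) ?N"
    by (rule half_family[OF analytic_family_refl[OF assms(5)] assms(7,2) mono(2), unfolded \<delta>(1)])
  define r where "r = min r1 r2"
  have r: "0 < r" "r \<le> r1" "r \<le> r2" using r1 r2 by (auto simp: r_def)
  define good where "good l \<longleftrightarrow> half_system (fst (Z l)) \<delta> b1 b01 r1 C1 (g1 l) (\<lambda>x. Re (\<phi> l (of_real x))) \<and>
     half_system (refl_field (snd (Z l))) (- \<delta>) b2 b02 r2 C2 (g2 l) (\<lambda>x. Re (\<psi> l (of_real x))) \<and>
     half_map r (\<phi> l) \<and> half_map r (\<psi> l) \<and> (\<forall>n. lyapunov_coeff (Z l) n = \<delta> * (coef (\<phi> l) n - coef (\<psi> l) n))" for l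
  have "\<forall>\<^sub>F l in ?N. good l"
    using ev1 ev2
  proof eventually_elim
    case (elim l)
    note a = conjunct1[OF elim(1)] conjunct1[OF conjunct2[OF elim(1)]] conjunct1[OF conjunct2[OF conjunct2[OF elim(1)]]] conjunct1[OF conjunct2[OF conjunct2[OF conjunct2[OF elim(1)]]]] conjunct2[OF conjunct2[OF conjunct2[OF conjunct2[OF elim(1)]]]]
    note b' = conjunct1[OF elim(2)] conjunct1[OF conjunct2[OF elim(2)]] conjunct1[OF conjunct2[OF conjunct2[OF elim(2)]]] conjunct1[OF conjunct2[OF conjunct2[OF conjunct2[OF elim(2)]]]] conjunct2[OF conjunct2[OF conjunct2[OF conjunct2[OF elim(2)]]]]
    note b = b'(2-5)
    have "half_return_coeff (-1) (snd (Z l)) n = half_return_coeff 1 (refl_field (snd (Z l))) n" for n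
      by (simp add: half_return_coeff_def half_return_refl)
    then have "lyapunov_coeff (Z l) n = \<delta> * (coef (\<phi> l) n - coef (\<psi> l) n)" for n
      unfolding lyapunov_coeff_def a(1) coef_def by (simp only: half_return_coeff_eq[OF a(2-5)] half_return_coeff_eq[OF b])
    then show ?case unfolding good_def
      using a(2) b(1) half_mapI[OF a(2-4) r(1,2)] half_mapI[OF b(1-3) r(1,3)] by (intro conjI allI)
  qed
  note evg = this
  have good0: "good l0" by (rule near_self[OF evg assms(7)])
  then have C: "0 \<le> C1" "0 \<le> C2" by (simp_all add: good_def half_system_def)
  define V where "V n l = lyapunov_coeff (Z l) n" for n l
  have hol: "\<forall>\<^sub>F l in ?N. \<phi> l holomorphic_on ball 0 r" "\<forall>\<^sub>F l in ?N. \<psi> l holomorphic_on ball 0 r"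
    by (rule eventually_mono[OF evg], simp add: good_def half_map_def)+
  have sub: "ball 0 r \<subseteq> (ball 0 r1 :: complex set)" "ball 0 r \<subseteq> (ball 0 r2 :: complex set)" using r by auto
  \<comment> \<open>Continuity of \<open>V 4\<close> at \<open>l0\<close> follows from the uniform
    convergence of the half maps, whereas the first-order behaviour of \<open>V 2\<close> comes from
    the differentiability hypothesis.\<close>
  have "((\<lambda>l. \<delta> * (coef (\<phi> l) 4 - coef (\<psi> l) 4)) \<longlongrightarrow> \<delta> * (coef (\<phi> l0) 4 - coef (\<psi> l0) 4)) ?N"
    by (intro tendsto_intros coef_tendsto[OF uniform_limit_on_subset[OF ul1 sub(1)] hol(1) near_self[OF hol(1) assms(7)] r(1)]
      coef_tendsto[OF uniform_limit_on_subset[OF ul2 sub(2)] hol(2) near_self[OF hol(2) assms(7)] r(1)])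
  moreover have "\<delta> * (coef (\<phi> l0) 4 - coef (\<psi> l0) 4) = L" using good0 assms(11) by (simp add: good_def)
  moreover have "\<forall>\<^sub>F l in ?N. \<delta> * (coef (\<phi> l) 4 - coef (\<psi> l) 4) = V 4 l"
    by (rule eventually_mono[OF evg]) (simp add: good_def V_def)
  ultimately have "(V 4 \<longlongrightarrow> L) ?N" by (simp add: Lim_transform_eventually)
  then have ev4: "\<forall>\<^sub>F l in ?N. dist (V 4 l) L < \<bar>L\<bar> / 2" by (rule tendstoD) (use assms(12) in simp)
  have "((\<lambda>l. (V 2 l - V 2 l0) / (l - l0)) \<longlongrightarrow> d) (at l0 within I)"
    using assms(9) by (simp add: has_field_derivative_iff V_def[abs_def])
  then have "\<forall>\<^sub>F l in at l0 within I. dist ((V 2 l - V 2 l0) / (l - l0)) d < \<bar>d\<bar> / 2" by (rule tendstoD) (use assms(10) in simp)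
  \<comment> \<open>The case \<open>l = l0\<close>, which this filter includes, has to be exempted:
    the difference quotient says nothing there.\<close>
  then have ev5: "\<forall>\<^sub>F l in ?N. l \<noteq> l0 \<longrightarrow> dist ((V 2 l - V 2 l0) / (l - l0)) d < \<bar>d\<bar> / 2"
    unfolding eventually_at_filter eventually_inf_principal by (rule eventually_mono) simp
  have K: "0 \<le> taylor_const r" using r(1) by (simp add: taylor_const_def)
  have dL: "0 < \<bar>d\<bar>" "0 < \<bar>L\<bar>" using assms(10,12) by simp_all
  obtain m M e0 where m: "0 < m" "m \<le> M" "0 < e0" and root0:
    "\<forall>\<epsilon> V2 V3 V4 F F'. 0 < \<epsilon> \<longrightarrow> \<epsilon> < e0 \<longrightarrow> - (3/2) * (\<bar>d\<bar> * \<epsilon>\<^sup>2) \<le> V2 \<longrightarrow> V2 \<le> - (1/2) * (\<bar>d\<bar> * \<epsilon>\<^sup>2) \<longrightarrow>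
       \<bar>L\<bar> / 2 \<le> V4 \<longrightarrow> V4 \<le> 2 * \<bar>L\<bar> \<longrightarrow> \<bar>V3\<bar> \<le> taylor_const r * \<bar>V2\<bar> \<longrightarrow>
       (\<forall>x. 0 \<le> x \<longrightarrow> x \<le> M * \<epsilon> \<longrightarrow> (F has_real_derivative F' x) (at x)) \<longrightarrow>
       (\<forall>x. 0 \<le> x \<longrightarrow> x \<le> M * \<epsilon> \<longrightarrow> \<bar>F x - (V2 * x\<^sup>2 + V3 * x ^ 3 + V4 * x ^ 4)\<bar> \<le> taylor_const r * x ^ 5) \<longrightarrow>
       (\<forall>x. 0 \<le> x \<longrightarrow> x \<le> M * \<epsilon> \<longrightarrow> \<bar>F' x - (2 * V2 * x + 3 * V3 * x\<^sup>2 + 4 * V4 * x ^ 3)\<bar> \<le> taylor_const r * x ^ 4) \<longrightarrow>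
       (\<exists>x. m * \<epsilon> \<le> x \<and> x \<le> M * \<epsilon> \<and> F x = 0 \<and> 0 < F' x)"
    by (rule quartic_root[OF dL K])
  note root = root0[rule_format]
  have M: "0 < M" using m by linarith
  \<comment> \<open>For \<epsilon> below \<open>e1\<close> the whole range satisfies
    \<open>M * \<epsilon> < r / 4\<close> and \<open>taylor_const r * (M * \<epsilon>) < 1\<close>,
    as \<open>root_gives_cycle\<close> demands. Since \<epsilon> is a square root, \<open>l\<close>
    is restricted by the square of \<open>e1\<close>.\<close>
  define e1 where "e1 = min e0 (min (r / 4) (1 / (taylor_const r + 1)) / M)"
  have e1: "0 < e1" using m M r(1) K by (simp add: e1_def)
  have "\<forall>\<^sub>F l in nhds l0. dist l l0 < e1\<^sup>2" unfolding eventually_nhds_metric using e1 by (intro exI[of _ "e1\<^sup>2"]) simp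
  then have ev6: "\<forall>\<^sub>F l in ?N. dist l l0 < e1\<^sup>2" unfolding eventually_inf_principal by (rule eventually_mono) simp
  let ?C = "(3 + C1 + C2) * M"
  have C0: "0 < ?C" using C M by simp
  have cyc: "admits_cycle (Z l) L (?C * sqrt \<bar>l - l0\<bar>)"
    if g: "good l" and V4: "dist (V 4 l) L < \<bar>L\<bar> / 2" and V2: "l \<noteq> l0 \<longrightarrow> dist ((V 2 l - V 2 l0) / (l - l0)) d < \<bar>d\<bar> / 2"
      and near: "dist l l0 < e1\<^sup>2" and sg: "d * L * (l - l0) < 0" for l
  proof -
    define \<epsilon> where "\<epsilon> = sqrt \<bar>l - l0\<bar>"
    have ne: "l \<noteq> l0" using sg by auto
    have \<epsilon>: "0 < \<epsilon>" "\<epsilon>\<^sup>2 = \<bar>l - l0\<bar>" using ne by (simp_all add: \<epsilon>_def)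
    have "\<epsilon>\<^sup>2 < e1\<^sup>2" using near \<epsilon>(2) by (simp add: dist_real_def)
    from power_less_imp_less_base[OF this] e1 have \<epsilon>1: "\<epsilon> < e1" by simp
    then have "\<epsilon> < e0" "\<epsilon> < min (r / 4) (1 / (taylor_const r + 1)) / M" by (simp_all add: e1_def)
    then have \<epsilon>e: "\<epsilon> < e0" and "\<epsilon> * M < min (r / 4) (1 / (taylor_const r + 1))"
      unfolding pos_less_divide_eq[OF M] .
    from this(2) have M\<epsilon>: "M * \<epsilon> < r / 4" "M * \<epsilon> < 1 / (taylor_const r + 1)"
      unfolding mult.commute[of \<epsilon> M] by (simp_all only: min_less_iff_conj)
    \<comment> \<open>Multiplication by \<open>s\<close> produces the normalisation
      \<open>V2 < 0 < V4\<close> of \<open>quartic_root\<close>: the sign condition on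
      \<open>l\<close> says that
      \<open>s * (d * (l - l0)) = - (\<bar>d\<bar> * \<epsilon>\<^sup>2)\<close>.\<close>
    define s where "s = sgn L"
    have s: "s = 1 \<or> s = -1" "s * L = \<bar>L\<bar>" using assms(12) by (auto simp: s_def sgn_real_def)
    have "\<bar>V 2 l / (l - l0) - d\<bar> < \<bar>d\<bar> / 2" using V2 ne assms(8) by (simp add: V_def dist_real_def)
    then have "\<bar>V 2 l / (l - l0) - d\<bar> * \<bar>l - l0\<bar> \<le> \<bar>d\<bar> / 2 * \<bar>l - l0\<bar>" by (intro mult_right_mono) auto
    moreover have "\<bar>V 2 l / (l - l0) - d\<bar> * \<bar>l - l0\<bar> = \<bar>V 2 l - d * (l - l0)\<bar>"
      unfolding abs_mult[symmetric] using ne by (simp add: left_diff_distrib)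
    ultimately have v2: "\<bar>V 2 l - d * (l - l0)\<bar> \<le> \<bar>d\<bar> * \<epsilon>\<^sup>2 / 2" by (simp add: \<epsilon>(2))
    have "s * (d * (l - l0)) = - (\<bar>d\<bar> * \<epsilon>\<^sup>2)"
    proof -
      have "s * (d * (l - l0)) < 0" using sg assms(12) by (auto simp: s_def sgn_real_def mult_less_0_iff zero_less_mult_iff)
      moreover have "\<bar>s * (d * (l - l0))\<bar> = \<bar>d\<bar> * \<epsilon>\<^sup>2" using s(1) by (auto simp: abs_mult \<epsilon>(2))
      ultimately show ?thesis by linarith
    qed
    note A = this
    have s1: "\<bar>s * t\<bar> = \<bar>t\<bar>" for t using s(1) by (rule disjE) simp_all
    have sd: "\<bar>s * x - s * y\<bar> = \<bar>x - y\<bar>" for x y unfolding right_diff_distrib[symmetric] by (rule s1)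
    define E where "E = \<bar>d\<bar> * \<epsilon>\<^sup>2"
    have "\<bar>s * V 2 l - s * (d * (l - l0))\<bar> \<le> E / 2" using v2 unfolding sd E_def .
    then have "\<bar>s * V 2 l + E\<bar> \<le> E / 2" unfolding A by (simp add: E_def)
    then have "- (3/2) * E \<le> s * V 2 l" "s * V 2 l \<le> - (1/2) * E" unfolding abs_le_iff by linarith+
    then have sV2: "- (3/2) * (\<bar>d\<bar> * \<epsilon>\<^sup>2) \<le> s * V 2 l" "s * V 2 l \<le> - (1/2) * (\<bar>d\<bar> * \<epsilon>\<^sup>2)" unfolding E_def .
    define E' where "E' = \<bar>L\<bar>"
    have "\<bar>s * V 4 l - s * L\<bar> < E' / 2" using V4 unfolding sd E'_def dist_real_def .
    then have "\<bar>s * V 4 l - E'\<bar> < E' / 2" unfolding s(2) E'_def .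
    moreover have "0 < E'" using dL(2) by (simp add: E'_def)
    ultimately have "E' / 2 \<le> s * V 4 l" "s * V 4 l \<le> 2 * E'" unfolding abs_less_iff by linarith+
    then have sV4: "\<bar>L\<bar> / 2 \<le> s * V 4 l" "s * V 4 l \<le> 2 * \<bar>L\<bar>" unfolding E'_def .
    note g' = g[unfolded good_def]
    have h: "half_map r (\<phi> l)" "half_map r (\<psi> l)" and lc: "V n l = \<delta> * (coef (\<phi> l) n - coef (\<psi> l) n)" for n
      using g' by (simp_all add: V_def)
    \<comment> \<open>The displacement function is \<delta> times the difference of the half maps,
      so the normalised one carries the factor \<tau>, which is also
      \<open>sgn (\<delta> * L)\<close>.\<close>
    define \<tau> where "\<tau> = s * \<delta>"
    have \<tau>: "\<tau> = 1 \<or> \<tau> = -1" using s(1) \<delta>(2) by (auto simp: \<tau>_def)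
    have sV: "s * V n l = \<tau> * (coef (\<phi> l) n - coef (\<psi> l) n)" for n by (simp add: lc \<tau>_def)
    have \<tau>1: "\<bar>\<tau> * t\<bar> = \<bar>t\<bar>" for t using \<tau> by (rule disjE) simp_all
    note est = displacement_estimates[OF h]
    have xr: "x \<le> r / 2" "\<bar>x\<bar> < r" if "0 \<le> x" "x \<le> M * \<epsilon>" for x using that M\<epsilon>(1) r(1) by auto
    have "\<exists>x. m * \<epsilon> \<le> x \<and> x \<le> M * \<epsilon> \<and> \<tau> * (Re (\<phi> l (of_real x)) - Re (\<psi> l (of_real x))) = 0 \<and>
      0 < \<tau> * (Re (deriv (\<phi> l) (of_real x)) - Re (deriv (\<psi> l) (of_real x)))"
    proof (rule root[OF \<epsilon>(1) \<epsilon>e sV2 sV4, of "s * V 3 l"])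
      show "\<bar>s * V 3 l\<bar> \<le> taylor_const r * \<bar>s * V 2 l\<bar>" unfolding sV \<tau>1 by (rule est(1))
      fix x assume x: "0 \<le> x" "x \<le> M * \<epsilon>"
      show "((\<lambda>x. \<tau> * (Re (\<phi> l (of_real x)) - Re (\<psi> l (of_real x)))) has_real_derivative
          \<tau> * (Re (deriv (\<phi> l) (of_real x)) - Re (deriv (\<psi> l) (of_real x)))) (at x)"
        by (rule DERIV_cmult[OF DERIV_diff[OF Re_derivative[OF half_mapD(2)[OF h(1)] xr(2)[OF x]] Re_derivative[OF half_mapD(2)[OF h(2)] xr(2)[OF x]]]])
      have d: "\<bar>\<tau> * A - B\<bar> = \<bar>A - C\<bar>" if "B = \<tau> * C" for A B C
        unfolding that right_diff_distrib[symmetric] by (rule \<tau>1)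
      show "\<bar>\<tau> * (Re (\<phi> l (of_real x)) - Re (\<psi> l (of_real x))) - (s * V 2 l * x\<^sup>2 + s * V 3 l * x ^ 3 + s * V 4 l * x ^ 4)\<bar> \<le> taylor_const r * x ^ 5"
        by (rule ord_eq_le_trans[OF d est(2)[OF x(1) xr(1)[OF x]]]) (simp only: sV, simp add: algebra_simps)
      show "\<bar>\<tau> * (Re (deriv (\<phi> l) (of_real x)) - Re (deriv (\<psi> l) (of_real x))) - (2 * (s * V 2 l) * x + 3 * (s * V 3 l) * x\<^sup>2 + 4 * (s * V 4 l) * x ^ 3)\<bar> \<le> taylor_const r * x ^ 4"
        by (rule ord_eq_le_trans[OF d est(3)[OF x(1) xr(1)[OF x]]]) (simp only: sV, simp add: algebra_simps)
    qed
    then obtain x where x: "m * \<epsilon> \<le> x" "x \<le> M * \<epsilon>" and z: "\<tau> * (Re (\<phi> l (of_real x)) - Re (\<psi> l (of_real x))) = 0"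
      and D: "0 < \<tau> * (Re (deriv (\<phi> l) (of_real x)) - Re (deriv (\<psi> l) (of_real x)))" by blast
    have "0 < m * \<epsilon>" using m(1) \<epsilon>(1) by simp
    then have x0: "0 < x" using x(1) by linarith
    have x4: "x < r / 4" using x(2) M\<epsilon>(1) by linarith
    have "x < 1 / (taylor_const r + 1)" using x(2) M\<epsilon>(2) by linarith
    moreover have "0 < taylor_const r + 1" using K by linarith
    ultimately have "x * (taylor_const r + 1) < 1" by (simp only: pos_less_divide_eq)
    then have xK: "taylor_const r * x < 1" using x0 by (simp add: algebra_simps)
    have eq: "Re (\<phi> l (of_real x)) = Re (\<psi> l (of_real x))" using z \<tau> by auto
    have sg': "sgn (\<delta> * L) = \<tau>" using \<delta>(2) by (auto simp: \<tau>_def s_def sgn_mult)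
    have "admits_cycle (Z l) L ((3 + C1 + C2) * x)"
      by (rule root_gives_cycle[OF conjunct1[OF g'] conjunct1[OF conjunct2[OF g']] h r_def x0 x4 xK eq D[folded sg'] assms(12)])
    then show ?thesis
    proof (rule admits_cycle_mono)
      have "(3 + C1 + C2) * x \<le> (3 + C1 + C2) * (M * \<epsilon>)" using x(2) C by (intro mult_left_mono) auto
      then show "(3 + C1 + C2) * x \<le> ?C * sqrt \<bar>l - l0\<bar>" by (simp only: \<epsilon>_def mult.assoc)
    qed
  qed
  have "\<forall>\<^sub>F l in ?N. d * L * (l - l0) < 0 \<longrightarrow> admits_cycle (Z l) L (?C * sqrt \<bar>l - l0\<bar>)"
    by (rule eventually_mono[OF eventually_conj[OF evg eventually_conj[OF ev4 eventually_conj[OF ev5 ev6]]]])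
      (intro impI, elim conjE, (rule cyc; assumption))
  then obtain S where S: "open S" "l0 \<in> S"
    "\<forall>l\<in>S. l \<in> I \<longrightarrow> d * L * (l - l0) < 0 \<longrightarrow> admits_cycle (Z l) L (?C * sqrt \<bar>l - l0\<bar>)"
    unfolding eventually_inf_principal eventually_nhds by blast
  have "openin (top_of_set I) (I \<inter> S)" by (rule openin_open_Int[OF S(1)])
  moreover have "l0 \<in> I \<inter> S" using S(2) assms(7) by simp
  moreover have "\<forall>l\<in>I \<inter> S. d * L * (l - l0) < 0 \<longrightarrow> admits_cycle (Z l) L (?C * sqrt \<bar>l - l0\<bar>)"
  proof (intro ballI impI)
    fix l assume a: "l \<in> I \<inter> S" "d * L * (l - l0) < 0"
    show "admits_cycle (Z l) L (?C * sqrt \<bar>l - l0\<bar>)"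
      by (rule S(3)[rule_format, OF IntD2[OF a(1)] IntD1[OF a(1)] a(2)])
  qed
  ultimately show ?thesis
    unfolding admits_cycle_def by (intro exI[of _ "I \<inter> S"] exI[of _ ?C] conjI C0)
qed

end
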